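(* For any (small) bicategory $\mathcal{C}$, all the maps in the following diagram of classifying spaces are homotopy equivalences: (1) the maps $$\mathrm{B}\mathcal{C}\to \mathrm{B}\underline{\mathrm{S}}\mathcal{C},\qquad \mathrm{B}\mathcal{C}\to \mathrm{B}\underline{\Delta}^{\mathrm u}\mathcal{C},\qquad \mathrm{B}\mathcal{C}\to \mathrm{B}\overline{\nabla}_{\mathrm u}\mathcal{C}$$ induced by the pseudo-simplicial functors $J$ from the pseudo-simplicial nerve $\underline{\mathrm{N}}\mathcal{C}$ to $\underline{\mathrm{S}}\mathcal{C}$, $\underline{\Delta}^{\mathrm u}\mathcal{C}$ and $\overline{\nabla}_{\mathrm u}\mathcal{C}$ respectively; (2) the maps $$\mathrm{B}\underline{\mathrm{S}}\mathcal{C}\to \mathrm{B}\underline{\Delta}^{\mathrm u}\mathcal{C}\to \mathrm{B}\underline{\Delta}\mathcal{C},\qquad \mathrm{B}\underline{\mathrm{S}}\mathcal{C}\to \mathrm{B}\overline{\nabla}_{\mathrm u}\mathcal{C}\to \mathrm{B}\overline{\nabla}\mathcal{C}$$ induced by the simplicial functors $\underline{\mathrm{S}}\mathcal{C}\hookrightarrow\underline{\Delta}^{\mathrm u}\mathcal{C}\hookrightarrow\underline{\Delta}\mathcal{C}$ and $\underline{\mathrm{S}}\mathcal{C}\hookrightarrow\overline{\nabla}_{\mathrm u}\mathcal{C}\hookrightarrow\overline{\nabla}\mathcal{C}$; (3) the maps $$\mathrm{B}\Delta\mathcal{C}\to \mathrm{B}\underline{\Delta}\mathcal{C},\quad \mathrm{B}\Delta^{\mathrm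 u}\mathcal{C}\to \mathrm{B}\underline{\Delta}^{\mathrm u}\mathcal{C},\quad \mathrm{B}\nabla_{\mathrm u}\mathcal{C}\to \mathrm{B}\overline{\nabla}_{\mathrm u}\mathcal{C},\quad \mathrm{B}\nabla\mathcal{C}\to \mathrm{B}\overline{\nabla}\mathcal{C}$$ induced by the inclusions of simplicial sets of objects; (4) the maps $$\mathrm{B}\Delta^{\mathrm u}\mathcal{C}\to \mathrm{B}\Delta\mathcal{C},\qquad \mathrm{B}\nabla_{\mathrm u}\mathcal{C}\to \mathrm{B}\nabla\mathcal{C}$$ induced by the inclusions of simplicial sets.
   Context: **Bicategories.** A small bicategory $\mathcal{C}$ has objects, hom-categories $\mathcal{C}(y,x)$ whose objects are morphisms $u:y\to x$ and whose arrows are deformations (2-cells) $\alpha:u\Rightarrow u'$ with vertical composition $\beta\cdot\alpha$, horizontal composition functors $\circ:\mathcal{C}(y,x)\times\mathcal{C}(z,y)\to\mathcal{C}(z,x)$, identities $1_x$, and natural invertible constraints $\boldsymbol{a}:u\circ(v\circ w)\Rightarrow(u\circ v)\circ w$, $\boldsymbol{l}_u:1_x\circ u\Rightarrow u$, $\boldsymbol{r}_u:u\circ 1_y\Rightarrow u$ satisfying the usual coherence axioms. A category is regarded as a bicategory with only identity deformations. **The category $[n]$.** $[n]=\{0,\dots,n\}$ is regarded as the category with exactly one arrow $j\to i$ whenever $i\le j$. $\Delta$ is the simplicial category of the $[n]$ and non-decreasing maps (functors). **Lax functors on $[p]$.** A lax functor $F=(F,\widehat F):[p]\rightsquigarrow\mathcal{C}$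 consists of objects $Fi$ ($0\le i\le p$), morphisms $F_{i,j}:Fj\to Fi$ ($i\le j$), deformations $\widehat F_{i,j,k}:F_{i,j}\circ F_{j,k}\Rightarrow F_{i,k}$ ($i\le j\le k$) and $\widehat F_i:1_{Fi}\Rightarrow F_{i,i}$, such that $\widehat F_{i,j,\ell}\cdot(1\circ\widehat F_{j,k,\ell})=\widehat F_{i,k,\ell}\cdot(\widehat F_{i,j,k}\circ 1)\cdot\boldsymbol{a}$ for $i\le j\le k\le \ell$, $\widehat F_{i,j,j}\cdot(1\circ\widehat F_j)=\boldsymbol{r}$ and $\widehat F_{i,i,j}\cdot(\widehat F_i\circ 1)=\boldsymbol{l}$. An oplax functor is defined dually, with $\widehat F_{i,j,k}:F_{i,k}\Rightarrow F_{i,j}\circ F_{j,k}$ and $\widehat F_i:F_{i,i}\Rightarrow 1_{Fi}$. A lax or oplax functor is normal if all $\widehat F_i$ are identities (so $F_{i,i}=1_{Fi}$). A homomorphism is a lax functor with all $\widehat F_{i,j,k},\widehat F_i$ invertible. A relative-to-objects lax transformation $\widehat\alpha:F\Rightarrow F'$ between lax functors $[p]\rightsquigarrow\mathcal{C}$ exists only if $Fi=F'i$ for all $i$, and then is a family of deformations $\widehat\alpha_{i,j}:F_{i,j}\Rightarrow F'_{i,j}$ ($i\le j$) with $\widehat F'_{i,j,k}\cdot(\widehat\alpha_{i,j}\circ\widehat\alpha_{j,k})=\widehat\alpha_{i,k}\cdot\widehat F_{i,j,k}$ and $\widehat\alpha_{i,i}\cdot\widehat F_i=\widehat F'_i$.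 Between oplax functors the conditions are $\widehat F'_{i,j,k}\cdot\widehat\alpha_{i,k}=(\widehat\alpha_{i,j}\circ\widehat\alpha_{j,k})\cdot\widehat F_{i,j,k}$ and $\widehat F'_i\cdot\widehat\alpha_{i,i}=\widehat F_i$. **Nerves.** All the following are contravariant in $[p]$ by precomposition. - $\Delta\mathcal{C}$, $\Delta^{\mathrm u}\mathcal{C}$, $\nabla\mathcal{C}$, $\nabla_{\mathrm u}\mathcal{C}$ are the simplicial sets whose $p$-simplices are, respectively, all lax functors, all normal lax functors, all oplax functors, all normal oplax functors $[p]\rightsquigarrow\mathcal{C}$. - $\underline{\Delta}\mathcal{C}$, $\underline{\Delta}^{\mathrm u}\mathcal{C}$, $\overline{\nabla}\mathcal{C}$, $\overline{\nabla}_{\mathrm u}\mathcal{C}$ are the simplicial categories whose categories of $p$-simplices have as objects, respectively, all lax functors, all normal lax functors, all oplax functors, all normal oplax functors $[p]\rightsquigarrow\mathcal{C}$, and relative-to-objects lax transformations as arrows (normal versions are the full simplicial subcategories). - The Segal nerve $\underline{\mathrm S}\mathcal{C}\subseteq\underline{\Delta}^{\mathrm u}\mathcal{C}$ is the full simplicial subcategory of normal homomorphisms $[p]\rightsquigarrow\mathcal{C}$. - The pseudo-simplicial nerve $\underline{\mathrm N}\mathcal{C}:\Delta^{\mathrm{op}}\rightsquigarrow\mathbf{Cat}$ is the pseudo-functor with $\underline{\mathrm N}\mathcal{C}_0=\mathrm{Ob}\,\mathcal{C}$ (discrete) and $$\underline{\mathrm N}\mathcal{C}_p=\bigsqcup_{(x_0,\dots,x_p)}\mathcal{C}(x_1,x_0)\times\cdots\times\mathcal{C}(x_p,x_{p-1}),$$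 faces and degeneracies being as in the nerve of a category, both on morphisms and deformations: $d_0(u_1,\dots,u_p)=(u_2,\dots,u_p)$, $d_i(u_1,\dots,u_p)=(u_1,\dots,u_i\circ u_{i+1},\dots,u_p)$ for $0<i<p$, $d_p(u_1,\dots,u_p)=(u_1,\dots,u_{p-1})$, $s_i(u_1,\dots,u_p)=(u_1,\dots,u_i,1_{x_i},u_{i+1},\dots,u_p)$. If $a=d^{i_1}\cdots d^{i_s}s^{j_1}\cdots s^{j_t}:[q]\to[p]$ is the unique factorization with $0\le i_s<\dots<i_1\le p$, $0\le j_1<\dots<j_t\le q$, then $a^*=s_{j_t}\cdots s_{j_1}d_{i_s}\cdots d_{i_1}$. The structure isomorphisms $b^*a^*\cong(ab)^*$ are the canonical ones built from the constraints $\boldsymbol a,\boldsymbol l,\boldsymbol r$ of $\mathcal{C}$ (uniquely determined by coherence). **Classifying spaces.** For a pseudo-functor (or, more generally, lax functor) $\mathcal{D}:\Delta^{\mathrm{op}}\rightsquigarrow\mathbf{Cat}$, the Grothendieck construction $\int_\Delta\mathcal{D}$ is the category with objects pairs $(x,[p])$, $x\in\mathcal{D}_p$, and morphisms $(u,a):(y,[q])\to(x,[p])$ with $a:[q]\to[p]$ in $\Delta$ and $u:y\to a^*x$ in $\mathcal{D}_q$; the composite of $(v,b):(z,[r])\to(y,[q])$ followed by $(u,a)$ is $(\widehat{\mathcal{D}}x\cdot b^*u\cdot v,\,ab)$, where $\widehat{\mathcal{D}}:b^*a^*\Rightarrow(ab)^*$ is the structure transformation. $\mathrm{B}\mathcal{D}$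 is the geometric realization of the nerve of $\int_\Delta\mathcal{D}$. A lax morphism $F:\mathcal{D}\rightsquigarrow\mathcal{D}'$, i.e. functors $F_p:\mathcal{D}_p\to\mathcal{D}'_p$ with coherent natural transformations $\widehat F_a:F_qa^*\Rightarrow a^*F_p$, induces $\mathrm{B}F:\mathrm{B}\mathcal{D}\to\mathrm{B}\mathcal{D}'$ through the functor $(x,[p])\mapsto(F_px,[p])$, $(u,a)\mapsto(\widehat F_ax\cdot F_qu,\,a)$. For a simplicial category this space is naturally homotopy equivalent to the Segal realization $\mathrm{B}([p]\mapsto \mathrm{B}\mathcal{D}_p)$ (equivalently, to the realization of the diagonal of the bisimplicial nerve), and for a simplicial set, regarded as a discrete simplicial category, to its geometric realization. The classifying space of the bicategory is $\mathrm{B}\mathcal{C}:=\mathrm{B}\underline{\mathrm N}\mathcal{C}=\mathrm{B}\int_\Delta\underline{\mathrm N}\mathcal{C}$. **The functors inducing the maps.** The simplicial functors $\underline{\mathrm S}\mathcal{C}\hookrightarrow\underline{\Delta}^{\mathrm u}\mathcal{C}\hookrightarrow\underline{\Delta}\mathcal{C}$, $\overline{\nabla}_{\mathrm u}\mathcal{C}\hookrightarrow\overline{\nabla}\mathcal{C}$, and the simplicial maps $\Delta^{\mathrm u}\mathcal{C}\hookrightarrow\Delta\mathcal{C}$, $\nabla_{\mathrm u}\mathcal{C}\hookrightarrow\nabla\mathcal{C}$ are inclusions; each geometric nerve $\Delta\mathcal{C},\Delta^{\mathrm u}\mathcal{C},\nabla\mathcal{C},\nabla_{\mathrm u}\mathcal{C}$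 is included as the (discrete) simplicial set of objects of $\underline{\Delta}\mathcal{C},\underline{\Delta}^{\mathrm u}\mathcal{C},\overline{\nabla}\mathcal{C},\overline{\nabla}_{\mathrm u}\mathcal{C}$ respectively. The simplicial functor $\underline{\mathrm S}\mathcal{C}\hookrightarrow\overline{\nabla}_{\mathrm u}\mathcal{C}$ is the full embedding $(F,\widehat F)\mapsto(F,\widehat F^{-1})$, $\widehat\alpha\mapsto\widehat\alpha$. The pseudo-simplicial functor $J:\underline{\mathrm N}\mathcal{C}\rightsquigarrow\underline{\mathrm S}\mathcal{C}$ has $J_0,J_1$ the evident identities, and for $n\ge2$ the functor $J_n$ sends a string $(F0\xleftarrow{F_{0,1}}F1\leftarrow\cdots\xleftarrow{F_{n-1,n}}Fn)$ to the normal homomorphism $F^{\mathrm e}:[n]\rightsquigarrow\mathcal{C}$ with $F^{\mathrm e}i=Fi$, $F^{\mathrm e}_{i,i+1}=F_{i,i+1}$, $F^{\mathrm e}_{i,j+1}=F^{\mathrm e}_{i,j}\circ F_{j,j+1}$ for $i<j$, $\widehat F^{\mathrm e}_{i,j,j+1}=1$, and $\widehat F^{\mathrm e}_{i,j,k+1}=(\widehat F^{\mathrm e}_{i,j,k}\circ1)\cdot\boldsymbol a$ for $i<j<k$; it sends $(\alpha_{0,1},\dots,\alpha_{n-1,n})$ to $\widehat\alpha^{\mathrm e}$ with $\widehat\alpha^{\mathrm e}_{i,i+1}=\alpha_{i,i+1}$, $\widehat\alpha^{\mathrm e}_{i,j+1}=\widehat\alpha^{\mathrm e}_{i,j}\circ\alpha_{j,j+1}$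 for $i<j$. The structure isomorphisms $J_qa^*\cong a^*J_p$ are the canonical ones built from $\boldsymbol a,\boldsymbol l,\boldsymbol r$. The pseudo-simplicial functors $J:\underline{\mathrm N}\mathcal{C}\rightsquigarrow\underline{\Delta}^{\mathrm u}\mathcal{C}$ and $J:\underline{\mathrm N}\mathcal{C}\rightsquigarrow\overline{\nabla}_{\mathrm u}\mathcal{C}$ are the composites of this $J$ with $\underline{\mathrm S}\mathcal{C}\hookrightarrow\underline{\Delta}^{\mathrm u}\mathcal{C}$ and $\underline{\mathrm S}\mathcal{C}\hookrightarrow\overline{\nabla}_{\mathrm u}\mathcal{C}$. *)

theory Defs
  imports "HOL-Homology.Simplices" "HOL-Analysis.Analysis"
begin

section \<open>Categories and bicategories\<close>

record ('x, 'f) cat =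
  obs :: "'x set"
  ars :: "'f set"
  dm :: "'f \<Rightarrow> 'x"
  cd :: "'f \<Rightarrow> 'x"
  idn :: "'x \<Rightarrow> 'f"
  cmp :: "'f \<Rightarrow> 'f \<Rightarrow> 'f"    \<comment> \<open>\<open>cmp g f\<close> is \<open>f\<close> followed by \<open>g\<close>\<close>

locale category =
  fixes E :: "('x, 'f) cat"
  assumes dm: "f \<in> ars E \<Longrightarrow> dm E f \<in> obs E"
    and cd: "f \<in> ars E \<Longrightarrow> cd E f \<in> obs E"
    and idn: "x \<in> obs E \<Longrightarrow> idn E x \<in> ars E \<and> dm E (idn E x) = x \<and> cd E (idn E x) = x"
    and cmp: "\<lbrakk>f \<in> ars E; g \<in> ars E; dm E g = cd E f\<rbrakk>
      \<Longrightarrow> cmp E g f \<in> ars E \<and> dm E (cmp E g f) = dm E f \<and> cd E (cmp E g f) = cd E g"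
    and idn_right: "f \<in> ars E \<Longrightarrow> cmp E f (idn E (dm E f)) = f"
    and idn_left: "f \<in> ars E \<Longrightarrow> cmp E (idn E (cd E f)) f = f"
    and cmp_assoc: "\<lbrakk>f \<in> ars E; g \<in> ars E; h \<in> ars E; dm E g = cd E f; dm E h = cd E g\<rbrakk>
      \<Longrightarrow> cmp E h (cmp E g f) = cmp E (cmp E h g) f"

text \<open>
  A small bicategory is given by sets of objects, morphisms and deformations; each morphism
  \<open>u : src u \<rightarrow> tgt u\<close> and each deformation \<open>\<alpha> : ddom \<alpha> \<Rightarrow> dcod \<alpha>\<close> carries its boundary,
  so that different hom-categories are disjoint.  Composites are written in the order
  of function application.
\<close>

record ('o, 'm, 'd) bicat =
  Ob :: "'o set"
  Mor :: "'m set"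
  Cell :: "'d set"
  src :: "'m \<Rightarrow> 'o"
  tgt :: "'m \<Rightarrow> 'o"
  ddom :: "'d \<Rightarrow> 'm"
  dcod :: "'d \<Rightarrow> 'm"
  vid :: "'m \<Rightarrow> 'd"
  vcomp :: "'d \<Rightarrow> 'd \<Rightarrow> 'd" (infixl \<open>\<cdot>\<index>\<close> 70)
  mcomp :: "'m \<Rightarrow> 'm \<Rightarrow> 'm" (infixl \<open>\<diamondop>\<index>\<close> 75)
  hcomp :: "'d \<Rightarrow> 'd \<Rightarrow> 'd" (infixl \<open>\<star>\<index>\<close> 75)
  unit_mor :: "'o \<Rightarrow> 'm"
  asc :: "'m \<Rightarrow> 'm \<Rightarrow> 'm \<Rightarrow> 'd"
  lun :: "'m \<Rightarrow> 'd"
  run :: "'m \<Rightarrow> 'd"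

definition mors :: "('o, 'm, 'd) bicat \<Rightarrow> 'o \<Rightarrow> 'o \<Rightarrow> 'm set" where
  "mors C y x = {u \<in> Mor C. src C u = y \<and> tgt C u = x}"

definition cells :: "('o, 'm, 'd) bicat \<Rightarrow> 'm \<Rightarrow> 'm \<Rightarrow> 'd set" where
  "cells C u v = {\<alpha> \<in> Cell C. ddom C \<alpha> = u \<and> dcod C \<alpha> = v}"

definition hom_cat :: "('o, 'm, 'd) bicat \<Rightarrow> 'o \<Rightarrow> 'o \<Rightarrow> ('m, 'd) cat" where
  "hom_cat C y x =
    \<lparr>obs = mors C y x,
     ars = {\<alpha> \<in> Cell C. ddom C \<alpha> \<in> mors C y x \<and> dcod C \<alpha> \<in> mors C y x},
     dm = ddom C, cd = dcod C, idn = vid C, cmp = vcomp C\<rparr>"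

definition inverse_cells :: "('o, 'm, 'd) bicat \<Rightarrow> 'd \<Rightarrow> 'd \<Rightarrow> bool" where
  "inverse_cells C \<alpha> \<beta> \<longleftrightarrow>
     \<alpha> \<in> Cell C \<and> \<beta> \<in> cells C (dcod C \<alpha>) (ddom C \<alpha>) \<and>
     vcomp C \<beta> \<alpha> = vid C (ddom C \<alpha>) \<and> vcomp C \<alpha> \<beta> = vid C (dcod C \<alpha>)"

definition invertible_cell :: "('o, 'm, 'd) bicat \<Rightarrow> 'd \<Rightarrow> bool" where
  "invertible_cell C \<alpha> \<longleftrightarrow> (\<exists>\<beta>. inverse_cells C \<alpha> \<beta>)"

definition cell_inv :: "('o, 'm, 'd) bicat \<Rightarrow> 'd \<Rightarrow> 'd" where
  "cell_inv C \<alpha> = (THE \<beta>. inverse_cells C \<alpha> \<beta>)"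

locale bicategory =
  fixes C :: "('o, 'm, 'd) bicat" (structure)
  assumes src: "u \<in> Mor C \<Longrightarrow> src C u \<in> Ob C"
    and tgt: "u \<in> Mor C \<Longrightarrow> tgt C u \<in> Ob C"
    and ddom: "\<alpha> \<in> Cell C \<Longrightarrow> ddom C \<alpha> \<in> Mor C"
    and dcod: "\<alpha> \<in> Cell C \<Longrightarrow> dcod C \<alpha> \<in> Mor C"
    and parallel: "\<alpha> \<in> Cell C \<Longrightarrow>
      src C (ddom C \<alpha>) = src C (dcod C \<alpha>) \<and> tgt C (ddom C \<alpha>) = tgt C (dcod C \<alpha>)"
    and hom_category: "\<lbrakk>x \<in> Ob C; y \<in> Ob C\<rbrakk> \<Longrightarrow> category (hom_cat C y x)"
    and mcomp: "\<lbrakk>u \<in> mors C y x; v \<in> mors C z y\<rbrakk> \<Longrightarrow> u \<diamondop> v \<in> mors C z x"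
    and hcomp: "\<lbrakk>u \<in> mors C y x; v \<in> mors C z y; \<alpha> \<in> cells C u u'; \<beta> \<in> cells C v v'\<rbrakk>
      \<Longrightarrow> \<alpha> \<star> \<beta> \<in> cells C (u \<diamondop> v) (u' \<diamondop> v')"
    and hcomp_vid: "\<lbrakk>u \<in> mors C y x; v \<in> mors C z y\<rbrakk> \<Longrightarrow> vid C u \<star> vid C v = vid C (u \<diamondop> v)"
    and interchange: "\<lbrakk>u \<in> mors C y x; v \<in> mors C z y;
        \<alpha> \<in> cells C u u'; \<alpha>' \<in> cells C u' u''; \<beta> \<in> cells C v v'; \<beta>' \<in> cells C v' v''\<rbrakk>
      \<Longrightarrow> (\<alpha>' \<cdot> \<alpha>) \<star> (\<beta>' \<cdot> \<beta>) = (\<alpha>' \<star> \<beta>') \<cdot> (\<alpha> \<star> \<beta>)"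
    and unit_mor: "x \<in> Ob C \<Longrightarrow> unit_mor C x \<in> mors C x x"
    and asc: "\<lbrakk>u \<in> mors C y x; v \<in> mors C z y; w \<in> mors C t z\<rbrakk>
      \<Longrightarrow> asc C u v w \<in> cells C (u \<diamondop> (v \<diamondop> w)) ((u \<diamondop> v) \<diamondop> w) \<and> invertible_cell C (asc C u v w)"
    and lun: "u \<in> mors C y x
      \<Longrightarrow> lun C u \<in> cells C (unit_mor C x \<diamondop> u) u \<and> invertible_cell C (lun C u)"
    and run: "u \<in> mors C y x
      \<Longrightarrow> run C u \<in> cells C (u \<diamondop> unit_mor C y) u \<and> invertible_cell C (run C u)"
    and asc_natural: "\<lbrakk>u \<in> mors C y x; v \<in> mors C z y; w \<in> mors C t z;
        \<alpha> \<in> cells C u u'; \<beta> \<in> cells C v v'; \<gamma> \<in> cells C w w'\<rbrakk>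
      \<Longrightarrow> asc C u' v' w' \<cdot> (\<alpha> \<star> (\<beta> \<star> \<gamma>)) = ((\<alpha> \<star> \<beta>) \<star> \<gamma>) \<cdot> asc C u v w"
    and lun_natural: "\<lbrakk>u \<in> mors C y x; \<alpha> \<in> cells C u u'\<rbrakk>
      \<Longrightarrow> lun C u' \<cdot> (vid C (unit_mor C x) \<star> \<alpha>) = \<alpha> \<cdot> lun C u"
    and run_natural: "\<lbrakk>u \<in> mors C y x; \<alpha> \<in> cells C u u'\<rbrakk>
      \<Longrightarrow> run C u' \<cdot> (\<alpha> \<star> vid C (unit_mor C y)) = \<alpha> \<cdot> run C u"
    and pentagon: "\<lbrakk>u \<in> mors C y x; v \<in> mors C z y; w \<in> mors C t z; k \<in> mors C s t\<rbrakk>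
      \<Longrightarrow> asc C (u \<diamondop> v) w k \<cdot> asc C u v (w \<diamondop> k)
        = (asc C u v w \<star> vid C k) \<cdot> asc C u (v \<diamondop> w) k \<cdot> (vid C u \<star> asc C v w k)"
    and triangle: "\<lbrakk>u \<in> mors C y x; v \<in> mors C z y\<rbrakk>
      \<Longrightarrow> (run C u \<star> vid C v) \<cdot> asc C u (unit_mor C y) v = vid C u \<star> lun C v"


section \<open>The simplicial category and geometric realization\<close>

text \<open>
  Maps \<open>[q] \<rightarrow> [p]\<close> are extensional functions on \<open>{..q}\<close>; the same convention (value
  \<open>undefined\<close> off the index range) is used for all functor data on \<open>[p]\<close>, so that equality of
  such data is equality of functions.
\<close>

definition Delta :: "nat \<Rightarrow> nat \<Rightarrow> (nat \<Rightarrow> nat) set" where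
  "Delta q p = {a \<in> {..q} \<rightarrow>\<^sub>E {..p}. mono_on {..q} a}"

definition Delta_id :: "nat \<Rightarrow> nat \<Rightarrow> nat" where
  "Delta_id p = (\<lambda>i\<in>{..p}. i)"

text \<open>\<open>sact X q p a\<close> is the map \<open>X p \<rightarrow> X q\<close> induced by \<open>a : [q] \<rightarrow> [p]\<close>.\<close>

record 's sset =
  simps :: "nat \<Rightarrow> 's set"
  sact :: "nat \<Rightarrow> nat \<Rightarrow> (nat \<Rightarrow> nat) \<Rightarrow> 's \<Rightarrow> 's"

definition simplex_push :: "nat \<Rightarrow> (nat \<Rightarrow> nat) \<Rightarrow> (nat \<Rightarrow> real) \<Rightarrow> nat \<Rightarrow> real" where
  "simplex_push q a t = (\<lambda>j. \<Sum>i | i \<le> q \<and> a i = j. t i)"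

definition presimplices :: "'s sset \<Rightarrow> (nat \<times> 's \<times> (nat \<Rightarrow> real)) topology" where
  "presimplices X =
     sum_topology (\<lambda>p. prod_topology (discrete_topology (simps X p))
       (subtopology (powertop_real UNIV) (standard_simplex p))) UNIV"

definition glue :: "'s sset \<Rightarrow> (nat \<times> 's \<times> (nat \<Rightarrow> real)) rel" where
  "glue X = {((q, sact X q p a s, t), (p, s, simplex_push q a t)) | q p a s t.
     a \<in> Delta q p \<and> s \<in> simps X p \<and> t \<in> standard_simplex q}"

definition glue_eq :: "'s sset \<Rightarrow> (nat \<times> 's \<times> (nat \<Rightarrow> real)) rel" where
  "glue_eq X = (glue X \<union> (glue X)\<inverse>)\<^sup>* \<inter> topspace (presimplices X) \<times> topspace (presimplices X)"

text \<open>The points are equivalence classes, so \<open>\<Union>U\<close> is the preimage of \<open>U\<close> under the projection.\<close>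

definition realization :: "'s sset \<Rightarrow> (nat \<times> 's \<times> (nat \<Rightarrow> real)) set topology" where
  "realization X =
     topology (\<lambda>U. U \<subseteq> topspace (presimplices X) // glue_eq X \<and> openin (presimplices X) (\<Union>U))"

definition realization_map ::
  "'r sset \<Rightarrow> (nat \<Rightarrow> 's \<Rightarrow> 'r) \<Rightarrow>
    (nat \<times> 's \<times> (nat \<Rightarrow> real)) set \<Rightarrow> (nat \<times> 'r \<times> (nat \<Rightarrow> real)) set" where
  "realization_map Y g c = glue_eq Y `` ((\<lambda>(p, s, t). (p, g p s, t)) ` c)"

lemma equiv_glue_eq: "equiv (topspace (presimplices X)) (glue_eq X)"
proof -
  let ?S = "glue X \<union> (glue X)\<inverse>"
  have "sym ?S"
    by (auto simp: sym_def)
  then have "sym (?S\<^sup>*)"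
    by (rule sym_rtrancl)
  moreover have "trans (?S\<^sup>*)"
    by (rule trans_rtrancl)
  ultimately show ?thesis
    unfolding glue_eq_def equiv_def refl_on_def sym_def trans_def by blast
qed

lemma openin_realization:
  "openin (realization X) U \<longleftrightarrow>
     U \<subseteq> topspace (presimplices X) // glue_eq X \<and> openin (presimplices X) (\<Union>U)"
proof -
  have *: "\<Union>(U \<inter> V) = \<Union>U \<inter> \<Union>V"
    if "U \<subseteq> topspace (presimplices X) // glue_eq X" "V \<subseteq> topspace (presimplices X) // glue_eq X" for U V
    using that quotient_disj[OF equiv_glue_eq] by blast
  have "istopology (\<lambda>U. U \<subseteq> topspace (presimplices X) // glue_eq X \<and> openin (presimplices X) (\<Union>U))"
    unfolding istopology_def
  proof (intro conjI allI impI)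
    fix K assume "\<forall>k\<in>K. k \<subseteq> topspace (presimplices X) // glue_eq X \<and> openin (presimplices X) (\<Union>k)"
    moreover have "\<Union>(\<Union>K) = (\<Union>k\<in>K. \<Union>k)" by blast
    ultimately show "openin (presimplices X) (\<Union>(\<Union>K))" by auto
  qed (use * in auto)
  then show ?thesis
    by (simp add: realization_def)
qed

lemma topspace_realization: "topspace (realization X) = topspace (presimplices X) // glue_eq X"
proof
  show "topspace (realization X) \<subseteq> topspace (presimplices X) // glue_eq X"
    using openin_realization openin_topspace by blast
  have "openin (realization X) (topspace (presimplices X) // glue_eq X)"
    by (simp add: openin_realization Union_quotient[OF equiv_glue_eq])
  then show "topspace (presimplices X) // glue_eq X \<subseteq> topspace (realization X)"
    by (rule openin_subset)
qed

definition homotopy_equivalence_map :: "'a topology \<Rightarrow> 'b topology \<Rightarrow> ('a \<Rightarrow> 'b) \<Rightarrow> bool" where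
  "homotopy_equivalence_map X Y f \<longleftrightarrow>
     continuous_map X Y f \<and>
     (\<exists>g. continuous_map Y X g \<and>
          homotopic_with (\<lambda>_. True) X X (g \<circ> f) id \<and>
          homotopic_with (\<lambda>_. True) Y Y (f \<circ> g) id)"

text \<open>
  A \<open>p\<close>-simplex of the nerve is a functor \<open>[p] \<rightarrow> E\<close>, where \<open>[p]\<close> has one arrow \<open>j \<rightarrow> i\<close> for
  \<open>i \<le> j\<close>: objects \<open>X i\<close> and arrows \<open>f i j : X j \<rightarrow> X i\<close>.
\<close>

definition nerve_simps :: "('x, 'f) cat \<Rightarrow> nat \<Rightarrow> ((nat \<Rightarrow> 'x) \<times> (nat \<Rightarrow> nat \<Rightarrow> 'f)) set" where
  "nerve_simps E p = {(X, f).
     X \<in> {..p} \<rightarrow>\<^sub>E obs E \<and>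
     (\<forall>i j. \<not> (i \<le> j \<and> j \<le> p) \<longrightarrow> f i j = undefined) \<and>
     (\<forall>i j. i \<le> j \<and> j \<le> p \<longrightarrow> f i j \<in> ars E \<and> dm E (f i j) = X j \<and> cd E (f i j) = X i) \<and>
     (\<forall>i\<le>p. f i i = idn E (X i)) \<and>
     (\<forall>i j k. i \<le> j \<and> j \<le> k \<and> k \<le> p \<longrightarrow> cmp E (f i j) (f j k) = f i k)}"

definition nerve :: "('x, 'f) cat \<Rightarrow> ((nat \<Rightarrow> 'x) \<times> (nat \<Rightarrow> nat \<Rightarrow> 'f)) sset" where
  "nerve E =
     \<lparr>simps = nerve_simps E,
      sact = (\<lambda>q p a (X, f). (\<lambda>i\<in>{..q}. X (a i),
                \<lambda>i j. if i \<le> j \<and> j \<le> q then f (a i) (a j) else undefined))\<rparr>"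

definition nerve_map ::
  "('x \<Rightarrow> 'y) \<Rightarrow> ('f \<Rightarrow> 'g) \<Rightarrow> nat \<Rightarrow>
    (nat \<Rightarrow> 'x) \<times> (nat \<Rightarrow> nat \<Rightarrow> 'f) \<Rightarrow> (nat \<Rightarrow> 'y) \<times> (nat \<Rightarrow> nat \<Rightarrow> 'g)" where
  "nerve_map G H p = (\<lambda>(X, f). (\<lambda>i\<in>{..p}. G (X i),
     \<lambda>i j. if i \<le> j \<and> j \<le> p then H (f i j) else undefined))"


section \<open>Lax functors from the opposite of the simplicial category to Cat\<close>

text \<open>
  \<open>pb_ob D q p a\<close> and \<open>pb_ar D q p a\<close> form the functor \<open>a\<^sup>* : D\<^sub>p \<rightarrow> D\<^sub>q\<close> for \<open>a : [q] \<rightarrow> [p]\<close>;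
  \<open>pcmp D r q p b a x : b\<^sup>* (a\<^sup>* x) \<rightarrow> (a b)\<^sup>* x\<close> for \<open>b : [r] \<rightarrow> [q]\<close>, and \<open>punit D p x : x \<rightarrow> id\<^sup>* x\<close>.
\<close>

record ('x, 'f) simp_cat =
  level :: "nat \<Rightarrow> ('x, 'f) cat"
  pb_ob :: "nat \<Rightarrow> nat \<Rightarrow> (nat \<Rightarrow> nat) \<Rightarrow> 'x \<Rightarrow> 'x"
  pb_ar :: "nat \<Rightarrow> nat \<Rightarrow> (nat \<Rightarrow> nat) \<Rightarrow> 'f \<Rightarrow> 'f"
  pcmp :: "nat \<Rightarrow> nat \<Rightarrow> nat \<Rightarrow> (nat \<Rightarrow> nat) \<Rightarrow> (nat \<Rightarrow> nat) \<Rightarrow> 'x \<Rightarrow> 'f"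
  punit :: "nat \<Rightarrow> 'x \<Rightarrow> 'f"

definition strict_simp_cat ::
  "(nat \<Rightarrow> ('x, 'f) cat) \<Rightarrow> (nat \<Rightarrow> nat \<Rightarrow> (nat \<Rightarrow> nat) \<Rightarrow> 'x \<Rightarrow> 'x) \<Rightarrow>
    (nat \<Rightarrow> nat \<Rightarrow> (nat \<Rightarrow> nat) \<Rightarrow> 'f \<Rightarrow> 'f) \<Rightarrow> ('x, 'f) simp_cat" where
  "strict_simp_cat L po pa =
     \<lparr>level = L, pb_ob = po, pb_ar = pa,
      pcmp = (\<lambda>r q p b a x. idn (L r) (po r p (compose {..r} a b) x)),
      punit = (\<lambda>p x. idn (L p) x)\<rparr>"

definition discrete_cat :: "'x set \<Rightarrow> ('x, 'x) cat" where
  "discrete_cat S =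
     \<lparr>obs = S, ars = S, dm = (\<lambda>x. x), cd = (\<lambda>x. x), idn = (\<lambda>x. x), cmp = (\<lambda>g f. f)\<rparr>"

definition discrete_simp_cat :: "'x sset \<Rightarrow> ('x, 'x) simp_cat" where
  "discrete_simp_cat X = strict_simp_cat (\<lambda>p. discrete_cat (simps X p)) (sact X) (sact X)"

text \<open>An arrow \<open>(u, a) : (y, [q]) \<rightarrow> (x, [p])\<close> is stored together with its domain and codomain.\<close>

type_synonym ('x, 'f) groth_arrow = "('x \<times> nat) \<times> ('x \<times> nat) \<times> 'f \<times> (nat \<Rightarrow> nat)"

definition grothendieck :: "('x, 'f) simp_cat \<Rightarrow> ('x \<times> nat, ('x, 'f) groth_arrow) cat" where
  "grothendieck D =
     \<lparr>obs = {(x, p). x \<in> obs (level D p)},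
      ars = {((y, q), (x, p), u, a) | y q x p u a.
               y \<in> obs (level D q) \<and> x \<in> obs (level D p) \<and> a \<in> Delta q p \<and>
               u \<in> ars (level D q) \<and> dm (level D q) u = y \<and> cd (level D q) u = pb_ob D q p a x},
      dm = (\<lambda>(Y, X, u, a). Y),
      cd = (\<lambda>(Y, X, u, a). X),
      idn = (\<lambda>(x, p). ((x, p), (x, p), punit D p x, Delta_id p)),
      cmp = (\<lambda>((y, q), (x, p), u, a) ((z, r), _, v, b).
               ((z, r), (x, p),
                cmp (level D r) (pcmp D r q p b a x) (cmp (level D r) (pb_ar D r q b u) v),
                compose {..r} a b))\<rparr>"

definition classifying_space where
  "classifying_space D = realization (nerve (grothendieck D))"

text \<open>Lax morphisms; \<open>mstr F q p a x : F\<^sub>q (a\<^sup>* x) \<rightarrow> a\<^sup>* (F\<^sub>p x)\<close> for \<open>a : [q] \<rightarrow> [p]\<close>.\<close>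

record ('x, 'f, 'y, 'g) lax_mor =
  mob :: "nat \<Rightarrow> 'x \<Rightarrow> 'y"
  mar :: "nat \<Rightarrow> 'f \<Rightarrow> 'g"
  mstr :: "nat \<Rightarrow> nat \<Rightarrow> (nat \<Rightarrow> nat) \<Rightarrow> 'x \<Rightarrow> 'g"

definition strict_mor ::
  "('y, 'g) simp_cat \<Rightarrow> (nat \<Rightarrow> 'x \<Rightarrow> 'y) \<Rightarrow> (nat \<Rightarrow> 'f \<Rightarrow> 'g) \<Rightarrow> ('x, 'f, 'y, 'g) lax_mor" where
  "strict_mor D' Fo Fa =
     \<lparr>mob = Fo, mar = Fa, mstr = (\<lambda>q p a x. idn (level D' q) (pb_ob D' q p a (Fo p x)))\<rparr>"

definition inclusion :: "('x, 'f) simp_cat \<Rightarrow> ('x, 'f, 'x, 'f) lax_mor" where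
  "inclusion D' = strict_mor D' (\<lambda>p x. x) (\<lambda>p u. u)"

definition objects_inclusion :: "('x, 'f) simp_cat \<Rightarrow> ('x, 'x, 'x, 'f) lax_mor" where
  "objects_inclusion D' = strict_mor D' (\<lambda>p x. x) (\<lambda>p x. idn (level D' p) x)"

definition lax_mor_comp ::
  "('z, 'h) simp_cat \<Rightarrow> ('y, 'g, 'z, 'h) lax_mor \<Rightarrow> ('x, 'f, 'y, 'g) lax_mor \<Rightarrow> ('x, 'f, 'z, 'h) lax_mor"
  where
  "lax_mor_comp D'' G F =
     \<lparr>mob = (\<lambda>p x. mob G p (mob F p x)),
      mar = (\<lambda>p u. mar G p (mar F p u)),
      mstr = (\<lambda>q p a x. cmp (level D'' q) (mstr G q p a (mob F p x)) (mar G q (mstr F q p a x)))\<rparr>"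

definition grothendieck_map_ob :: "('x, 'f, 'y, 'g) lax_mor \<Rightarrow> 'x \<times> nat \<Rightarrow> 'y \<times> nat" where
  "grothendieck_map_ob F = (\<lambda>(x, p). (mob F p x, p))"

definition grothendieck_map_ar ::
  "('y, 'g) simp_cat \<Rightarrow> ('x, 'f, 'y, 'g) lax_mor \<Rightarrow> ('x, 'f) groth_arrow \<Rightarrow> ('y, 'g) groth_arrow" where
  "grothendieck_map_ar D' F = (\<lambda>((y, q), (x, p), u, a).
     ((mob F q y, q), (mob F p x, p), cmp (level D' q) (mstr F q p a x) (mar F q u), a))"

definition classifying_map where
  "classifying_map D' F =
     realization_map (nerve (grothendieck D'))
       (nerve_map (grothendieck_map_ob F) (grothendieck_map_ar D' F))"

definition induces_homotopy_equivalence ::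
  "('x, 'f) simp_cat \<Rightarrow> ('y, 'g) simp_cat \<Rightarrow> ('x, 'f, 'y, 'g) lax_mor \<Rightarrow> bool" where
  "induces_homotopy_equivalence D D' F \<longleftrightarrow>
     homotopy_equivalence_map (classifying_space D) (classifying_space D') (classifying_map D' F)"


section \<open>Lax and oplax functors on [p]\<close>

text \<open>
  \<open>lmor F i j : F j \<rightarrow> F i\<close> for \<open>i \<le> j\<close>; \<open>lcmp F i j k\<close> and \<open>lone F i\<close> are the structure
  deformations, whose direction depends on whether the data are read as lax or as oplax.
\<close>

record ('o, 'm, 'd) lax_data =
  lob :: "nat \<Rightarrow> 'o"
  lmor :: "nat \<Rightarrow> nat \<Rightarrow> 'm"
  lcmp :: "nat \<Rightarrow> nat \<Rightarrow> nat \<Rightarrow> 'd"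
  lone :: "nat \<Rightarrow> 'd"

definition restr_data :: "nat \<Rightarrow> ('o, 'm, 'd) lax_data \<Rightarrow> ('o, 'm, 'd) lax_data" where
  "restr_data p F =
     \<lparr>lob = (\<lambda>i. if i \<le> p then lob F i else undefined),
      lmor = (\<lambda>i j. if i \<le> j \<and> j \<le> p then lmor F i j else undefined),
      lcmp = (\<lambda>i j k. if i \<le> j \<and> j \<le> k \<and> k \<le> p then lcmp F i j k else undefined),
      lone = (\<lambda>i. if i \<le> p then lone F i else undefined)\<rparr>"

definition restr_trans :: "nat \<Rightarrow> (nat \<Rightarrow> nat \<Rightarrow> 'd) \<Rightarrow> nat \<Rightarrow> nat \<Rightarrow> 'd" where
  "restr_trans p \<alpha> = (\<lambda>i j. if i \<le> j \<and> j \<le> p then \<alpha> i j else undefined)"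

definition pull_data :: "nat \<Rightarrow> (nat \<Rightarrow> nat) \<Rightarrow> ('o, 'm, 'd) lax_data \<Rightarrow> ('o, 'm, 'd) lax_data" where
  "pull_data q a F = restr_data q
     \<lparr>lob = (\<lambda>i. lob F (a i)), lmor = (\<lambda>i j. lmor F (a i) (a j)),
      lcmp = (\<lambda>i j k. lcmp F (a i) (a j) (a k)), lone = (\<lambda>i. lone F (a i))\<rparr>"

definition pull_trans :: "nat \<Rightarrow> (nat \<Rightarrow> nat) \<Rightarrow> (nat \<Rightarrow> nat \<Rightarrow> 'd) \<Rightarrow> nat \<Rightarrow> nat \<Rightarrow> 'd" where
  "pull_trans q a \<alpha> = restr_trans q (\<lambda>i j. \<alpha> (a i) (a j))"

definition lax_functor :: "('o, 'm, 'd) bicat \<Rightarrow> nat \<Rightarrow> ('o, 'm, 'd) lax_data \<Rightarrow> bool" where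
  "lax_functor C p F \<longleftrightarrow>
     restr_data p F = F \<and>
     (\<forall>i\<le>p. lob F i \<in> Ob C) \<and>
     (\<forall>i j. i \<le> j \<and> j \<le> p \<longrightarrow> lmor F i j \<in> mors C (lob F j) (lob F i)) \<and>
     (\<forall>i j k. i \<le> j \<and> j \<le> k \<and> k \<le> p \<longrightarrow>
        lcmp F i j k \<in> cells C (lmor F i j \<diamondop>\<^bsub>C\<^esub> lmor F j k) (lmor F i k)) \<and>
     (\<forall>i\<le>p. lone F i \<in> cells C (unit_mor C (lob F i)) (lmor F i i)) \<and>
     (\<forall>i j k l. i \<le> j \<and> j \<le> k \<and> k \<le> l \<and> l \<le> p \<longrightarrow>
        lcmp F i j l \<cdot>\<^bsub>C\<^esub> (vid C (lmor F i j) \<star>\<^bsub>C\<^esub> lcmp F j k l) =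
        lcmp F i k l \<cdot>\<^bsub>C\<^esub> (lcmp F i j k \<star>\<^bsub>C\<^esub> vid C (lmor F k l))
          \<cdot>\<^bsub>C\<^esub> asc C (lmor F i j) (lmor F j k) (lmor F k l)) \<and>
     (\<forall>i j. i \<le> j \<and> j \<le> p \<longrightarrow>
        lcmp F i j j \<cdot>\<^bsub>C\<^esub> (vid C (lmor F i j) \<star>\<^bsub>C\<^esub> lone F j) = run C (lmor F i j) \<and>
        lcmp F i i j \<cdot>\<^bsub>C\<^esub> (lone F i \<star>\<^bsub>C\<^esub> vid C (lmor F i j)) = lun C (lmor F i j))"

definition oplax_functor :: "('o, 'm, 'd) bicat \<Rightarrow> nat \<Rightarrow> ('o, 'm, 'd) lax_data \<Rightarrow> bool" where
  "oplax_functor C p F \<longleftrightarrow>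
     restr_data p F = F \<and>
     (\<forall>i\<le>p. lob F i \<in> Ob C) \<and>
     (\<forall>i j. i \<le> j \<and> j \<le> p \<longrightarrow> lmor F i j \<in> mors C (lob F j) (lob F i)) \<and>
     (\<forall>i j k. i \<le> j \<and> j \<le> k \<and> k \<le> p \<longrightarrow>
        lcmp F i j k \<in> cells C (lmor F i k) (lmor F i j \<diamondop>\<^bsub>C\<^esub> lmor F j k)) \<and>
     (\<forall>i\<le>p. lone F i \<in> cells C (lmor F i i) (unit_mor C (lob F i))) \<and>
     (\<forall>i j k l. i \<le> j \<and> j \<le> k \<and> k \<le> l \<and> l \<le> p \<longrightarrow>
        asc C (lmor F i j) (lmor F j k) (lmor F k l)
          \<cdot>\<^bsub>C\<^esub> (vid C (lmor F i j) \<star>\<^bsub>C\<^esub> lcmp F j k l) \<cdot>\<^bsub>C\<^esub> lcmp F i j l =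
        (lcmp F i j k \<star>\<^bsub>C\<^esub> vid C (lmor F k l)) \<cdot>\<^bsub>C\<^esub> lcmp F i k l) \<and>
     (\<forall>i j. i \<le> j \<and> j \<le> p \<longrightarrow>
        run C (lmor F i j) \<cdot>\<^bsub>C\<^esub> (vid C (lmor F i j) \<star>\<^bsub>C\<^esub> lone F j) \<cdot>\<^bsub>C\<^esub> lcmp F i j j
          = vid C (lmor F i j) \<and>
        lun C (lmor F i j) \<cdot>\<^bsub>C\<^esub> (lone F i \<star>\<^bsub>C\<^esub> vid C (lmor F i j)) \<cdot>\<^bsub>C\<^esub> lcmp F i i j
          = vid C (lmor F i j))"

definition normal_data :: "('o, 'm, 'd) bicat \<Rightarrow> nat \<Rightarrow> ('o, 'm, 'd) lax_data \<Rightarrow> bool" where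
  "normal_data C p F \<longleftrightarrow>
     (\<forall>i\<le>p. lmor F i i = unit_mor C (lob F i) \<and> lone F i = vid C (unit_mor C (lob F i)))"

definition normal_lax_functor :: "('o, 'm, 'd) bicat \<Rightarrow> nat \<Rightarrow> ('o, 'm, 'd) lax_data \<Rightarrow> bool" where
  "normal_lax_functor C p F \<longleftrightarrow> lax_functor C p F \<and> normal_data C p F"

definition normal_oplax_functor :: "('o, 'm, 'd) bicat \<Rightarrow> nat \<Rightarrow> ('o, 'm, 'd) lax_data \<Rightarrow> bool" where
  "normal_oplax_functor C p F \<longleftrightarrow> oplax_functor C p F \<and> normal_data C p F"

definition homomorphism :: "('o, 'm, 'd) bicat \<Rightarrow> nat \<Rightarrow> ('o, 'm, 'd) lax_data \<Rightarrow> bool" where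
  "homomorphism C p F \<longleftrightarrow>
     lax_functor C p F \<and>
     (\<forall>i j k. i \<le> j \<and> j \<le> k \<and> k \<le> p \<longrightarrow> invertible_cell C (lcmp F i j k)) \<and>
     (\<forall>i\<le>p. invertible_cell C (lone F i))"

definition normal_homomorphism :: "('o, 'm, 'd) bicat \<Rightarrow> nat \<Rightarrow> ('o, 'm, 'd) lax_data \<Rightarrow> bool" where
  "normal_homomorphism C p F \<longleftrightarrow> homomorphism C p F \<and> normal_data C p F"

definition trans_family ::
  "('o, 'm, 'd) bicat \<Rightarrow> nat \<Rightarrow> ('o, 'm, 'd) lax_data \<Rightarrow> ('o, 'm, 'd) lax_data \<Rightarrow> (nat \<Rightarrow> nat \<Rightarrow> 'd) \<Rightarrow> bool"
  where
  "trans_family C p F F' \<alpha> \<longleftrightarrow>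
     restr_trans p \<alpha> = \<alpha> \<and>
     (\<forall>i\<le>p. lob F i = lob F' i) \<and>
     (\<forall>i j. i \<le> j \<and> j \<le> p \<longrightarrow> \<alpha> i j \<in> cells C (lmor F i j) (lmor F' i j))"

text \<open>Relative-to-objects lax transformations between lax, respectively oplax, functors.\<close>

definition lax_trans ::
  "('o, 'm, 'd) bicat \<Rightarrow> nat \<Rightarrow> ('o, 'm, 'd) lax_data \<Rightarrow> ('o, 'm, 'd) lax_data \<Rightarrow> (nat \<Rightarrow> nat \<Rightarrow> 'd) \<Rightarrow> bool"
  where
  "lax_trans C p F F' \<alpha> \<longleftrightarrow>
     trans_family C p F F' \<alpha> \<and>
     (\<forall>i j k. i \<le> j \<and> j \<le> k \<and> k \<le> p \<longrightarrow>
        lcmp F' i j k \<cdot>\<^bsub>C\<^esub> (\<alpha> i j \<star>\<^bsub>C\<^esub> \<alpha> j k) = \<alpha> i k \<cdot>\<^bsub>C\<^esub> lcmp F i j k) \<and>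
     (\<forall>i\<le>p. \<alpha> i i \<cdot>\<^bsub>C\<^esub> lone F i = lone F' i)"

definition oplax_trans ::
  "('o, 'm, 'd) bicat \<Rightarrow> nat \<Rightarrow> ('o, 'm, 'd) lax_data \<Rightarrow> ('o, 'm, 'd) lax_data \<Rightarrow> (nat \<Rightarrow> nat \<Rightarrow> 'd) \<Rightarrow> bool"
  where
  "oplax_trans C p F F' \<alpha> \<longleftrightarrow>
     trans_family C p F F' \<alpha> \<and>
     (\<forall>i j k. i \<le> j \<and> j \<le> k \<and> k \<le> p \<longrightarrow>
        lcmp F' i j k \<cdot>\<^bsub>C\<^esub> \<alpha> i k = (\<alpha> i j \<star>\<^bsub>C\<^esub> \<alpha> j k) \<cdot>\<^bsub>C\<^esub> lcmp F i j k) \<and>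
     (\<forall>i\<le>p. lone F' i \<cdot>\<^bsub>C\<^esub> \<alpha> i i = lone F i)"


section \<open>The nerves of a bicategory\<close>

type_synonym ('o, 'm, 'd) trans_arrow =
  "('o, 'm, 'd) lax_data \<times> ('o, 'm, 'd) lax_data \<times> (nat \<Rightarrow> nat \<Rightarrow> 'd)"

type_synonym ('o, 'm, 'd) functor_nerve =
  "(('o, 'm, 'd) lax_data, ('o, 'm, 'd) trans_arrow) simp_cat"

text \<open>
  The simplicial category whose \<open>p\<close>-simplices are the functor data satisfying \<open>P p\<close>, with the
  transformations satisfying \<open>T p\<close> as arrows.
\<close>

definition functor_cat ::
  "('o, 'm, 'd) bicat \<Rightarrow> (nat \<Rightarrow> ('o, 'm, 'd) lax_data \<Rightarrow> bool) \<Rightarrow>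
    (nat \<Rightarrow> ('o, 'm, 'd) lax_data \<Rightarrow> ('o, 'm, 'd) lax_data \<Rightarrow> (nat \<Rightarrow> nat \<Rightarrow> 'd) \<Rightarrow> bool) \<Rightarrow>
    nat \<Rightarrow> (('o, 'm, 'd) lax_data, ('o, 'm, 'd) trans_arrow) cat" where
  "functor_cat C P T p =
     \<lparr>obs = {F. P p F},
      ars = {(F, F', \<alpha>). P p F \<and> P p F' \<and> T p F F' \<alpha>},
      dm = (\<lambda>(F, F', \<alpha>). F),
      cd = (\<lambda>(F, F', \<alpha>). F'),
      idn = (\<lambda>F. (F, F, restr_trans p (\<lambda>i j. vid C (lmor F i j)))),
      cmp = (\<lambda>(F', F'', \<beta>) (F, _, \<alpha>). (F, F'', restr_trans p (\<lambda>i j. \<beta> i j \<cdot>\<^bsub>C\<^esub> \<alpha> i j)))\<rparr>"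

definition functor_nerve ::
  "('o, 'm, 'd) bicat \<Rightarrow> (nat \<Rightarrow> ('o, 'm, 'd) lax_data \<Rightarrow> bool) \<Rightarrow>
    (nat \<Rightarrow> ('o, 'm, 'd) lax_data \<Rightarrow> ('o, 'm, 'd) lax_data \<Rightarrow> (nat \<Rightarrow> nat \<Rightarrow> 'd) \<Rightarrow> bool) \<Rightarrow>
    ('o, 'm, 'd) functor_nerve" where
  "functor_nerve C P T = strict_simp_cat (functor_cat C P T)
     (\<lambda>q p a F. pull_data q a F)
     (\<lambda>q p a (F, F', \<alpha>). (pull_data q a F, pull_data q a F', pull_trans q a \<alpha>))"

definition lax_nerve :: "('o, 'm, 'd) bicat \<Rightarrow> ('o, 'm, 'd) functor_nerve" where
  "lax_nerve C = functor_nerve C (lax_functor C) (lax_trans C)"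

definition normal_lax_nerve :: "('o, 'm, 'd) bicat \<Rightarrow> ('o, 'm, 'd) functor_nerve" where
  "normal_lax_nerve C = functor_nerve C (normal_lax_functor C) (lax_trans C)"

definition oplax_nerve :: "('o, 'm, 'd) bicat \<Rightarrow> ('o, 'm, 'd) functor_nerve" where
  "oplax_nerve C = functor_nerve C (oplax_functor C) (oplax_trans C)"

definition normal_oplax_nerve :: "('o, 'm, 'd) bicat \<Rightarrow> ('o, 'm, 'd) functor_nerve" where
  "normal_oplax_nerve C = functor_nerve C (normal_oplax_functor C) (oplax_trans C)"

definition segal_nerve :: "('o, 'm, 'd) bicat \<Rightarrow> ('o, 'm, 'd) functor_nerve" where
  "segal_nerve C = functor_nerve C (normal_homomorphism C) (lax_trans C)"

definition functor_sset ::
  "(nat \<Rightarrow> ('o, 'm, 'd) lax_data \<Rightarrow> bool) \<Rightarrow> ('o, 'm, 'd) lax_data sset" where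
  "functor_sset P = \<lparr>simps = (\<lambda>p. {F. P p F}), sact = (\<lambda>q p a F. pull_data q a F)\<rparr>"

text \<open>The geometric nerves, regarded as discrete simplicial categories.\<close>

type_synonym ('o, 'm, 'd) discrete_nerve =
  "(('o, 'm, 'd) lax_data, ('o, 'm, 'd) lax_data) simp_cat"

definition lax_geometric_nerve :: "('o, 'm, 'd) bicat \<Rightarrow> ('o, 'm, 'd) discrete_nerve" where
  "lax_geometric_nerve C = discrete_simp_cat (functor_sset (lax_functor C))"

definition normal_lax_geometric_nerve :: "('o, 'm, 'd) bicat \<Rightarrow> ('o, 'm, 'd) discrete_nerve" where
  "normal_lax_geometric_nerve C = discrete_simp_cat (functor_sset (normal_lax_functor C))"

definition oplax_geometric_nerve :: "('o, 'm, 'd) bicat \<Rightarrow> ('o, 'm, 'd) discrete_nerve" where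
  "oplax_geometric_nerve C = discrete_simp_cat (functor_sset (oplax_functor C))"

definition normal_oplax_geometric_nerve :: "('o, 'm, 'd) bicat \<Rightarrow> ('o, 'm, 'd) discrete_nerve" where
  "normal_oplax_geometric_nerve C = discrete_simp_cat (functor_sset (normal_oplax_functor C))"

definition invert_data ::
  "('o, 'm, 'd) bicat \<Rightarrow> nat \<Rightarrow> ('o, 'm, 'd) lax_data \<Rightarrow> ('o, 'm, 'd) lax_data" where
  "invert_data C p F = restr_data p
     \<lparr>lob = lob F, lmor = lmor F,
      lcmp = (\<lambda>i j k. cell_inv C (lcmp F i j k)), lone = (\<lambda>i. cell_inv C (lone F i))\<rparr>"

definition segal_to_oplax ::
  "('o, 'm, 'd) bicat \<Rightarrow>
    (('o, 'm, 'd) lax_data, ('o, 'm, 'd) trans_arrow,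
     ('o, 'm, 'd) lax_data, ('o, 'm, 'd) trans_arrow) lax_mor" where
  "segal_to_oplax C = strict_mor (normal_oplax_nerve C)
     (invert_data C)
     (\<lambda>p (F, F', \<alpha>). (invert_data C p F, invert_data C p F', \<alpha>))"


section \<open>The pseudo-simplicial nerve\<close>

text \<open>
  A string is a pair \<open>([x\<^sub>0, \<dots>, x\<^sub>p], [u\<^sub>1, \<dots>, u\<^sub>p])\<close>, so \<open>u\<^sub>i\<close> is \<open>us ! (i - 1)\<close>.  Faces and
  degeneracies are parametrized by the composition \<open>m\<close> and the identities \<open>e\<close>: they are used for
  morphisms, for deformations, and for formal composites of morphisms.
\<close>

type_synonym ('o, 'u) string = "'o list \<times> 'u list"

definition face :: "('u \<Rightarrow> 'u \<Rightarrow> 'u) \<Rightarrow> nat \<Rightarrow> ('o, 'u) string \<Rightarrow> ('o, 'u) string" where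
  "face m i = (\<lambda>(xs, us).
     (take i xs @ drop (Suc i) xs,
      if i = 0 then tl us
      else if i = length us then butlast us
      else take (i - 1) us @ m (us ! (i - 1)) (us ! i) # drop (Suc i) us))"

definition degen :: "('o \<Rightarrow> 'u) \<Rightarrow> nat \<Rightarrow> ('o, 'u) string \<Rightarrow> ('o, 'u) string" where
  "degen e i = (\<lambda>(xs, us). (take (Suc i) xs @ drop i xs, take i us @ e (xs ! i) # drop i us))"

text \<open>
  For \<open>a : [q] \<rightarrow> [p]\<close> with canonical factorization \<open>d\<^bsup>i\<^sub>1\<^esup> \<dots> d\<^bsup>i\<^sub>s\<^esup> s\<^bsup>j\<^sub>1\<^esup> \<dots> s\<^bsup>j\<^sub>t\<^esup>\<close>, the \<open>i\<close>'s are the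
  elements of \<open>[p]\<close> not in the image of \<open>a\<close>, and the \<open>j\<close>'s are those with \<open>a j = a (j + 1)\<close>.
  The faces are applied with decreasing, then the degeneracies with increasing index.
\<close>

definition string_pull ::
  "('u \<Rightarrow> 'u \<Rightarrow> 'u) \<Rightarrow> ('o \<Rightarrow> 'u) \<Rightarrow> nat \<Rightarrow> nat \<Rightarrow> (nat \<Rightarrow> nat) \<Rightarrow> ('o, 'u) string \<Rightarrow> ('o, 'u) string" where
  "string_pull m e q p a s =
     fold (degen e) (sorted_list_of_set {j. j < q \<and> a j = a (Suc j)})
       (fold (face m) (rev (sorted_list_of_set ({..p} - a ` {..q}))) s)"

text \<open>
  Formal composites of the morphisms of a string \<open>x\<^sub>0 \<leftarrow> x\<^sub>1 \<leftarrow> \<dots> \<leftarrow> x\<^sub>p\<close>: \<open>Gen k\<close> stands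
  for \<open>u\<^sub>k : x\<^sub>k \<rightarrow> x\<^bsub>k-1\<^esub>\<close> and \<open>Unit i\<close> for the identity of \<open>x\<^sub>i\<close>.
\<close>

datatype word = Gen nat | Unit nat | Cmp word word

primrec word_src :: "word \<Rightarrow> nat" where
  "word_src (Gen k) = k"
| "word_src (Unit i) = i"
| "word_src (Cmp v w) = word_src w"

primrec word_tgt :: "word \<Rightarrow> nat" where
  "word_tgt (Gen k) = k - 1"
| "word_tgt (Unit i) = i"
| "word_tgt (Cmp v w) = word_tgt v"

primrec word_eval :: "('o, 'm, 'd) bicat \<Rightarrow> ('o, 'm) string \<Rightarrow> word \<Rightarrow> 'm" where
  "word_eval C s (Gen k) = snd s ! (k - 1)"
| "word_eval C s (Unit i) = unit_mor C (fst s ! i)"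
| "word_eval C s (Cmp v w) = word_eval C s v \<diamondop>\<^bsub>C\<^esub> word_eval C s w"

text \<open>
  \<open>canonical C s v w \<gamma>\<close>: the deformation \<open>\<gamma>\<close> from the value of \<open>v\<close> to the value of \<open>w\<close> is
  built from the constraints of \<open>C\<close>.  Formal composites are needed because two canonical
  deformations between the same morphisms of \<open>C\<close> may differ; by coherence, \<open>\<gamma>\<close> is determined by
  the formal composites \<open>v\<close> and \<open>w\<close>.
\<close>

inductive canonical :: "('o, 'm, 'd) bicat \<Rightarrow> ('o, 'm) string \<Rightarrow> word \<Rightarrow> word \<Rightarrow> 'd \<Rightarrow> bool"
  for C s where
  can_id: "canonical C s w w (vid C (word_eval C s w))"
| can_asc: "canonical C s (Cmp u (Cmp v w)) (Cmp (Cmp u v) w)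
      (asc C (word_eval C s u) (word_eval C s v) (word_eval C s w))"
| can_lun: "canonical C s (Cmp (Unit (word_tgt w)) w) w (lun C (word_eval C s w))"
| can_run: "canonical C s (Cmp w (Unit (word_src w))) w (run C (word_eval C s w))"
| can_inv: "\<lbrakk>canonical C s v w \<gamma>; inverse_cells C \<gamma> \<delta>\<rbrakk> \<Longrightarrow> canonical C s w v \<delta>"
| can_vcomp: "\<lbrakk>canonical C s u v \<gamma>; canonical C s v w \<delta>\<rbrakk> \<Longrightarrow> canonical C s u w (\<delta> \<cdot>\<^bsub>C\<^esub> \<gamma>)"
| can_hcomp: "\<lbrakk>canonical C s v v' \<gamma>; canonical C s w w' \<delta>\<rbrakk>
      \<Longrightarrow> canonical C s (Cmp v w) (Cmp v' w') (\<gamma> \<star>\<^bsub>C\<^esub> \<delta>)"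

definition canonical_cell :: "('o, 'm, 'd) bicat \<Rightarrow> ('o, 'm) string \<Rightarrow> word \<Rightarrow> word \<Rightarrow> 'd" where
  "canonical_cell C s v w = (THE \<gamma>. canonical C s v w \<gamma>)"

definition generic_string :: "nat \<Rightarrow> (nat, word) string" where
  "generic_string p = ([0..<Suc p], map Gen [1..<Suc p])"

abbreviation word_pull ::
  "nat \<Rightarrow> nat \<Rightarrow> (nat \<Rightarrow> nat) \<Rightarrow> (nat, word) string \<Rightarrow> (nat, word) string" where
  "word_pull \<equiv> string_pull Cmp Unit"

definition string_cat :: "('o, 'm, 'd) bicat \<Rightarrow> nat \<Rightarrow> (('o, 'm) string, ('o, 'd) string) cat" where
  "string_cat C p =
     \<lparr>obs = {(xs, us). length xs = Suc p \<and> length us = p \<and> set xs \<subseteq> Ob C \<and>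
               (\<forall>i<p. us ! i \<in> obs (hom_cat C (xs ! Suc i) (xs ! i)))},
      ars = {(xs, \<alpha>s). length xs = Suc p \<and> length \<alpha>s = p \<and> set xs \<subseteq> Ob C \<and>
               (\<forall>i<p. \<alpha>s ! i \<in> ars (hom_cat C (xs ! Suc i) (xs ! i)))},
      dm = (\<lambda>(xs, \<alpha>s). (xs, map (ddom C) \<alpha>s)),
      cd = (\<lambda>(xs, \<alpha>s). (xs, map (dcod C) \<alpha>s)),
      idn = (\<lambda>(xs, us). (xs, map (vid C) us)),
      cmp = (\<lambda>(xs, \<beta>s) (_, \<alpha>s). (xs, map2 (vcomp C) \<beta>s \<alpha>s))\<rparr>"

definition pseudo_nerve :: "('o, 'm, 'd) bicat \<Rightarrow> (('o, 'm) string, ('o, 'd) string) simp_cat" where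
  "pseudo_nerve C =
     \<lparr>level = string_cat C,
      pb_ob = string_pull (mcomp C) (unit_mor C),
      pb_ar = string_pull (hcomp C) (\<lambda>x. vid C (unit_mor C x)),
      pcmp = (\<lambda>r q p b a s.
        let W = word_pull r q b (word_pull q p a (generic_string p));
            W' = word_pull r p (compose {..r} a b) (generic_string p)
        in (map (\<lambda>i. fst s ! i) (fst W'), map2 (canonical_cell C s) (snd W) (snd W'))),
      punit = (\<lambda>p s. idn (string_cat C p) s)\<rparr>"


section \<open>The pseudo-simplicial functors J\<close>

text \<open>\<open>string_ext m e s i j\<close> is the left-bracketed composite of the entries \<open>i + 1, \<dots>, j\<close> of the
  string, and an identity for \<open>i = j\<close>.\<close>

fun string_ext :: "('u \<Rightarrow> 'u \<Rightarrow> 'u) \<Rightarrow> ('o \<Rightarrow> 'u) \<Rightarrow> ('o, 'u) string \<Rightarrow> nat \<Rightarrow> nat \<Rightarrow> 'u" where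
  "string_ext m e s i 0 = e (fst s ! i)"
| "string_ext m e s i (Suc j) =
     (if Suc j \<le> i then e (fst s ! i)
      else if i = j then snd s ! j
      else m (string_ext m e s i j) (snd s ! j))"

text \<open>The values \<open>lun\<close> for \<open>i = j\<close> and \<open>run\<close> for \<open>j = k\<close> are forced by normality.\<close>

fun ext_cell :: "('o, 'm, 'd) bicat \<Rightarrow> ('o, 'm) string \<Rightarrow> nat \<Rightarrow> nat \<Rightarrow> nat \<Rightarrow> 'd" where
  "ext_cell C s i j 0 = lun C (unit_mor C (fst s ! 0))"
| "ext_cell C s i j (Suc k) =
     (let F = string_ext (mcomp C) (unit_mor C) s in
      if i = j then lun C (F i (Suc k))
      else if j = Suc k then run C (F i j)
      else if j = k then vid C (F i (Suc k))
      else (ext_cell C s i j k \<star>\<^bsub>C\<^esub> vid C (snd s ! k)) \<cdot>\<^bsub>C\<^esub> asc C (F i j) (F j k) (snd s ! k))"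

definition ext_data :: "('o, 'm, 'd) bicat \<Rightarrow> nat \<Rightarrow> ('o, 'm) string \<Rightarrow> ('o, 'm, 'd) lax_data" where
  "ext_data C p s = restr_data p
     \<lparr>lob = (\<lambda>i. fst s ! i),
      lmor = string_ext (mcomp C) (unit_mor C) s,
      lcmp = ext_cell C s,
      lone = (\<lambda>i. vid C (unit_mor C (fst s ! i)))\<rparr>"

definition J_segal ::
  "('o, 'm, 'd) bicat \<Rightarrow>
    (('o, 'm) string, ('o, 'd) string, ('o, 'm, 'd) lax_data, ('o, 'm, 'd) trans_arrow) lax_mor" where
  "J_segal C =
     \<lparr>mob = ext_data C,
      mar = (\<lambda>p t. (ext_data C p (dm (string_cat C p) t), ext_data C p (cd (string_cat C p) t),
                    restr_trans p (string_ext (hcomp C) (\<lambda>x. vid C (unit_mor C x)) t))),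
      mstr = (\<lambda>q p a s.
        (ext_data C q (pb_ob (pseudo_nerve C) q p a s), pull_data q a (ext_data C p s),
         restr_trans q (\<lambda>i j. canonical_cell C s
           (string_ext Cmp Unit (word_pull q p a (generic_string p)) i j)
           (string_ext Cmp Unit (generic_string p) (a i) (a j)))))\<rparr>"

definition J_normal_lax ::
  "('o, 'm, 'd) bicat \<Rightarrow>
    (('o, 'm) string, ('o, 'd) string, ('o, 'm, 'd) lax_data, ('o, 'm, 'd) trans_arrow) lax_mor" where
  "J_normal_lax C = lax_mor_comp (normal_lax_nerve C) (inclusion (normal_lax_nerve C)) (J_segal C)"

definition J_normal_oplax ::
  "('o, 'm, 'd) bicat \<Rightarrow>
    (('o, 'm) string, ('o, 'd) string, ('o, 'm, 'd) lax_data, ('o, 'm, 'd) trans_arrow) lax_mor" where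
  "J_normal_oplax C = lax_mor_comp (normal_oplax_nerve C) (segal_to_oplax C) (J_segal C)"

end

theory Submission
  imports Defs
begin

text \<open>
Everything rests on acyclic carriers. Maps out of the realization of a simplicial set that send each
simplex \<open>\<sigma>\<close> into a contractible space \<open>V \<sigma>\<close>, naturally in \<open>\<sigma>\<close>, exist and are unique up to homotopy;
they are extended over nondegenerate cells by a radial retraction. For the nerve of a category, with
\<open>V\<close> the classifying space of a comma category over the vertex 0, this gives the homotopy induced by a
natural transformation and Quillen's Theorem A.

Theorem A is applied to Grothendieck constructions in three ways. A strict simplicial functor that is
levelwise reflective is an equivalence, by universal arrows. A full simplicial subcategory that is
levelwise coreflective is one too, because the relevant comma category is fibred over a slice of the
simplex category with terminal objects in its fibres; no stability of the coreflections under the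
simplicial operators is needed. Finally, the inclusion of the objects is an equivalence as soon as an
arrow \<open>F \<Rightarrow> G\<close> and a map \<open>[q] \<rightarrow> [1]\<close> can be mixed to an object that agrees with \<open>G\<close> on one convex
half of \<open>[q]\<close> and with \<open>F\<close> elsewhere, for this contracts the simplicial sets of arrows with a given target.

For a bicategory, normalization is a coreflection of lax functors onto normal ones, and rectification
(left bracketing the string of consecutive morphisms) is a coreflection of normal lax functors onto
normal homomorphisms; oplax functors are lax functors of the dual with arrows reversed, where these
become reflections. Coherence is obtained by comparing every formal composite with its left bracketed
normal form. This comparison makes \<open>J\<close> bijective on arrows of the Grothendieck constructions, so that
the associativity of \<open>\<integral>N\<close> is inherited from \<open>\<integral>S\<close>, and \<open>J\<close> is an equivalence by universal arrows.
\<close>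

text \<open>An arrow \<open>(y, [q]) -> (x, [p])\<close> of a Grothendieck construction over
  \<open>a\<close> is an arrow \<open>y -> a^* x\<close> of the level of its source. This asymmetry
  decides how the two kinds of adjunction are treated. A reflection of \<open>y\<close> acts on the
  source and serves every \<open>a\<close> at once, so it is a universal arrow of the whole
  construction. A coreflection would have to act on \<open>a^* x\<close>, and neither normalization
  nor rectification commutes with \<open>a^*\<close>: along a degeneracy, a consecutive morphism of
  \<open>a^* F\<close> is some \<open>F i i\<close>, which normalizing \<open>a^* F\<close> keeps;
  along a face, rectifying \<open>a^* F\<close> starts from the morphisms \<open>F i k\<close> and
  not from composites. Coreflective inclusions are therefore compared through Theorem A, one
  operator at a time. The orientation of \<open>[p]\<close> matters as well. Vertex 0 is the common
  target of a simplex, and an operator \<open>a\<close> yields an arrow from vertex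
  \<open>a 0\<close> to vertex 0. Over-categories are covariant along this arrow, which is why comma
  categories over the image of vertex 0 form a carrier.\<close>

abbreviation (input) "lobs D p == obs (level D p)"
abbreviation (input) "lars D p == ars (level D p)"
abbreviation (input) "ldm D p == dm (level D p)"
abbreviation (input) "lcd D p == cd (level D p)"
abbreviation (input) "lidn D p == idn (level D p)"
abbreviation (input) "lcp D p == cmp (level D p)"
abbreviation (input) "cp q a b == compose {..q} a b"
abbreviation (input) "Hot == homotopic_with (%_. True)"
abbreviation (input) "Gro == grothendieck"
abbreviation (input) "Splx == standard_simplex"
abbreviation (input) "hequiv == homotopy_equivalence_map"
abbreviation (input) "hinduced == induces_homotopy_equivalence"
abbreviation (input) "spush == simplex_push"
abbreviation (input) "Did == Delta_id"
abbreviation (input) "restr == restr_trans"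
abbreviation (input) "pulld == pull_data"
abbreviation (input) "invcell == invertible_cell"
abbreviation (input) "strc == string_cat"
abbreviation (input) "Gro_ar == grothendieck_map_ar"
abbreviation (input) "Gro_ob == grothendieck_map_ob"
abbreviation (input) "nhom == normal_homomorphism"
abbreviation (input) "dsc == discrete_simp_cat"
abbreviation (input) "wsrc == word_src"
abbreviation (input) "wtgt == word_tgt"
abbreviation (input) "invd == invert_data"
abbreviation (input) "cmap == continuous_map"
abbreviation (input) "presimp == presimplices"
abbreviation (input) "fnerve == functor_nerve"
abbreviation (input) "Nerve == pseudo_nerve"
abbreviation (input) "Segal == segal_nerve"
abbreviation (input) "laxF == lax_functor"
abbreviation (input) "laxT == lax_trans"
abbreviation (input) "oplaxT == oplax_trans"
abbreviation (input) "cinv == cell_inv"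
abbreviation (input) "extd == ext_data"
abbreviation (input) "mstrJ C == mstr (J_segal C)"
abbreviation (input) equiv_bool (infixr "<->" 25) where "a <-> b == (a :: bool) = b"
notation vcomp (infixl ";;\<index>" 70) and mcomp (infixl "<>\<index>" 75) and hcomp (infixl "*.\<index>" 75)

section \<open>Geometric realization\<close>

abbreviation Simplex :: "nat => (nat => real) topology" where
 "Simplex p == subtopology (powertop_real UNIV) (Splx p)"

section \<open>Operators of the simplex category and points of the standard simplices\<close>

lemma DeltaD:
 assumes "a : Delta q p"
 shows "i <= q ==> a i <= p" "i <= j ==> j <= q ==> a i <= a j" "~ i <= q ==> a i = undefined"
 using assms by (auto simp: Delta_def mono_on_def PiE_def extensional_def)

lemma DeltaI:
 assumes "!!i. i <= q ==> a i <= p" "!!i j. i <= j ==> j <= q ==> a i <= a j"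
  "!!i. q < i ==> a i = undefined"
 shows "a : Delta q p"
 using assms by (auto simp: Delta_def mono_on_def PiE_def extensional_def)

lemma Delta_eqI:
 assumes "a : Delta q p" "b : Delta q p'" "!!i. i <= q ==> a i = b i"
 shows "a = b"
 using assms by (auto simp: Delta_def PiE_def extensional_def fun_eq_iff) (metis atMost_iff)

lemma compose_apply [simp]: "i <= q ==> cp q a b i = a (b i)"
 by (simp add: compose_def)

lemma cp_Delta [simp, intro]:
 "[|b : Delta r q; a : Delta q p|] ==> cp r a b : Delta r p"
 by (rule DeltaI) (auto simp: DeltaD, simp add: compose_def)

lemma Delta_id_apply [simp]: "i <= p ==> Did p i = i"
 by (simp add: Delta_id_def)

lemma Delta_id_in [simp, intro]: "Did p : Delta p p"
 by (rule DeltaI) (auto simp: Delta_id_def)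

lemma comp_id:
 assumes "a : Delta q p"
 shows "cp q a (Did q) = a" "cp q (Did p) a = a"
 using assms by (auto intro!: Delta_eqI[where q = q and p = p and p' = p] cp_Delta simp: DeltaD)

lemma comp_assoc:
 assumes "c : Delta s r" "b : Delta r q" "a : Delta q p"
 shows "cp s (cp r a b) c = cp s a (cp s b c)"
 using assms by (auto intro!: Delta_eqI[where q = s and p = p and p' = p] cp_Delta simp: DeltaD)

lemma simplexD:
 assumes "t : Splx p"
 shows "0 <= t i" "t i <= 1" "p < i ==> t i = 0" "(SUM i<=p. t i) = 1"
 using assms by (auto simp: standard_simplex_def)

lemma simplexI:
 assumes "!!i. i <= p ==> 0 <= t i" "!!i. p < i ==> t i = 0" "(SUM i<=p. t i) = 1"
 shows "t : Splx p"
proof -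
 have "t i <= 1" for i
 proof (cases "i <= p")
  case True
  then have "t i <= (SUM i<=p. t i)" by (intro member_le_sum) (auto simp: assms)
  then show ?thesis by (simp add: assms)
 qed (simp add: assms)
 moreover have "0 <= t i" for i using assms(1,2) by (cases "i <= p") auto
 ultimately show ?thesis
  using assms by (auto simp: standard_simplex_def)
qed

lemma spush_in [simp, intro]:
 assumes a: "a : Delta q p" and t: "t : Splx q"
 shows "spush q a t : Splx p"
proof (rule simplexI)
 show "0 <= spush q a t i" for i
  unfolding simplex_push_def using simplexD[OF t] by (auto intro: sum_nonneg)
 show "spush q a t i = 0" if "p < i" for i
 proof -
  have "{j. j <= q & a j = i} = {}" using that DeltaD(1)[OF a] by force
  then show ?thesis unfolding simplex_push_def by (simp only: sum.empty)
 qed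
 have "(SUM j<=p. \<Sum>i | i <= q & a i = j. t i) = (SUM i<=q. t i)"
  using sum.group[of "{..q}" "{..p}" a t] DeltaD(1)[OF a] by (auto simp: image_subset_iff)
 then show "(SUM i<=p. spush q a t i) = 1"
  by (simp add: simplex_push_def simplexD(4)[OF t])
qed

lemma spush_comp:
 assumes b: "b : Delta r q"
 shows "spush q a (spush r b t) = spush r (cp r a b) t"
proof
 fix j
 have "(\<Sum>i | i <= q & a i = j. \<Sum>k | k <= r & b k = i. t k)
   = (\<Sum>i\<in>{i. i <= q & a i = j}. \<Sum>k | k : {k. k <= r & a (b k) = j} & b k = i. t k)"
  by (intro sum.cong) (auto intro: arg_cong2[where f=sum])
 also have "... = (\<Sum>k | k <= r & a (b k) = j. t k)"
  using DeltaD(1)[OF b] by (intro sum.group) auto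
 also have "... = (\<Sum>k | k <= r & cp r a b k = j. t k)"
  by (intro sum.cong) auto
 finally show "spush q a (spush r b t) j = spush r (cp r a b) t j"
  by (simp add: simplex_push_def)
qed

lemma spush_id:
 assumes t: "t : Splx p"
 shows "spush p (Did p) t = t"
proof
 fix j
 have "{i. i <= p & Did p i = j} = (if j <= p then {j} else {})"
  by auto
 then show "spush p (Did p) t j = t j"
  using simplexD(3)[OF t, of j] by (auto simp: simplex_push_def)
qed

lemma spush_inj:
 assumes a: "a : Delta q p" and inj: "inj_on a {..q}" and i: "i <= q"
 shows "spush q a t (a i) = t i"
proof -
 have "{j. j <= q & a j = a i} = {i}"
  using inj i by (auto dest: inj_onD)
 then show ?thesis by (simp add: simplex_push_def)
qed

lemma spush_notin: "j ~: a ` {..q} ==> spush q a t j = 0"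
 unfolding simplex_push_def by (rule sum.neutral) auto

lemma cmap_coord: "cmap (Simplex p) euclideanreal (%t. t i)"
 by (intro continuous_map_from_subtopology continuous_map_product_projection) auto

lemma cmap_Simplex:
 assumes "!!i. cmap X euclideanreal (%x. f x i)"
  "!!x. x : topspace X ==> f x : Splx p"
 shows "cmap X (Simplex p) f"
 using assms by (auto simp: continuous_map_in_subtopology continuous_map_componentwise_UNIV
   simp del: euclidean_product_topology)

lemma cmap_spush:
 assumes "a : Delta q p"
 shows "cmap (Simplex q) (Simplex p) (spush q a)"
 by (rule cmap_Simplex)
  (auto simp: simplex_push_def[abs_def] assms spush_in[unfolded simplex_push_def]
   intro!: continuous_map_sum cmap_coord simp del: euclidean_product_topology)

section \<open>The realization as a quotient of its cells\<close>

locale simplicial_set =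
 fixes X :: "'s sset"
 assumes sact_in: "[|a : Delta q p; s : simps X p|] ==> sact X q p a s : simps X q"
  and sact_comp: "[|b : Delta r q; a : Delta q p; s : simps X p|]
   ==> sact X r q b (sact X q p a s) = sact X r p (cp r a b) s"
  and sact_id: "s : simps X p ==> sact X p p (Did p) s = s"

definition pt :: "'s sset => nat => 's => (nat => real) => (nat * 's * (nat => real)) set" where
 "pt X p s t = glue_eq X `` {(p, s, t)}"

lemma top_presimp:
 "topspace (presimp X) = {(p, s, t). s : simps X p & t : Splx p}"
 by (auto simp: presimplices_def)

text \<open>The discrete factor splits the product into one copy of the standard simplex for each
  simplex, so openness is tested on each cell separately.\<close>

lemma openin_presimp:
 "openin (presimp X) U <->
   U \<subseteq> topspace (presimp X) &
   (ALL p. ALL s:simps X p. openin (Simplex p) {t : Splx p. (p, s, t) : U})"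
proof -
 have *: "openin (prod_topology (discrete_topology (simps X p)) (Simplex p)) {x. (p, x) : U}
   <-> (ALL s:simps X p. openin (Simplex p) {t : Splx p. (p, s, t) : U})"
  if U: "U \<subseteq> topspace (presimp X)" for p
 proof
  assume L: "openin (prod_topology (discrete_topology (simps X p)) (Simplex p)) {x. (p, x) : U}"
  show "ALL s:simps X p. openin (Simplex p) {t : Splx p. (p, s, t) : U}"
  proof
   fix s assume s: "s : simps X p"
   have "cmap (Simplex p) (prod_topology (discrete_topology (simps X p)) (Simplex p)) (Pair s)"
    using s by (auto simp: continuous_map_pairwise o_def)
   from openin_continuous_map_preimage[OF this L]
   show "openin (Simplex p) {t : Splx p. (p, s, t) : U}"
    by simp
  qed
 next
  assume R: "ALL s:simps X p. openin (Simplex p) {t : Splx p. (p, s, t) : U}"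
  have "{x. (p, x) : U} = (\<Union>s\<in>simps X p. {s} \<times> {t : Splx p. (p, s, t) : U})"
   using U by (auto simp: top_presimp)
  moreover have "openin (prod_topology (discrete_topology (simps X p)) (Simplex p)) ..."
   using R by (auto intro!: openin_Union simp: openin_prod_Times_iff)
  ultimately show "openin (prod_topology (discrete_topology (simps X p)) (Simplex p)) {x. (p, x) : U}"
   by simp
 qed
 show ?thesis
 proof (cases "U \<subseteq> topspace (presimp X)")
  case True
  then show ?thesis using *[OF True] 
   by (auto simp: openin_sum_topology presimplices_def)
 next
  case False
  then show ?thesis using openin_subset by blast
 qed
qed

lemma cmap_presimp:
 "cmap (presimp X) Z f <->
  (ALL p. ALL s:simps X p. cmap (Simplex p) Z (%t. f (p, s, t)))"
 (is "_ <-> ?R")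
proof
 assume L: "cmap (presimp X) Z f"
 have "cmap (Simplex p) (presimp X) (%t. (p, s, t))" if "s : simps X p" for p s
  using that unfolding continuous_map openin_presimp top_presimp by auto
 then show ?R
  using L continuous_map_compose by (force simp: o_def)
next
 assume R: ?R
 show "cmap (presimp X) Z f"
  unfolding continuous_map openin_presimp
 proof (intro conjI allI impI ballI)
  show "f ` topspace (presimp X) \<subseteq> topspace Z"
   using R by (auto simp: top_presimp continuous_map_def Pi_iff)
  fix U p s assume U: "openin Z U" and s: "s : simps X p"
  have "{t : topspace (Simplex p). f (p, s, t) : U} =
    {t : Splx p. (p, s, t) : {x : topspace (presimp X). f x : U}}"
   using s by (auto simp: top_presimp)
  then show "openin (Simplex p) {t : Splx p. (p, s, t) : {x : topspace (presimp X). f x : U}}"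
   using openin_continuous_map_preimage[of "Simplex p" Z "%t. f (p, s, t)" U] R s U by simp
 qed auto
qed

lemma quotient_real:
 "quotient_map (presimp X) (realization X) (%x. glue_eq X `` {x})"
 unfolding quotient_map_def
proof (intro conjI allI impI)
 let ?q = "%x. glue_eq X `` {x}"
 show "?q ` topspace (presimp X) = topspace (realization X)"
  by (auto simp: topspace_realization quotient_def)
 fix U assume U: "U \<subseteq> topspace (realization X)"
 have "{x : topspace (presimp X). ?q x : U} = \<Union>U"
 proof (intro equalityI subsetI)
  fix x assume "x : {x : topspace (presimp X). ?q x : U}"
  then show "x : \<Union>U" using equiv_class_self[OF equiv_glue_eq, of x X] by blast
 next
  fix x assume "x : \<Union>U"
  then obtain c where c: "c : U" "x : c" by blast
  then have "c : topspace (presimp X) // glue_eq X"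
   using U topspace_realization by blast
  then obtain y where y: "y : topspace (presimp X)" "c = ?q y"
   by (auto simp: quotient_def)
  then have yx: "(y, x) : glue_eq X" using c by simp
  have "c = ?q x" using y equiv_class_eq[OF equiv_glue_eq yx] by simp
  moreover have "x : topspace (presimp X)" using yx by (auto simp: glue_eq_def)
  ultimately show "x : {x : topspace (presimp X). ?q x : U}" using c by auto
 qed
 then show "openin (presimp X) {x : topspace (presimp X). ?q x : U} = openin (realization X) U"
  using U by (simp add: openin_realization topspace_realization)
qed

lemma pt_in [simp, intro]:
 "[|s : simps X p; t : Splx p|] ==> pt X p s t : topspace (realization X)"
 by (auto simp: pt_def topspace_realization top_presimp intro!: quotientI)

lemma realization_cases:
 assumes "c : topspace (realization X)"
 obtains p s t where "s : simps X p" "t : Splx p" "c = pt X p s t"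
proof -
 have "c : (%x. glue_eq X `` {x}) ` topspace (presimp X)"
  using assms quotient_real[of X] by (simp add: quotient_map_def)
 then show thesis using that by (auto simp: top_presimp pt_def)
qed

lemma cmap_pt:
 "s : simps X p ==> cmap (Simplex p) (realization X) (pt X p s)"
 using quotient_imp_continuous_map[OF quotient_real[of X]]
 by (simp add: cmap_presimp pt_def[abs_def])

lemma glue_eq_invariant:
 assumes "(x, y) : glue_eq X"
  and inv: "!!x y. (x, y) : glue X ==> ph x = ph y"
 shows "ph x = ph y"
proof -
 have "(x, y) : (glue X \<union> (glue X)\<inverse>)\<^sup>*"
  using assms by (auto simp: glue_eq_def)
 then show ?thesis
  by induction (auto simp: inv dest!: inv)
qed

context simplicial_set
begin

lemma pt_push:
 assumes "a : Delta q p" "s : simps X p" "t : Splx q"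
 shows "pt X q (sact X q p a s) t = pt X p s (spush q a t)"
proof -
 have "((q, sact X q p a s, t), (p, s, spush q a t)) : glue_eq X"
  using assms by (auto simp: glue_eq_def glue_def top_presimp sact_in)
 then show ?thesis
  unfolding pt_def by (rule equiv_class_eq[OF equiv_glue_eq])
qed

text \<open>The product of a quotient map with a locally compact Hausdorff space is again a quotient
  map, so a map on \<open>T\<close> times the realization can be given cell by cell.
  \<open>T = {0..1}\<close> produces homotopies and \<open>T = {0}\<close> plain maps.\<close>

lemma real_lift_param:
 fixes T :: "real set" and ph :: "nat => 's => real * (nat => real) => 'z"
 assumes T: "compact T"
  and cont: "!!p s. s : simps X p ==>
    cmap (prod_topology (top_of_set T) (Simplex p)) Z (ph p s)"
  and nat: "!!q p a s u t. [|a : Delta q p; s : simps X p; u : T; t : Splx q|]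
    ==> ph q (sact X q p a s) (u, t) = ph p s (u, spush q a t)"
 obtains H where "cmap (prod_topology (top_of_set T) (realization X)) Z H"
  "!!p s u t. [|s : simps X p; u : T; t : Splx p|] ==> H (u, pt X p s t) = ph p s (u, t)"
proof -
 let ?q = "%(u::real, x). (u, glue_eq X `` {x})"
 let ?f = "%(u, p, s, t). ph p s (u, t)"
 have haus: "Hausdorff_space (top_of_set T)" 
  by (simp add: Hausdorff_space_subtopology)
 have lc: "locally_compact_space (top_of_set T)"
  using T by (auto intro: compact_imp_locally_compact_space simp: compact_space_subtopology compactin_euclidean_iff)
 have q: "quotient_map (prod_topology (top_of_set T) (presimp X))
   (prod_topology (top_of_set T) (realization X)) ?q"
  using quotient_map_prod_right[OF lc _ quotient_real] haus by blast
 have f: "cmap (prod_topology (top_of_set T) (presimp X)) Z ?f"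
  unfolding continuous_map
 proof (intro conjI allI impI)
  show "?f ` topspace (prod_topology (top_of_set T) (presimp X)) \<subseteq> topspace Z"
   using cont by (force simp: top_presimp continuous_map_def Pi_iff)
  fix U assume U: "openin Z U"
  let ?V = "{x : topspace (prod_topology (top_of_set T) (presimp X)). ?f x : U}"
  show "openin (prod_topology (top_of_set T) (presimp X)) ?V"
   unfolding openin_prod_topology_alt
  proof (intro allI impI)
   fix u x assume ux: "(u, x) : ?V"
   obtain p s t where x: "x = (p, s, t)" by (cases x)
   have s: "s : simps X p" "t : Splx p" "u : T" "ph p s (u, t) : U"
    using ux by (auto simp: x top_presimp)
   have "openin (prod_topology (top_of_set T) (Simplex p))
     {z : topspace (prod_topology (top_of_set T) (Simplex p)). ph p s z : U}"
    using openin_continuous_map_preimage[OF cont[OF s(1)] U] .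
   then obtain A B where AB: "openin (top_of_set T) A" "openin (Simplex p) B" "u : A" "t : B"
     "A \<times> B \<subseteq> {z : topspace (prod_topology (top_of_set T) (Simplex p)). ph p s z : U}"
    unfolding openin_prod_topology_alt using s(2-4)
    by (smt (verit, best) mem_Collect_eq mem_Sigma_iff topspace_euclidean_subtopology
      topspace_prod_topology topspace_standard_simplex)
   have Bs: "B \<subseteq> Splx p"
    using openin_subset[OF AB(2)] by simp
   have "openin (presimp X) ({p} \<times> {s} \<times> B)"
    unfolding openin_presimp top_presimp
   proof (intro conjI allI ballI)
    fix p' s' assume "s' : simps X p'"
    show "openin (Simplex p') {t : Splx p'. (p', s', t) : {p} \<times> {s} \<times> B}"
    proof (cases "p' = p & s' = s")
     case True
     then have "{t : Splx p'. (p', s', t) : {p} \<times> {s} \<times> B} = B" using Bs by auto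
     then show ?thesis using AB True by simp
    next
     case False
     then have "{t : Splx p'. (p', s', t) : {p} \<times> {s} \<times> B} = {}" by auto
     then show ?thesis by (simp only: openin_empty)
    qed
   qed (use s Bs in auto)
   then show "EX U' V'. openin (top_of_set T) U' & openin (presimp X) V' & u : U' & x : V' & U' \<times> V' \<subseteq> ?V"
    using AB s by (intro exI[of _ A] exI[of _ "{p} \<times> {s} \<times> B"])
     (auto simp: x top_presimp)
  qed
 qed
 have inv: "ph p s (u, t) = ph p' s' (u, t')"
  if "u : T" "((p, s, t), (p', s', t')) : glue_eq X" for u p s t p' s' t'
 proof -
  have "(case x of (p, s, t) => ph p s (u, t)) = (case y of (p, s, t) => ph p s (u, t))"
   if "(x, y) : glue X" for x y
   using that nat \<open>u : T\<close> by (force simp: glue_def)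
  from glue_eq_invariant[OF that(2), of "%(p, s, t). ph p s (u, t)", OF this]
  show ?thesis by simp
 qed
 have resp: "?f x = ?f y"
  if "x : topspace (prod_topology (top_of_set T) (presimp X))" 
   "y : topspace (prod_topology (top_of_set T) (presimp X))" "?q x = ?q y" for x y
 proof -
  obtain u p s t u' p' s' t' where xy: "x = (u, p, s, t)" "y = (u', p', s', t')"
   by (metis surj_pair)
  have "((p, s, t), (p', s', t')) : glue_eq X"
   using that eq_equiv_class_iff[OF equiv_glue_eq[of X]] by (auto simp: xy)
  moreover have "u = u'" "u : T" using that by (auto simp: xy)
  ultimately show ?thesis using inv by (simp add: xy)
 qed
 show thesis
 proof (rule quotient_map_lift_exists[OF q f resp])
  fix H assume H: "cmap (prod_topology (top_of_set T) (realization X)) Z H"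
   "!!x. x : topspace (prod_topology (top_of_set T) (presimp X)) ==> H (?q x) = ?f x"
  show thesis
   by (rule that[OF H(1)]) (use H(2) in "force simp: pt_def top_presimp")
 qed
qed

lemma real_lift:
 fixes ph :: "nat => 's => (nat => real) => 'z"
 assumes cont: "!!p s. s : simps X p ==> cmap (Simplex p) Z (ph p s)"
  and nat: "!!q p a s t. [|a : Delta q p; s : simps X p; t : Splx q|]
    ==> ph q (sact X q p a s) t = ph p s (spush q a t)"
 obtains G where "cmap (realization X) Z G"
  "!!p s t. [|s : simps X p; t : Splx p|] ==> G (pt X p s t) = ph p s t"
proof -
 obtain H where H: "cmap (prod_topology (top_of_set {0::real}) (realization X)) Z H"
  "!!p s u t. [|s : simps X p; u : {0}; t : Splx p|] ==> H (u, pt X p s t) = ph p s t"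
 proof (rule real_lift_param[of "{0}" Z "%p s (u, t). ph p s t"])
  show "cmap (prod_topology (top_of_set {0}) (Simplex p)) Z (%(u, t). ph p s t)"
   if "s : simps X p" for p s
   using continuous_map_compose[OF continuous_map_snd cont[OF that]] 
   by (simp add: o_def case_prod_unfold)
  fix H :: "real * (nat * 's * (nat => real)) set => 'z"
  assume "cmap (prod_topology (top_of_set {0}) (realization X)) Z H"
   "!!p s u t. [|s : simps X p; u : {0}; t : Splx p|]
    ==> H (u, pt X p s t) = (case (u, t) of (u, t) => ph p s t)"
  then show thesis by (intro that[of H]) simp_all
 qed (simp_all add: nat)
 have "cmap (realization X) (prod_topology (top_of_set {0::real}) (realization X)) (Pair 0)"
  by (auto simp: continuous_map_pairwise o_def continuous_map_in_subtopology)
 from continuous_map_compose[OF this H(1)] H(2) show thesis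
  by (intro that[of "H o Pair 0"]) auto
qed

lemma real_homotopic:
 fixes ph :: "nat => 's => real * (nat => real) => 'z"
 assumes cont: "!!p s. s : simps X p ==>
    cmap (prod_topology (top_of_set {0..1}) (Simplex p)) Z (ph p s)"
  and nat: "!!q p a s u t. [|a : Delta q p; s : simps X p; u : {0..1}; t : Splx q|]
    ==> ph q (sact X q p a s) (u, t) = ph p s (u, spush q a t)"
  and "!!p s t. [|s : simps X p; t : Splx p|] ==> G (pt X p s t) = ph p s (0, t)"
  and "!!p s t. [|s : simps X p; t : Splx p|] ==> G' (pt X p s t) = ph p s (1, t)"
 shows "Hot (realization X) Z G G'"
proof -
 obtain H where H: "cmap (prod_topology (top_of_set {0..1}) (realization X)) Z H"
  "!!p s u t. [|s : simps X p; u : {0..1}; t : Splx p|] ==> H (u, pt X p s t) = ph p s (u, t)"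
  using real_lift_param[OF compact_Icc cont nat] by blast
 have "H (0, c) = G c" "H (1, c) = G' c" if "c : topspace (realization X)" for c
  using that H(2) assms(3,4) by (metis realization_cases atLeastAtMost_iff order.refl zero_le_one)+
 then show ?thesis
  using H(1) by (subst homotopic_with) auto
qed

end

section \<open>Nondegenerate simplices\<close>

lemma Delta_inj_le:
 assumes "a : Delta q p" "inj_on a {..q}"
 shows "q <= p"
 using card_inj_on_le[OF assms(2), of "{..p}"] DeltaD(1)[OF assms(1)] by (auto simp: image_subset_iff)

lemma Delta_surj_le:
 assumes "a : Delta q p" "a ` {..q} = {..p}"
 shows "p <= q"
 using card_image_le[of "{..q}" a] assms(2) by simp

lemma Delta_inj_self:
 assumes a: "a : Delta p p" and inj: "inj_on a {..p}"
 shows "a = Did p"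
proof (rule Delta_eqI[OF a Delta_id_in])
 have lt: "a i < a j" if "i < j" "j <= p" for i j
 proof -
  have "a i ~= a j" using inj that by (auto dest: inj_onD)
  then show ?thesis using DeltaD(2)[OF a, of i j] that by simp
 qed
 have le: "i <= p ==> i <= a i" for i
 proof (induction i)
  case (Suc i)
  then show ?case using lt[of i "Suc i"] by simp
 qed simp
 have ge: "k <= p ==> a (p - k) <= p - k" for k
 proof (induction k)
  case 0 then show ?case using DeltaD(1)[OF a] by simp
 next
  case (Suc k)
  have "p - Suc k < p - k" using Suc.prems by simp
  then show ?case using lt[of "p - Suc k" "p - k"] Suc by simp
 qed
 show "a i = Did p i" if "i <= p" for i
  using that le[OF that] ge[of "p - i"] by simp
qed

text \<open>The rank function \<open>r\<close> numbers the image of \<open>a\<close> in increasing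
  order: \<open>pj\<close> takes the rank of a value, and \<open>io\<close> enumerates the image by
  rank.\<close>

lemma epi_mono:
 assumes a: "a : Delta q p"
 obtains k pj io where "pj : Delta q k" "pj ` {..q} = {..k}" "io : Delta k p" "inj_on io {..k}"
  "io ` {..k} = a ` {..q}" "a = cp q io pj" "k <= q" "k <= p"
proof -
 define I where "I = a ` {..q}"
 define r where "r x = card {j : I. j < x}" for x
 define k where "k = card I - 1"
 have I: "finite I" "I ~= {}" "I \<subseteq> {..p}" using DeltaD(1)[OF a] by (auto simp: I_def)
 have cI: "card I = Suc k" using I by (simp add: k_def card_gt_0_iff)
 have r_lt: "r x < r y" if "x : I" "x < y" for x y
  unfolding r_def using I that by (intro psubset_card_mono) auto
 have r_k: "r x <= k" if "x : I" for x
 proof -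
  have "r x < card I" unfolding r_def using I that by (intro psubset_card_mono) auto
  then show ?thesis by (simp add: cI)
 qed
 have r_inj: "inj_on r I"
  by (rule inj_onI) (metis r_lt less_irrefl linorder_neqE_nat)
 have r_img: "r ` I = {..k}"
  by (rule card_subset_eq) (use r_k card_image[OF r_inj] cI in auto)
 define pj where "pj = (\<lambda>i\<in>{..q}. r (a i))"
 define io where "io = (\<lambda>i\<in>{..k}. inv_into I r i)"
 have inv_in: "inv_into I r i : I" if "i <= k" for i
  using that r_img by (intro inv_into_into) auto
 have r_inv: "r (inv_into I r i) = i" if "i <= k" for i
  using that r_img by (intro f_inv_into_f) auto
 have aI: "a i : I" if "i <= q" for i using that by (auto simp: I_def)
 have pj: "pj : Delta q k"
 proof (rule DeltaI)
  show "pj i <= pj j" if "i <= j" "j <= q" for i j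
   using that DeltaD(2)[OF a that] aI[of i] r_lt[of "a i" "a j"]
   by (cases "a i = a j") (auto simp: pj_def)
 qed (auto simp: pj_def r_k aI)
 have io: "io : Delta k p"
 proof (rule DeltaI)
  show "io i <= p" if "i <= k" for i using inv_in[OF that] that I by (auto simp: io_def)
  show "io i <= io j" if "i <= j" "j <= k" for i j
   using that inv_in[of j] r_inv[of i] r_inv[of j] r_lt[of "inv_into I r j" "inv_into I r i"]
   by (cases "inv_into I r i <= inv_into I r j") (auto simp: io_def)
 qed (auto simp: io_def)
 have img: "pj ` {..q} = {..k}"
  using r_img by (auto simp: pj_def I_def image_image)
 show thesis
 proof (rule that[OF pj img io])
  show inj: "inj_on io {..k}"
   by (rule inj_onI) (metis io_def atMost_iff r_inv restrict_apply')
  show "io ` {..k} = a ` {..q}"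
   using inv_into_image_cancel[OF r_inj, of I] r_img by (auto simp: io_def I_def[symmetric])
  show "a = cp q io pj"
   by (rule Delta_eqI[OF a cp_Delta[OF pj io]])
    (use r_inj aI r_k in "auto simp: pj_def io_def inv_into_f_f")
  show "k <= q" using Delta_surj_le[OF pj img] .
  show "k <= p" using Delta_inj_le[OF io inj] .
 qed
qed

text \<open>Every set-theoretic section of a monotone surjection is monotone, so its value at one
  point may be prescribed. Hence a surjection can be recovered from its sections.\<close>

lemma Delta_section:
 assumes s: "s : Delta n m" "s ` {..n} = {..m}" and x: "x <= n"
 obtains d where "d : Delta m n" "cp m s d = Did m" "d (s x) = x"
proof -
 define d where "d = (\<lambda>j\<in>{..m}. if j = s x then x else (SOME i. i <= n & s i = j))"
 have d: "d j <= n & s (d j) = j" if "j <= m" for j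
 proof -
  have "EX i. i <= n & s i = j" using s(2) that by (metis atMost_iff imageE)
  from someI_ex[OF this] show ?thesis using that x by (auto simp: d_def)
 qed
 have "d : Delta m n"
 proof (rule DeltaI)
  show "d i <= d j" if "i <= j" "j <= m" for i j
  proof (rule ccontr)
   assume "~ d i <= d j"
   then have "s (d j) <= s (d i)" using d that by (intro DeltaD(2)[OF s(1)]) auto
   then have "i = j" using d[of i] d[of j] that by auto
   then show False using \<open>~ d i <= d j\<close> by simp
  qed
 qed (use d in "auto simp: d_def")
 moreover have "cp m s d = Did m"
  by (rule Delta_eqI[OF cp_Delta[OF calculation s(1)] Delta_id_in]) (simp add: d)
 moreover have "d (s x) = x" using DeltaD(1)[OF s(1) x] by (simp add: d_def)
 ultimately show thesis by (rule that)
qed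

text \<open>A point lies in the interior of the face spanned by its support. The face is obtained as
  the injective part of a monotone retraction of \<open>{..q}\<close> onto the support.\<close>

lemma simplex_support:
 assumes t: "t : Splx q"
 obtains l ep t' where "ep : Delta l q" "l <= q" "t' : Splx l" "ALL i<=l. 0 < t' i"
  "spush l ep t' = t" "ep ` {..l} = {i. 0 < t i}" "inj_on ep {..l}"
proof -
 define S where "S = {i. i <= q & 0 < t i}"
 have S: "{i. 0 < t i} = S"
  using simplexD(3)[OF t] by (auto simp: S_def) (metis less_irrefl not_le)
 have zero: "t i = 0" if "i ~: S" for i
  using simplexD(1)[OF t, of i] that S by (auto simp: not_less)
 have fin: "finite S" by (simp add: S_def)
 have le: "i <= q" if "i : S" for i using that by (simp add: S_def)
 have "S ~= {}"
 proof
  assume "S = {}"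
  then have "(SUM i<=q. t i) = 0" using zero by simp
  then show False using simplexD(4)[OF t] by simp
 qed
 define m where "m = Min S"
 have m: "m : S" unfolding m_def by (rule Min_in[OF fin \<open>S ~= {}\<close>])
 \<comment> \<open>The retraction sends \<open>j\<close> to the largest element of the support below
   it. Inserting the least element \<open>m\<close> gives the indices below the support a value
   too.\<close>
 define M where "M j = insert m {i\<in>S. i <= j}" for j
 define a where "a = (\<lambda>j\<in>{..q}. Max (M j))"
 have M: "finite (M j)" "M j ~= {}" "M j \<subseteq> S" for j
  using fin m by (auto simp: M_def)
 have aS: "a j : S" if "j <= q" for j
  using Max_in[OF M(1,2), of j] M(3)[of j] that by (auto simp: a_def)
 have aid: "a j = j" if "j : S" for j
 proof -
  have "Max (M j) = j"
   using that Min_le[OF fin that] by (intro Max_eqI[OF M(1)]) (auto simp: M_def m_def)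
  then show ?thesis using le[OF that] by (simp add: a_def)
 qed
 have a: "a : Delta q q"
 proof (rule DeltaI)
  show "a i <= a j" if "i <= j" "j <= q" for i j
  proof -
   have "Max (M i) <= Max (M j)"
    using that by (intro Max_mono[OF _ M(2,1)]) (auto simp: M_def)
   then show ?thesis using that by (simp add: a_def)
  qed
 qed (use aS le in "auto simp: a_def")
 have img: "a ` {..q} = S"
 proof
  show "S \<subseteq> a ` {..q}" using aid le by (metis atMost_iff image_eqI subsetI)
 qed (use aS in auto)
 obtain l pj io where l: "pj : Delta q l" "pj ` {..q} = {..l}" "io : Delta l q" "inj_on io {..l}"
  "io ` {..l} = S" "l <= q"
  using epi_mono[OF a] img by metis
 define t' where "t' i = (if i <= l then t (io i) else 0)" for i
 have "(SUM i<=l. t' i) = (\<Sum>i\<in>io ` {..l}. t i)"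
  using l(4) by (simp add: sum.reindex t'_def)
 also have "... = (SUM i<=q. t i)"
  unfolding l(5) using zero le by (intro sum.mono_neutral_left) auto
 finally have t': "t' : Splx l"
  using simplexD[OF t] by (intro simplexI) (auto simp: t'_def)
 have "spush l io t' j = t j" for j
 proof (cases "j : io ` {..l}")
  case True
  then obtain i where "i <= l" "j = io i" by auto
  then show ?thesis using spush_inj[OF l(3,4)] by (simp add: t'_def)
 next
  case False
  then show ?thesis using spush_notin[OF False] l(5) zero by force
 qed
 then have push: "spush l io t' = t" by blast
 have pos: "ALL i<=l. 0 < t' i" using l(5) S by (auto simp: t'_def)
 show thesis
  by (rule that[OF l(3,6) t' pos push]) (use l S in auto)
qed

context simplicial_set
begin

text \<open>Minimality is over all operators and not only over surjections. By image factorization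
  the two notions agree, and this one applies to composites at once.\<close>

definition nondeg :: "nat => 's => bool" where
 "nondeg n sg <-> sg : simps X n &
   (ALL m s ta. s : Delta n m & ta : simps X m & sact X n m s ta = sg --> n <= m)"

text \<open>Existence half of the Eilenberg-Zilber lemma. In a presentation of least dimension the
  injective part of the operator must be an identity, so the operator is surjective.\<close>

lemma degeneracy_exists:
 assumes sg: "sg : simps X n"
 obtains m s ta where "s : Delta n m" "s ` {..n} = {..m}" "nondeg m ta" "sact X n m s ta = sg"
  "m <= n"
proof -
 define P where "P m <-> (EX s ta. s : Delta n m & ta : simps X m & sact X n m s ta = sg)" for m
 have "P n" unfolding P_def using sg sact_id by blast
 define m where "m = (LEAST m. P m)"
 have m: "P m" "!!k. P k ==> m <= k"
  unfolding m_def using \<open>P n\<close> by (auto intro: LeastI Least_le)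
 obtain s ta where s: "s : Delta n m" "ta : simps X m" "sact X n m s ta = sg"
  using m(1) unfolding P_def by blast
 obtain k pj io where k: "pj : Delta n k" "io : Delta k m" "inj_on io {..k}" "io ` {..k} = s ` {..n}"
  "s = cp n io pj" "k <= m"
  using epi_mono[OF s(1)] by metis
 have "sact X n k pj (sact X k m io ta) = sg"
  using sact_comp[OF k(1,2) s(2)] s(3) k(5) by simp
 then have "P k" unfolding P_def using k sact_in s by blast
 then have "k = m" using m(2) k(6) by force
 then have "io = Did m" using k(2,3) Delta_inj_self by blast
 then have surj: "s ` {..n} = {..m}" using k(4) \<open>k = m\<close> by (force simp: image_iff)
 have "nondeg m ta"
  unfolding nondeg_def
 proof (intro conjI allI impI s)
  fix l u rh assume "u : Delta m l & rh : simps X l & sact X m l u rh = ta"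
  then have "P l" unfolding P_def using sact_comp[OF s(1)] s(1,3) cp_Delta by metis
  then show "m <= l" by (rule m(2))
 qed
 then show thesis using that s surj Delta_surj_le[OF s(1) surj] by blast
qed

text \<open>Uniqueness half of the Eilenberg-Zilber lemma. A section \<open>d\<close> of
  \<open>s\<close> exhibits \<open>ta\<close> as the pullback of \<open>ta'\<close> along
  \<open>s' d\<close>, which gives equal dimensions; minimality then forces \<open>s' d\<close> to
  be the identity. Choosing \<open>d\<close> through a given \<open>x\<close> yields
  \<open>s x = s' x\<close>.\<close>

lemma degeneracy_unique:
 assumes s: "s : Delta n m" "s ` {..n} = {..m}" and ta: "nondeg m ta"
  and s': "s' : Delta n m'" "s' ` {..n} = {..m'}" and ta': "nondeg m' ta'"
  and eq: "sact X n m s ta = sact X n m' s' ta'"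
 shows "m = m'" "s = s'" "ta = ta'"
proof -
 have ta_in: "ta : simps X m" "ta' : simps X m'" using ta ta' by (auto simp: nondeg_def)
 have *: "m <= m'" "ta = sact X m m' (cp m s' d) ta'"
  if "s : Delta n m" "s ` {..n} = {..m}" "s' : Delta n m'"  "nondeg m ta" "nondeg m' ta'"
   "sact X n m s ta = sact X n m' s' ta'" "d : Delta m n" "cp m s d = Did m" 
  for s s' m m' d ta ta'
 proof -
  have ta_in: "ta : simps X m" "ta' : simps X m'" using that by (auto simp: nondeg_def)
  have "ta = sact X m n d (sact X n m s ta)"
   using sact_comp[OF that(7,1) ta_in(1)] that(8) sact_id[OF ta_in(1)] by simp
  then show "ta = sact X m m' (cp m s' d) ta'"
   using sact_comp[OF that(7,3) ta_in(2)] that(6) by simp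
  then show "m <= m'" using that ta_in cp_Delta unfolding nondeg_def by metis
 qed
 obtain d where d: "d : Delta m n" "cp m s d = Did m"
  using Delta_section[OF s, of 0] by auto
 obtain d' where d': "d' : Delta m' n" "cp m' s' d' = Did m'"
  using Delta_section[OF s', of 0] by auto
 show mm: "m = m'"
  using *(1)[OF s s'(1) ta ta' eq d] *(1)[OF s' s(1) ta' ta eq[symmetric] d'] by simp
 have sd: "cp m s' d = Did m" if d: "d : Delta m n" "cp m s d = Did m" for d
 proof -
  have c: "cp m s' d : Delta m m" using d s' mm by blast
  obtain k pj io where k: "pj : Delta m k" "io : Delta k m" "inj_on io {..k}" "io ` {..k} = cp m s' d ` {..m}"
   "cp m s' d = cp m io pj" "k <= m" "pj ` {..m} = {..k}"
   using epi_mono[OF c] by metis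
  have "ta = sact X m k pj (sact X k m io ta')"
   using *(2)[OF s s'(1) ta ta' eq d] sact_comp[OF k(1,2), of ta'] ta_in k(5) mm by simp
  then have "m <= k" using ta k sact_in ta_in mm unfolding nondeg_def by metis
  then have "k = m" using k by simp
  moreover have "inj_on pj {..m}"
   using k(7) \<open>k = m\<close> by (intro eq_card_imp_inj_on) auto
  ultimately have "io = Did m" "pj = Did m" using k Delta_inj_self by blast+
  then show ?thesis using k(5) comp_id(1)[OF Delta_id_in] by simp
 qed
 show "ta = ta'"
  using *(2)[OF s s'(1) ta ta' eq d] sd[OF d] sact_id ta_in mm by simp
 show "s = s'"
 proof (rule Delta_eqI[OF s(1) s'(1)])
  fix x assume x: "x <= n"
  obtain d where d: "d : Delta m n" "cp m s d = Did m" "d (s x) = x"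
   using Delta_section[OF s x] .
  have "cp m s' d (s x) = s x" using sd[OF d(1,2)] DeltaD(1)[OF s(1) x] by simp
  then show "s x = s' x" using d(3) DeltaD(1)[OF s(1) x] by simp
 qed
qed

end

section \<open>Acyclic carriers\<close>

text \<open>\<open>contractible_space\<close> admits the empty space, into which no cell could be
  extended; hence the extra clause.\<close>

definition contract :: "'a topology => bool" where
 "contract Z <-> topspace Z ~= {} & contractible_space Z"

lemma contractible_nonemptyD:
 assumes "contract Z"
 shows "EX h w. cmap (prod_topology (top_of_set {0..1::real}) Z) Z h & w : topspace Z &
  (ALL x. h (0, x) = x) & (ALL x. h (1, x) = w)"
proof -
 obtain w where "homotopic_with (%x. True) Z Z id (%x. w)"
  using assms by (auto simp: contract_def contractible_space_def)
 then obtain h where h: "cmap (prod_topology (top_of_set {0..1::real}) Z) Z h"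
  "!!x. h (0, x) = x" "!!x. h (1, x) = w"
  unfolding homotopic_with_def by (auto simp: id_def)
 obtain x where "x : topspace Z" using assms unfolding contract_def by blast
 then have "h (1, x) : topspace Z"
  using continuous_map_image_subset_topspace[OF h(1)] by (auto simp: image_subset_iff)
 then show ?thesis using h by auto
qed

text \<open>The least barycentric coordinate: on the simplex it vanishes exactly on the boundary and
  takes its largest value \<open>1 / (n + 1)\<close> at the barycentre.\<close>

definition smin :: "nat => (nat => real) => real" where
 "smin n t = Min (t ` {..n})"

lemma simplex_min_le: "i <= n ==> smin n t <= t i"
 by (auto simp: smin_def intro: Min_le)

lemma smin_attained: obtains i where "i <= n" "smin n t = t i"
proof -
 have "smin n t : t ` {..n}" unfolding smin_def by (intro Min_in) auto
 then show thesis using that by auto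
qed

lemma cmap_smin: "cmap (Simplex p) euclideanreal (smin n)"
proof (induction n)
 case 0
 then show ?case by (simp add: smin_def[abs_def] cmap_coord del: euclidean_product_topology)
next
 case (Suc n)
 have "smin (Suc n) = (%t. min (t (Suc n)) (smin n t))"
  unfolding smin_def by (auto simp: atMost_Suc)
 then show ?case using Suc cmap_coord by (simp add: continuous_map_real_min del: euclidean_product_topology)
qed

text \<open>The intervals of length 0 and 1 around \<open>1/2\<close>: the two cases produce natural families of maps
 and homotopies between such families.\<close>

definition pset :: "real set => bool" where
 "pset T <-> T = {1/2} | T = {0..1}"

text \<open>Empty for \<open>T = {1/2}\<close>: a single map is prescribed only over the boundary of
  the simplex, a homotopy also at its two ends.\<close>

definition pends :: "real set => real set" where
 "pends T = {u : T. u = 0 | u = 1}"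

abbreviation prism :: "real set => nat => (real * (nat => real)) topology" where
 "prism T n == prod_topology (top_of_set T) (Simplex n)"

definition bdry :: "real set => nat => (real * (nat => real)) set" where
 "bdry T n = {(u, t). u : T & t : Splx n & (u : pends T | (EX i<=n. t i = 0))}"

text \<open>\<open>rh\<close> is the gauge of the prism about its centre, the point with
  \<open>u = 1/2\<close> and all \<open>n + 1\<close> coordinates equal to \<open>b\<close>: it is 0
  at the centre, linear along rays and 1 exactly on the boundary. \<open>tht\<close> is the radial
  projection to the boundary. Moving inwards along a ray, the extension runs the contraction of
  \<open>Z\<close> on the boundary value.\<close>

lemma cell_extension:
 fixes Z :: "'z topology"
 assumes T: "pset T" and Z: "contract Z"
  and f: "cmap (subtopology (prism T n) (bdry T n)) Z f"
 obtains F where "cmap (prism T n) Z F" "!!x. x : bdry T n ==> F x = f x"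
proof -
 obtain h w where h: "cmap (prod_topology (top_of_set {0..1::real}) Z) Z h" "w : topspace Z"
  "!!x. h (0, x) = x" "!!x. h (1, x) = w"
  using contractible_nonemptyD[OF Z] by auto
 define b where "b = 1 / (real n + 1)"
 define rh where "rh = (%(u, t). max (1 - (real n + 1) * smin n t) \<bar>2 * u - 1\<bar>)"
 define tht where "tht = (%(u, t). (1/2 + (u - 1/2) / rh (u, t),
   %i. if i <= n then b + (t i - b) / rh (u, t) else 0))"
 have b: "0 < b" "(real n + 1) * b = 1" by (simp_all add: b_def)
 have c_fst: "cmap (prism T n) euclideanreal fst"
  using continuous_map_fst[of "top_of_set T" "Simplex n"] by (simp add: continuous_map_in_subtopology)
 have c_coord: "cmap (prism T n) euclideanreal (%x. snd x i)" for i
  using continuous_map_compose[OF continuous_map_snd cmap_coord] by (simp only: o_def)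
 have c_min: "cmap (prism T n) euclideanreal (%x. smin n (snd x))"
  using continuous_map_compose[OF continuous_map_snd cmap_smin] by (simp only: o_def)
 have crh: "cmap (prism T n) euclideanreal rh"
  unfolding rh_def case_prod_unfold
  by (intro continuous_map_real_max continuous_map_diff continuous_map_real_mult continuous_map_real_abs
    c_min c_fst continuous_map_const[THEN iffD2]) auto
 have rh1: "rh x <= 1" if "x : topspace (prism T n)" for x
 proof -
  obtain u t where x: "x = (u, t)" "u : T" "t : Splx n" using \<open>x : _\<close> by auto
  have "0 <= smin n t" using simplexD(1)[OF x(3)] by (metis smin_attained)
  then show ?thesis using T x(2) by (auto simp: x(1) rh_def pset_def)
 qed
 have rh_bd: "rh x = 1 <-> x : bdry T n" if xx: "x : topspace (prism T n)" for x
 proof -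
  obtain u t where x: "x = (u, t)" "u : T" "t : Splx n" using xx by auto
  have "smin n t = 0 <-> (EX i<=n. t i = 0)"
  proof
   assume "EX i<=n. t i = 0"
   then have "smin n t <= 0" using simplex_min_le by metis
   then show "smin n t = 0"
    using simplexD(1)[OF x(3)] by (metis smin_attained order_antisym)
  qed (metis smin_attained)
  moreover have "\<bar>2 * u - 1\<bar> = 1 <-> u : pends T"
   using x(2) by (auto simp: pends_def)
  moreover have "rh x <= 1" using rh1[OF xx] .
  ultimately show ?thesis using x by (auto simp: rh_def bdry_def max_def split: if_splits)
 qed
 have tht_in: "tht x : bdry T n" if xx: "x : topspace (prism T n)" and pos: "0 < rh x" for x
 proof -
  obtain u t where x: "x = (u, t)" "u : T" "t : Splx n" using xx by auto
  define r where "r = rh x"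
  have r: "0 < r" "r <= 1" using pos rh1[OF xx] by (auto simp: r_def)
  have r1: "1 - (real n + 1) * smin n t <= r" "\<bar>2 * u - 1\<bar> <= r"
   by (auto simp: r_def x rh_def)
  define t' where "t' = (%i. if i <= n then b + (t i - b) / r else 0)"
  define u' where "u' = 1/2 + (u - 1/2) / r"
  have th: "tht x = (u', t')" by (auto simp: tht_def x t'_def u'_def r_def)
  have "b * (1 - (real n + 1) * smin n t) <= b * r"
   using r1(1) b(1) by (intro mult_left_mono) auto
  then have bm: "b - smin n t <= b * r"
   using b(2) by (simp add: right_diff_distrib mult.assoc[symmetric] mult.commute[of b])
  have "t' : Splx n"
  proof (rule simplexI)
   show "0 <= t' i" if "i <= n" for i
   proof -
    have "b - t i <= b * r" using bm simplex_min_le[OF that, of t] by simp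
    then have "(b - t i) / r <= b" using r(1) by (simp add: pos_divide_le_eq)
    then show ?thesis using that by (simp add: t'_def diff_divide_distrib)
   qed
   have "(SUM i<=n. t' i) = (SUM i<=n. b + (t i - b) / r)" by (intro sum.cong) (auto simp: t'_def)
   also have "... = (real n + 1) * b + ((SUM i<=n. t i) - (real n + 1) * b) / r"
    by (simp add: sum.distrib sum_divide_distrib[symmetric] sum_subtractf algebra_simps)
   finally show "(SUM i<=n. t' i) = 1" by (simp add: b simplexD(4)[OF x(3)])
  qed (simp add: t'_def)
  moreover have "u' : T"
  proof -
   have "\<bar>u - 1/2\<bar> * 2 <= r" using r1(2) by (auto simp: abs_if split: if_splits)
   then have "\<bar>(u - 1/2) / r\<bar> <= 1/2" using r(1) by (simp add: abs_divide divide_le_eq)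
   then have "0 <= u'" "u' <= 1" unfolding u'_def by linarith+
   then show ?thesis using T x(2) by (auto simp: pset_def u'_def)
  qed
  moreover have "u' : pends T | (EX i<=n. t' i = 0)"
  proof (cases "r = \<bar>2 * u - 1\<bar>")
   case True
   then have "u' = 0 | u' = 1" using r(1) by (cases "2 * u - 1 >= 0") (auto simp: u'_def field_simps)
   then show ?thesis using \<open>u' : T\<close> by (auto simp: pends_def)
  next
   case False
   then have "r = 1 - (real n + 1) * smin n t" by (auto simp: r_def x rh_def max_def split: if_splits)
   then have "b * r = b - smin n t" 
    using b(2) by (simp add: right_diff_distrib mult.assoc[symmetric] mult.commute[of b])
   moreover obtain i where "i <= n" "smin n t = t i" by (metis smin_attained)
   ultimately show ?thesis using r(1) by (intro disjI2 exI[of _ i]) (auto simp: t'_def field_simps)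
  qed
  ultimately show ?thesis by (auto simp: th bdry_def)
 qed
 have tht_id: "tht x = x" if xx: "x : topspace (prism T n)" "rh x = 1" for x
 proof -
  obtain u t where x: "x = (u, t)" "u : T" "t : Splx n" using xx by auto
  then show ?thesis using xx(2) simplexD(3)[OF x(3)] by (auto simp: tht_def fun_eq_iff)
 qed
 let ?P = "{x : topspace (prism T n). 1/2 <= rh x}"
 have ctht: "cmap (subtopology (prism T n) ?P) (subtopology (prism T n) (bdry T n)) tht"
  unfolding continuous_map_in_subtopology
 proof (intro conjI)
  have rh': "cmap (subtopology (prism T n) ?P) euclideanreal rh"
   using crh by (rule continuous_map_from_subtopology)
  have co: "cmap (subtopology (prism T n) ?P) euclideanreal (%x. snd x i)" for i
   using c_coord by (rule continuous_map_from_subtopology)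
  have cu: "cmap (subtopology (prism T n) ?P) euclideanreal fst"
   using c_fst by (rule continuous_map_from_subtopology)
  have in_cell: "tht x : topspace (prism T n)" if "x : topspace (subtopology (prism T n) ?P)" for x
   using tht_in[of x] that by (auto simp: bdry_def)
  show "cmap (subtopology (prism T n) ?P) (prism T n) tht"
   unfolding continuous_map_pairwise
  proof
   have "cmap (subtopology (prism T n) ?P) euclideanreal (%x. 1/2 + (fst x - 1/2) / rh x)"
    by (intro continuous_map_add continuous_map_real_divide continuous_map_diff rh' cu) auto
   then show "cmap (subtopology (prism T n) ?P) (top_of_set T) (fst o tht)"
    using in_cell by (auto simp: continuous_map_in_subtopology tht_def case_prod_unfold o_def)
   show "cmap (subtopology (prism T n) ?P) (Simplex n) (snd o tht)"
   proof (rule cmap_Simplex)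
    fix i
    have "cmap (subtopology (prism T n) ?P) euclideanreal (%x. b + (snd x i - b) / rh x)"
     by (intro continuous_map_add continuous_map_real_divide continuous_map_diff rh' co) auto
    then show "cmap (subtopology (prism T n) ?P) euclideanreal (%x. (snd o tht) x i)"
     by (cases "i <= n") (auto simp: tht_def case_prod_unfold)
   qed (use in_cell in force)
  qed
  show "tht : topspace (subtopology (prism T n) ?P) \<rightarrow> bdry T n"
   using tht_in by force
 qed
 have ftht: "cmap (subtopology (prism T n) ?P) Z (f o tht)"
  using continuous_map_compose[OF ctht f] .
 \<comment> \<open>The time \<open>2 * (1 - rh x)\<close> grows from 0 on the boundary to 1 where
   \<open>rh x = 1/2\<close>. Inside, the constant \<open>w\<close> takes over, which avoids the
   centre, where radial projection breaks down.\<close>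
 define F where "F x = (if rh x <= 1/2 then w else h (2 * (1 - rh x), f (tht x)))" for x
 have in_Z: "f (tht x) : topspace Z" if "x : topspace (prism T n)" "1/2 <= rh x" for x
  using continuous_map_image_subset_topspace[OF ftht] that by (auto simp: image_subset_iff)
 have "cmap (prism T n) Z (%x. if rh x <= 1/2 then w else h (2 * (1 - rh x), f (tht x)))"
 proof (rule continuous_map_cases_le[OF crh])
  show "cmap (subtopology (prism T n) ?P) Z (%x. h (2 * (1 - rh x), f (tht x)))"
  proof (rule continuous_map_compose[OF _ h(1), of _ "%x. (2 * (1 - rh x), f (tht x))", unfolded o_def])
   have "cmap (subtopology (prism T n) ?P) euclideanreal (%x. 2 * (1 - rh x))"
    using crh by (intro continuous_map_real_mult continuous_map_diff continuous_map_from_subtopology) auto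
   then show "cmap (subtopology (prism T n) ?P) (prod_topology (top_of_set {0..1}) Z)
     (%x. (2 * (1 - rh x), f (tht x)))"
    using ftht rh1 by (auto simp: continuous_map_pairwise o_def continuous_map_in_subtopology)
  qed
  show "w = h (2 * (1 - rh x), f (tht x))" if "x : topspace (prism T n)" "rh x = 1/2" for x
  proof -
   have "2 * (1 - rh x) = 1" using that by simp
   then show ?thesis using h(4) by simp
  qed
 qed (use h(2) in auto)
 then have "cmap (prism T n) Z F" unfolding F_def .
 moreover have "F x = f x" if "x : bdry T n" for x
 proof -
  have xx: "x : topspace (prism T n)" using that by (auto simp: bdry_def)
  have "rh x = 1" using iffD2[OF rh_bd[OF xx] that] .
  then show ?thesis using tht_id[OF xx] h(3) by (simp add: F_def)
 qed
 ultimately show thesis by (rule that[of F])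
qed

lemma Delta_inj_le_iff:
 assumes a: "a : Delta k n" "inj_on a {..k}" and "i <= k" "j <= k"
 shows "a i <= a j <-> i <= j"
proof
 assume "a i <= a j"
 then show "i <= j"
  using DeltaD(2)[OF a(1), of j i] inj_onD[OF a(2), of i j] assms by (cases "i <= j") auto
qed (use DeltaD(2)[OF a(1)] assms in auto)

text \<open>The relabelling \<open>kp\<close> that turns \<open>b\<close> into \<open>a\<close> is a
  monotone injection of \<open>{..k}\<close> into itself, hence the identity.\<close>

lemma Delta_inj_unique:
 assumes a: "a : Delta k n" "inj_on a {..k}" and b: "b : Delta k n" "inj_on b {..k}"
  and eq: "a ` {..k} = b ` {..k}"
 shows "a = b"
proof -
 define kp where "kp = (\<lambda>i\<in>{..k}. inv_into {..k} b (a i))"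
 have kp: "kp i <= k" "b (kp i) = a i" if "i <= k" for i
 proof -
  have "a i : b ` {..k}" using eq that by blast
  from inv_into_into[OF this] f_inv_into_f[OF this] show "kp i <= k" "b (kp i) = a i"
   using that by (simp_all add: kp_def)
 qed
 have kp_mono: "kp i <= kp j" if "i <= j" "j <= k" for i j
  using Delta_inj_le_iff[OF b, of "kp i" "kp j"] kp DeltaD(2)[OF a(1) that] that by simp
 have kpD: "kp : Delta k k"
  by (rule DeltaI) (use kp kp_mono in "auto simp: kp_def")
 have "inj_on kp {..k}"
  by (rule inj_onI) (metis kp(2) a(2) atMost_iff inj_onD)
 then have "kp = Did k" using Delta_inj_self[OF kpD] by blast
 then show ?thesis using kp by (intro Delta_eqI[OF a(1) b(1)]) auto
qed

text \<open>The last two axioms make the carrier blind to degeneracies. The value of a natural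
  family on a degenerate simplex is then forced by the nondegenerate simplex beneath it, and genuine
  choices occur only on nondegenerate simplices.\<close>

locale carriers = simplicial_set X for X :: "'s sset" +
 fixes V :: "nat => 's => 'w topology"
  and w :: "nat => nat => (nat => nat) => 's => 'w => 'w"
 assumes V_contractible: "sg : simps X p ==> contract (V p sg)"
  and w_continuous: "[|a : Delta q p; sg : simps X p|]
   ==> cmap (V q (sact X q p a sg)) (V p sg) (w q p a sg)"
  and w_comp: "[|b : Delta r q; a : Delta q p; sg : simps X p;
    x : topspace (V r (sact X r q b (sact X q p a sg)))|]
   ==> w q p a sg (w r q b (sact X q p a sg) x) = w r p (cp r a b) sg x"
  and V_degeneracy: "[|s : Delta n m; s ` {..n} = {..m}; ta : simps X m|]
   ==> V n (sact X n m s ta) = V m ta"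
  and w_degeneracy: "[|s : Delta n m; s ` {..n} = {..m}; ta : simps X m; x : topspace (V m ta)|]
   ==> w n m s ta x = x"
begin

text \<open>Induction hypothesis of the skeletal construction: naturality is asked for all operators
  between dimensions below \<open>N\<close>.\<close>

definition nat_below ::
 "nat => real set => (nat => 's => real * (nat => real) => 'w) => bool" where
 "nat_below N T g <->
   (ALL p sg. p < N & sg : simps X p --> cmap (prism T p) (V p sg) (g p sg)) &
   (ALL p q sg a u t. p < N & q < N & sg : simps X p & a : Delta q p & u : T & t : Splx q
    --> g p sg (u, spush q a t) = w q p a sg (g q (sact X q p a sg) (u, t)))"

definition nat_fam :: "real set => (nat => 's => real * (nat => real) => 'w) => bool" where
 "nat_fam T g <-> (ALL N. nat_below N T g)"

lemma nat_fam_iff: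
 "nat_fam T g <->
   (ALL p. ALL sg : simps X p. cmap (prism T p) (V p sg) (g p sg)) &
   (ALL p q sg a u t. sg : simps X p & a : Delta q p & u : T & t : Splx q
    --> g p sg (u, spush q a t) = w q p a sg (g q (sact X q p a sg) (u, t)))"
 unfolding nat_fam_def nat_below_def
 by (meson lessI less_SucI max.strict_coboundedI1 max.strict_coboundedI2)

lemma nat_famD:
 assumes "nat_fam T g"
 shows "sg : simps X p ==> cmap (prism T p) (V p sg) (g p sg)"
  "[|sg : simps X p; a : Delta q p; u : T; t : Splx q|]
   ==> g p sg (u, spush q a t) = w q p a sg (g q (sact X q p a sg) (u, t))"
 using assms unfolding nat_fam_iff by blast+

lemma below_D:
 assumes "nat_below N T g"
 shows "[|p < N; sg : simps X p|] ==> cmap (prism T p) (V p sg) (g p sg)"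
  "[|p < N; q < N; sg : simps X p; a : Delta q p; u : T; t : Splx q|]
   ==> g p sg (u, spush q a t) = w q p a sg (g q (sact X q p a sg) (u, t))"
  "[|p < N; sg : simps X p; u : T; t : Splx p|] ==> g p sg (u, t) : topspace (V p sg)"
proof -
 show c: "cmap (prism T p) (V p sg) (g p sg)" if "p < N" "sg : simps X p"
  using assms that unfolding nat_below_def by blast
 show "g p sg (u, t) : topspace (V p sg)" if "p < N" "sg : simps X p" "u : T" "t : Splx p"
  using continuous_map_image_subset_topspace[OF c] that by (force simp: image_subset_iff)
qed (use assms in "auto simp: nat_below_def")

text \<open>Two presentations of a boundary point as a point of a simplex of lower dimension are compared
 through the face spanned by the support of the point.\<close>

lemma boundary_value_unique:
 assumes g: "nat_below n T g" and sg: "sg : simps X n" and u: "u : T"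
  and a: "a : Delta q n" "q < n" "t : Splx q"
  and a': "a' : Delta q' n" "q' < n" "t' : Splx q'"
  and eq: "spush q a t = spush q' a' t'"
 shows "w q n a sg (g q (sact X q n a sg) (u, t)) = w q' n a' sg (g q' (sact X q' n a' sg) (u, t'))"
proof -
 have "spush q a t : Splx n" using a by auto
 then obtain k io z where z: "io : Delta k n" "z : Splx k" "ALL i<=k. 0 < z i"
  "spush k io z = spush q a t" "io ` {..k} = {i. 0 < spush q a t i}" "inj_on io {..k}"
  using simplex_support by metis
 \<comment> \<open>Every presentation is compared with the one through the support face
   \<open>io\<close>: shrink \<open>t\<close> to its own support by \<open>ep\<close>, then factor
   \<open>a ep\<close> through its image, which is the support of the pushed point.\<close>
 have *: "k < n & w q n a sg (g q (sact X q n a sg) (u, t)) = w k n io sg (g k (sact X k n io sg) (u, z))"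
  if a: "a : Delta q n" "q < n" "t : Splx q" and eq: "spush k io z = spush q a t"
   "io ` {..k} = {i. 0 < spush q a t i}" for q a t
 proof -
  obtain l ep y where y: "ep : Delta l q" "l <= q" "y : Splx l" "ALL i<=l. 0 < y i"
   "spush l ep y = t"
   using simplex_support[OF a(3)] by metis
  have ae: "cp l a ep : Delta l n" using y a by blast
  have push: "spush l (cp l a ep) y = spush q a t"
   using spush_comp[OF y(1)] y(5) by metis
  have "{i. 0 < spush l (cp l a ep) y i} = cp l a ep ` {..l}"
  proof (intro equalityI subsetI)
   fix i assume "i : {i. 0 < spush l (cp l a ep) y i}"
   then show "i : cp l a ep ` {..l}"
    by (metis less_irrefl mem_Collect_eq spush_notin)
  next
   fix i assume "i : cp l a ep ` {..l}"
   then obtain j where j: "j <= l" "i = cp l a ep j" by auto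
   then have "y j <= spush l (cp l a ep) y i"
    unfolding simplex_push_def using y(4) by (intro member_le_sum) (auto intro: less_imp_le)
   then show "i : {i. 0 < spush l (cp l a ep) y i}" using y(4) j by force
  qed
  then have img: "cp l a ep ` {..l} = io ` {..k}" using eq push by simp
  obtain k' pj io' where f: "pj : Delta l k'" "pj ` {..l} = {..k'}" "io' : Delta k' n" "inj_on io' {..k'}"
   "io' ` {..k'} = io ` {..k}" "cp l a ep = cp l io' pj" "k' <= l"
   using epi_mono[OF ae] img by metis
  have kk: "k' = k"
   using card_image[OF f(4)] card_image[OF z(6)] f(5) by simp
  have io': "io' = io"
   using Delta_inj_unique[of io' k n io] f z kk by simp
  have pz: "spush l pj y = z"
  proof
   fix i
   show "spush l pj y i = z i"
   proof (cases "i <= k")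
    case True
    have "spush k io (spush l pj y) = spush k io z"
     using spush_comp[OF f(1), of io' y] f(6) kk io' push eq by simp
    then show ?thesis
     using spush_inj[OF z(1,6) True] by metis
   next
    case False
    then show ?thesis
     using simplexD(3)[OF z(2)] simplexD(3)[OF spush_in[OF f(1) y(3)]] kk by simp
   qed
  qed
  let ?ae = "cp l a ep" let ?asg = "sact X q n a sg" let ?iosg = "sact X k n io sg"
  have asg: "?asg : simps X q" "?iosg : simps X k" "sact X l n ?ae sg : simps X l"
   using sact_in sg a z ae by auto
  have kn: "k < n" "l < n" using f(7) y(2) a(2) kk by simp_all
  have pj: "pj : Delta l k" using f kk by simp
  have s1: "sact X l q ep ?asg = sact X l n ?ae sg" using sact_comp[OF y(1) a(1) sg] .
  have s2: "sact X l k pj ?iosg = sact X l n ?ae sg"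
   using sact_comp[OF pj z(1) sg] f(6) io' by simp
  have mem: "g l (sact X l n ?ae sg) (u, y) : topspace (V l (sact X l n ?ae sg))"
   using below_D(3)[OF g kn(2) asg(3) u y(3)] .
  have "w q n a sg (g q ?asg (u, t)) = w q n a sg (w l q ep ?asg (g l (sact X l n ?ae sg) (u, y)))"
   using below_D(2)[OF g a(2) kn(2) asg(1) y(1) u y(3)] y(5) s1 by simp
  also have "... = w l n ?ae sg (g l (sact X l n ?ae sg) (u, y))"
   using w_comp[OF y(1) a(1) sg] mem s1 by simp
  also have "... = w k n io sg (w l k pj ?iosg (g l (sact X l n ?ae sg) (u, y)))"
   using w_comp[OF pj z(1) sg] mem s2 f(6) io' by simp
  also have "... = w k n io sg (g k ?iosg (u, z))"
   using below_D(2)[OF g kn(1,2) asg(2) pj u y(3)] pz s2 by simp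
  finally show ?thesis using kn by simp
 qed
 show ?thesis using *[OF a z(4,5)] *[OF a'] z(4,5) eq by metis
qed

end

definition coface :: "nat => nat => nat => nat" where
 "coface n i = (\<lambda>j\<in>{..n}. if j < i then j else Suc j)"

lemma coface_Delta: "coface n i : Delta n (Suc n)"
 by (rule DeltaI) (auto simp: coface_def)

definition omit :: "nat => (nat => real) => nat => real" where
 "omit i t = (%j. if j < i then t j else t (Suc j))"

lemma omit_in_simplex:
 assumes t: "t : Splx (Suc n)" "t i = 0" "i <= Suc n"
 shows "omit i t : Splx n" "spush n (coface n i) (omit i t) = t"
proof -
 have bij: "inj_on (coface n i) {..n}" "coface n i ` {..n} = {..Suc n} - {i}"
 proof -
  show "inj_on (coface n i) {..n}" by (auto simp: inj_on_def coface_def split: if_splits)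
  have "j : coface n i ` {..n}" if "j <= Suc n" "j ~= i" for j
   using that t(3) by (intro image_eqI[of _ _ "if j < i then j else j - 1"]) (auto simp: coface_def)
  then show "coface n i ` {..n} = {..Suc n} - {i}" by (auto simp: coface_def)
 qed
 have "(SUM j<=n. omit i t j) = (SUM j<=n. t (coface n i j))"
  by (intro sum.cong) (auto simp: omit_def coface_def)
 also have "... = sum t ({..Suc n} - {i})"
  using bij by (metis (no_types, lifting) sum.cong sum.reindex_cong)
 also have "... = sum t {..Suc n}" using t(2) by (simp add: sum_diff1 t(3))
 finally show o: "omit i t : Splx n"
  using simplexD[OF t(1)] t(3) by (intro simplexI) (auto simp: omit_def)
 show "spush n (coface n i) (omit i t) = t"
 proof
  fix j
  show "spush n (coface n i) (omit i t) j = t j"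
  proof (cases "j : coface n i ` {..n}")
   case True
   then obtain k where k: "k <= n" "j = coface n i k" by auto
   then show ?thesis using spush_inj[OF coface_Delta bij(1)] by (simp add: omit_def coface_def)
  next
   case False
   then show ?thesis using spush_notin[OF False] bij(2) t(2) simplexD(3)[OF t(1), of j] by auto
  qed
 qed
qed

lemma cmap_omit:
 assumes "i <= Suc n"
 shows "cmap (subtopology (Simplex (Suc n)) {t. t i = 0}) (Simplex n) (omit i)"
proof (rule cmap_Simplex)
 fix j
 show "cmap (subtopology (Simplex (Suc n)) {t. t i = 0}) euclideanreal (%t. omit i t j)"
  unfolding omit_def by (cases "j < i") (auto intro!: continuous_map_from_subtopology continuous_map_product_projection)
qed (use omit_in_simplex assms in auto)

context carriers
begin

text \<open>A nondegenerate \<open>n\<close>-simplex is filled in by \<open>cell_extension\<close>;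
  a degenerate one receives the value of the nondegenerate simplex beneath it. Naturality is then
  checked separately for operators leaving dimension \<open>n\<close> (\<open>K\<close>), entering
  it (\<open>L\<close>) and staying in it, the last by factoring through a lower dimension.\<close>

lemma nat_fam_step:
 assumes T: "pset T" and bb: "nat_fam (pends T) bb"
  and g: "nat_below n T g"
  and gb: "!!p sg u t. [|p < n; sg : simps X p; u : pends T; t : Splx p|]
   ==> g p sg (u, t) = bb p sg (u, t)"
 shows "EX g'. nat_below (Suc n) T g' & (ALL p<n. g' p = g p) &
  (ALL sg:simps X n. ALL u:pends T. ALL t:Splx n. g' n sg (u, t) = bb n sg (u, t))"
proof -
 have ends: "u : T" if "u : pends T" for u using that by (auto simp: pends_def)
 \<comment> \<open>At the ends the value is prescribed by \<open>bb\<close>. On the boundary of the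
   simplex it is computed from some presentation in lower dimension, and
   \<open>boundary_value_unique\<close> makes the choice irrelevant.\<close>
 define bd where "bd sg = (%(u, t). if u : pends T then bb n sg (u, t) else
   (SOME v. EX a q y. a : Delta q n & q < n & y : Splx q & spush q a y = t &
    v = w q n a sg (g q (sact X q n a sg) (u, y))))" for sg
 have bd_ends: "bd sg (u, t) = bb n sg (u, t)" if "u : pends T" for u t sg
  using that by (simp add: bd_def)
 have bd_face: "bd sg (u, spush q a y) = w q n a sg (g q (sact X q n a sg) (u, y))"
  if "sg : simps X n" "u : T" "a : Delta q n" "q < n" "y : Splx q" for sg u a q y
 proof (cases "u : pends T")
  case True
  then show ?thesis
   using nat_famD(2)[OF bb that(1,3) True that(5)] gb[OF that(4) sact_in[OF that(3,1)] True that(5)]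
   by (simp add: bd_def)
 next
  case False
  have "EX v. EX a' q' y'. a' : Delta q' n & q' < n & y' : Splx q' &
    spush q' a' y' = spush q a y & v = w q' n a' sg (g q' (sact X q' n a' sg) (u, y'))"
   using that by blast
  from someI_ex[OF this] obtain a' q' y' where a': "a' : Delta q' n" "q' < n" "y' : Splx q'"
   "spush q' a' y' = spush q a y"
   "bd sg (u, spush q a y) = w q' n a' sg (g q' (sact X q' n a' sg) (u, y'))"
   using False by (auto simp: bd_def)
  show ?thesis
   unfolding a'(5) using boundary_value_unique[OF g that(1,2) a'(1-3) that(3-5) a'(4)] .
 qed
 have bd_cont: "cmap (subtopology (prism T n) (bdry T n)) (V n sg) (bd sg)"
  if sg: "sg : simps X n" for sg
 proof -
  let ?B = "subtopology (prism T n) (bdry T n)"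
  \<comment> \<open>A finite closed cover for pasting: \<open>A i\<close> with \<open>i <= n\<close>
    is the facet opposite to vertex \<open>i\<close>, and \<open>A (Suc n)\<close> consists of the
    two ends.\<close>
  define A where "A i = (if i <= n then {x : topspace ?B. snd x i : {0}} else {x : topspace ?B. fst x : {0, 1}})" for i
  have cf: "cmap ?B euclideanreal fst" "cmap ?B euclideanreal (%x. snd x i)" for i
  proof -
   show "cmap ?B euclideanreal fst"
    using continuous_map_fst[of "top_of_set T" "Simplex n"]
    by (intro continuous_map_from_subtopology) (simp add: continuous_map_in_subtopology)
   show "cmap ?B euclideanreal (%x. snd x i)"
    using continuous_map_compose[OF continuous_map_snd cmap_coord, of "top_of_set T" n i]
    by (intro continuous_map_from_subtopology) (simp only: o_def)
  qed
  show ?thesis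
  proof (rule pasting_lemma_closed[where I = "{..Suc n}" and T = A and f = "%_. bd sg"])
   show "closedin ?B (A i)" if "i : {..Suc n}" for i
    unfolding A_def using cf closedin_continuous_map_preimage[OF cf(1), of "{0, 1}"]
     closedin_continuous_map_preimage[OF cf(2), of "{0}" i]
    by auto
   show "EX j. j : {..Suc n} & x : A j & bd sg x = bd sg x" if "x : topspace ?B" for x
   proof -
    obtain u t where x: "x = (u, t)" by (cases x)
    then have "u : pends T | (EX i<=n. t i = 0)" using that by (auto simp: bdry_def)
    then show ?thesis
    proof
     assume "u : pends T"
     then show ?thesis using that x by (intro exI[of _ "Suc n"]) (auto simp: A_def pends_def)
    next
     assume "EX i<=n. t i = 0"
     then show ?thesis using that x by (auto simp: A_def)
    qed
   qed
   show "cmap (subtopology ?B (A i)) (V n sg) (bd sg)" if "i : {..Suc n}" for i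
   proof (cases "i <= n")
    case False
    have m: "cmap (subtopology ?B (A i)) (prism (pends T) n) (%x. x)"
     unfolding continuous_map_pairwise
    proof
     have "cmap (subtopology ?B (A i)) euclideanreal fst"
      using cf(1) by (rule continuous_map_from_subtopology)
     then show "cmap (subtopology ?B (A i)) (top_of_set (pends T)) (fst o (%x. x))"
      using False by (auto simp: continuous_map_in_subtopology o_def A_def pends_def)
     show "cmap (subtopology ?B (A i)) (Simplex n) (snd o (%x. x))"
      using continuous_map_snd by (auto simp: o_def intro!: continuous_map_from_subtopology)
    qed
    show ?thesis
    proof (rule continuous_map_eq[OF continuous_map_compose[OF m nat_famD(1)[OF bb sg]]])
     fix x assume "x : topspace (subtopology ?B (A i))"
     then show "(bb n sg o (%x. x)) x = bd sg x"
      using False by (cases x) (auto simp: A_def bd_ends pends_def)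
    qed
   next
    case True
    show ?thesis
    proof (cases n)
     case 0
     \<comment> \<open>In dimension 0 the only facet is empty.\<close>
     have "t 0 = 1" if "t : Splx 0" for t
      using simplexD(4)[OF that] by simp
     then have E: "topspace (subtopology ?B (A i)) = {}"
      using True 0 by (fastforce simp: A_def)
     show ?thesis unfolding continuous_map_def E by simp
    next
     case (Suc m)
     have iS: "i <= Suc m" using True Suc by simp
     let ?d = "coface m i"
     have d: "?d : Delta m n" using coface_Delta Suc by simp
     have t0: "cmap (subtopology ?B (A i)) (subtopology (Simplex (Suc m)) {t. t i = 0}) snd"
      unfolding continuous_map_in_subtopology[of _ "Simplex (Suc m)"]
     proof
      show "cmap (subtopology ?B (A i)) (Simplex (Suc m)) snd"
       using Suc by (intro continuous_map_from_subtopology) (simp add: continuous_map_snd)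
     qed (use True in "auto simp: A_def")
     have m: "cmap (subtopology ?B (A i)) (prism T m) (%x. (fst x, omit i (snd x)))"
      unfolding continuous_map_pairwise
     proof
      have "cmap (subtopology ?B (A i)) (top_of_set T) fst"
       by (intro continuous_map_from_subtopology continuous_map_fst)
      then show "cmap (subtopology ?B (A i)) (top_of_set T) (fst o (%x. (fst x, omit i (snd x))))"
       by (simp add: o_def)
      show "cmap (subtopology ?B (A i)) (Simplex m) (snd o (%x. (fst x, omit i (snd x))))"
       using continuous_map_compose[OF t0 cmap_omit[OF iS]] by (simp add: o_def)
     qed
     have gm: "cmap (prism T m) (V m (sact X m n ?d sg)) (g m (sact X m n ?d sg))"
      using below_D(1)[OF g] sact_in[OF d sg] Suc by simp
     show ?thesis
     proof (rule continuous_map_eq[OF continuous_map_compose[OF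
         continuous_map_compose[OF m gm] w_continuous[OF d sg]]])
      fix x assume x: "x : topspace (subtopology ?B (A i))"
      obtain u t where ut: "x = (u, t)" by (cases x)
      have t: "t : Splx (Suc m)" "t i = 0" "u : T"
       using x True Suc by (auto simp: ut A_def)
      show "(w m n ?d sg o (g m (sact X m n ?d sg) o (%x. (fst x, omit i (snd x))))) x = bd sg x"
       using bd_face[OF sg t(3) d _ omit_in_simplex(1)[OF t(1,2) iS]] omit_in_simplex(2)[OF t(1,2) iS] Suc
       by (simp add: ut)
     qed
    qed
   qed
  qed auto
 qed
 have "ALL sg:simps X n. EX F. cmap (prism T n) (V n sg) F & (ALL x:bdry T n. F x = bd sg x)"
 proof
  fix sg assume sg: "sg : simps X n"
  show "EX F. cmap (prism T n) (V n sg) F & (ALL x:bdry T n. F x = bd sg x)"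
   by (rule cell_extension[OF T V_contractible[OF sg] bd_cont[OF sg]]) blast
 qed
 from bchoice[OF this] obtain F where F: "!!sg. sg : simps X n ==> cmap (prism T n) (V n sg) (F sg)"
  "!!sg x. [|sg : simps X n; x : bdry T n|] ==> F sg x = bd sg x"
  by blast+
 define DG where "DG m s ta sg <-> m < n & s : Delta n m & s ` {..n} = {..m} & ta : simps X m & sact X n m s ta = sg" for m s ta sg
 define g' where "g' p sg x = (if p = n then
   (if EX m s ta. nondeg m ta & DG m s ta sg
    then THE v. EX m s ta. nondeg m ta & DG m s ta sg & v = g m ta (fst x, spush n s (snd x)) else F sg x)
   else g p sg x)" for p sg x
 have g'_below: "g' p sg x = g p sg x" if "p < n" for p sg x using that by (simp add: g'_def)
 have g'_nondeg: "g' n sg x = g m ta (fst x, spush n s (snd x))" if d: "nondeg m ta" "DG m s ta sg" for sg m s ta x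
 proof -
  have "m' = m & s' = s & ta' = ta" if "nondeg m' ta'" "DG m' s' ta' sg" for m' s' ta'
   using degeneracy_unique[of s' n m' ta' s m ta] that d by (simp add: DG_def)
  then have "(THE v. EX m s ta. nondeg m ta & DG m s ta sg & v = g m ta (fst x, spush n s (snd x))) = g m ta (fst x, spush n s (snd x))"
   using d by (intro the_equality) blast+
  then show ?thesis using d unfolding g'_def by auto
 qed
 have g'_cases: "g' n sg = F sg | (EX m s ta. DG m s ta sg & g' n sg = (%x. g m ta (fst x, spush n s (snd x))))" for sg
 proof (cases "EX m s ta. nondeg m ta & DG m s ta sg")
  case True then show ?thesis using g'_nondeg by blast
 next
  case False then have "g' n sg = F sg" unfolding g'_def by (simp only: simp_thms if_True if_False)
  then show ?thesis by (rule disjI1)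
 qed
 have g'_cont: "cmap (prism T n) (V n sg) (g' n sg)" if sg: "sg : simps X n" for sg
  using g'_cases[of sg]
 proof
  assume "g' n sg = F sg" then show ?thesis using F(1)[OF sg] by simp
 next
  assume "EX m s ta. DG m s ta sg & g' n sg = (%x. g m ta (fst x, spush n s (snd x)))"
  then obtain m s ta where d: "m < n" "s : Delta n m" "s ` {..n} = {..m}" "ta : simps X m"
   "sact X n m s ta = sg" "g' n sg = (%x. g m ta (fst x, spush n s (snd x)))" unfolding DG_def by blast
  have "cmap (prism T n) (prism T m) (%x. (fst x, spush n s (snd x)))"
   unfolding continuous_map_pairwise
   using continuous_map_compose[OF continuous_map_snd cmap_spush[OF d(2)], of "top_of_set T"]
    continuous_map_fst[of "top_of_set T" "Simplex n"]
   by (simp add: o_def)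
  from continuous_map_compose[OF this below_D(1)[OF g d(1,4)]]
  show ?thesis using V_degeneracy[OF d(2-4)] d(5,6) by (simp add: o_def)
 qed
 have g'_mem: "g' n sg (u, t) : topspace (V n sg)"
  if "sg : simps X n" "u : T" "t : Splx n" for sg u t
  using continuous_map_image_subset_topspace[OF g'_cont[OF that(1)]] that by (force simp: image_subset_iff)
 \<comment> \<open>As \<open>m < n\<close>, the simplex \<open>s^* ta\<close> is degenerate. If
   \<open>rh\<close> is the nondegenerate simplex under \<open>ta\<close>, factoring
   \<open>v s\<close> through its image exposes the nondegenerate simplex \<open>kp\<close> under
   \<open>s^* ta\<close>, and everything is compared in dimensions below \<open>n\<close>.\<close>
 have K: "w n m s ta (g' n (sact X n m s ta) (u, t)) = g m ta (u, spush n s t)"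
  if s: "s : Delta n m" and m: "m < n" and ta: "ta : simps X m" and u: "u : T" and t: "t : Splx n"
  for m s ta u t
 proof -
  let ?sg = "sact X n m s ta"
  obtain l v rh where v: "v : Delta m l" "v ` {..m} = {..l}" "nondeg l rh" "sact X m l v rh = ta" "l <= m"
   using degeneracy_exists[OF ta] .
  have rh: "rh : simps X l" using v by (simp add: nondeg_def)
  have c: "cp n v s : Delta n l" using s v by blast
  obtain k pj io where k: "pj : Delta n k" "pj ` {..n} = {..k}" "io : Delta k l" 
   "cp n v s = cp n io pj" "k <= l"
   using epi_mono[OF c] by metis
  let ?iorh = "sact X k l io rh"
  have iorh: "?iorh : simps X k" using sact_in k rh by blast
  obtain j v' kp where j: "v' : Delta k j" "v' ` {..k} = {..j}" "nondeg j kp" "sact X k j v' kp = ?iorh" "j <= k"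
   using degeneracy_exists[OF iorh] .
  have kp: "kp : simps X j" using j by (simp add: nondeg_def)
  have dims: "l < n" "k < n" "j < n" using v(5) k(5) j(5) m by simp_all
  have sg: "?sg : simps X n" using sact_in s ta by blast
  have sg1: "?sg = sact X n l (cp n v s) rh" using sact_comp[OF s v(1) rh] v(4) by simp
  have sg2: "?sg = sact X n k pj ?iorh" using sact_comp[OF k(1,3) rh] k(4) sg1 by simp
  have sg3: "sact X n j (cp n v' pj) kp = ?sg" using sact_comp[OF k(1) j(1) kp] j(4) sg2 by simp
  have "cp n v' pj ` {..n} = v' ` (pj ` {..n})"
   unfolding image_image by (intro image_cong) auto
  then have vpj: "cp n v' pj : Delta n j" "cp n v' pj ` {..n} = {..j}"
   using k(1,2) j(1,2) by auto
  have pjt: "spush n pj t : Splx k" using k t by blast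
  have st: "spush n s t : Splx m" using s t by blast
  let ?x = "g' n ?sg (u, t)"
  have x_mem: "?x : topspace (V n ?sg)" using g'_mem[OF sg u t] .
  have "?x = g j kp (u, spush k v' (spush n pj t))"
   using g'_nondeg[OF j(3), of "cp n v' pj" ?sg "(u, t)"] vpj dims(3) kp sg3 spush_comp[OF k(1)] by (simp add: DG_def)
  also have "... = w k j v' kp (g k ?iorh (u, spush n pj t))"
   using below_D(2)[OF g dims(3,2) kp j(1) u pjt] j(4) by simp
  also have "... = g k ?iorh (u, spush n pj t)"
   using w_degeneracy[OF j(1,2) kp] below_D(3)[OF g dims(2) iorh u pjt] 
    V_degeneracy[OF j(1,2) kp] j(4) by simp
  finally have x: "?x = g k ?iorh (u, spush n pj t)" .
  have sx_mem: "w n m s ta ?x : topspace (V l rh)"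
   using continuous_map_image_subset_topspace[OF w_continuous[OF s ta]] x_mem V_degeneracy[OF v(1,2) rh] v(4)
   by (auto simp: image_subset_iff)
  have "w n m s ta ?x = w m l v rh (w n m s ta ?x)"
   using w_degeneracy[OF v(1,2) rh sx_mem] by simp
  also have "... = w n l (cp n v s) rh ?x"
   using w_comp[OF s v(1) rh] x_mem v(4) by simp
  also have "... = w k l io rh (w n k pj ?iorh ?x)"
   using w_comp[OF k(1,3) rh] x_mem sg2 k(4) by simp
  also have "... = w k l io rh ?x"
   using w_degeneracy[OF k(1,2) iorh] x_mem V_degeneracy[OF k(1,2) iorh] sg2 by simp
  also have "... = g l rh (u, spush k io (spush n pj t))"
   unfolding x using below_D(2)[OF g dims(1,2) rh k(3) u pjt] by simp
  also have "... = g l rh (u, spush m v (spush n s t))"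
   using spush_comp[OF k(1)] spush_comp[OF s] k(4) by simp
  also have "... = w m l v rh (g m ta (u, spush n s t))"
   using below_D(2)[OF g dims(1) m rh v(1) u st] v(4) by simp
  also have "... = g m ta (u, spush n s t)"
   using w_degeneracy[OF v(1,2) rh] below_D(3)[OF g m ta u st] V_degeneracy[OF v(1,2) rh] v(4)
   by simp
  finally show ?thesis .
 qed
 \<comment> \<open>An operator from a lower dimension misses some vertex, so the pushed point lies
   on the boundary, where the filling agrees with \<open>bd\<close>. On a degenerate simplex the
   claim descends to the simplex \<open>ta\<close> beneath.\<close>
 have L: "g' n sg (u, spush q a t) = w q n a sg (g q (sact X q n a sg) (u, t))"
  if a: "a : Delta q n" and q: "q < n" and sg: "sg : simps X n" and u: "u : T" and t: "t : Splx q"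
  for q a sg u t
  using g'_cases[of sg]
 proof
  assume *: "g' n sg = F sg"
  have "~ {..n} \<subseteq> a ` {..q}" 
   using card_mono[of "a ` {..q}" "{..n}"] card_image_le[of "{..q}" a] q by fastforce
  then obtain i where "i <= n" "spush q a t i = 0"
   using spush_notin by (metis atMost_iff subsetI)
  then have "(u, spush q a t) : bdry T n"
   using u a t by (auto simp: bdry_def)
  then show ?thesis using F(2)[OF sg] bd_face[OF sg u a q t] * by simp
 next
  assume "EX m s ta. DG m s ta sg & g' n sg = (%x. g m ta (fst x, spush n s (snd x)))"
  then obtain m s ta where d: "m < n" "s : Delta n m" "s ` {..n} = {..m}" "ta : simps X m"
   "sact X n m s ta = sg" "g' n sg = (%x. g m ta (fst x, spush n s (snd x)))" unfolding DG_def by blast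
  have sa: "cp q s a : Delta q m" using a d by blast
  have asg: "sact X q m (cp q s a) ta = sact X q n a sg" using sact_comp[OF a d(2,4)] d(5) by simp
  have mem: "g q (sact X q n a sg) (u, t) : topspace (V q (sact X q n a sg))"
   using below_D(3)[OF g q sact_in[OF a sg] u t] .
  then have mem': "w q n a sg (g q (sact X q n a sg) (u, t)) : topspace (V m ta)"
   using continuous_map_image_subset_topspace[OF w_continuous[OF a sg]] V_degeneracy[OF d(2-4)] d(5)
   by (auto simp: image_subset_iff)
  have "g' n sg (u, spush q a t) = g m ta (u, spush q (cp q s a) t)"
   using spush_comp[OF a] by (simp add: d(6))
  also have "... = w q m (cp q s a) ta (g q (sact X q n a sg) (u, t))"
   using below_D(2)[OF g d(1) q d(4) sa u t] asg by simp
  also have "... = w n m s ta (w q n a sg (g q (sact X q n a sg) (u, t)))"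
   using w_comp[OF a d(2,4)] d(5) mem by simp
  also have "... = w q n a sg (g q (sact X q n a sg) (u, t))"
   using w_degeneracy[OF d(2-4) mem'] .
  finally show ?thesis .
 qed
 have "nat_below (Suc n) T g'"
  unfolding nat_below_def
 proof (intro conjI allI impI; elim conjE)
  fix p sg assume "p < Suc n" "sg : simps X p"
  then show "cmap (prism T p) (V p sg) (g' p sg)"
   using below_D(1)[OF g, of p sg] g'_cont g'_below[of p]
   by (cases "p = n") (auto simp: less_Suc_eq fun_eq_iff[symmetric] intro: continuous_map_eq)
 next
  fix p q sg a u t
  assume p: "p < Suc n" and q: "q < Suc n" and sg: "sg : simps X p" and a: "a : Delta q p" and u: "u : T" 
   and t: "t : Splx q"
  consider "p < n" "q < n" | "p < n" "q = n" | "p = n" "q < n" | "p = n" "q = n"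
   using p q by (metis less_antisym)
  then show "g' p sg (u, spush q a t) = w q p a sg (g' q (sact X q p a sg) (u, t))"
  proof cases
   case 1 then show ?thesis using below_D(2)[OF g _ _ sg a u t] g'_below by simp
  next
   case 2 then show ?thesis using K[of a p sg u t] sg a u t g'_below by simp
  next
   case 3 then show ?thesis using L[of a q sg u t] sg a u t g'_below by simp
  next
   case 4
   \<comment> \<open>An operator of \<open>[n]\<close> other than the identity factors through some
     \<open>k < n\<close>; \<open>L\<close> treats the injective factor and \<open>K\<close> the
     surjective one.\<close>
   obtain k pj io where k: "pj : Delta n k" "pj ` {..n} = {..k}" "io : Delta k n" "inj_on io {..k}"
    "a = cp n io pj" "k <= n"
    using epi_mono[of a n n] a 4 by metis
   show ?thesis
   proof (cases "k = n")
    case True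
    have "inj_on pj {..n}" using k(2) True by (intro eq_card_imp_inj_on) auto
    with True have "pj = Did n" "io = Did n"
     using k(1,3,4) Delta_inj_self by blast+
    then have id: "a = Did n" using k comp_id(1)[OF Delta_id_in] by simp
    have "Did n ` {..n} = {..n}" by (auto simp: image_iff)
    then show ?thesis
     using w_degeneracy[OF Delta_id_in, of n sg "g' n sg (u, t)"] g'_mem[of sg u t] sg u t 4 id
     by (simp add: sact_id spush_id)
   next
    case False
    then have kn: "k < n" using k by simp
    have sgn: "sg : simps X n" and tn: "t : Splx n" using sg t 4 by auto
    have pjt: "spush n pj t : Splx k" using k tn by blast
    have iosg: "sact X k n io sg : simps X k" using sact_in k sgn by blast
    have asg: "sact X n k pj (sact X k n io sg) = sact X n n a sg"
     using sact_comp[OF k(1,3) sgn] k(5) by simp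
    have "g' n sg (u, spush n a t) = g' n sg (u, spush k io (spush n pj t))"
     using spush_comp[OF k(1)] k(5) by simp
    also have "... = w k n io sg (g k (sact X k n io sg) (u, spush n pj t))"
     using L[OF k(3) kn sgn u pjt] .
    also have "... = w k n io sg (w n k pj (sact X k n io sg) (g' n (sact X n n a sg) (u, t)))"
     using K[OF k(1) kn iosg u tn] asg by simp
    also have "... = w n n a sg (g' n (sact X n n a sg) (u, t))"
     using w_comp[OF k(1,3) sgn] g'_mem[OF _ u tn] sact_in[of a n n sg] a asg k(5) sgn 4 by simp
    finally show ?thesis using 4 by simp
   qed
  qed
 qed
 moreover have "ALL p<n. g' p = g p" using g'_below by (auto simp: fun_eq_iff)
 moreover have "g' n sg (u, t) = bb n sg (u, t)"
  if sg: "sg : simps X n" and u: "u : pends T" and t: "t : Splx n" for sg u t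
  using g'_cases[of sg]
 proof
  assume "g' n sg = F sg"
  then show ?thesis using F(2)[OF sg, of "(u, t)"] bd_ends u t ends by (simp add: bdry_def)
 next
  assume "EX m s ta. DG m s ta sg & g' n sg = (%x. g m ta (fst x, spush n s (snd x)))"
  then obtain m s ta where d: "m < n" "s : Delta n m" "s ` {..n} = {..m}" "ta : simps X m"
   "sact X n m s ta = sg" "g' n sg = (%x. g m ta (fst x, spush n s (snd x)))" unfolding DG_def by blast
  have "bb n sg (u, t) : topspace (V m ta)"
   using continuous_map_image_subset_topspace[OF nat_famD(1)[OF bb sg]] u t V_degeneracy[OF d(2-4)] d(5)
   by (force simp: image_subset_iff)
  then show ?thesis
   using gb[OF d(1,4) u spush_in[OF d(2) t]] nat_famD(2)[OF bb d(4,2) u t]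
    w_degeneracy[OF d(2-4)] d(5,6) by simp
 qed
 ultimately show ?thesis by blast
qed

theorem nat_fam_exists:
 assumes T: "pset T" and bb: "nat_fam (pends T) bb"
 shows "EX g. nat_fam T g & (ALL p. ALL sg:simps X p. ALL u:pends T. ALL t:Splx p.
  g p sg (u, t) = bb p sg (u, t))"
proof -
 define P where "P n g <-> nat_below n T g & (ALL p<n. ALL sg:simps X p. ALL u:pends T.
  ALL t:Splx p. g p sg (u, t) = bb p sg (u, t))" for n g
 have "EX f. ALL n. P n (f n) & (ALL p<n. f (Suc n) p = f n p)"
 proof (rule dependent_nat_choice)
  show "EX g. P 0 g" by (simp add: P_def nat_below_def)
  fix g n assume g: "P n g"
  then obtain g' where "nat_below (Suc n) T g'" "ALL p<n. g' p = g p"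
   "ALL sg:simps X n. ALL u:pends T. ALL t:Splx n. g' n sg (u, t) = bb n sg (u, t)"
   using nat_fam_step[OF T bb, of n g] unfolding P_def by blast
  then show "EX g'. P (Suc n) g' & (ALL p<n. g' p = g p)"
   using g unfolding P_def by (intro exI[of _ g']) (auto simp: less_Suc_eq)
 qed
 then obtain f where f: "!!n. P n (f n)" "!!n p. p < n ==> f (Suc n) p = f n p" by blast
 \<comment> \<open>Stage \<open>Suc p\<close> is the first one that contains dimension
   \<open>p\<close>, and later stages leave it unchanged.\<close>
 define g where "g p = f (Suc p) p" for p
 have fg: "f (Suc p + k) p = g p" for p k
  by (induction k) (simp_all add: g_def f(2))
 have fg': "f N p = g p" if "p < N" for N p
  using fg[of p "N - Suc p"] that by simp
 have "nat_below N T g" for N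
  using f(1)[of N] fg'[of _ N] unfolding P_def nat_below_def by simp
 moreover have "ALL p. ALL sg:simps X p. ALL u:pends T. ALL t:Splx p. g p sg (u, t) = bb p sg (u, t)"
  using f(1) unfolding P_def g_def by blast
 ultimately show ?thesis unfolding nat_fam_def by blast
qed

definition nat_sec :: "(nat => 's => (nat => real) => 'w) => bool" where
 "nat_sec g <->
   (ALL p. ALL sg : simps X p. cmap (Simplex p) (V p sg) (g p sg)) &
   (ALL p q sg a t. sg : simps X p & a : Delta q p & t : Splx q
    --> g p sg (spush q a t) = w q p a sg (g q (sact X q p a sg) t))"

text \<open>The one-point interval \<open>{1/2}\<close> has no ends, so the empty family serves as
  prescribed data.\<close>

corollary nat_sec_exists: "EX g. nat_sec g"
proof -
 have ends: "pends {1/2} = {}" by (auto simp: pends_def)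
 have "nat_fam {} bb" for bb
  unfolding nat_fam_iff by (auto simp: continuous_map_def)
 then obtain g where g: "nat_fam {1/2} g"
  using nat_fam_exists[of "{1/2}"] ends by (auto simp: pset_def)
 have "cmap (Simplex p) (V p sg) (%t. g p sg (1/2, t))" if "sg : simps X p" for p sg
 proof -
  have "cmap (Simplex p) (prism {1/2} p) (Pair (1/2))"
   by (auto simp: continuous_map_pairwise o_def continuous_map_in_subtopology)
  from continuous_map_compose[OF this nat_famD(1)[OF g that]] show ?thesis by (simp add: o_def)
 qed
 then have "nat_sec (%p sg t. g p sg (1/2, t))"
  using nat_famD(2)[OF g] unfolding nat_sec_def by auto
 then show ?thesis by blast
qed

corollary nat_sec_homotopic:
 assumes g: "nat_sec g0" "nat_sec g1"
 shows "EX h. nat_fam {0..1} h & (ALL p. ALL sg:simps X p. ALL t:Splx p.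
  h p sg (0, t) = g0 p sg t & h p sg (1, t) = g1 p sg t)"
proof -
 have ends: "pends {0..1} = {0, 1}" by (auto simp: pends_def)
 \<comment> \<open>The threshold \<open>1/2\<close> merely separates the two ends 0 and 1.\<close>
 define bb where "bb p sg x = (if fst x <= (1/2::real) then g0 p sg (snd x) else g1 p sg (snd x))" for p sg x
 have "cmap (prism {0, 1} p) (V p sg) (bb p sg)" if sg: "sg : simps X p" for p sg
  unfolding bb_def
 proof (rule continuous_map_cases_le)
  show "cmap (prism {0, 1} p) euclideanreal fst"
   using continuous_map_fst[of "top_of_set {0, 1::real}" "Simplex p"] by (simp add: continuous_map_in_subtopology)
  have *: "cmap (subtopology (prism {0, 1} p) A) (V p sg) (%x. g (snd x))"
   if "cmap (Simplex p) (V p sg) g" for A g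
   using continuous_map_compose[OF continuous_map_snd that, of "top_of_set {0, 1::real}"]
   by (intro continuous_map_from_subtopology) (simp only: o_def)
  show "cmap (subtopology (prism {0, 1} p) {x : topspace (prism {0, 1} p). fst x <= 1/2}) (V p sg) (%x. g0 p sg (snd x))"
   "cmap (subtopology (prism {0, 1} p) {x : topspace (prism {0, 1} p). 1/2 <= fst x}) (V p sg) (%x. g1 p sg (snd x))"
   using g sg unfolding nat_sec_def by (auto intro!: *)
 qed auto
 then have bb: "nat_fam (pends {0..1}) bb"
  using g unfolding nat_fam_iff nat_sec_def ends by (auto simp: bb_def)
 have T: "pset {0..1}" by (simp add: pset_def)
 show ?thesis
  using nat_fam_exists[OF T bb] unfolding ends by (auto simp: bb_def)
qed

end

section \<open>Nerves of categories\<close>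

definition chain :: "nat => (nat => 'x) => (nat => nat => 'f) => (nat => 'x) * (nat => nat => 'f)" where
 "chain p X f = (\<lambda>i\<in>{..p}. X i, %i j. if i <= j & j <= p then f i j else undefined)"

lemma chain_eqI:
 assumes "!!i. i <= p ==> X i = Y i" "!!i j. [|i <= j; j <= p|] ==> f i j = g i j"
 shows "chain p X f = chain p Y g"
 using assms by (auto simp: chain_def fun_eq_iff)

lemma chain_apply:
 "i <= p ==> fst (chain p X f) i = X i" "i <= j ==> j <= p ==> snd (chain p X f) i j = f i j"
 by (auto simp: chain_def)

lemma simps_nerve [simp]: "simps (nerve E) p = nerve_simps E p"
 by (simp add: nerve_def)

lemma sact_nerve: "sact (nerve E) q p a sg = chain q (%i. fst sg (a i)) (%i j. snd sg (a i) (a j))"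
 by (simp add: nerve_def chain_def case_prod_unfold)

lemma nmap_chain: "nerve_map G H p sg = chain p (%i. G (fst sg i)) (%i j. H (snd sg i j))"
 by (simp add: nerve_map_def chain_def case_prod_unfold)

lemma simpsI:
 assumes "!!i. i <= p ==> X i : obs E"
  "!!i j. [|i <= j; j <= p|] ==> f i j : ars E & dm E (f i j) = X j & cd E (f i j) = X i"
  "!!i. i <= p ==> f i i = idn E (X i)"
  "!!i j k. [|i <= j; j <= k; k <= p|] ==> cmp E (f i j) (f j k) = f i k"
 shows "chain p X f : nerve_simps E p"
 using assms by (auto simp: nerve_simps_def chain_def)

lemma simpsD:
 assumes "sg : nerve_simps E p"
 shows "i <= p ==> fst sg i : obs E"
  "[|i <= j; j <= p|] ==> snd sg i j : ars E"
  "[|i <= j; j <= p|] ==> dm E (snd sg i j) = fst sg j"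
  "[|i <= j; j <= p|] ==> cd E (snd sg i j) = fst sg i"
  "i <= p ==> snd sg i i = idn E (fst sg i)"
  "[|i <= j; j <= k; k <= p|] ==> cmp E (snd sg i j) (snd sg j k) = snd sg i k"
  "chain p (fst sg) (snd sg) = sg"
proof -
 show "chain p (fst sg) (snd sg) = sg"
  using assms by (cases sg) (auto simp: nerve_simps_def chain_def fun_eq_iff PiE_def extensional_def)
qed (use assms in "auto simp: nerve_simps_def")

lemma nerve_eqI:
 assumes "sg : nerve_simps E p" "!!i. i <= p ==> fst sg i = Y i" "!!i j. [|i <= j; j <= p|] ==> snd sg i j = g i j"
 shows "sg = chain p Y g"
proof -
 have "sg = chain p (fst sg) (snd sg)" using simpsD(7)[OF assms(1)] by simp
 also have "... = chain p Y g" using assms by (intro chain_eqI) auto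
 finally show ?thesis .
qed

lemma sact_nerve_in:
 assumes "a : Delta q p" "sg : nerve_simps E p"
 shows "sact (nerve E) q p a sg : nerve_simps E q"
 unfolding sact_nerve using DeltaD[OF assms(1)] simpsD[OF assms(2)]
 by (intro simpsI) auto

lemma sset_nerve: "simplicial_set (nerve E)"
proof
 fix q p a sg assume a: "a : Delta q p" and sg: "sg : simps (nerve E) p"
 show "sact (nerve E) q p a sg : simps (nerve E) q"
  using sact_nerve_in[OF a] sg by simp
 fix r b assume b: "b : Delta r q"
 show "sact (nerve E) r q b (sact (nerve E) q p a sg) = sact (nerve E) r p (cp r a b) sg"
  unfolding sact_nerve using DeltaD[OF b] by (intro chain_eqI) (auto simp: chain_apply)
next
 fix sg p assume sg: "sg : simps (nerve E) p"
 show "sact (nerve E) p p (Did p) sg = sg"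
  unfolding sact_nerve using sg by (intro nerve_eqI[symmetric]) auto
qed

abbreviation BB :: "('x, 'f) cat => (nat * ((nat => 'x) * (nat => nat => 'f)) * (nat => real)) set topology" where
 "BB E == realization (nerve E)"

text \<open>By definition \<open>realization_map\<close> returns the union of the classes of all
  images of a class. Since \<open>g\<close> respects the gluing, these classes coincide.\<close>

lemma real_map_pt:
 assumes X: "simplicial_set X" and Y: "simplicial_set Y"
  and g: "!!p s. s : simps X p ==> g p s : simps Y p"
  and nat: "!!q p a s. [|a : Delta q p; s : simps X p|] ==> g q (sact X q p a s) = sact Y q p a (g p s)"
  and s: "s : simps X p" and t: "t : Splx p"
 shows "realization_map Y g (pt X p s t) = pt Y p (g p s) t"
proof -
 let ?g = "%(p, s, t). pt Y p (g p s) t"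
 have inv: "?g x = ?g y" if "(x, y) : glue_eq X" for x y
 proof (rule glue_eq_invariant[OF that])
  fix x y assume "(x, y) : glue X"
  then show "?g x = ?g y"
   using simplicial_set.pt_push[OF Y] g nat by (auto simp: glue_def)
 qed
 have mem: "(p, s, t) : pt X p s t"
  using s t by (auto simp: pt_def glue_eq_def top_presimp)
 have "realization_map Y g c = (\<Union>x\<in>c. ?g x)" for c
  unfolding realization_map_def pt_def by (subst Image_eq_UN) (simp add: case_prod_unfold)
 also have "(\<Union>x\<in>pt X p s t. ?g x) = ?g (p, s, t)"
 proof
  show "(\<Union>x\<in>pt X p s t. ?g x) \<subseteq> ?g (p, s, t)"
  proof (rule UN_least)
   fix x assume "x : pt X p s t"
   then have "((p, s, t), x) : glue_eq X" by (simp add: pt_def)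
   from inv[OF this] show "?g x \<subseteq> ?g (p, s, t)" by (rule equalityD2)
  qed
 qed (rule UN_upper[OF mem])
 finally show ?thesis by simp
qed

definition functr :: "('x, 'f) cat => ('y, 'g) cat => ('x => 'y) => ('f => 'g) => bool" where
 "functr A B Fo Fa <->
   (ALL x:obs A. Fo x : obs B) &
   (ALL f:ars A. Fa f : ars B & dm B (Fa f) = Fo (dm A f) & cd B (Fa f) = Fo (cd A f)) &
   (ALL x:obs A. Fa (idn A x) = idn B (Fo x)) &
   (ALL f:ars A. ALL g:ars A. dm A g = cd A f --> Fa (cmp A g f) = cmp B (Fa g) (Fa f))"

lemma functrD:
 assumes "functr A B Fo Fa"
 shows "x : obs A ==> Fo x : obs B" "f : ars A ==> Fa f : ars B"
  "f : ars A ==> dm B (Fa f) = Fo (dm A f)" "f : ars A ==> cd B (Fa f) = Fo (cd A f)"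
  "x : obs A ==> Fa (idn A x) = idn B (Fo x)"
  "[|f : ars A; g : ars A; dm A g = cd A f|] ==> Fa (cmp A g f) = cmp B (Fa g) (Fa f)"
 using assms unfolding functr_def by blast+

lemma functrI:
 assumes "!!x. x : obs A ==> Fo x : obs B"
  "!!f. f : ars A ==> Fa f : ars B & dm B (Fa f) = Fo (dm A f) & cd B (Fa f) = Fo (cd A f)"
  "!!x. x : obs A ==> Fa (idn A x) = idn B (Fo x)"
  "!!f g. [|f : ars A; g : ars A; dm A g = cd A f|] ==> Fa (cmp A g f) = cmp B (Fa g) (Fa f)"
 shows "functr A B Fo Fa"
 using assms unfolding functr_def by blast

lemma functr_id: "functr A A (%x. x) (%f. f)"
 by (rule functrI) auto

lemma functr_comp:
 assumes "functr A B Fo Fa" "functr B C Go Ga"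
 shows "functr A C (%x. Go (Fo x)) (%f. Ga (Fa f))"
 by (rule functrI) (simp_all add: functrD[OF assms(1)] functrD[OF assms(2)])

lemma nerve_map_in:
 assumes "functr A B Fo Fa" "sg : nerve_simps A p"
 shows "nerve_map Fo Fa p sg : nerve_simps B p"
 unfolding nmap_chain
proof (rule simpsI)
 note sg = simpsD[OF assms(2)] and F = functrD[OF assms(1)]
 show "cmp B (Fa (snd sg i j)) (Fa (snd sg j k)) = Fa (snd sg i k)" if "i <= j" "j <= k" "k <= p" for i j k
  using F(6)[of "snd sg j k" "snd sg i j"] sg(2-4)[of j k] sg(2-4)[of i j] sg(6)[OF that] that by simp
qed (simp_all add: simpsD[OF assms(2)] functrD[OF assms(1)])

lemma nerve_map_sact:
 assumes "a : Delta q p"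
 shows "nerve_map Fo Fa q (sact (nerve A) q p a sg) = sact (nerve B) q p a (nerve_map Fo Fa p sg)"
 unfolding nmap_chain sact_nerve using DeltaD[OF assms] by (intro chain_eqI) (auto simp: chain_apply)

definition Bmap :: "('y, 'g) cat => ('x => 'y) => ('f => 'g) =>
  (nat * ((nat => 'x) * (nat => nat => 'f)) * (nat => real)) set =>
  (nat * ((nat => 'y) * (nat => nat => 'g)) * (nat => real)) set" where
 "Bmap B Fo Fa = realization_map (nerve B) (nerve_map Fo Fa)"

lemma Bmap_pt:
 assumes "functr A B Fo Fa" "sg : nerve_simps A p" "t : Splx p"
 shows "Bmap B Fo Fa (pt (nerve A) p sg t) = pt (nerve B) p (nerve_map Fo Fa p sg) t"
 unfolding Bmap_def
 by (rule real_map_pt)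
  (use assms nerve_map_in nerve_map_sact in "auto simp: sset_nerve")

lemma BB_cases:
 assumes "c : topspace (BB E)"
 obtains p sg t where "sg : nerve_simps E p" "t : Splx p" "c = pt (nerve E) p sg t"
 by (rule realization_cases[OF assms, unfolded simps_nerve]) (rule that)

lemma cmap_Bmap:
 assumes F: "functr A B Fo Fa"
 shows "cmap (BB A) (BB B) (Bmap B Fo Fa)"
proof -
 interpret A: simplicial_set "nerve A" by (rule sset_nerve)
 interpret B: simplicial_set "nerve B" by (rule sset_nerve)
 have 1: "cmap (Simplex p) (BB B) (%t. pt (nerve B) p (nerve_map Fo Fa p sg) t)"
  if "sg : simps (nerve A) p" for p sg
  using cmap_pt[of "nerve_map Fo Fa p sg" "nerve B" p] nerve_map_in[OF F] that by simp
 obtain G where G: "cmap (BB A) (BB B) G"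
  "!!p sg t. [|sg : simps (nerve A) p; t : Splx p|]
   ==> G (pt (nerve A) p sg t) = pt (nerve B) p (nerve_map Fo Fa p sg) t"
 proof (rule A.real_lift[OF 1])
  show "pt (nerve B) q (nerve_map Fo Fa q (sact (nerve A) q p a s)) t =
    pt (nerve B) p (nerve_map Fo Fa p s) (spush q a t)"
   if "a : Delta q p" "s : simps (nerve A) p" "t : Splx q" for q p a s t
   using B.pt_push[OF that(1) _ that(3)] nerve_map_in[OF F] that by (simp add: nerve_map_sact[where B = B])
 qed (use that in blast)+
 show ?thesis
 proof (rule continuous_map_eq[OF G(1)])
  fix c assume "c : topspace (BB A)"
  then show "G c = Bmap B Fo Fa c"
   by (rule BB_cases) (simp add: G(2) Bmap_pt[OF F])
 qed
qed

lemma Bmap_comp: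
 assumes F: "functr A B Fo Fa" and G: "functr B C Go Ga" and c: "c : topspace (BB A)"
 shows "Bmap C Go Ga (Bmap B Fo Fa c) = Bmap C (%x. Go (Fo x)) (%f. Ga (Fa f)) c"
 using c
proof (rule BB_cases)
 fix p sg t assume s: "sg : nerve_simps A p" "t : Splx p" "c = pt (nerve A) p sg t"
 have "nerve_map Go Ga p (nerve_map Fo Fa p sg) = nerve_map (%x. Go (Fo x)) (%f. Ga (Fa f)) p sg"
  unfolding nmap_chain by (intro chain_eqI) (auto simp: chain_apply)
 then show ?thesis
  using s Bmap_pt[OF F] Bmap_pt[OF G nerve_map_in[OF F]] Bmap_pt[OF functr_comp[OF F G]] by simp
qed

lemma Bmap_cong:
 assumes F: "functr A B Fo Fa" and G: "functr A B Go Ga"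
  and eq: "!!x. x : obs A ==> Fo x = Go x" "!!f. f : ars A ==> Fa f = Ga f"
  and c: "c : topspace (BB A)"
 shows "Bmap B Fo Fa c = Bmap B Go Ga c"
 using c
proof (rule BB_cases)
 fix p sg t assume s: "sg : nerve_simps A p" "t : Splx p" "c = pt (nerve A) p sg t"
 have "nerve_map Fo Fa p sg = nerve_map Go Ga p sg"
  unfolding nmap_chain using simpsD[OF s(1)] by (intro chain_eqI) (auto simp: eq)
 then show ?thesis using s Bmap_pt[OF F] Bmap_pt[OF G] by simp
qed

lemma Bmap_id:
 assumes "c : topspace (BB A)"
 shows "Bmap A (%x. x) (%f. f) c = c"
 using assms
proof (rule BB_cases)
 fix p sg t assume s: "sg : nerve_simps A p" "t : Splx p" "c = pt (nerve A) p sg t"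
 then show ?thesis
  using Bmap_pt[OF functr_id s(1,2)] simpsD(7)[OF s(1)] by (simp add: nmap_chain)
qed

subsection \<open>Categories with a terminal object\<close>

text \<open>Since all arrows of a simplex point towards lower indices, the terminal object is placed
  in front of every simplex as a new vertex 0. \<open>join (u, t)\<close> gives it the weight
  \<open>u\<close>, and letting \<open>u\<close> grow from 0 to 1 slides every point to it.\<close>

lemma contract_terminal:
 assumes E: "category E" and z: "z : obs E"
  and bang: "!!x. x : obs E ==> bang x : ars E & dm E (bang x) = x & cd E (bang x) = z"
  and unique: "!!f g. [|f : ars E; g : ars E; dm E f = dm E g; cd E f = z; cd E g = z|] ==> f = g"
 shows "contract (BB E)"
proof -
 interpret E: category E by (rule E)
 interpret N: simplicial_set "nerve E" by (rule sset_nerve)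
 define cone where "cone p sg = chain (Suc p) (%i. case i of 0 => z | Suc i => fst sg i)
  (%i j. case i of 0 => (case j of 0 => idn E z | Suc j => bang (fst sg j)) | Suc i => snd sg i (j - 1))"
  for p and sg :: "(nat => 'a) * (nat => nat => 'b)"
 define join :: "real * (nat => real) => nat => real"
  where "join = (%(u, t) i. case i of 0 => u | Suc i => (1 - u) * t i)"
 define lift where "lift a = (%i. case i of 0 => 0 | Suc i => Suc (a i))" for a :: "nat => nat"
 let ?lift = "%q a. restrict (lift a) {..Suc q}"
 have cone_in: "cone p sg : nerve_simps E (Suc p)" if s: "sg : nerve_simps E p" for p sg
 proof -
  let ?o = "%i. case i of 0 => z | Suc i => fst sg i"
  let ?f = "%i j. case i of 0 => (case j of 0 => idn E z | Suc j => bang (fst sg j)) | Suc i => snd sg i (j - 1)"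
  note sg = simpsD[OF s]
  have f: "?f i j : ars E & dm E (?f i j) = ?o j & cd E (?f i j) = ?o i" if "i <= j" "j <= Suc p" for i j
   using that z sg bang E.idn[OF z] by (auto split: nat.split)
  show ?thesis
   unfolding cone_def
  proof (rule simpsI)
   show "?o i : obs E" if "i <= Suc p" for i using that z sg by (auto split: nat.split)
   show "?f i i = idn E (?o i)" if "i <= Suc p" for i using that sg by (auto split: nat.split)
   show "cmp E (?f i j) (?f j k) = ?f i k" if ij: "i <= j" "j <= k" "k <= Suc p" for i j k
   proof (cases i)
    case (Suc i')
    then obtain j' k' where "j = Suc j'" "k = Suc k'" using ij by (metis Suc_le_D le_trans)
    then show ?thesis using sg(6) ij Suc by simp
   next
    case 0
    show ?thesis using E.cmp[of "?f j k" "?f i j"] f[of i j] f[of j k] f[of i k] ij 0 by (intro unique) auto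
   qed
  qed (rule f)
 qed
 have join_in: "join (u, t) : Splx (Suc p)" if "u : {0..1}" "t : Splx p" for u t p
 proof (rule simplexI)
  have "(SUM i<=Suc p. join (u, t) i) = u + (1 - u) * (SUM i<=p. t i)"
   unfolding sum.atMost_Suc_shift by (simp add: join_def sum_distrib_left)
  then show "(SUM i<=Suc p. join (u, t) i) = 1" using simplexD(4)[OF that(2)] by simp
 qed (use that simplexD[OF that(2)] in "auto simp: join_def split: nat.split")
 have lift_Delta: "?lift q a : Delta (Suc q) (Suc p)" if a: "a : Delta q p" for q p a
  using DeltaD[OF a] by (intro DeltaI) (auto simp: lift_def split: nat.split)
 have push_join: "spush (Suc q) (?lift q a) (join (u, t)) = join (u, spush q a t)" for q a u t
 proof
  fix j
  show "spush (Suc q) (?lift q a) (join (u, t)) j = join (u, spush q a t) j"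
  proof (cases j)
   case 0
   have "{i. i <= Suc q & ?lift q a i = j} = {0}" using 0 by (auto simp: lift_def split: nat.splits) (metis old.nat.exhaust)
   then show ?thesis using 0 by (simp add: simplex_push_def join_def)
  next
   case (Suc j')
   have "{i. i <= Suc q & ?lift q a i = j} = Suc ` {i. i <= q & a i = j'}"
   proof (rule Set.set_eqI)
    show "i : {i. i <= Suc q & ?lift q a i = j} <-> i : Suc ` {i. i <= q & a i = j'}" for i
     using Suc by (cases i) (auto simp: lift_def)
   qed
   then show ?thesis
    using Suc by (simp add: simplex_push_def join_def sum.reindex sum_distrib_left)
  qed
 qed
 have cone_sact: "sact (nerve E) (Suc q) (Suc p) (?lift q a) (cone p sg) = cone q (sact (nerve E) q p a sg)"
  if a: "a : Delta q p" for q p a sg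
  unfolding cone_def sact_nerve
  using DeltaD[OF a] by (intro chain_eqI) (auto simp: chain_apply lift_def split: nat.split)
 let ?ph = "%p sg x. pt (nerve E) (Suc p) (cone p sg) (join x)"
 define v where "v = chain 0 (%_. z) (%_ _. idn E z)"
 have v: "v : nerve_simps E 0"
  unfolding v_def using z E.idn[OF z] E.idn_left[of "idn E z"] by (intro simpsI) auto
 define b where "b = pt (nerve E) 0 v (%j. if j = 0 then 1 else 0)"
 have bmem: "b : topspace (BB E)" unfolding b_def using v by (intro pt_in) auto
 have "Hot (BB E) (BB E) id (%_. b)"
 proof (rule N.real_homotopic[of "BB E" ?ph])
  fix p sg assume s: "sg : simps (nerve E) p"
  have u: "cmap (prism {0..1} p) euclideanreal fst"
   using continuous_map_fst[of "top_of_set {0..1::real}" "Simplex p"] by (simp add: continuous_map_in_subtopology)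
  have c: "cmap (prism {0..1} p) euclideanreal (%x. snd x i)" for i
   using continuous_map_compose[OF continuous_map_snd cmap_coord] by (simp only: o_def)
  have "cmap (prism {0..1} p) (Simplex (Suc p)) join"
  proof (rule cmap_Simplex)
   fix i
   have "cmap (prism {0..1} p) euclideanreal (%x. (1 - fst x) * snd x i)" for i
    by (intro continuous_map_real_mult continuous_map_diff u c) auto
   then show "cmap (prism {0..1} p) euclideanreal (%x. join x i)"
    using u by (cases i) (auto simp: join_def case_prod_unfold)
  qed (use join_in in force)
  from continuous_map_compose[OF this cmap_pt[of "cone p sg" "nerve E" "Suc p"]]
  show "cmap (prism {0..1} p) (BB E) (?ph p sg)"
   using cone_in s by (simp add: o_def)
 next
  fix q p a sg u t
  assume a: "a : Delta q p" and s: "sg : simps (nerve E) p" and u: "u : {0..1::real}" and t: "t : Splx q"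
  show "?ph q (sact (nerve E) q p a sg) (u, t) = ?ph p sg (u, spush q a t)"
   using N.pt_push[OF lift_Delta[OF a] _ join_in[OF u t], of "cone p sg"] cone_in s
   by (simp add: cone_sact[OF a] push_join)
 next
  fix p sg t assume s: "sg : simps (nerve E) p" and t: "t : Splx p"
  \<comment> \<open>At \<open>u = 0\<close> the point lies on the face of the cone opposite to the
    new vertex, which is \<open>sg\<close> itself; at \<open>u = 1\<close> it is the new
    vertex.\<close>
  have "sact (nerve E) p (Suc p) (coface p 0) (cone p sg) = sg"
   unfolding sact_nerve cone_def using s
   by (intro nerve_eqI[symmetric]) (auto simp: chain_apply coface_def)
  moreover have "omit 0 (join (0, t)) = t" by (auto simp: omit_def join_def)
  then have "spush p (coface p 0) t = join (0, t)"
   using omit_in_simplex(2)[OF join_in[OF _ t], of 0 0] by (simp add: join_def)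
  ultimately show "id (pt (nerve E) p sg t) = ?ph p sg (0, t)"
   using N.pt_push[OF coface_Delta _ t, of "cone p sg" 0] cone_in s by simp
  let ?a = "\<lambda>i\<in>{..0::nat}. 0::nat" let ?e = "%j::nat. if j = 0 then 1 else 0::real"
  have a: "?a : Delta 0 (Suc p)" by (intro DeltaI) auto
  have "sact (nerve E) 0 (Suc p) ?a (cone p sg) = v"
   unfolding sact_nerve cone_def v_def by (intro chain_eqI) (auto simp: chain_apply)
  moreover have "spush 0 ?a ?e = join (1, t)"
  proof
   fix j
   have "{i. i <= 0 & ?a i = j} = (if j = 0 then {0} else {})" by auto
   then show "spush 0 ?a ?e j = join (1, t) j"
    by (simp add: simplex_push_def join_def split: nat.split)
  qed
  moreover have "?e : Splx 0" by simp
  ultimately show "b = ?ph p sg (1, t)"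
   unfolding b_def using N.pt_push[OF a, of "cone p sg" ?e] cone_in s by simp
 qed
 then show ?thesis
  unfolding contract_def contractible_space_def using bmem by blast
qed

section \<open>Comma categories\<close>

text \<open>The over-category of the functor \<open>(Ho, Ha)\<close> at \<open>e\<close>. Arrows
  record their ends, because an arrow of \<open>D\<close> does not determine the arrows to
  \<open>e\<close>.\<close>

definition comma :: "('x, 'f) cat => ('y, 'g) cat => ('x => 'y) => ('f => 'g) => 'y =>
  ('x * 'g, ('x * 'g) * ('x * 'g) * 'f) cat" where
 "comma D B Ho Ha e =
   (|obs = {(x, f). x : obs D & f : ars B & dm B f = Ho x & cd B f = e},
   ars = {((x, f), (y, g), h) | x f y g h.
    x : obs D & f : ars B & dm B f = Ho x & cd B f = e &
    y : obs D & g : ars B & dm B g = Ho y & cd B g = e &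
    h : ars D & dm D h = x & cd D h = y & cmp B g (Ha h) = f},
   dm = (%(s, t, h). s), cd = (%(s, t, h). t),
   idn = (%(x, f). ((x, f), (x, f), idn D x)),
   cmp = (%(s', t', h') (s, t, h). (s, t', cmp D h' h))|)"

lemma comma_simps [simp]:
 "dm (comma D B Ho Ha e) (s, t, h) = s" "cd (comma D B Ho Ha e) (s, t, h) = t"
 "idn (comma D B Ho Ha e) (x, f) = ((x, f), (x, f), idn D x)"
 "cmp (comma D B Ho Ha e) (s', t', h') (s, t, h) = (s, t', cmp D h' h)"
 "(x, f) : obs (comma D B Ho Ha e) <-> x : obs D & f : ars B & dm B f = Ho x & cd B f = e"
 "((x, f), (y, g), h) : ars (comma D B Ho Ha e) <->
   x : obs D & f : ars B & dm B f = Ho x & cd B f = e &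
   y : obs D & g : ars B & dm B g = Ho y & cd B g = e &
   h : ars D & dm D h = x & cd D h = y & cmp B g (Ha h) = f"
 by (auto simp: comma_def)

lemma category_comma:
 assumes D: "category D" and B: "category B" and H: "functr D B Ho Ha"
 shows "category (comma D B Ho Ha e)"
proof -
 interpret D: category D by (rule D)
 interpret B: category B by (rule B)
 note Hs = functrD[OF H]
 show ?thesis
 proof (rule category.intro)
  fix x assume "x : obs (comma D B Ho Ha e)"
  then show "idn (comma D B Ho Ha e) x : ars (comma D B Ho Ha e) &
    dm (comma D B Ho Ha e) (idn (comma D B Ho Ha e) x) = x &
    cd (comma D B Ho Ha e) (idn (comma D B Ho Ha e) x) = x"
   using D.idn Hs(5) by (cases x) (auto, metis B.idn_right)
 next
  fix f g assume fg: "f : ars (comma D B Ho Ha e)" "g : ars (comma D B Ho Ha e)"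
   "dm (comma D B Ho Ha e) g = cd (comma D B Ho Ha e) f"
  obtain x a y b h where f: "f = ((x, a), (y, b), h)" by (metis prod.exhaust)
  obtain z c k where g: "g = ((y, b), (z, c), k)" using fg(3) by (cases g) (auto simp: f)
  have "cmp B c (Ha (cmp D k h)) = a"
   using fg Hs D.cmp B.cmp_assoc by (auto simp: f g)
  then show "cmp (comma D B Ho Ha e) g f : ars (comma D B Ho Ha e) &
    dm (comma D B Ho Ha e) (cmp (comma D B Ho Ha e) g f) = dm (comma D B Ho Ha e) f &
    cd (comma D B Ho Ha e) (cmp (comma D B Ho Ha e) g f) = cd (comma D B Ho Ha e) g"
   using fg D.cmp by (auto simp: f g)
 next
  fix f g h assume "f : ars (comma D B Ho Ha e)" "g : ars (comma D B Ho Ha e)"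
   "h : ars (comma D B Ho Ha e)" "dm (comma D B Ho Ha e) g = cd (comma D B Ho Ha e) f"
   "dm (comma D B Ho Ha e) h = cd (comma D B Ho Ha e) g"
  then show "cmp (comma D B Ho Ha e) h (cmp (comma D B Ho Ha e) g f) =
    cmp (comma D B Ho Ha e) (cmp (comma D B Ho Ha e) h g) f"
   by (cases f; cases g; cases h) (auto simp: D.cmp_assoc)
 qed (auto simp: comma_def D.idn_left D.idn_right)
qed

definition post_ob :: "('y, 'g) cat => 'g => 'x * 'g => 'x * 'g" where
 "post_ob B k = (%(x, f). (x, cmp B k f))"

definition post_ar :: "('y, 'g) cat => 'g => ('x * 'g) * ('x * 'g) * 'f => ('x * 'g) * ('x * 'g) * 'f" where
 "post_ar B k = (%(s, t, h). (post_ob B k s, post_ob B k t, h))"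

lemma functr_post:
 assumes B: "category B" and H: "functr D B Ho Ha" and k: "k : ars B" "dm B k = e" "cd B k = e'"
 shows "functr (comma D B Ho Ha e) (comma D B Ho Ha e') (post_ob B k) (post_ar B k)"
proof -
 interpret B: category B by (rule B)
 show ?thesis
 proof (rule functrI)
  have o: "post_ob B k x : obs (comma D B Ho Ha e')" if "x : obs (comma D B Ho Ha e)" for x
   using that k B.cmp by (cases x) (auto simp: post_ob_def)
  then show "post_ob B k x : obs (comma D B Ho Ha e')" if "x : obs (comma D B Ho Ha e)" for x
   using that .
  fix f assume f: "f : ars (comma D B Ho Ha e)"
  obtain x a y b h where fe: "f = ((x, a), (y, b), h)" by (metis prod.exhaust)
  have h: "h : ars D" "dm D h = x" "cd D h = y" "b : ars B" "dm B b = Ho y" "cd B b = e" "cmp B b (Ha h) = a"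
   "a : ars B" "dm B a = Ho x" "cd B a = e" "x : obs D" "y : obs D"
   using f by (auto simp: fe)
  have "cmp B (cmp B k b) (Ha h) = cmp B k a"
   using B.cmp_assoc[of "Ha h" b k] h k functrD(2-4)[OF H] by simp
  then show "post_ar B k f : ars (comma D B Ho Ha e') &
    dm (comma D B Ho Ha e') (post_ar B k f) = post_ob B k (dm (comma D B Ho Ha e) f) &
    cd (comma D B Ho Ha e') (post_ar B k f) = post_ob B k (cd (comma D B Ho Ha e) f)"
   using h k B.cmp[of a k] B.cmp[of b k] by (simp add: fe post_ar_def post_ob_def)
 qed (auto simp: post_ar_def post_ob_def)
qed

abbreviation comma_ar :: "('x * 'g) * ('x * 'g) * 'f => 'f" where
 "comma_ar x == snd (snd x)"

lemma functr_comma: "functr (comma D B Ho Ha e) D fst comma_ar"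
 by (rule functrI) auto

definition nat_trans :: "('x, 'f) cat => ('y, 'g) cat => ('x => 'y) => ('f => 'g) => ('x => 'y) => ('f => 'g) =>
  ('x => 'g) => bool" where
 "nat_trans A B Fo Fa Go Ga ta <->
   (ALL x:obs A. ta x : ars B & dm B (ta x) = Fo x & cd B (ta x) = Go x) &
   (ALL f:ars A. cmp B (Ga f) (ta (dm A f)) = cmp B (ta (cd A f)) (Fa f))"

lemma nat_transD:
 assumes "nat_trans A B Fo Fa Go Ga ta"
 shows "x : obs A ==> ta x : ars B" "x : obs A ==> dm B (ta x) = Fo x" "x : obs A ==> cd B (ta x) = Go x"
  "f : ars A ==> cmp B (Ga f) (ta (dm A f)) = cmp B (ta (cd A f)) (Fa f)"
 using assms unfolding nat_trans_def by blast+

lemma nat_trans_id: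
 assumes B: "category B" and F: "functr A B Fo Fa"
 shows "nat_trans A B Fo Fa Fo Fa (%x. idn B (Fo x))"
 using category.idn[OF B] category.idn_left[OF B] category.idn_right[OF B] functrD[OF F]
 unfolding nat_trans_def by (auto, metis)

text \<open>A simplex of \<open>A\<close> is lifted to a simplex of the comma category over the image of its vertex 0,
 which is the target of all its arrows.\<close>

definition comma_lift ::
 "('x => 'z) => ('f => 'h) => ('y, 'g) cat => ('h => 'g) => ('x => 'g) => nat =>
  (nat => 'x) * (nat => nat => 'f) =>
  (nat => 'z * 'g) * (nat => nat => ('z * 'g) * ('z * 'g) * 'h)" where
 "comma_lift Ko Ka B Ha ta p sg =
   (let x = (%i. (Ko (fst sg i), cmp B (ta (fst sg 0)) (Ha (Ka (snd sg 0 i)))))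
   in chain p x (%i j. (x j, x i, Ka (snd sg i j))))"

text \<open>\<open>nat_sec\<close> for the carrier made of the comma categories over the image of
  vertex 0, spelled out so that it can be used for several carriers at once.\<close>

definition comma_sec where
 "comma_sec A D B Ho Ha Go Ga g <->
   (ALL p. ALL sg:nerve_simps A p. cmap (Simplex p) (BB (comma D B Ho Ha (Go (fst sg 0)))) (g p sg)) &
   (ALL p q sg a t. sg : nerve_simps A p & a : Delta q p & t : Splx q -->
    g p sg (spush q a t) =
    Bmap (comma D B Ho Ha (Go (fst sg 0))) (post_ob B (Ga (snd sg 0 (a 0)))) (post_ar B (Ga (snd sg 0 (a 0))))
     (g q (sact (nerve A) q p a sg) t))"

text \<open>Supplies the sections to be compared: a natural transformation from \<open>H K\<close>
  to \<open>G\<close> turns the functor \<open>K\<close> into a section of the comma categories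
  \<open>H / G x\<close>, and projecting this section to \<open>D\<close> gives back the map induced
  by \<open>K\<close>.\<close>

lemma section_lift:
 assumes cats: "category A" "category B" and H: "functr D B Ho Ha" and K: "functr A D Ko Ka" 
  and G: "functr A B Go Ga"
  and ta: "nat_trans A B (%x. Ho (Ko x)) (%f. Ha (Ka f)) Go Ga ta"
 shows "comma_sec A D B Ho Ha Go Ga
   (%p sg. pt (nerve (comma D B Ho Ha (Go (fst sg 0)))) p (comma_lift Ko Ka B Ha ta p sg))"
  "!!p sg t. [|sg : nerve_simps A p; t : Splx p|] ==>
   Bmap D fst comma_ar (pt (nerve (comma D B Ho Ha (Go (fst sg 0)))) p (comma_lift Ko Ka B Ha ta p sg) t) =
   pt (nerve D) p (nerve_map Ko Ka p sg) t"
proof -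
 interpret A: category A by (rule cats)
 interpret B: category B by (rule cats)
 note Hs = functrD[OF H] and Ks = functrD[OF K] and Gs = functrD[OF G] and tas = nat_transD[OF ta]
 have lift_in: "comma_lift Ko Ka B Ha ta p sg : nerve_simps (comma D B Ho Ha (Go (fst sg 0))) p"
  if s: "sg : nerve_simps A p" for p sg
 proof -
  note sg = simpsD[OF s]
  let ?x = "fst sg" and ?f = "%i j. Ka (snd sg i j)" and ?t = "ta (fst sg 0)"
  let ?C = "comma D B Ho Ha (Go (?x 0))" and ?z = "%i. (Ko (?x i), cmp B ?t (Ha (?f 0 i)))"
  have x: "?t : ars B" "dm B ?t = Ho (Ko (?x 0))" "cd B ?t = Go (?x 0)"
   using tas sg(1)[of 0] by auto
  have a: "Ha (?f i j) : ars B" "dm B (Ha (?f i j)) = Ho (Ko (?x j))" "cd B (Ha (?f i j)) = Ho (Ko (?x i))"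
   if "i <= j" "j <= p" for i j
   using sg(2-4)[OF that] Hs Ks by auto
  have o: "?z i : obs ?C" if "i <= p" for i
   using Ks(1) sg(1)[OF that] B.cmp[OF a(1)[of 0 i] x(1)] a[of 0 i] x that by auto
  have c: "cmp B (Ha (?f i j)) (Ha (?f j k)) = Ha (?f i k)" "cmp D (?f i j) (?f j k) = ?f i k"
   if "i <= j" "j <= k" "k <= p" for i j k
   using sg(2-4)[of i j] sg(2-4)[of j k] sg(6)[OF that] that Ks Hs(6)[of "?f j k" "?f i j"]
    Ks(6)[of "snd sg j k" "snd sg i j"] by auto
  have e: "cmp B (cmp B ?t (Ha (?f 0 i))) (Ha (?f i j)) = cmp B ?t (Ha (?f 0 j))" if "i <= j" "j <= p" for i j
   using B.cmp_assoc[OF a(1)[OF that] a(1)[of 0 i] x(1)] a[OF that] a[of 0 i] x c(1)[of 0 i j] that by simp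
  show ?thesis
   unfolding comma_lift_def Let_def
  proof (rule simpsI)
   show "(?z i, ?z i, ?f i i) = idn ?C (?z i)" if "i <= p" for i using sg(5)[OF that] Ks(5) sg(1)[OF that] by simp
   show "(?z j, ?z i, ?f i j) : ars ?C & dm ?C (?z j, ?z i, ?f i j) = ?z j & cd ?C (?z j, ?z i, ?f i j) = ?z i"
    if "i <= j" "j <= p" for i j
    using o[of i] o[of j] e[OF that] that sg(2-4)[OF that] Ks by simp
   show "cmp ?C (?z j, ?z i, ?f i j) (?z k, ?z j, ?f j k) = (?z k, ?z i, ?f i k)" if "i <= j" "j <= k" "k <= p" for i j k
    using c(2)[OF that] by simp
  qed (rule o)
 qed
 show "comma_sec A D B Ho Ha Go Ga
   (%p sg. pt (nerve (comma D B Ho Ha (Go (fst sg 0)))) p (comma_lift Ko Ka B Ha ta p sg))"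
  unfolding comma_sec_def
 proof (intro conjI allI impI ballI; (elim conjE)?)
  show "cmap (Simplex p) (BB (comma D B Ho Ha (Go (fst sg 0))))
    (pt (nerve (comma D B Ho Ha (Go (fst sg 0)))) p (comma_lift Ko Ka B Ha ta p sg))"
   if "sg : nerve_simps A p" for p sg
   using cmap_pt lift_in[OF that] by (metis simps_nerve)
  fix p q sg a t assume s: "sg : nerve_simps A p" and a: "a : Delta q p" and t: "t : Splx q"
  note sg = simpsD[OF s]
  let ?E = "comma D B Ho Ha (Go (fst sg 0))" let ?k = "Ga (snd sg 0 (a 0))"
  let ?asg = "sact (nerve A) q p a sg"
  have a0: "a 0 <= p" "!!i. i <= q ==> a 0 <= a i" "!!i. i <= q ==> a i <= p" using DeltaD[OF a] by auto
  have as0: "fst ?asg 0 = fst sg (a 0)" unfolding sact_nerve by (simp add: chain_apply)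
  have k: "?k : ars B" "dm B ?k = Go (fst sg (a 0))" "cd B ?k = Go (fst sg 0)"
   using Gs sg(2-4)[of 0 "a 0"] a0 by auto
  have asin: "?asg : nerve_simps A q" using sact_nerve_in[OF a s] .
  \<comment> \<open>Naturality of \<open>ta\<close> along the arrow from vertex \<open>a 0\<close>
    to vertex 0.\<close>
  have key: "cmp B ?k (cmp B (ta (fst sg (a 0))) (Ha (Ka (snd sg (a 0) (a i))))) =
    cmp B (ta (fst sg 0)) (Ha (Ka (snd sg 0 (a i))))" if i: "i <= q" for i
  proof -
   have f: "Ha (Ka (snd sg (a 0) (a i))) : ars B" "cd B (Ha (Ka (snd sg (a 0) (a i)))) = Ho (Ko (fst sg (a 0)))"
    using sg(2-4)[of "a 0" "a i"] a0 i Hs Ks by auto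
   have g: "Ha (Ka (snd sg 0 (a 0))) : ars B" "cd B (Ha (Ka (snd sg 0 (a 0)))) = Ho (Ko (fst sg 0))"
    "dm B (Ha (Ka (snd sg 0 (a 0)))) = Ho (Ko (fst sg (a 0)))"
    using sg(2-4)[of 0 "a 0"] a0 Hs Ks by auto
   have t: "ta (fst sg (a 0)) : ars B" "ta (fst sg 0) : ars B"
    "dm B (ta (fst sg (a 0))) = Ho (Ko (fst sg (a 0)))" "cd B (ta (fst sg (a 0))) = Go (fst sg (a 0))"
    "dm B (ta (fst sg 0)) = Ho (Ko (fst sg 0))"
    using tas sg(1)[of 0] sg(1)[of "a 0"] a0 by auto
   have n: "cmp B ?k (ta (fst sg (a 0))) = cmp B (ta (fst sg 0)) (Ha (Ka (snd sg 0 (a 0))))"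
    using tas(4)[of "snd sg 0 (a 0)"] sg(2-4)[of 0 "a 0"] a0 by simp
   have c: "cmp B (Ha (Ka (snd sg 0 (a 0)))) (Ha (Ka (snd sg (a 0) (a i)))) = Ha (Ka (snd sg 0 (a i)))"
    using sg(2-4)[of 0 "a 0"] sg(2-4)[of "a 0" "a i"] sg(6)[of 0 "a 0" "a i"] a0 i
     Hs(6)[of "Ka (snd sg (a 0) (a i))" "Ka (snd sg 0 (a 0))"] Ks(6)[of "snd sg (a 0) (a i)" "snd sg 0 (a 0)"] Ks
    by auto
   have "cmp B ?k (cmp B (ta (fst sg (a 0))) (Ha (Ka (snd sg (a 0) (a i))))) =
     cmp B (cmp B ?k (ta (fst sg (a 0)))) (Ha (Ka (snd sg (a 0) (a i))))"
    using B.cmp_assoc[OF f(1) t(1) k(1)] f t k by simp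
   also have "... = cmp B (ta (fst sg 0)) (Ha (Ka (snd sg 0 (a i))))"
    unfolding n using B.cmp_assoc[OF f(1) g(1) t(2)] f g t c by simp
   finally show ?thesis .
  qed
  have eq: "nerve_map (post_ob B ?k) (post_ar B ?k) q (comma_lift Ko Ka B Ha ta q ?asg) =
    sact (nerve ?E) q p a (comma_lift Ko Ka B Ha ta p sg)"
   unfolding nmap_chain sact_nerve comma_lift_def Let_def
   using key a0 DeltaD(2)[OF a]
   by (intro chain_eqI) (auto simp: chain_apply post_ob_def post_ar_def)
  show "pt (nerve ?E) p (comma_lift Ko Ka B Ha ta p sg) (spush q a t) =
    Bmap ?E (post_ob B ?k) (post_ar B ?k)
     (pt (nerve (comma D B Ho Ha (Go (fst ?asg 0)))) q (comma_lift Ko Ka B Ha ta q ?asg) t)"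
   using Bmap_pt[OF functr_post[OF cats(2) H k] _ t] lift_in[OF asin] as0 eq
    simplicial_set.pt_push[OF sset_nerve a _ t, of "comma_lift Ko Ka B Ha ta p sg" ?E] lift_in[OF s]
   by simp
 qed
 show "Bmap D fst comma_ar (pt (nerve (comma D B Ho Ha (Go (fst sg 0)))) p (comma_lift Ko Ka B Ha ta p sg) t) =
   pt (nerve D) p (nerve_map Ko Ka p sg) t" if "sg : nerve_simps A p" "t : Splx p" for p sg t
 proof -
  have "nerve_map fst comma_ar p (comma_lift Ko Ka B Ha ta p sg) = nerve_map Ko Ka p sg"
   unfolding nmap_chain comma_lift_def Let_def by (intro chain_eqI) (auto simp: chain_apply)
  then show ?thesis using Bmap_pt[OF functr_comma lift_in[OF that(1)] that(2)] by simp
 qed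
qed

text \<open>Vertex 0 of \<open>a^* sg\<close> is vertex \<open>a 0\<close> of \<open>sg\<close>, and
  composing with the arrow from there to vertex 0 changes the comma category accordingly. A
  surjective operator fixes 0, so this arrow is then an identity, which gives the two degeneracy
  axioms.\<close>

lemma carriers_comma:
 assumes cats: "category A" "category B" "category D" and H: "functr D B Ho Ha" and G: "functr A B Go Ga"
  and contr: "!!x. x : obs A ==> contract (BB (comma D B Ho Ha (Go x)))"
 shows "carriers (nerve A) (%p sg. BB (comma D B Ho Ha (Go (fst sg 0))))
  (%q p a sg. Bmap (comma D B Ho Ha (Go (fst sg 0))) (post_ob B (Ga (snd sg 0 (a 0)))) (post_ar B (Ga (snd sg 0 (a 0)))))"
proof -
 interpret A: category A by (rule cats)
 interpret B: category B by (rule cats)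
 interpret N: simplicial_set "nerve A" by (rule sset_nerve)
 note Gs = functrD[OF G]
 have k: "Ga (snd sg 0 (a 0)) : ars B" "dm B (Ga (snd sg 0 (a 0))) = Go (fst sg (a 0))"
   "cd B (Ga (snd sg 0 (a 0))) = Go (fst sg 0)" "fst (sact (nerve A) q p a sg) 0 = fst sg (a 0)"
  if "sg : nerve_simps A p" "a : Delta q p" for p q sg a
  using Gs simpsD(2-4)[OF that(1), of 0 "a 0"] DeltaD(1)[OF that(2), of 0]
  by (auto simp: sact_nerve chain_apply)
 show ?thesis
 proof (unfold_locales; (unfold simps_nerve)?)
  fix sg p assume s: "sg : nerve_simps A p"
  then show "contract (BB (comma D B Ho Ha (Go (fst sg 0))))"
   using contr simpsD(1)[OF s] by blast
 next
  fix a q p sg assume a: "a : Delta q p" and s: "sg : nerve_simps A p"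
  show "cmap (BB (comma D B Ho Ha (Go (fst (sact (nerve A) q p a sg) 0)))) (BB (comma D B Ho Ha (Go (fst sg 0))))
    (Bmap (comma D B Ho Ha (Go (fst sg 0))) (post_ob B (Ga (snd sg 0 (a 0)))) (post_ar B (Ga (snd sg 0 (a 0)))))"
   using cmap_Bmap[OF functr_post[OF cats(2) H k(1-3)[OF s a]]] k(4)[OF s a] by simp
 next
  fix b r q a p sg x
  assume b: "b : Delta r q" and a: "a : Delta q p" and s: "sg : nerve_simps A p"
   and x: "x : topspace (BB (comma D B Ho Ha (Go (fst (sact (nerve A) r q b (sact (nerve A) q p a sg)) 0))))"
  let ?asg = "sact (nerve A) q p a sg"
  have as: "?asg : nerve_simps A q" using sact_nerve_in[OF a s] .
  note ka = k[OF s a] and kb = k[OF as b]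
  have ab: "cp r a b : Delta r p" using a b by blast
  note kab = k[OF s ab]
  have le: "a 0 <= a (b 0)" "a (b 0) <= p" using DeltaD[OF a] DeltaD(1)[OF b, of 0] by auto
  have kb': "snd ?asg 0 (b 0) = snd sg (a 0) (a (b 0))" 
   using DeltaD(1)[OF b, of 0] by (simp add: sact_nerve chain_apply)
  have c: "cmp B (Ga (snd sg 0 (a 0))) (Ga (snd ?asg 0 (b 0))) = Ga (snd sg 0 (cp r a b 0))"
   unfolding kb' using Gs(6)[of "snd sg (a 0) (a (b 0))" "snd sg 0 (a 0)"] simpsD(2-4)[OF s, of 0 "a 0"]
    simpsD(2-4)[OF s, of "a 0" "a (b 0)"] simpsD(6)[OF s, of 0 "a 0" "a (b 0)"] le by auto
  let ?E = "comma D B Ho Ha (Go (fst sg 0))" and ?k = "Ga (snd sg 0 (a 0))" and ?k' = "Ga (snd ?asg 0 (b 0))"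
  have F1: "functr (comma D B Ho Ha (Go (fst ?asg (b 0)))) (comma D B Ho Ha (Go (fst ?asg 0))) (post_ob B ?k') (post_ar B ?k')"
   using functr_post[OF cats(2) H kb(1-3)] .
  have F2: "functr (comma D B Ho Ha (Go (fst ?asg 0))) ?E (post_ob B ?k) (post_ar B ?k)"
   using functr_post[OF cats(2) H ka(1-3)] ka(4) by simp
  have ab0: "fst ?asg (b 0) = fst sg (cp r a b 0)" using DeltaD(1)[OF b, of 0] by (simp add: sact_nerve chain_apply)
  have F3: "functr (comma D B Ho Ha (Go (fst ?asg (b 0)))) ?E (post_ob B (Ga (snd sg 0 (cp r a b 0))))
    (post_ar B (Ga (snd sg 0 (cp r a b 0))))"
   using functr_post[OF cats(2) H kab(1-3)] ab0 by simp
  have x': "x : topspace (BB (comma D B Ho Ha (Go (fst ?asg (b 0)))))" using x kb(4) by simp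
  have p: "post_ob B ?k (post_ob B ?k' y) = post_ob B (Ga (snd sg 0 (cp r a b 0))) y"
   if "y : obs (comma D B Ho Ha (Go (fst ?asg (b 0))))" for y
   using that B.cmp_assoc[OF _ kb(1) ka(1)] kb ka c[symmetric] by (cases y) (auto simp: post_ob_def)
  have "Bmap ?E (post_ob B ?k) (post_ar B ?k) (Bmap (comma D B Ho Ha (Go (fst ?asg 0))) (post_ob B ?k') (post_ar B ?k') x)
   = Bmap ?E (%y. post_ob B ?k (post_ob B ?k' y)) (%y. post_ar B ?k (post_ar B ?k' y)) x"
   by (rule Bmap_comp[OF F1 F2 x'])
  also have "... = Bmap ?E (post_ob B (Ga (snd sg 0 (cp r a b 0)))) (post_ar B (Ga (snd sg 0 (cp r a b 0)))) x"
  proof (rule Bmap_cong[OF functr_comp[OF F1 F2] F3 p _ x'])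
   fix y assume y: "y : ars (comma D B Ho Ha (Go (fst ?asg (b 0))))"
   obtain s t h where yy: "y = (s, t, h)" by (cases y)
   have "s : obs (comma D B Ho Ha (Go (fst ?asg (b 0))))" "t : obs (comma D B Ho Ha (Go (fst ?asg (b 0))))"
    using y by (cases s; cases t; auto simp: yy)+
   then show "post_ar B ?k (post_ar B ?k' y) = post_ar B (Ga (snd sg 0 (cp r a b 0))) y"
    using p by (simp add: yy post_ar_def)
  qed
  finally show "Bmap ?E (post_ob B ?k) (post_ar B ?k) (Bmap (comma D B Ho Ha (Go (fst ?asg 0))) (post_ob B ?k') (post_ar B ?k') x)
   = Bmap ?E (post_ob B (Ga (snd sg 0 (cp r a b 0)))) (post_ar B (Ga (snd sg 0 (cp r a b 0)))) x" .
 next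
  fix s :: "nat => nat" and n m ta assume s: "s : Delta n m" "s ` {..n} = {..m}" and t: "ta : nerve_simps A m"
  have "0 : s ` {..n}" using s(2) by simp
  then obtain i where "i <= n" "s i = 0" by force
  then have s0: "s 0 = 0" using DeltaD(2)[OF s(1), of 0 i] by simp
  show "BB (comma D B Ho Ha (Go (fst (sact (nerve A) n m s ta) 0))) = BB (comma D B Ho Ha (Go (fst ta 0)))"
   using k(4)[OF t s(1)] s0 by simp
  fix x assume x: "x : topspace (BB (comma D B Ho Ha (Go (fst ta 0))))"
  let ?E = "comma D B Ho Ha (Go (fst ta 0))" and ?k = "Ga (snd ta 0 (s 0))"
  have id: "?k = idn B (Go (fst ta 0))" using simpsD(1,5)[OF t, of 0] Gs(5) s0 by simp
  have F: "functr ?E ?E (post_ob B ?k) (post_ar B ?k)"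
   using functr_post[OF cats(2) H k(1-3)[OF t s(1)]] s0 by simp
  have p: "post_ob B ?k y = y" if "y : obs ?E" for y
   using that B.idn_left[of "snd y"] by (cases y) (auto simp: post_ob_def id)
  have "Bmap ?E (post_ob B ?k) (post_ar B ?k) x = Bmap ?E (%x. x) (%f. f) x"
  proof (rule Bmap_cong[OF F functr_id p _ x])
   fix y assume y: "y : ars ?E"
   obtain s' t h where yy: "y = (s', t, h)" by (cases y)
   have "s' : obs ?E" "t : obs ?E" using y by (cases s'; cases t; auto simp: yy)+
   then show "post_ar B ?k y = y" using p by (simp add: yy post_ar_def)
  qed
  then show "Bmap ?E (post_ob B ?k) (post_ar B ?k) x = x" using Bmap_id[OF x] by simp
 qed
qed

section \<open>Quillen's Theorem A\<close>

lemma section_exists: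
 assumes cats: "category A" "category B" "category D" and H: "functr D B Ho Ha" and G: "functr A B Go Ga"
  and contr: "!!x. x : obs A ==> contract (BB (comma D B Ho Ha (Go x)))"
 shows "EX g. comma_sec A D B Ho Ha Go Ga g"
proof -
 interpret carriers "nerve A" "%p sg. BB (comma D B Ho Ha (Go (fst sg 0)))"
  "%q p a sg. Bmap (comma D B Ho Ha (Go (fst sg 0))) (post_ob B (Ga (snd sg 0 (a 0)))) (post_ar B (Ga (snd sg 0 (a 0))))"
  by (rule carriers_comma[OF cats H G contr])
 show ?thesis
  using nat_sec_exists unfolding nat_sec_def comma_sec_def simps_nerve .
qed

text \<open>Changing the base of the comma category leaves the component in \<open>D\<close> alone.
  Hence the projections of a section to \<open>BB D\<close> agree on glued points and descend to the
  realization.\<close>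

lemma Bmap_proj_post:
 assumes B: "category B" and H: "functr D B Ho Ha" and k: "k : ars B" "dm B k = e" "cd B k = e'"
  and x: "x : topspace (BB (comma D B Ho Ha e))"
 shows "Bmap D fst comma_ar (Bmap (comma D B Ho Ha e') (post_ob B k) (post_ar B k) x) = Bmap D fst comma_ar x"
proof -
 note P = functr_post[OF B H k]
 have "Bmap D fst comma_ar (Bmap (comma D B Ho Ha e') (post_ob B k) (post_ar B k) x) =
   Bmap D (%x. fst (post_ob B k x)) (%x. comma_ar (post_ar B k x)) x"
  by (rule Bmap_comp[OF P functr_comma x])
 also have "... = Bmap D fst comma_ar x"
  by (rule Bmap_cong[OF functr_comp[OF P functr_comma] functr_comma _ _ x])
   (auto simp: post_ob_def post_ar_def)
 finally show ?thesis .
qed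

lemma comma_secD:
 assumes "comma_sec A D B Ho Ha Go Ga g"
 shows "sg : nerve_simps A p ==> cmap (Simplex p) (BB (comma D B Ho Ha (Go (fst sg 0)))) (g p sg)"
  "[|sg : nerve_simps A p; t : Splx p|] ==> g p sg t : topspace (BB (comma D B Ho Ha (Go (fst sg 0))))"
  "[|sg : nerve_simps A p; a : Delta q p; t : Splx q|] ==>
    g p sg (spush q a t) =
    Bmap (comma D B Ho Ha (Go (fst sg 0))) (post_ob B (Ga (snd sg 0 (a 0)))) (post_ar B (Ga (snd sg 0 (a 0))))
     (g q (sact (nerve A) q p a sg) t)"
proof -
 show c: "cmap (Simplex p) (BB (comma D B Ho Ha (Go (fst sg 0)))) (g p sg)" if "sg : nerve_simps A p"
  using assms that unfolding comma_sec_def by blast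
 show "g p sg t : topspace (BB (comma D B Ho Ha (Go (fst sg 0))))" if "sg : nerve_simps A p" "t : Splx p"
  using continuous_map_image_subset_topspace[OF c[OF that(1)]] that(2) by (auto simp: image_subset_iff)
 show "[|sg : nerve_simps A p; a : Delta q p; t : Splx q|] ==>
    g p sg (spush q a t) =
    Bmap (comma D B Ho Ha (Go (fst sg 0))) (post_ob B (Ga (snd sg 0 (a 0)))) (post_ar B (Ga (snd sg 0 (a 0))))
     (g q (sact (nerve A) q p a sg) t)"
  using assms unfolding comma_sec_def by blast
qed

lemma vertex_action:
 assumes "functr A B Go Ga" "sg : nerve_simps A p" "a : Delta q p"
 shows "Ga (snd sg 0 (a 0)) : ars B" "dm B (Ga (snd sg 0 (a 0))) = Go (fst sg (a 0))"
   "cd B (Ga (snd sg 0 (a 0))) = Go (fst sg 0)" "fst (sact (nerve A) q p a sg) 0 = fst sg (a 0)"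
 using functrD[OF assms(1)] simpsD(2-4)[OF assms(2), of 0 "a 0"] DeltaD(1)[OF assms(3), of 0]
 by (auto simp: sact_nerve chain_apply)

text \<open>Two sections of one acyclic carrier are joined by a natural family of homotopies, whose
  projection to \<open>BB D\<close> is the homotopy asked for.\<close>

lemma section_homotopic:
 assumes cats: "category A" "category B" "category D" and H: "functr D B Ho Ha" and G: "functr A B Go Ga"
  and contr: "!!x. x : obs A ==> contract (BB (comma D B Ho Ha (Go x)))"
  and g: "comma_sec A D B Ho Ha Go Ga g0" "comma_sec A D B Ho Ha Go Ga g1"
  and eq: "!!p sg t. [|sg : nerve_simps A p; t : Splx p|] ==>
    Ph0 (pt (nerve A) p sg t) = Bmap D fst comma_ar (g0 p sg t) &
    Ph1 (pt (nerve A) p sg t) = Bmap D fst comma_ar (g1 p sg t)"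
 shows "Hot (BB A) (BB D) Ph0 Ph1"
proof -
 interpret carriers "nerve A" "%p sg. BB (comma D B Ho Ha (Go (fst sg 0)))"
  "%q p a sg. Bmap (comma D B Ho Ha (Go (fst sg 0))) (post_ob B (Ga (snd sg 0 (a 0)))) (post_ar B (Ga (snd sg 0 (a 0))))"
  by (rule carriers_comma[OF cats H G contr])
 have "nat_sec g0" "nat_sec g1"
  using g unfolding nat_sec_def comma_sec_def simps_nerve .
 from nat_sec_homotopic[OF this] obtain h where h: "nat_fam {0..1} h"
  and h': "ALL p. ALL sg:simps (nerve A) p. ALL t:Splx p. h p sg (0, t) = g0 p sg t & h p sg (1, t) = g1 p sg t"
  by (elim exE conjE) (rule that)
 show ?thesis
 proof (rule real_homotopic[of _ "%p sg x. Bmap D fst comma_ar (h p sg x)"])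
  show "cmap (prism {0..1} p) (BB D) (%x. Bmap D fst comma_ar (h p sg x))"
   if "sg : simps (nerve A) p" for p sg
   using continuous_map_compose[OF nat_famD(1)[OF h that] cmap_Bmap[OF functr_comma]]
   by (simp add: o_def)
  fix q p a sg u t
  assume a: "a : Delta q p" and s: "sg : simps (nerve A) p" and u: "u : {0..1::real}" and t: "t : Splx q"
  let ?asg = "sact (nerve A) q p a sg"
  have s': "sg : nerve_simps A p" using s by simp
  have as: "?asg : simps (nerve A) q" using sact_nerve_in[OF a s'] by simp
  note k = vertex_action[OF G s' a]
  have m: "h q ?asg (u, t) : topspace (BB (comma D B Ho Ha (Go (fst sg (a 0)))))"
   using continuous_map_image_subset_topspace[OF nat_famD(1)[OF h as]] u t k(4)
   by (force simp: image_subset_iff)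
  show "Bmap D fst comma_ar (h q ?asg (u, t)) = Bmap D fst comma_ar (h p sg (u, spush q a t))"
   using nat_famD(2)[OF h s a u t] Bmap_proj_post[OF cats(2) H k(1-3) m] by simp
 qed (simp_all add: eq h'[rule_format])
qed

lemma slice_contractible:
 assumes B: "category B" and e: "e : obs B"
 shows "contract (BB (comma B B (%x. x) (%f. f) e))"
proof -
 interpret B: category B by (rule B)
 show ?thesis
 proof (rule contract_terminal[of _ "(e, idn B e)" "%(x, f). ((x, f), (e, idn B e), f)"])
  show "category (comma B B (%x. x) (%f. f) e)" by (rule category_comma[OF B B functr_id])
  show "(e, idn B e) : obs (comma B B (%x. x) (%f. f) e)" using e B.idn[OF e] by simp
  fix x assume x: "x : obs (comma B B (%x. x) (%f. f) e)"
  then show "(case x of (x, f) => ((x, f), (e, idn B e), f)) : ars (comma B B (%x. x) (%f. f) e) &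
    dm (comma B B (%x. x) (%f. f) e) (case x of (x, f) => ((x, f), (e, idn B e), f)) = x &
    cd (comma B B (%x. x) (%f. f) e) (case x of (x, f) => ((x, f), (e, idn B e), f)) = (e, idn B e)"
   using e B.idn[OF e] B.dm[of "snd x"] B.idn_left[of "snd x"] by (cases x) auto
 next
  fix f g assume fg: "f : ars (comma B B (%x. x) (%f. f) e)" "g : ars (comma B B (%x. x) (%f. f) e)"
   "dm (comma B B (%x. x) (%f. f) e) f = dm (comma B B (%x. x) (%f. f) e) g"
   "cd (comma B B (%x. x) (%f. f) e) f = (e, idn B e)" "cd (comma B B (%x. x) (%f. f) e) g = (e, idn B e)"
  obtain x a y b h where f: "f = ((x, a), (y, b), h)" by (metis prod.exhaust)
  obtain x' a' y' b' h' where g: "g = ((x', a'), (y', b'), h')" by (metis prod.exhaust)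
  have h: "h : ars B" "cd B h = e" "cmp B (idn B e) h = a" "h' : ars B" "cd B h' = e" "cmp B (idn B e) h' = a'"
   and eq: "x = x'" "a = a'" "y = y'" "b = b'"
   using fg by (auto simp: f g)
  have "h = a" using B.idn_left[OF h(1)] h(2,3) by simp
  moreover have "h' = a'" using B.idn_left[OF h(4)] h(5,6) by simp
  ultimately show "f = g" using eq by (simp add: f g)
 qed
qed

text \<open>Both maps are projections of sections of the slices \<open>B / G x\<close>: the first
  functor is lifted along \<open>ta\<close>, the second along identities. Slices are contractible
  because they have a terminal object.\<close>

theorem nat_trans_homotopic:
 assumes cats: "category A" "category B" and F: "functr A B Fo Fa" and G: "functr A B Go Ga"
  and ta: "nat_trans A B Fo Fa Go Ga ta"
 shows "Hot (BB A) (BB B) (Bmap B Fo Fa) (Bmap B Go Ga)"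
proof (rule section_homotopic[OF cats cats(2) functr_id G])
 let ?E = "%sg. comma B B (%x. x) (%f. f) (Go (fst sg (0::nat)))"
 show "contract (BB (comma B B (%x. x) (%f. f) (Go x)))" if "x : obs A" for x
  using slice_contractible[OF cats(2)] functrD(1)[OF G that] .
 note L = section_lift[OF cats functr_id F G ta]
 note M = section_lift[OF cats functr_id G G nat_trans_id[OF cats(2) G]]
 show "comma_sec A B B (%x. x) (%f. f) Go Ga (%p sg. pt (nerve (?E sg)) p (comma_lift Fo Fa B (%f. f) ta p sg))"
  using L(1) .
 show "comma_sec A B B (%x. x) (%f. f) Go Ga
   (%p sg. pt (nerve (?E sg)) p (comma_lift Go Ga B (%f. f) (%x. idn B (Go x)) p sg))"
  using M(1) .
 fix p sg t assume st: "sg : nerve_simps A p" "t : Splx p"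
 show "Bmap B Fo Fa (pt (nerve A) p sg t) =
   Bmap B fst comma_ar (pt (nerve (?E sg)) p (comma_lift Fo Fa B (%f. f) ta p sg) t) &
   Bmap B Go Ga (pt (nerve A) p sg t) =
   Bmap B fst comma_ar (pt (nerve (?E sg)) p (comma_lift Go Ga B (%f. f) (%x. idn B (Go x)) p sg) t)"
  using L(2)[OF st] M(2)[OF st] Bmap_pt[OF F st] Bmap_pt[OF G st] by simp
qed

text \<open>The homotopy inverse \<open>Gm\<close> is the projection of a section of the comma
  categories \<open>F / e\<close>. The composite of \<open>Gm\<close> with \<open>F\<close> on
  \<open>E\<close> is compared with the identity inside the slices \<open>E / e\<close>, the one on
  \<open>Q\<close> inside \<open>F / F x\<close>.\<close>

theorem theorem_A:
 assumes cats: "category Q" "category E" and F: "functr Q E Fo Fa"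
  and contr: "!!e. e : obs E ==> contract (BB (comma Q E Fo Fa e))"
 shows "hequiv (BB Q) (BB E) (Bmap E Fo Fa)"
proof -
 interpret Q: category Q by (rule cats)
 interpret E: category E by (rule cats)
 interpret NE: simplicial_set "nerve E" by (rule sset_nerve)
 let ?C = "%e. comma Q E Fo Fa e" and ?S = "%e. comma E E (%x. x) (%f. f) e"
 obtain g where g: "comma_sec E Q E Fo Fa (%x. x) (%f. f) g"
  using section_exists[OF cats(2,2,1) F functr_id contr] by blast
 note gs = comma_secD[OF g]
 obtain Gm where Gm: "cmap (BB E) (BB Q) Gm"
  "!!p sg t. [|sg : simps (nerve E) p; t : Splx p|] ==>
   Gm (pt (nerve E) p sg t) = Bmap Q fst comma_ar (g p sg t)"
 proof (rule NE.real_lift[where ph = "%p sg t. Bmap Q fst comma_ar (g p sg t)" and Z = "BB Q"])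
  show "cmap (Simplex p) (BB Q) (%t. Bmap Q fst comma_ar (g p sg t))" if "sg : simps (nerve E) p" for p sg
   using continuous_map_compose[OF gs(1) cmap_Bmap[OF functr_comma]] that by (simp add: o_def)
  fix q p a sg t assume a: "a : Delta q p" and s: "sg : simps (nerve E) p" and t: "t : Splx q"
  have s': "sg : nerve_simps E p" using s by simp
  note k = vertex_action[OF functr_id s' a]
  show "Bmap Q fst comma_ar (g q (sact (nerve E) q p a sg) t) = Bmap Q fst comma_ar (g p sg (spush q a t))"
   using gs(3)[OF s' a t] gs(2)[OF sact_nerve_in[OF a s'] t] k(4) Bmap_proj_post[OF cats(2) F k(1-3)] by simp
 qed (use that in blast)+
 note cF = cmap_Bmap[OF F]
 have "Hot (BB E) (BB E) (Bmap E Fo Fa o Gm) id"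
 proof (rule section_homotopic[OF cats(2,2,2) functr_id functr_id slice_contractible[OF cats(2)]])
  \<comment> \<open>Applying the functor to the first component maps \<open>F / e\<close> to the
    slice \<open>E / e\<close> and turns the section \<open>g\<close> into a section of
    slices.\<close>
  let ?po = "%x. (Fo (fst x), snd x)" and ?pa = "%x. ((Fo (fst (fst x)), snd (fst x)), (Fo (fst (fst (snd x))), snd (fst (snd x))), Fa (snd (snd x)))"
  have T: "functr (?C e) (?S e) ?po ?pa" for e
   using functrD[OF F] by (intro functrI) auto
  let ?g0 = "%p sg t. Bmap (?S (fst sg 0)) ?po ?pa (g p sg t)"
  show "comma_sec E E E (%x. x) (%f. f) (%x. x) (%f. f) ?g0"
   unfolding comma_sec_def
  proof (intro conjI allI impI ballI; (elim conjE)?)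
   fix p sg assume s: "sg : nerve_simps E p"
   show "cmap (Simplex p) (BB (?S (fst sg 0))) (?g0 p sg)"
    using continuous_map_compose[OF gs(1)[OF s] cmap_Bmap[OF T]] by (simp add: o_def)
  next
   fix p q sg a t assume s: "sg : nerve_simps E p" and a: "a : Delta q p" and t: "t : Splx q"
   note k = vertex_action[OF functr_id s a]
   let ?k = "snd sg 0 (a 0)" and ?x = "g q (sact (nerve E) q p a sg) t"
   have x: "?x : topspace (BB (?C (fst sg (a 0))))" using gs(2)[OF sact_nerve_in[OF a s] t] k(4) by simp
   note P = functr_post[OF cats(2) F k(1-3)] and P' = functr_post[OF cats(2) functr_id k(1-3)]
   have "?g0 p sg (spush q a t) =
     Bmap (?S (fst sg 0)) (%x. ?po (post_ob E ?k x)) (%x. ?pa (post_ar E ?k x)) ?x"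
    unfolding gs(3)[OF s a t] by (rule Bmap_comp[OF P T x])
   also have "... = Bmap (?S (fst sg 0)) (%x. post_ob E ?k (?po x)) (%x. post_ar E ?k (?pa x)) ?x"
    by (rule Bmap_cong[OF functr_comp[OF P T] functr_comp[OF T P'] _ _ x])
     (auto simp: post_ob_def post_ar_def)
   also have "... = Bmap (?S (fst sg 0)) (post_ob E ?k) (post_ar E ?k) (?g0 q (sact (nerve E) q p a sg) t)"
    using Bmap_comp[OF T P' x] k(4) by simp
   finally show "?g0 p sg (spush q a t) =
     Bmap (?S (fst sg 0)) (post_ob E ?k) (post_ar E ?k) (?g0 q (sact (nerve E) q p a sg) t)" .
  qed
  note L = section_lift[OF cats(2,2) functr_id functr_id functr_id nat_trans_id[OF cats(2) functr_id]]
  show "comma_sec E E E (%x. x) (%f. f) (%x. x) (%f. f)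
    (%p sg. pt (nerve (?S (fst sg 0))) p (comma_lift (%x. x) (%f. f) E (%f. f) (idn E) p sg))"
   using L(1) .
  fix p sg t assume st: "sg : nerve_simps E p" "t : Splx p"
  have x: "g p sg t : topspace (BB (?C (fst sg 0)))" using gs(2)[OF st] .
  have "Bmap E fst comma_ar (?g0 p sg t) = Bmap E (%x. fst (?po x)) (%x. comma_ar (?pa x)) (g p sg t)"
   by (rule Bmap_comp[OF T functr_comma x])
  also have "... = Bmap E Fo Fa (Bmap Q fst comma_ar (g p sg t))"
   using Bmap_comp[OF functr_comma F x] by simp
  finally have 1: "(Bmap E Fo Fa o Gm) (pt (nerve E) p sg t) = Bmap E fst comma_ar (?g0 p sg t)"
   using Gm(2) st by simp
  have 2: "id (pt (nerve E) p sg t) = Bmap E fst comma_ar (pt (nerve (?S (fst sg 0))) p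
    (comma_lift (%x. x) (%f. f) E (%f. f) (idn E) p sg) t)"
   using L(2)[OF st] simpsD(7)[OF st(1)] by (simp add: nmap_chain)
  show "(Bmap E Fo Fa o Gm) (pt (nerve E) p sg t) = Bmap E fst comma_ar (?g0 p sg t) &
    id (pt (nerve E) p sg t) = Bmap E fst comma_ar (pt (nerve (?S (fst sg 0))) p
    (comma_lift (%x. x) (%f. f) E (%f. f) (idn E) p sg) t)"
   using 1 2 ..
 qed
 moreover have "Hot (BB Q) (BB Q) (Gm o Bmap E Fo Fa) id"
 proof (rule section_homotopic[OF cats cats(1) F F])
  show "contract (BB (?C (Fo x)))" if "x : obs Q" for x using contr functrD(1)[OF F that] .
  let ?g0 = "%p sg. g p (nerve_map Fo Fa p sg)"
  have v: "fst (nerve_map Fo Fa p sg) 0 = Fo (fst sg 0)" "i <= p ==> snd (nerve_map Fo Fa p sg) 0 i = Fa (snd sg 0 i)" for p sg i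
   by (simp_all add: nmap_chain chain_apply)
  show "comma_sec Q Q E Fo Fa Fo Fa ?g0"
   unfolding comma_sec_def
  proof (intro conjI allI impI ballI; (elim conjE)?)
   fix p sg assume s: "sg : nerve_simps Q p"
   show "cmap (Simplex p) (BB (?C (Fo (fst sg 0)))) (?g0 p sg)"
    using gs(1)[OF nerve_map_in[OF F s]] v by simp
  next
   fix p q sg a t assume s: "sg : nerve_simps Q p" and a: "a : Delta q p" and t: "t : Splx q"
   show "?g0 p sg (spush q a t) =
     Bmap (?C (Fo (fst sg 0))) (post_ob E (Fa (snd sg 0 (a 0)))) (post_ar E (Fa (snd sg 0 (a 0))))
      (?g0 q (sact (nerve Q) q p a sg) t)"
    using gs(3)[OF nerve_map_in[OF F s] a t] v DeltaD(1)[OF a, of 0] nerve_map_sact[OF a, of Fo Fa Q sg E] by simp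
  qed
  note L = section_lift[OF cats F functr_id F nat_trans_id[OF cats(2) F]]
  show "comma_sec Q Q E Fo Fa Fo Fa
    (%p sg. pt (nerve (?C (Fo (fst sg 0)))) p (comma_lift (%x. x) (%f. f) E Fa (%x. idn E (Fo x)) p sg))"
   using L(1) .
  fix p sg t assume st: "sg : nerve_simps Q p" "t : Splx p"
  have "(Gm o Bmap E Fo Fa) (pt (nerve Q) p sg t) = Bmap Q fst comma_ar (?g0 p sg t)"
   using Gm(2) nerve_map_in[OF F st(1)] st(2) Bmap_pt[OF F st] by simp
  moreover have "id (pt (nerve Q) p sg t) = Bmap Q fst comma_ar (pt (nerve (?C (Fo (fst sg 0)))) p
    (comma_lift (%x. x) (%f. f) E Fa (%x. idn E (Fo x)) p sg) t)"
   using L(2)[OF st] simpsD(7)[OF st(1)] by (simp add: nmap_chain)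
  ultimately show "(Gm o Bmap E Fo Fa) (pt (nerve Q) p sg t) = Bmap Q fst comma_ar (?g0 p sg t) &
    id (pt (nerve Q) p sg t) = Bmap Q fst comma_ar (pt (nerve (?C (Fo (fst sg 0)))) p
    (comma_lift (%x. x) (%f. f) E Fa (%x. idn E (Fo x)) p sg) t)" ..
 qed
 ultimately show ?thesis
  unfolding homotopy_equivalence_map_def using cF Gm(1) by blast
qed

section \<open>Homotopy equivalences of classifying spaces\<close>

lemma hequiv_homotopic:
 assumes f: "hequiv X Y f" and h: "Hot X Y f f'"
 shows "hequiv X Y f'"
proof -
 obtain g where g: "cmap Y X g" "Hot X X (g o f) id"
  "Hot Y Y (f o g) id"
  using f unfolding homotopy_equivalence_map_def by blast
 have h': "Hot X Y f' f" using h by (simp add: homotopic_with_symD)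
 have "Hot X X (g o f') (g o f)"
  using homotopic_with_compose_continuous_map_left[OF h' g(1)] by simp
 moreover have "Hot Y Y (f' o g) (f o g)"
  using homotopic_with_compose_continuous_map_right[OF h' g(1)] by simp
 ultimately show ?thesis
  unfolding homotopy_equivalence_map_def
  using homotopic_with_imp_continuous_maps[OF h] g(1) homotopic_with_trans[OF _ g(2)] homotopic_with_trans[OF _ g(3)]
  by (intro conjI exI[of _ g]) simp_all
qed

lemma hequiv_eq:
 assumes f: "hequiv X Y f" and eq: "!!x. x : topspace X ==> f x = f' x"
 shows "hequiv X Y f'"
 using f homotopic_with_equal[of "%_. True" f f' X Y] eq
 by (intro hequiv_homotopic[OF f]) (simp add: homotopy_equivalence_map_def)

lemma hequiv_compose:
 assumes f: "hequiv X Y f" and g: "hequiv Y Z g"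
 shows "hequiv X Z (g o f)"
proof -
 obtain f' where f': "cmap X Y f" "cmap Y X f'" "Hot X X (f' o f) id"
  "Hot Y Y (f o f') id"
  using f unfolding homotopy_equivalence_map_def by blast
 obtain g' where g': "cmap Y Z g" "cmap Z Y g'" "Hot Y Y (g' o g) id"
  "Hot Z Z (g o g') id"
  using g unfolding homotopy_equivalence_map_def by blast
 have "Hot X Y ((g' o g) o f) (id o f)"
  by (rule homotopic_with_compose_continuous_map_right[OF g'(3) f'(1)]) simp
 then have "Hot X X (f' o ((g' o g) o f)) (f' o (id o f))"
  by (rule homotopic_with_compose_continuous_map_left[OF _ f'(2)]) simp
 then have "Hot X X (f' o ((g' o g) o f)) id"
  using f'(3) by (simp add: homotopic_with_trans)
 moreover have "Hot Z Y ((f o f') o g') (id o g')"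
  by (rule homotopic_with_compose_continuous_map_right[OF f'(4) g'(2)]) simp
 then have "Hot Z Z (g o ((f o f') o g')) (g o (id o g'))"
  by (rule homotopic_with_compose_continuous_map_left[OF _ g'(1)]) simp
 then have "Hot Z Z (g o ((f o f') o g')) id"
  using g'(4) by (simp add: homotopic_with_trans)
 ultimately show ?thesis
  unfolding homotopy_equivalence_map_def
  using continuous_map_compose[OF f'(1) g'(1)] continuous_map_compose[OF g'(2) f'(2)]
  by (auto simp: o_assoc intro!: exI[of _ "f' o g'"])
qed

lemma hequiv_inverse:
 assumes "hequiv X Y f"
 obtains g where "hequiv Y X g" "Hot X X (g o f) id"
  "Hot Y Y (f o g) id"
 using assms unfolding homotopy_equivalence_map_def by blast

lemma hequiv_cancel_left:
 assumes f: "cmap X Y f" and g: "hequiv Y Z g"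
  and gf: "hequiv X Z (g o f)"
 shows "hequiv X Y f"
proof -
 obtain g' where g': "hequiv Z Y g'" "Hot Y Y (g' o g) id"
  using hequiv_inverse[OF g] by metis
 have "Hot X Y ((g' o g) o f) (id o f)"
  by (rule homotopic_with_compose_continuous_map_right[OF g'(2) f]) simp
 then show ?thesis
  using hequiv_homotopic[OF hequiv_compose[OF gf g'(1)]]
  by (simp add: o_assoc)
qed

lemma contract_equiv:
 assumes f: "hequiv X Y f" and Y: "contract Y"
 shows "contract X"
proof -
 obtain g where g: "cmap X Y f" "cmap Y X g" "Hot X X (g o f) id"
  "Hot Y Y (f o g) id"
  using f unfolding homotopy_equivalence_map_def by blast
 have "X homotopy_equivalent_space Y"
  unfolding homotopy_equivalent_space_def using g by blast
 moreover have "topspace X ~= {}"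
  using Y continuous_map_image_subset_topspace[OF g(2)] unfolding contract_def by auto
 ultimately show ?thesis
  using Y homotopy_equivalent_space_contractibility unfolding contract_def by blast
qed

lemma Bmap_equiv_comp:
 assumes F: "functr A B Fo Fa" and G: "functr B C Go Ga"
  and "hequiv (BB A) (BB B) (Bmap B Fo Fa)"
  and "hequiv (BB B) (BB C) (Bmap C Go Ga)"
 shows "hequiv (BB A) (BB C) (Bmap C (%x. Go (Fo x)) (%f. Ga (Fa f)))"
 by (rule hequiv_eq[OF hequiv_compose[OF assms(3,4)]])
  (simp add: Bmap_comp[OF F G])

lemma Bmap_equiv_cancel:
 assumes F: "functr A B Fo Fa" and G: "functr B C Go Ga"
  and GF: "hequiv (BB A) (BB C) (Bmap C (%x. Go (Fo x)) (%f. Ga (Fa f)))"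
  and "hequiv (BB B) (BB C) (Bmap C Go Ga)"
 shows "hequiv (BB A) (BB B) (Bmap B Fo Fa)"
 by (rule hequiv_cancel_left[OF cmap_Bmap[OF F] assms(4)
    hequiv_eq[OF GF]]) (simp add: Bmap_comp[OF F G])

lemma functr_const:
 assumes "category B" "c : obs B"
 shows "functr A B (%_. c) (%_. idn B c)"
 using category.idn[OF assms] category.idn_left[OF assms(1), of "idn B c"] assms(2) by (intro functrI) auto

lemma contract_if_const:
 assumes A: "category A" and c: "c : obs A"
  and h: "Hot (BB A) (BB A) (Bmap A (%x. x) (%f. f)) (Bmap A (%_. c) (%_. idn A c))"
 shows "contract (BB A)"
proof -
 interpret A: category A by (rule A)
 interpret N: simplicial_set "nerve A" by (rule sset_nerve)
 let ?v = "%p. chain p (%_. c) (%_ _. idn A c)" let ?e = "%j::nat. if j = 0 then 1 else 0::real"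
 have v: "?v p : nerve_simps A p" for p
  using c A.idn[OF c] A.idn_left[of "idn A c"] by (intro simpsI) auto
 \<comment> \<open>\<open>?v p\<close> is the degeneracy of \<open>?v 0\<close> along
   \<open>[p] -> [0]\<close>, so all its points are glued to a single one.\<close>
 have const: "pt (nerve A) p (?v p) t = pt (nerve A) 0 (?v 0) ?e" if t: "t : Splx p" for p t
 proof -
  let ?a = "\<lambda>i\<in>{..p}. 0::nat"
  have a: "?a : Delta p 0" by (intro DeltaI) auto
  have "sact (nerve A) p 0 ?a (?v 0) = ?v p"
   unfolding sact_nerve by (intro chain_eqI) (auto simp: chain_apply)
  moreover have "spush p ?a t = ?e"
   using spush_in[OF a t] by (simp add: standard_simplex_0)
  ultimately show ?thesis using N.pt_push[OF a _ t, of "?v 0"] v by simp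
 qed
 have "Hot (BB A) (BB A) id (%_. pt (nerve A) 0 (?v 0) ?e)"
 proof (rule homotopic_with_eq[OF h])
  show "id x = Bmap A (%x. x) (%f. f) x" if "x : topspace (BB A)" for x using Bmap_id[OF that] by simp
  show "pt (nerve A) 0 (?v 0) ?e = Bmap A (%_. c) (%_. idn A c) x" if "x : topspace (BB A)" for x
   using that
  proof (rule BB_cases)
   fix p sg t assume s: "sg : nerve_simps A p" "t : Splx p" "x = pt (nerve A) p sg t"
   then show ?thesis
    using Bmap_pt[OF functr_const[OF A c] s(1,2)] const[OF s(2)] by (simp add: nmap_chain)
  qed
 qed simp
 moreover have "pt (nerve A) 0 (?v 0) ?e : topspace (BB A)"
  using v by (intro pt_in) auto
 ultimately show ?thesis
  unfolding contract_def contractible_space_def by blast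
qed

text \<open>The identity and the constant functor both map to \<open>T\<close>, and the two
  resulting homotopies compose to a contraction.\<close>

lemma contract_zigzag:
 assumes A: "category A" and c: "c : obs A" and T: "functr A A To Ta"
  and ta: "nat_trans A A (%x. x) (%f. f) To Ta ta"
  and nv: "nat_trans A A (%_. c) (%_. idn A c) To Ta nv"
 shows "contract (BB A)"
proof (rule contract_if_const[OF A c])
 have "Hot (BB A) (BB A) (Bmap A (%x. x) (%f. f)) (Bmap A To Ta)"
  by (rule nat_trans_homotopic[OF A A functr_id T ta])
 moreover have "Hot (BB A) (BB A) (Bmap A (%_. c) (%_. idn A c)) (Bmap A To Ta)"
  by (rule nat_trans_homotopic[OF A A functr_const[OF A c] T nv])
 ultimately show "Hot (BB A) (BB A) (Bmap A (%x. x) (%f. f)) (Bmap A (%_. c) (%_. idn A c))"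
  using homotopic_with_symD homotopic_with_trans by blast
qed

section \<open>Opposite categories have homeomorphic classifying spaces\<close>

definition op_cat :: "('x, 'f) cat => ('x, 'f) cat" where
 "op_cat E = (|obs = obs E, ars = ars E, dm = cd E, cd = dm E, idn = idn E, cmp = (%g f. cmp E f g)|)"

lemma op_cat_simps [simp]:
 "obs (op_cat E) = obs E" "ars (op_cat E) = ars E" "dm (op_cat E) = cd E" "cd (op_cat E) = dm E"
 "idn (op_cat E) = idn E" "cmp (op_cat E) g f = cmp E f g" "op_cat (op_cat E) = E"
 by (simp_all add: op_cat_def)

lemma category_op:
 assumes "category E"
 shows "category (op_cat E)"
proof -
 interpret category E by (rule assms)
 show ?thesis
  by unfold_locales (simp_all add: dm cd idn cmp idn_left idn_right cmp_assoc)
qed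

lemma functr_op: "functr A B Fo Fa ==> functr (op_cat A) (op_cat B) Fo Fa"
 unfolding functr_def by simp

definition rev_chain :: "nat => (nat => 'x) * (nat => nat => 'f) => (nat => 'x) * (nat => nat => 'f)" where
 "rev_chain p sg = chain p (%i. fst sg (p - i)) (%i j. snd sg (p - j) (p - i))"

lemma rev_chain_in: "sg : nerve_simps (op_cat E) p ==> rev_chain p sg : nerve_simps E p"
 unfolding rev_chain_def using simpsD(1-6)[of sg "op_cat E" p] by (intro simpsI) auto

definition rev_point :: "nat => (nat => real) => nat => real" where
 "rev_point p t = (%i. if i <= p then t (p - i) else 0)"

lemma sum_rev: "(SUM i<=p. f (p - i)) = (SUM i<=(p::nat). f i :: real)"
 by (rule sum.reindex_bij_witness[of _ "%i. p - i" "%i. p - i"]) auto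

lemma rev_point_in: "t : Splx p ==> rev_point p t : Splx p"
 using sum_rev[of t p] simplexD[of t p] by (intro simplexI) (auto simp: rev_point_def)

text \<open>Reversing the vertices is not simplicial, since it conjugates operators by the reversal
  (\<open>?b\<close> below). Reversing the barycentric coordinates at the same time makes the map
  respect the gluing.\<close>

lemma op_map:
 "EX R. cmap (BB (op_cat E)) (BB E) R &
  (ALL p. ALL sg:nerve_simps (op_cat E) p. ALL t:Splx p.
    R (pt (nerve (op_cat E)) p sg t) = pt (nerve E) p (rev_chain p sg) (rev_point p t))"
proof -
 interpret N: simplicial_set "nerve E" by (rule sset_nerve)
 interpret O: simplicial_set "nerve (op_cat E)" by (rule sset_nerve)
 show ?thesis
 proof (rule O.real_lift[where Z = "BB E" and ph = "%p sg t. pt (nerve E) p (rev_chain p sg) (rev_point p t)"])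
  fix p sg assume s: "sg : simps (nerve (op_cat E)) p"
  have "cmap (Simplex p) (Simplex p) (rev_point p)"
  proof (rule cmap_Simplex)
   show "cmap (Simplex p) euclideanreal (%t. rev_point p t i)" for i
    unfolding rev_point_def using cmap_coord by (cases "i <= p") auto
  qed (use rev_point_in in auto)
  from continuous_map_compose[OF this cmap_pt[of "rev_chain p sg" "nerve E" p]]
  show "cmap (Simplex p) (BB E) (%t. pt (nerve E) p (rev_chain p sg) (rev_point p t))"
   using rev_chain_in[of sg E p] s by (simp add: o_def)
 next
  fix q p a sg t assume a: "a : Delta q p" and s: "sg : simps (nerve (op_cat E)) p" and t: "t : Splx q"
  let ?b = "\<lambda>i\<in>{..q}. p - a (q - i)"
  have b: "?b : Delta q p" using DeltaD[OF a] by (intro DeltaI) (auto simp: diff_le_mono2)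
  have 1: "sact (nerve E) q p ?b (rev_chain p sg) = rev_chain q (sact (nerve (op_cat E)) q p a sg)"
   unfolding sact_nerve rev_chain_def using DeltaD(1,2)[OF a] DeltaD(1,2)[OF b]
   by (intro chain_eqI) (auto simp: chain_apply)
  have 2: "spush q ?b (rev_point q t) = rev_point p (spush q a t)"
  proof
   fix j
   show "spush q ?b (rev_point q t) j = rev_point p (spush q a t) j"
   proof (cases "j <= p")
    case True
    have "(\<Sum>i | i <= q & ?b i = j. rev_point q t i) = (\<Sum>i | i <= q & a i = p - j. t i)"
     using DeltaD(1)[OF a] True
     by (intro sum.reindex_bij_witness[of _ "%i. q - i" "%i. q - i"]) (auto simp: rev_point_def)
    then show ?thesis using True by (simp add: simplex_push_def rev_point_def)
   next
    case False
    then show ?thesis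
     using simplexD(3)[OF spush_in[OF b rev_point_in[OF t]], of j] by (simp add: rev_point_def)
   qed
  qed
  show "pt (nerve E) q (rev_chain q (sact (nerve (op_cat E)) q p a sg)) (rev_point q t) =
    pt (nerve E) p (rev_chain p sg) (rev_point p (spush q a t))"
   using N.pt_push[OF b _ rev_point_in[OF t], of "rev_chain p sg"] rev_chain_in[of sg E p] s 1 2 by simp
 next
  fix R assume "cmap (BB (op_cat E)) (BB E) R" and
   "!!p sg t. [|sg : simps (nerve (op_cat E)) p; t : Splx p|] ==>
    R (pt (nerve (op_cat E)) p sg t) = pt (nerve E) p (rev_chain p sg) (rev_point p t)"
  then show ?thesis by (intro exI[of _ R]) simp
 qed
qed

lemma contract_op:
 assumes "contract (BB (op_cat E))"
 shows "contract (BB E)"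
proof -
 obtain R where R: "cmap (BB (op_cat E)) (BB E) R" and R2:
  "ALL p. ALL sg:nerve_simps (op_cat E) p. ALL t:Splx p.
    R (pt (nerve (op_cat E)) p sg t) = pt (nerve E) p (rev_chain p sg) (rev_point p t)"
  using op_map[of E] by (elim exE conjE) (rule that)
 obtain S where S: "cmap (BB E) (BB (op_cat E)) S" and S2:
  "ALL p. ALL sg:nerve_simps E p. ALL t:Splx p.
    S (pt (nerve E) p sg t) = pt (nerve (op_cat E)) p (rev_chain p sg) (rev_point p t)"
  using op_map[of "op_cat E"] unfolding op_cat_simps by (elim exE conjE) (rule that)
 have rr: "rev_chain p (rev_chain p sg) = sg" if "sg : nerve_simps E' p" for p sg and E' :: "('a, 'b) cat"
  unfolding rev_chain_def using that
  by (intro nerve_eqI[symmetric]) (auto simp: chain_apply)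
 have rp: "rev_point p (rev_point p t) = t" if "t : Splx p" for p t
  using simplexD(3)[OF that] by (auto simp: rev_point_def fun_eq_iff)
 have "R (S c) = c" if "c : topspace (BB E)" for c
  using that
 proof (rule BB_cases)
  fix p sg t assume s: "sg : nerve_simps E p" "t : Splx p" "c = pt (nerve E) p sg t"
  then show ?thesis
   using rev_chain_in[of sg "op_cat E" p] rev_point_in[OF s(2)] by (simp add: R2 S2 rr[OF s(1)] rp)
 qed
 moreover have "S (R c) = c" if "c : topspace (BB (op_cat E))" for c
  using that
 proof (rule BB_cases)
  fix p sg t assume s: "sg : nerve_simps (op_cat E) p" "t : Splx p" "c = pt (nerve (op_cat E)) p sg t"
  then show ?thesis
   using rev_chain_in[OF s(1)] rev_point_in[OF s(2)] by (simp add: R2 S2 rr[OF s(1)] rp)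
 qed
 ultimately have "homeomorphic_maps (BB E) (BB (op_cat E)) S R"
  using R S by (simp add: homeomorphic_maps_def)
 then have "hequiv (BB E) (BB (op_cat E)) S"
  unfolding homotopy_equivalence_map_def homeomorphic_maps_def
  by (intro conjI exI[of _ R]) (auto intro!: homotopic_with_equal continuous_map_compose)
 then show ?thesis using contract_equiv assms by blast
qed

text \<open>Pointwise universal arrows assemble to a left adjoint of \<open>K\<close>; its unit and
  counit are natural transformations and hence homotopies. The pointwise form suits reflections that
  are obtained by choice.\<close>

theorem universal_arrows_equiv:
 assumes cats: "category A" "category B" and K: "functr A B Ko Ka"
  and et: "!!b. b : obs B ==> r b : obs A & et b : ars B & dm B (et b) = b & cd B (et b) = Ko (r b)"
  and univ: "!!b a f. [|b : obs B; a : obs A; f : ars B; dm B f = b; cd B f = Ko a|] ==>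
   EX! g. g : ars A & dm A g = r b & cd A g = a & cmp B (Ka g) (et b) = f"
 shows "hequiv (BB A) (BB B) (Bmap B Ko Ka)"
proof -
 interpret A: category A by (rule cats)
 interpret B: category B by (rule cats)
 note Ks = functrD[OF K]
 define Lm where "Lm b a f = (THE g. g : ars A & dm A g = r b & cd A g = a & cmp B (Ka g) (et b) = f)" for b a f
 have Lm: "Lm b a f : ars A" "dm A (Lm b a f) = r b" "cd A (Lm b a f) = a" "cmp B (Ka (Lm b a f)) (et b) = f"
  if "b : obs B" "a : obs A" "f : ars B" "dm B f = b" "cd B f = Ko a" for b a f
  using theI'[OF univ[OF that]] unfolding Lm_def by blast+
 have uniq: "g = h" if "b : obs B" "g : ars A" "h : ars A" "dm A g = r b" "dm A h = r b" "cd A g = cd A h"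
   "cmp B (Ka g) (et b) = cmp B (Ka h) (et b)" for b g h
 proof -
  have "Ka g : ars B" "dm B (Ka g) = cd B (et b)" "cd B (Ka g) = Ko (cd A g)" using Ks et that by auto
  then have "cmp B (Ka g) (et b) : ars B" "dm B (cmp B (Ka g) (et b)) = b" "cd B (cmp B (Ka g) (et b)) = Ko (cd A g)"
   using B.cmp[of "et b" "Ka g"] et[OF that(1)] by auto
  from univ[OF that(1) A.cd[OF that(2)] this] show ?thesis using that by metis
 qed
 define La where "La f = Lm (dm B f) (r (cd B f)) (cmp B (et (cd B f)) f)" for f
 have La: "La f : ars A" "dm A (La f) = r (dm B f)" "cd A (La f) = r (cd B f)"
   "cmp B (Ka (La f)) (et (dm B f)) = cmp B (et (cd B f)) f" if "f : ars B" for f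
 proof -
  have "cmp B (et (cd B f)) f : ars B" "dm B (cmp B (et (cd B f)) f) = dm B f" "cd B (cmp B (et (cd B f)) f) = Ko (r (cd B f))"
   using B.cmp[OF that, of "et (cd B f)"] et[OF B.cd[OF that]] by auto
  from Lm[OF B.dm[OF that] _ this] et[OF B.cd[OF that]]
  show "La f : ars A" "dm A (La f) = r (dm B f)" "cd A (La f) = r (cd B f)"
   "cmp B (Ka (La f)) (et (dm B f)) = cmp B (et (cd B f)) f" unfolding La_def by auto
 qed
 have L: "functr B A r La"
 proof (rule functrI)
  show "r x : obs A" if "x : obs B" for x using et[OF that] by blast
  show "La f : ars A & dm A (La f) = r (dm B f) & cd A (La f) = r (cd B f)" if "f : ars B" for f
   using La[OF that] by blast
  show "La (idn B x) = idn A (r x)" if x: "x : obs B" for x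
  proof (rule uniq[OF x])
   show "cmp B (Ka (La (idn B x))) (et x) = cmp B (Ka (idn A (r x))) (et x)"
    using La(4)[of "idn B x"] B.idn[OF x] et[OF x] B.idn_right[of "et x"] B.idn_left[of "et x"] Ks(5) by auto
  qed (use La[of "idn B x"] B.idn[OF x] A.idn et[OF x] in auto)
  show "La (cmp B g f) = cmp A (La g) (La f)" if fg: "f : ars B" "g : ars B" "dm B g = cd B f" for f g
  proof (rule uniq[OF B.dm[OF fg(1)]])
   note c = B.cmp[OF fg] and et1 = et[OF B.dm[OF fg(1)]] and et2 = et[OF B.cd[OF fg(1)]] and et3 = et[OF B.cd[OF fg(2)]]
   have k: "Ka (cmp A (La g) (La f)) = cmp B (Ka (La g)) (Ka (La f))"
    using Ks(6)[of "La f" "La g"] La[OF fg(1)] La[OF fg(2)] fg by simp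
   have "cmp B (Ka (cmp A (La g) (La f))) (et (dm B f)) = cmp B (Ka (La g)) (cmp B (Ka (La f)) (et (dm B f)))"
    unfolding k using B.cmp_assoc[of "et (dm B f)" "Ka (La f)" "Ka (La g)"] Ks et1 La[OF fg(1)] La[OF fg(2)] fg by simp
   also have "... = cmp B (cmp B (Ka (La g)) (et (dm B g))) f"
    using La(4)[OF fg(1)] B.cmp_assoc[of f "et (cd B f)" "Ka (La g)"] Ks et2 La[OF fg(2)] fg by simp
   also have "... = cmp B (et (cd B g)) (cmp B g f)"
    using La(4)[OF fg(2)] B.cmp_assoc[OF fg(1,2), of "et (cd B g)"] et3 fg by simp
   finally show "cmp B (Ka (La (cmp B g f))) (et (dm B f)) = cmp B (Ka (cmp A (La g) (La f))) (et (dm B f))"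
    using La(4)[of "cmp B g f"] c by simp
  qed (use La[OF fg(1)] La[OF fg(2)] La[of "cmp B g f"] B.cmp[OF fg] A.cmp[of "La f" "La g"] fg in auto)
 qed
 define ep where "ep a = Lm (Ko a) a (idn B (Ko a))" for a
 have ep: "ep a : ars A" "dm A (ep a) = r (Ko a)" "cd A (ep a) = a" "cmp B (Ka (ep a)) (et (Ko a)) = idn B (Ko a)"
  if "a : obs A" for a
  using Lm[OF Ks(1)[OF that] that, of "idn B (Ko a)"] B.idn[OF Ks(1)[OF that]] unfolding ep_def by auto
 have n1: "nat_trans A A (%x. r (Ko x)) (%f. La (Ka f)) (%x. x) (%f. f) ep"
  unfolding nat_trans_def
 proof (intro conjI ballI)
  fix f assume f: "f : ars A"
  note d = A.dm[OF f] and c = A.cd[OF f]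
  note etd = et[OF Ks(1)[OF d]] and etc = et[OF Ks(1)[OF c]]
  note L = La[OF Ks(2)[OF f]]
  show "cmp A f (ep (dm A f)) = cmp A (ep (cd A f)) (La (Ka f))"
  proof (rule uniq[OF Ks(1)[OF d]])
   have "cmp B (Ka (cmp A f (ep (dm A f)))) (et (Ko (dm A f))) = cmp B (Ka f) (cmp B (Ka (ep (dm A f))) (et (Ko (dm A f))))"
    using Ks(6)[of "ep (dm A f)" f] ep[OF d] f B.cmp_assoc[of "et (Ko (dm A f))" "Ka (ep (dm A f))" "Ka f"] Ks etd by simp
   also have "... = Ka f" using ep(4)[OF d] B.idn_right[OF Ks(2)[OF f]] Ks(3)[OF f] by simp
   also have "... = cmp B (cmp B (Ka (ep (cd A f))) (et (Ko (cd A f)))) (Ka f)"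
    using ep(4)[OF c] B.idn_left[OF Ks(2)[OF f]] Ks(4)[OF f] by simp
   also have "... = cmp B (Ka (ep (cd A f))) (cmp B (Ka (La (Ka f))) (et (Ko (dm A f))))"
    using L(4) B.cmp_assoc[of "Ka f" "et (Ko (cd A f))" "Ka (ep (cd A f))"] Ks etc ep[OF c] f by simp
   also have "... = cmp B (Ka (cmp A (ep (cd A f)) (La (Ka f)))) (et (Ko (dm A f)))"
    using Ks(6)[of "La (Ka f)" "ep (cd A f)"] L ep[OF c] Ks etd f
     B.cmp_assoc[of "et (Ko (dm A f))" "Ka (La (Ka f))" "Ka (ep (cd A f))"] by simp
   finally show "cmp B (Ka (cmp A f (ep (dm A f)))) (et (Ko (dm A f))) =
     cmp B (Ka (cmp A (ep (cd A f)) (La (Ka f)))) (et (Ko (dm A f)))" .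
  qed (use A.cmp[of "ep (dm A f)" f] A.cmp[of "La (Ka f)" "ep (cd A f)"] L ep[OF c] ep[OF d] f Ks in auto)
 qed (use ep in auto)
 have n2: "nat_trans B B (%x. x) (%f. f) (%x. Ko (r x)) (%f. Ka (La f)) et"
  unfolding nat_trans_def using et La(4) by auto
 have h1: "Hot (BB A) (BB A) (Bmap A r La o Bmap B Ko Ka) id"
  by (rule homotopic_with_eq[OF nat_trans_homotopic[OF cats(1,1) functr_comp[OF K L] functr_id n1]])
   (simp_all add: Bmap_comp[OF K L] Bmap_id)
 have h2: "Hot (BB B) (BB B) id (Bmap B Ko Ka o Bmap A r La)"
  by (rule homotopic_with_eq[OF nat_trans_homotopic[OF cats(2,2) functr_id functr_comp[OF L K] n2]])
   (simp_all add: Bmap_comp[OF L K] Bmap_id)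
 show ?thesis
  unfolding homotopy_equivalence_map_def
  using cmap_Bmap[OF K] cmap_Bmap[OF L] h1 homotopic_with_symD[OF h2] by blast
qed

section \<open>Grothendieck constructions of simplicial categories\<close>

locale strict_simp =
 fixes D :: "('x, 'f) simp_cat"
 assumes level: "category (level D p)"
  and pb: "a : Delta q p ==> functr (level D p) (level D q) (pb_ob D q p a) (pb_ar D q p a)"
  and pb_ob_comp: "[|b : Delta r q; a : Delta q p; x : lobs D p|]
   ==> pb_ob D r q b (pb_ob D q p a x) = pb_ob D r p (cp r a b) x"
  and pb_ar_comp: "[|b : Delta r q; a : Delta q p; u : lars D p|]
   ==> pb_ar D r q b (pb_ar D q p a u) = pb_ar D r p (cp r a b) u"
  and pb_ob_id: "x : lobs D p ==> pb_ob D p p (Did p) x = x"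
  and pb_ar_id: "u : lars D p ==> pb_ar D p p (Did p) u = u"
  and pcmp: "pcmp D r q p b a x = lidn D r (pb_ob D r p (cp r a b) x)"
  and punit: "punit D p x = lidn D p x"

lemma Gro_simps [simp]:
 "(x, p) : obs (Gro D) <-> x : lobs D p"
 "((y, q), (x, p), u, a) : ars (Gro D) <->
   y : lobs D q & x : lobs D p & a : Delta q p &
   u : lars D q & ldm D q u = y & lcd D q u = pb_ob D q p a x"
 "dm (Gro D) (Y, X, u, a) = Y" "cd (Gro D) (Y, X, u, a) = X"
 "idn (Gro D) (x, p) = ((x, p), (x, p), punit D p x, Did p)"
 by (auto simp: grothendieck_def)

lemma cmp_grothendieck:
 "cmp (Gro D) ((y, q), (x, p), u, a) ((z, r), Y, v, b) =
  ((z, r), (x, p), lcp D r (pcmp D r q p b a x) (lcp D r (pb_ar D r q b u) v), cp r a b)"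
 by (simp add: grothendieck_def)

context strict_simp
begin

lemmas pbD = functrD[OF pb]

lemma level_cmp:
 assumes "f : lars D p" "g : lars D p" "ldm D p g = lcd D p f"
 shows "lcp D p g f : lars D p" "ldm D p (lcp D p g f) = ldm D p f"
  "lcd D p (lcp D p g f) = lcd D p g"
 using category.cmp[OF level assms] by auto

lemma cmp_strict:
 assumes "((y, q), (x, p), u, a) : ars (Gro D)" "((z, r), (y, q), v, b) : ars (Gro D)"
 shows "cmp (Gro D) ((y, q), (x, p), u, a) ((z, r), (y, q), v, b) =
   ((z, r), (x, p), lcp D r (pb_ar D r q b u) v, cp r a b)"
  "lcp D r (pb_ar D r q b u) v : lars D r"
  "ldm D r (lcp D r (pb_ar D r q b u) v) = z"
  "lcd D r (lcp D r (pb_ar D r q b u) v) = pb_ob D r p (cp r a b) x"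
proof -
 have h: "x : lobs D p" "a : Delta q p" "b : Delta r q" "u : lars D q" "v : lars D r"
  "lcd D q u = pb_ob D q p a x" "ldm D r v = z" "lcd D r v = pb_ob D r q b y" "ldm D q u = y"
  using assms by auto
 have p: "pb_ar D r q b u : lars D r" "ldm D r (pb_ar D r q b u) = lcd D r v"
  "lcd D r (pb_ar D r q b u) = pb_ob D r p (cp r a b) x"
  using pbD[OF h(3)] h pb_ob_comp[OF h(3,2,1)] by auto
 note c = level_cmp[OF h(5) p(1,2)]
 show "lcp D r (pb_ar D r q b u) v : lars D r"
  "ldm D r (lcp D r (pb_ar D r q b u) v) = z"
  "lcd D r (lcp D r (pb_ar D r q b u) v) = pb_ob D r p (cp r a b) x"
  using c h p by auto
 show "cmp (Gro D) ((y, q), (x, p), u, a) ((z, r), (y, q), v, b) =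
   ((z, r), (x, p), lcp D r (pb_ar D r q b u) v, cp r a b)"
  using category.idn_left[OF level c(1)] c p by (simp add: cmp_grothendieck pcmp)
qed

lemma category_Gro: "category (Gro D)"
proof
 fix f assume "f : ars (Gro D)"
 then obtain y q x p u a where f: "f = ((y, q), (x, p), u, a)" "y : lobs D q" "x : lobs D p"
  "a : Delta q p" "u : lars D q" "ldm D q u = y" "lcd D q u = pb_ob D q p a x"
  by (auto simp: grothendieck_def)
 show "dm (Gro D) f : obs (Gro D)" "cd (Gro D) f : obs (Gro D)"
  using f by simp_all
 have i1: "((y, q), (y, q), lidn D q y, Did q) : ars (Gro D)"
  "((x, p), (x, p), lidn D p x, Did p) : ars (Gro D)"
  using f category.idn[OF level] pb_ob_id by auto
 have fa: "((y, q), (x, p), u, a) : ars (Gro D)" using f by simp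
 show "cmp (Gro D) f (idn (Gro D) (dm (Gro D) f)) = f"
  using cmp_strict(1)[OF fa i1(1)] f pb_ar_id[OF f(5)] category.idn_right[OF level f(5)] comp_id[OF f(4)]
  by (simp add: punit)
 show "cmp (Gro D) (idn (Gro D) (cd (Gro D) f)) f = f"
  using cmp_strict(1)[OF i1(2) fa] f pbD(5)[OF f(4,3)] category.idn_left[OF level f(5)] comp_id[OF f(4)]
  by (simp add: punit)
next
 fix x assume "x : obs (Gro D)"
 then show "idn (Gro D) x : ars (Gro D) & dm (Gro D) (idn (Gro D) x) = x &
   cd (Gro D) (idn (Gro D) x) = x"
  using category.idn[OF level] pb_ob_id by (cases x) (auto simp: punit)
next
 fix f g assume fg: "f : ars (Gro D)" "g : ars (Gro D)"
  "dm (Gro D) g = cd (Gro D) f"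
 obtain z r y q v b where f: "f = ((z, r), (y, q), v, b)" by (metis prod.exhaust)
 obtain Y x p u a where g0: "g = (Y, (x, p), u, a)" by (metis prod.exhaust)
 have g: "g = ((y, q), (x, p), u, a)" using fg(3) by (simp add: f g0)
 show "cmp (Gro D) g f : ars (Gro D) &
   dm (Gro D) (cmp (Gro D) g f) = dm (Gro D) f &
   cd (Gro D) (cmp (Gro D) g f) = cd (Gro D) g"
  using cmp_strict[of y q x p u a z r v b] fg by (auto simp: f g)
next
 fix f g h assume fg: "f : ars (Gro D)" "g : ars (Gro D)" "h : ars (Gro D)"
  "dm (Gro D) g = cd (Gro D) f" "dm (Gro D) h = cd (Gro D) g"
 obtain z r y q v b where f: "f = ((z, r), (y, q), v, b)" by (metis prod.exhaust)
 obtain Y x p u a where g0: "g = (Y, (x, p), u, a)" by (metis prod.exhaust)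
 have g: "g = ((y, q), (x, p), u, a)" using fg(4) by (simp add: f g0)
 obtain Z w m k c where h0: "h = (Z, (w, m), k, c)" by (metis prod.exhaust)
 have h: "h = ((x, p), (w, m), k, c)" using fg(5) by (simp add: g h0)
 have F: "((z, r), (y, q), v, b) : ars (Gro D)" "((y, q), (x, p), u, a) : ars (Gro D)"
  "((x, p), (w, m), k, c) : ars (Gro D)" using fg f g h by auto
 note gf = cmp_strict[OF F(2,1)] and hg = cmp_strict[OF F(3,2)]
 have GF: "((z, r), (x, p), lcp D r (pb_ar D r q b u) v, cp r a b) : ars (Gro D)"
  and HG: "((y, q), (w, m), lcp D q (pb_ar D q p a k) u, cp q c a) : ars (Gro D)"
  using gf hg F by auto
 have m: "b : Delta r q" "a : Delta q p" "c : Delta p m" "k : lars D p" "u : lars D q" "v : lars D r"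
  "ldm D q u = y" "lcd D q u = pb_ob D q p a x" "ldm D p k = x"
  "lcd D r v = pb_ob D r q b y"
  using F by auto
 have "pb_ar D r q b (lcp D q (pb_ar D q p a k) u) = lcp D r (pb_ar D r p (cp r a b) k) (pb_ar D r q b u)"
  using pbD(6)[OF m(1,5), of "pb_ar D q p a k"] pbD(2,3)[OF m(2,4)] m pb_ar_comp[OF m(1,2,4)] by simp
 moreover have "lcp D r (pb_ar D r p (cp r a b) k) (lcp D r (pb_ar D r q b u) v) =
   lcp D r (lcp D r (pb_ar D r p (cp r a b) k) (pb_ar D r q b u)) v"
  using category.cmp_assoc[OF level m(6), of "pb_ar D r q b u" "pb_ar D r p (cp r a b) k"]
   pbD(2-4)[OF m(1,5)] pbD(2-4)[OF cp_Delta[OF m(1,2)] m(4)] m pb_ob_comp[OF m(1,2)] F by simp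
 ultimately show "cmp (Gro D) h (cmp (Gro D) g f) = cmp (Gro D) (cmp (Gro D) h g) f"
  unfolding f g h gf(1) hg(1) cmp_strict(1)[OF F(3) GF] cmp_strict(1)[OF HG F(1)]
  using comp_assoc[OF m(1-3)] by simp
qed

end

section \<open>Categories of elements\<close>

lemma discrete_simp_cat_simps [simp]:
 "lobs (dsc X) p = simps X p" "lars (dsc X) p = simps X p"
 "ldm (dsc X) p x = x" "lcd (dsc X) p x = x"
 "lidn (dsc X) p x = x" "lcp (dsc X) p g f = f"
 "pb_ob (dsc X) = sact X" "pb_ar (dsc X) = sact X"
 "pcmp (dsc X) r q p b a x = sact X r p (cp r a b) x" "punit (dsc X) p x = x"
 by (simp_all add: discrete_simp_cat_def discrete_cat_def strict_simp_cat_def)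

lemma strict_discrete:
 assumes "simplicial_set X"
 shows "strict_simp (dsc X)"
proof -
 interpret simplicial_set X by (rule assms)
 show ?thesis
  by unfold_locales (auto simp: functr_def sact_in sact_comp sact_id)
qed

abbreviation elts :: "'s sset => ('s * nat, ('s, 's) groth_arrow) cat" where
 "elts X == Gro (dsc X)"

lemma category_elements: "simplicial_set X ==> category (elts X)"
 using strict_simp.category_Gro[OF strict_discrete] .

lemma elements_arE:
 assumes "f : ars (elts X)"
 obtains q x p a where "f = ((sact X q p a x, q), (x, p), sact X q p a x, a)" "x : simps X p" "a : Delta q p"
  "sact X q p a x : simps X q"
proof -
 obtain y q x p u a where "f = ((y, q), (x, p), u, a)" by (metis prod.exhaust)
 then show thesis using assms that by auto
qed

lemma elements_cmp:
 "cmp (elts X) ((y, q), (x, p), u, a) ((z, r), Y, v, b) = ((z, r), (x, p), v, cp r a b)"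
 by (simp add: cmp_grothendieck)

definition elts_ob :: "(nat => 's => 'r) => 's * nat => 'r * nat" where
 "elts_ob g = (%(x, p). (g p x, p))"

definition elts_ar :: "(nat => 's => 'r) => ('s, 's) groth_arrow => ('r, 'r) groth_arrow" where
 "elts_ar g = (%((y, q), (x, p), u, a). ((g q y, q), (g p x, p), g q u, a))"

definition simplicial_map :: "'s sset => 'r sset => (nat => 's => 'r) => bool" where
 "simplicial_map X Y g <-> (ALL p. ALL x:simps X p. g p x : simps Y p) &
   (ALL q p a x. a : Delta q p & x : simps X p --> g q (sact X q p a x) = sact Y q p a (g p x))"

lemma functr_elts:
 assumes "simplicial_map X Y g"
 shows "functr (elts X) (elts Y) (elts_ob g) (elts_ar g)"
proof (rule functrI)
 fix f assume "f : ars (elts X)"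
 then show "elts_ar g f : ars (elts Y) &
   dm (elts Y) (elts_ar g f) = elts_ob g (dm (elts X) f) &
   cd (elts Y) (elts_ar g f) = elts_ob g (cd (elts X) f)"
 proof (rule elements_arE)
  fix q x p a assume f: "f = ((sact X q p a x, q), (x, p), sact X q p a x, a)" "x : simps X p" "a : Delta q p"
   "sact X q p a x : simps X q"
  have g: "g p x : simps Y p" "g q (sact X q p a x) : simps Y q" "g q (sact X q p a x) = sact Y q p a (g p x)"
   using assms f(2-4) unfolding simplicial_map_def by blast+
  then show ?thesis using f by (simp add: elts_ar_def elts_ob_def)
 qed
next
 fix f h assume fh: "f : ars (elts X)" "h : ars (elts X)" "dm (elts X) h = cd (elts X) f"
 then show "elts_ar g (cmp (elts X) h f) = cmp (elts Y) (elts_ar g h) (elts_ar g f)"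
  by (elim elements_arE) (auto simp: elts_ar_def elements_cmp)
qed (use assms in "auto simp: simplicial_map_def elts_ar_def elts_ob_def")

section \<open>The product with the standard 1-simplex and simplicial homotopies\<close>

definition cylinder :: "'s sset => ('s * (nat => nat)) sset" where
 "cylinder X = (|simps = (%q. simps X q \<times> Delta q 1),
   sact = (%r q b (x, h). (sact X r q b x, cp r h b))|)"

lemma cylinder_simps [simp]:
 "simps (cylinder X) q = simps X q \<times> Delta q 1"
 "sact (cylinder X) r q b (x, h) = (sact X r q b x, cp r h b)"
 by (simp_all add: cylinder_def)

lemma simplicial_set_cylinder:
 assumes "simplicial_set X"
 shows "simplicial_set (cylinder X)"
proof -
 interpret simplicial_set X by (rule assms)
 show ?thesis
  by unfold_locales (auto simp: sact_in sact_comp sact_id comp_assoc comp_id)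
qed

text \<open>Prolongs an operator to one more last vertex, with value \<open>v\<close> there. With
  \<open>v = Suc q\<close> it is the action on operators of the functor that adds a last
  vertex.\<close>

definition snoc :: "nat => (nat => nat) => nat => nat => nat" where
 "snoc q ph v = (\<lambda>i\<in>{..Suc q}. if i <= q then ph i else v)"

lemma snoc_Delta: "[|ph : Delta q m; v = m|] ==> snoc q ph v : Delta (Suc q) m"
 by (rule DeltaI) (auto simp: snoc_def DeltaD)

lemma snoc_Suc_Delta: "b : Delta r q ==> snoc r b (Suc q) : Delta (Suc r) (Suc q)"
 by (rule DeltaI) (auto simp: snoc_def DeltaD le_SucI)

lemma snoc_comp:
 assumes "b : Delta r q"
 shows "compose {..Suc r} (snoc q ph v) (snoc r b (Suc q)) = snoc r (cp r ph b) v"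
 using DeltaD(1)[OF assms] by (auto simp: snoc_def compose_def fun_eq_iff le_SucI)

text \<open>Operators do not record their codomain: the extensional identity on \<open>{..q}\<close>
  is also the inclusion of \<open>[q]\<close> as the first vertices of
  \<open>[Suc q]\<close>.\<close>

lemma Delta_id_Suc: "Did q : Delta q (Suc q)"
 by (rule DeltaI) (auto simp: Delta_id_def)

lemma snoc_init:
 assumes "ph : Delta q m"
 shows "cp q (snoc q ph v) (Did q) = ph"
 using DeltaD(3)[OF assms] by (auto simp: snoc_def compose_def fun_eq_iff Delta_id_def)

lemma snoc_id: "snoc q (Did q) (Suc q) = Did (Suc q)"
 by (auto simp: snoc_def Delta_id_def fun_eq_iff)

text \<open>The fibre of the projection over a simplex of dimension \<open>n\<close> is the category of simplices of
 \<open>\<Delta>\<^sup>n \<times> \<Delta>\<^sup>1\<close>; it is contracted by appending the terminal vertex.\<close>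

lemma cyl_proj_equiv:
 fixes X :: "'s sset"
 assumes X: "simplicial_set X"
 shows "hequiv (BB (elts (cylinder X))) (BB (elts X))
  (Bmap (elts X) (elts_ob (%_. fst)) (elts_ar (%_. fst)))"
proof -
 interpret simplicial_set X by (rule X)
 interpret C: simplicial_set "cylinder X" by (rule simplicial_set_cylinder[OF X])
 have catC: "category (elts (cylinder X))" and catX: "category (elts X)"
  by (rule category_elements, rule simplicial_set_cylinder, rule X)+ (rule category_elements, rule X)
 let ?po = "elts_ob (%_. fst) :: ('s * (nat => nat)) * nat => 's * nat"
 let ?pa = "elts_ar (%_. fst) :: _ => ('s, 's) groth_arrow"
 have P: "functr (elts (cylinder X)) (elts X) ?po ?pa"
  by (rule functr_elts) (auto simp: simplicial_map_def)
 show ?thesis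
 proof (rule theorem_A[OF catC catX P])
  fix e assume "e : obs (elts X)"
  then obtain s0 n where e: "e = (s0, n)" and s0: "s0 : simps X n" by (cases e) auto
  let ?K = "comma (elts (cylinder X)) (elts X) ?po ?pa (s0, n)"
  define ob where "ob q ph h = (((sact X q n ph s0, h), q), ((sact X q n ph s0, q), (s0, n), sact X q n ph s0, ph))" for q ph and h :: "nat => nat"
  define ar where "ar r b q ph h = (ob r (cp r ph b) (cp r h b), ob q ph h,
   (((sact X r n (cp r ph b) s0, cp r h b), r), ((sact X q n ph s0, h), q),
    (sact X r n (cp r ph b) s0, cp r h b), b))" for r b q ph h
  have ob_in: "ob q ph h : obs ?K" if "ph : Delta q n" "h : Delta q 1" for q ph h
   using that s0 sact_in by (auto simp: ob_def elts_ob_def)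
  have obE: "EX q ph h. x = ob q ph h & ph : Delta q n & h : Delta q 1" if "x : obs ?K" for x
  proof -
   obtain s h q f where x: "x = (((s, h), q), f)" by (metis prod.exhaust)
   have "f : ars (elts X)" "dm (elts X) f = (s, q)" "cd (elts X) f = (s0, n)" "h : Delta q 1"
    using that by (auto simp: x elts_ob_def)
   then show ?thesis by (elim elements_arE) (auto simp: x ob_def)
  qed
  have ar_in: "ar r b q ph h : ars ?K" "dm ?K (ar r b q ph h) = ob r (cp r ph b) (cp r h b)"
   "cd ?K (ar r b q ph h) = ob q ph h"
   if "b : Delta r q" "ph : Delta q n" "h : Delta q 1" for r b q ph h
   using that s0 sact_in sact_comp[OF that(1,2) s0]
   by (auto simp: ar_def ob_def elts_ob_def elts_ar_def elements_cmp)
  have arE: "EX r b q ph h. f = ar r b q ph h & b : Delta r q & ph : Delta q n & h : Delta q 1"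
   if f: "f : ars ?K" for f
  proof -
   obtain x g y g' k where ff: "f = ((x, g), (y, g'), k)" by (metis prod.exhaust)
   have "(x, g) : obs ?K" "(y, g') : obs ?K" using f by (auto simp: ff)
   then obtain r ps h' q ph h where o: "(x, g) = ob r ps h'" "(y, g') = ob q ph h" "ps : Delta r n" "ph : Delta q n"
    "h' : Delta r 1" "h : Delta q 1" using obE by metis
   have k: "k : ars (elts (cylinder X))" "dm (elts (cylinder X)) k = x" "cd (elts (cylinder X)) k = y"
    "cmp (elts X) g' (?pa k) = g" using f by (auto simp: ff)
   obtain s q' z p' b where kk: "k = ((s, q'), (z, p'), s, b)" "b : Delta q' p'" "s = sact (cylinder X) q' p' b z"
    using k(1) by (elim elements_arE) auto
   have kx: "x = (s, q')" "y = (z, p')" using k(2,3) kk by auto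
   have q: "q' = r" "p' = q" "s = (sact X r n ps s0, h')" "z = (sact X q n ph s0, h)" 
    using o(1,2) kx by (auto simp: ob_def)
   have "h' = cp r h b" using kk(3) q by simp
   moreover have "ps = cp r ph b" using k(4) o(1,2) q by (auto simp: ob_def kk elts_ar_def elements_cmp)
   ultimately have "f = ar r b q ph h" using o(1,2) kk q by (auto simp: ff ar_def ob_def)
   then show ?thesis using kk q o by blast
  qed
  have ar_cmp: "cmp ?K (ar r b q ph h) (ar l c r ps h') = ar l (cp l b c) q ph h"
   if "c : Delta l r" "b : Delta r q" "ph : Delta q n" "h : Delta q 1" "ps = cp r ph b" "h' = cp r h b"
   for r b q ph h l c ps h'
   using comp_assoc[OF that(1-3)] comp_assoc[OF that(1,2,4)]
   by (simp add: ar_def elements_cmp that(5,6))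
  have idn_ob: "idn ?K (ob q ph h) = ar q (Did q) q ph h" if "ph : Delta q n" "h : Delta q 1" for q ph h
   using that by (simp add: ob_def ar_def comp_id)
  \<comment> \<open>The vertex \<open>(n, 1)\<close> is the largest one of \<open>[n] x [1]\<close>,
    so it can be appended to every simplex of the prism.\<close>
  define To where "To x = (case x of ((_, q), (_, _, _, ph)) => ob (Suc q) (snoc q ph n) (snoc q (snd (fst (fst x))) 1))"
   for x :: "(('s * (nat => nat)) * nat) * ('s, 's) groth_arrow"
  have To: "To (ob q ph h) = ob (Suc q) (snoc q ph n) (snoc q h 1)" for q ph h
   by (simp add: To_def ob_def)
  define Ta where "Ta f = (case f of (x, y, ((_, r), (_, q), _, b)) =>
    ar (Suc r) (snoc r b (Suc q)) (Suc q) (snoc q (snd (snd (snd (snd y)))) n) (snoc q (snd (fst (fst y))) 1))"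
   for f :: "((('s * (nat => nat)) * nat) * ('s, 's) groth_arrow) * ((('s * (nat => nat)) * nat) * ('s, 's) groth_arrow)
    * ('s * (nat => nat), 's * (nat => nat)) groth_arrow"
  have Ta: "Ta (ar r b q ph h) = ar (Suc r) (snoc r b (Suc q)) (Suc q) (snoc q ph n) (snoc q h 1)" for r b q ph h
   by (simp add: Ta_def ar_def ob_def)
  have sn: "snoc q ph n : Delta (Suc q) n" "snoc q h 1 : Delta (Suc q) 1" if "ph : Delta q n" "h : Delta q 1" for q ph h
   using snoc_Delta that by auto
  have catK: "category ?K" by (rule category_comma[OF catC catX P])
  have T: "functr ?K ?K To Ta"
  proof (rule functrI)
   fix x assume xx: "x : obs ?K"
   obtain q ph h where x: "x = ob q ph h" "ph : Delta q n" "h : Delta q 1" using obE[OF xx] by blast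
   show "To x : obs ?K" unfolding x(1) To by (rule ob_in[OF sn[OF x(2,3)]])
   show "Ta (idn ?K x) = idn ?K (To x)"
    unfolding x(1) idn_ob[OF x(2,3)] Ta To idn_ob[OF sn[OF x(2,3)]] snoc_id ..
  next
   fix f assume ff: "f : ars ?K"
   obtain r b q ph h where f: "f = ar r b q ph h" "b : Delta r q" "ph : Delta q n" "h : Delta q 1" using arE[OF ff] by blast
   show "Ta f : ars ?K & dm ?K (Ta f) = To (dm ?K f) & cd ?K (Ta f) = To (cd ?K f)"
    unfolding f(1) Ta ar_in(2,3)[OF f(2-4)] To
    using ar_in[OF snoc_Suc_Delta[OF f(2)] sn[OF f(3,4)]] snoc_comp[OF f(2)] by simp
  next
   fix f g assume f: "f : ars ?K" and g: "g : ars ?K" and eq: "dm ?K g = cd ?K f"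
   obtain r b q ph h where g': "g = ar r b q ph h" "b : Delta r q" "ph : Delta q n" "h : Delta q 1" using arE[OF g] by blast
   obtain l c r' ps h' where f': "f = ar l c r' ps h'" "c : Delta l r'" "ps : Delta r' n" "h' : Delta r' 1" using arE[OF f] by blast
   have e: "r' = r" "ps = cp r ph b" "h' = cp r h b"
    using eq ar_in(2)[OF g'(2-4)] ar_in(3)[OF f'(2-4)] by (auto simp: f' g' ob_def)
   have c: "c : Delta l r" using f' e by simp
   show "Ta (cmp ?K g f) = cmp ?K (Ta g) (Ta f)"
    unfolding f'(1) g'(1) e(1) Ta ar_cmp[OF c g'(2-4) e(2,3)]
    using ar_cmp[OF snoc_Suc_Delta[OF c] snoc_Suc_Delta[OF g'(2)] sn[OF g'(3,4)]]
    by (simp add: e snoc_comp[OF g'(2)] snoc_comp[OF c])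
  qed
  define ta where "ta x = (case x of ((_, q), (_, _, _, ph)) => ar q (Did q) (Suc q) (snoc q ph n) (snoc q (snd (fst (fst x))) 1))"
   for x :: "(('s * (nat => nat)) * nat) * ('s, 's) groth_arrow"
  have ta: "ta (ob q ph h) = ar q (Did q) (Suc q) (snoc q ph n) (snoc q h 1)" for q ph h
   by (simp add: ta_def ob_def)
  have natta: "nat_trans ?K ?K (%x. x) (%f. f) To Ta ta"
   unfolding nat_trans_def
  proof (intro conjI ballI)
   fix x assume xx: "x : obs ?K"
   obtain q ph h where x: "x = ob q ph h" "ph : Delta q n" "h : Delta q 1" using obE[OF xx] by blast
   show "ta x : ars ?K" "dm ?K (ta x) = x" "cd ?K (ta x) = To x"
    unfolding x(1) ta To using ar_in[OF Delta_id_Suc sn[OF x(2,3)]] snoc_init[OF x(2)] snoc_init[OF x(3)] by auto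
  next
   fix f assume ff: "f : ars ?K"
   obtain r b q ph h where f: "f = ar r b q ph h" "b : Delta r q" "ph : Delta q n" "h : Delta q 1" using arE[OF ff] by blast
   have "cp r (snoc r b (Suc q)) (Did r) = cp r (Did q) b"
    using DeltaD[OF f(2)] by (auto simp: snoc_def compose_def fun_eq_iff Delta_id_def)
   then show "cmp ?K (Ta f) (ta (dm ?K f)) = cmp ?K (ta (cd ?K f)) f"
    unfolding f(1) ar_in(2,3)[OF f(2-4)] Ta ta
    using ar_cmp[OF Delta_id_Suc snoc_Suc_Delta[OF f(2)] sn[OF f(3,4)], of "snoc r (cp r ph b) n" "snoc r (cp r h b) 1"]
     ar_cmp[OF f(2) Delta_id_Suc sn[OF f(3,4)], of ph h] snoc_init[OF f(3)] snoc_init[OF f(4)]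
    by (simp add: snoc_comp[OF f(2)])
  qed
  define v where "v m = (\<lambda>i\<in>{..0::nat}. m)" for m :: nat
  have v: "v m : Delta 0 m" for m by (rule DeltaI) (auto simp: v_def)
  have v1: "v 1 : Delta 0 1" by (rule v)
  let ?c = "ob 0 (v n) (v 1)"
  \<comment> \<open>The vertex \<open>(n, 1)\<close> alone is included into the prolonged simplex as
    its last vertex; this is the second leg of the zigzag.\<close>
  define nv where "nv x = (case x of ((_, q), (_, _, _, ph)) => ar 0 (v (Suc q)) (Suc q) (snoc q ph n) (snoc q (snd (fst (fst x))) 1))"
   for x :: "(('s * (nat => nat)) * nat) * ('s, 's) groth_arrow"
  have nv: "nv (ob q ph h) = ar 0 (v (Suc q)) (Suc q) (snoc q ph n) (snoc q h 1)" for q ph h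
   by (simp add: nv_def ob_def)
  have sv: "cp 0 (snoc q ph m) (v (Suc q)) = v m" for q ph m
   by (auto simp: snoc_def compose_def v_def)
  have natnv: "nat_trans ?K ?K (%_. ?c) (%_. idn ?K ?c) To Ta nv"
   unfolding nat_trans_def
  proof (intro conjI ballI)
   fix x assume xx: "x : obs ?K"
   obtain q ph h where x: "x = ob q ph h" "ph : Delta q n" "h : Delta q 1" using obE[OF xx] by blast
   show "nv x : ars ?K" "dm ?K (nv x) = ?c" "cd ?K (nv x) = To x"
    unfolding x(1) nv To using ar_in[OF v sn[OF x(2,3)]] sv by auto
  next
   fix f assume ff: "f : ars ?K"
   obtain r b q ph h where f: "f = ar r b q ph h" "b : Delta r q" "ph : Delta q n" "h : Delta q 1" using arE[OF ff] by blast
   show "cmp ?K (Ta f) (nv (dm ?K f)) = cmp ?K (nv (cd ?K f)) (idn ?K ?c)"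
    unfolding f(1) ar_in(2,3)[OF f(2-4)] Ta nv idn_ob[OF v v1]
    using ar_cmp[OF v snoc_Suc_Delta[OF f(2)] sn[OF f(3,4)], of "snoc r (cp r ph b) n" "snoc r (cp r h b) 1"]
     ar_cmp[OF Delta_id_in v sn[OF f(3,4)], of "v n" "v 1"] sv comp_id(1)[OF v]
    by (simp add: snoc_comp[OF f(2)])
  qed
  have "contract (BB ?K)"
   by (rule contract_zigzag[OF catK ob_in[OF v v1] T natta natnv])
  then show "contract (BB (comma (elts (cylinder X)) (elts X) ?po ?pa e))"
   unfolding e .
 qed
qed

definition Dconst :: "nat => nat => nat => nat" where
 "Dconst q v = (\<lambda>i\<in>{..q}. v)"

lemma Dconst_in: "v <= p ==> Dconst q v : Delta q p"
 by (rule DeltaI) (auto simp: Dconst_def)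

lemma Dconst_comp: "b : Delta r q ==> cp r (Dconst q v) b = Dconst r v"
 using DeltaD(1)[of b r q] by (auto simp: Dconst_def compose_def fun_eq_iff)

text \<open>The two end inclusions of \<open>X\<close> into the cylinder are sections of the same
  homotopy equivalence, the projection. They are therefore homotopic, and \<open>H\<close> carries
  the homotopy to \<open>Y\<close>.\<close>

theorem simp_homotopy:
 assumes X: "simplicial_set X" and Y: "simplicial_set Y"
  and H: "simplicial_map (cylinder X) Y H"
 shows "Hot (BB (elts X)) (BB (elts Y))
  (Bmap (elts Y) (elts_ob (%q x. H q (x, Dconst q 0))) (elts_ar (%q x. H q (x, Dconst q 0))))
  (Bmap (elts Y) (elts_ob (%q x. H q (x, Dconst q 1))) (elts_ar (%q x. H q (x, Dconst q 1))))"
proof -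
 let ?C = "BB (elts (cylinder X))" and ?X = "BB (elts X)"
 let ?pr = "Bmap (elts X) (elts_ob (%_. fst)) (elts_ar (%_. fst))"
 let ?i = "%v. Bmap (elts (cylinder X)) (elts_ob (%q x. (x, Dconst q v))) (elts_ar (%q x. (x, Dconst q v)))"
 have P: "functr (elts (cylinder X)) (elts X) (elts_ob (%_. fst)) (elts_ar (%_. fst))"
  by (rule functr_elts) (auto simp: simplicial_map_def)
 have I: "functr (elts X) (elts (cylinder X)) (elts_ob (%q x. (x, Dconst q v)))
   (elts_ar (%q x. (x, Dconst q v)))" if "v <= 1" for v
  by (rule functr_elts)
   (use Dconst_in[OF that] in "auto simp: simplicial_map_def simplicial_set.sact_in[OF X] Dconst_comp")
 have HF: "functr (elts (cylinder X)) (elts Y) (elts_ob H) (elts_ar H)"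
  by (rule functr_elts[OF H])
 have pi: "?pr (?i v x) = x" if "v <= 1" "x : topspace ?X" for v x
 proof -
  have "?pr (?i v x) = Bmap (elts X) (%x. x) (%f. f) x"
   unfolding Bmap_comp[OF I[OF that(1)] P that(2)]
   by (rule Bmap_cong[OF functr_comp[OF I[OF that(1)] P] functr_id _ _ that(2)])
    (auto simp: elts_ob_def elts_ar_def)
  then show ?thesis using Bmap_id[OF that(2)] by simp
 qed
 obtain g where g: "cmap ?X ?C g" "Hot ?C ?C (g o ?pr) id"
  using cyl_proj_equiv[OF X] unfolding homotopy_equivalence_map_def by blast
 have ci: "cmap ?X ?C (?i v)" if "v <= 1" for v by (rule cmap_Bmap[OF I[OF that]])
 have gi: "Hot ?X ?C g (?i v)" if v: "v <= 1" for v
 proof (rule homotopic_with_eq[OF homotopic_with_compose_continuous_map_right[OF g(2) ci[OF v]]])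
  show "g x = (g o ?pr o ?i v) x" if "x : topspace ?X" for x using pi[OF v that] by simp
 qed auto
 have "Hot ?X ?C (?i 0) (?i 1)"
  using homotopic_with_trans[OF homotopic_with_symD[OF gi[of 0]] gi[of 1]] by simp
 from homotopic_with_compose_continuous_map_left[OF this cmap_Bmap[OF HF], of "%_. True"]
 show ?thesis
 proof (rule homotopic_with_eq; simp?)
  have *: "Bmap (elts Y) (elts_ob (%q x. H q (x, Dconst q v))) (elts_ar (%q x. H q (x, Dconst q v))) x =
    Bmap (elts Y) (elts_ob H) (elts_ar H) (?i v x)" if v: "v <= 1" and x: "x : topspace ?X" for v x
  proof -
   have "(%x. elts_ob H (elts_ob (%q x. (x, Dconst q v)) x)) = elts_ob (%q x. H q (x, Dconst q v))"
    "(%x. elts_ar H (elts_ar (%q x. (x, Dconst q v)) x)) = elts_ar (%q x. H q (x, Dconst q v))"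
    by (auto simp: elts_ob_def elts_ar_def fun_eq_iff)
   then show ?thesis using Bmap_comp[OF I[OF v] HF x] by simp
  qed
  show "Bmap (elts Y) (elts_ob (%q x. H q (x, Dconst q 0))) (elts_ar (%q x. H q (x, Dconst q 0))) x =
    Bmap (elts Y) (elts_ob H) (elts_ar H) (?i 0 x)" if "x : topspace ?X" for x
   by (rule *[OF _ that]) simp
  show "Bmap (elts Y) (elts_ob (%q x. H q (x, Dconst q (Suc 0)))) (elts_ar (%q x. H q (x, Dconst q (Suc 0)))) x =
    Bmap (elts Y) (elts_ob H) (elts_ar H) (Bmap (elts (cylinder X)) (elts_ob (%q x. (x, Dconst q (Suc 0)))) (elts_ar (%q x. (x, Dconst q (Suc 0)))) x)"
   if "x : topspace ?X" for x
   using *[of 1, OF _ that] by simp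
 qed
qed

lemma contract_iso:
 assumes F: "functr A B Fo Fa" and G: "functr B A Go Ga"
  and GF: "!!x. x : obs A ==> Go (Fo x) = x" "!!f. f : ars A ==> Ga (Fa f) = f"
  and FG: "!!x. x : obs B ==> Fo (Go x) = x" "!!f. f : ars B ==> Fa (Ga f) = f"
  and B: "contract (BB B)"
 shows "contract (BB A)"
proof (rule contract_equiv[OF _ B])
 have 1: "Bmap A Go Ga (Bmap B Fo Fa x) = x" if "x : topspace (BB A)" for x
  using Bmap_comp[OF F G that] Bmap_cong[OF functr_comp[OF F G] functr_id GF that] Bmap_id[OF that] by simp
 have 2: "Bmap B Fo Fa (Bmap A Go Ga x) = x" if "x : topspace (BB B)" for x
  using Bmap_comp[OF G F that] Bmap_cong[OF functr_comp[OF G F] functr_id FG that] Bmap_id[OF that] by simp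
 note c = cmap_Bmap[OF F] cmap_Bmap[OF G]
 show "hequiv (BB A) (BB B) (Bmap B Fo Fa)"
  unfolding homotopy_equivalence_map_def
 proof (intro conjI exI)
  show "Hot (BB A) (BB A) (Bmap A Go Ga o Bmap B Fo Fa) id"
   by (rule homotopic_with_equal) (use 1 continuous_map_compose[OF c] in auto)
  show "Hot (BB B) (BB B) (Bmap B Fo Fa o Bmap A Go Ga) id"
   by (rule homotopic_with_equal) (use 2 continuous_map_compose[OF c(2,1)] in auto)
 qed (use c in auto)
qed

section \<open>The inclusion of the simplicial set of objects\<close>

definition obsset :: "('x, 'f) simp_cat => 'x sset" where
 "obsset D = (|simps = (%p. lobs D p), sact = pb_ob D|)"

lemma object_sset_simps [simp]: "simps (obsset D) p = lobs D p" "sact (obsset D) = pb_ob D"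
 by (simp_all add: obsset_def)

context strict_simp
begin

lemma simplicial_set_object: "simplicial_set (obsset D)"
 by unfold_locales (auto simp: pbD pb_ob_comp pb_ob_id)

lemma incl_simps:
 assumes "x : lobs D p" "a : Delta q p" "y = pb_ob D q p a x"
 shows "Gro_ar D (objects_inclusion D) ((y, q), (x, p), y, a) = ((y, q), (x, p), lidn D q y, a)"
  "Gro_ob (objects_inclusion D) (x, p) = (x, p)"
proof -
 have "y : lobs D q" using pbD(1)[OF assms(2,1)] assms(3) by simp
 from category.idn[OF level this] have "lcp D q (lidn D q y) (lidn D q y) = lidn D q y"
  using category.idn_left[OF level[of q], of "lidn D q y"] by simp
 then show "Gro_ar D (objects_inclusion D) ((y, q), (x, p), y, a) = ((y, q), (x, p), lidn D q y, a)"
  using assms(3) by (simp add: grothendieck_map_ar_def objects_inclusion_def strict_mor_def)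
qed (simp add: grothendieck_map_ob_def objects_inclusion_def strict_mor_def)

lemma functr_incl:
 "functr (elts (obsset D)) (Gro D)
   (Gro_ob (objects_inclusion D)) (Gro_ar D (objects_inclusion D))"
 (is "functr ?E _ ?o ?a")
proof (rule functrI)
 fix x assume "x : obs ?E"
 then show "?o x : obs (Gro D)"
  by (cases x) (auto simp: grothendieck_map_ob_def objects_inclusion_def strict_mor_def)
next
 fix f assume "f : ars ?E"
 then show "?a f : ars (Gro D) & dm (Gro D) (?a f) = ?o (dm ?E f) & cd (Gro D) (?a f) = ?o (cd ?E f)"
 proof (rule elements_arE)
  fix q x p a assume f: "f = ((sact (obsset D) q p a x, q), (x, p), sact (obsset D) q p a x, a)"
   "x : simps (obsset D) p" "a : Delta q p" "sact (obsset D) q p a x : simps (obsset D) q"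
  then show ?thesis
   using incl_simps[of x p a q "pb_ob D q p a x"] category.idn[OF level]
    incl_simps(2)[of "pb_ob D q p a x" q "Did q" q] pb_ob_id by simp
 qed
next
 fix x assume "x : obs ?E"
 then show "?a (idn ?E x) = idn (Gro D) (?o x)"
  using incl_simps(1)[of "fst x" "snd x" "Did (snd x)" "snd x" "fst x"] pb_ob_id
  by (cases x) (auto simp: grothendieck_map_ob_def objects_inclusion_def strict_mor_def punit)
next
 fix f g assume f: "f : ars ?E" and g: "g : ars ?E" and fg: "dm ?E g = cd ?E f"
 show "?a (cmp ?E g f) = cmp (Gro D) (?a g) (?a f)"
  using g
 proof (rule elements_arE)
  fix q x p a assume g': "g = ((sact (obsset D) q p a x, q), (x, p), sact (obsset D) q p a x, a)"
   "x : simps (obsset D) p" "a : Delta q p" "sact (obsset D) q p a x : simps (obsset D) q"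
  show ?thesis
   using f
  proof (rule elements_arE)
   fix r y q' b assume f': "f = ((sact (obsset D) r q' b y, r), (y, q'), sact (obsset D) r q' b y, b)"
   "y : simps (obsset D) q'" "b : Delta r q'" "sact (obsset D) r q' b y : simps (obsset D) r"
   have e: "q' = q" "y = pb_ob D q p a x" using fg by (auto simp: f' g')
   have h: "x : lobs D p" "a : Delta q p" "b : Delta r q" "pb_ob D q p a x : lobs D q"
    using f' g' e by auto
   let ?y = "pb_ob D q p a x" let ?z = "pb_ob D r p (cp r a b) x"
   have z: "pb_ob D r q b ?y = ?z" by (rule pb_ob_comp[OF h(3,2,1)])
   have zo: "?z : lobs D r" using pbD(1)[OF cp_Delta[OF h(3,2)] h(1)] .
   have gg: "((?y, q), (x, p), lidn D q ?y, a) : ars (Gro D)" 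
    using h category.idn[OF level h(4)] by simp
   have ff: "((?z, r), (?y, q), lidn D r ?z, b) : ars (Gro D)"
    using h category.idn[OF level zo] z zo by simp
   have ii: "lcp D r (pb_ar D r q b (lidn D q ?y)) (lidn D r ?z) = lidn D r ?z"
    using pbD(5)[OF h(3,4)] z category.idn_left[OF level, of "lidn D r ?z" r] category.idn[OF level zo] by simp
   have "?a g = ((?y, q), (x, p), lidn D q ?y, a)"
    using incl_simps(1)[OF h(1,2) refl] by (simp add: g')
   moreover have "?a f = ((?z, r), (?y, q), lidn D r ?z, b)"
    using incl_simps(1)[OF h(4,3) refl] by (simp add: f' e z)
   moreover have "cmp ?E g f = ((?z, r), (x, p), ?z, cp r a b)"
    by (simp add: f' g' e elements_cmp z)
   moreover have "?a ((?z, r), (x, p), ?z, cp r a b) = ((?z, r), (x, p), lidn D r ?z, cp r a b)"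
    using incl_simps(1)[OF h(1) cp_Delta[OF h(3,2)] refl] .
   ultimately show ?thesis using cmp_strict(1)[OF gg ff] ii by simp
  qed
 qed
qed

text \<open>For an arrow \<open>u : y \<rightarrow> z\<close> of \<open>D\<^sub>q\<close> and \<open>h : [q] \<rightarrow> [1]\<close>, \<open>mix q h u\<close> is an arrow to \<open>z\<close> whose
 domain interpolates between \<open>y\<close> and \<open>z\<close>.  This contracts the simplicial sets of arrows of \<open>D\<close>
 with a given target, which are the fibres of the inclusion of the objects.\<close>

theorem obj_incl_equiv:
 assumes mix: "!!q h u. [|h : Delta q 1; u : lars D q|] ==>
   mix q h u : lars D q & lcd D q (mix q h u) = lcd D q u"
  and mix_pb: "!!r q b h u. [|b : Delta r q; h : Delta q 1; u : lars D q|] ==>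
   pb_ar D r q b (mix q h u) = mix r (cp r h b) (pb_ar D r q b u)"
  and mix_0: "!!q u. u : lars D q ==> mix q (Dconst q 0) u = u"
  and mix_1: "!!q u. u : lars D q ==> mix q (Dconst q 1) u = lidn D q (lcd D q u)"
 shows "hequiv (BB (elts (obsset D))) (BB (Gro D))
   (Bmap (Gro D) (Gro_ob (objects_inclusion D)) (Gro_ar D (objects_inclusion D)))"
proof (rule theorem_A[OF category_elements[OF simplicial_set_object] category_Gro functr_incl])
 let ?E = "elts (obsset D)" and ?o = "Gro_ob (objects_inclusion D)"
  and ?a = "Gro_ar D (objects_inclusion D)"
 fix e assume "e : obs (Gro D)"
 then obtain x n where e: "e = (x, n)" and x: "x : lobs D n" by (cases e) auto
 let ?K = "comma ?E (Gro D) ?o ?a e"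
 \<comment> \<open>\<open>X\<close> consists of the arrows into the pullbacks of \<open>x\<close>.
   The comma category is isomorphic to its category of elements, by the mutually inverse functors
   \<open>?Pso\<close>, \<open>?Psa\<close> and \<open>?Pho\<close>, \<open>?Pha\<close>.\<close>
 define X where "X = (|simps = (%q. {(u, a). a : Delta q n & u : lars D q & lcd D q u = pb_ob D q n a x}),
  sact = (%r q b (u, a). (pb_ar D r q b u, cp r a b))|)"
 have X_simps [simp]: "(u, a) : simps X q <-> a : Delta q n & u : lars D q & lcd D q u = pb_ob D q n a x"
  "sact X r q b (u, a) = (pb_ar D r q b u, cp r a b)" for u a q r b
  by (simp_all add: X_def)
 interpret X: simplicial_set X
  by unfold_locales (auto simp: pbD pb_ob_comp[OF _ _ x] pb_ar_comp pb_ar_id comp_assoc comp_id)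
 have catX: "category (elts X)" by (rule category_elements) (rule X.simplicial_set_axioms)
 have contr: "contract (BB (elts X))"
 proof (rule contract_if_const[OF catX])
  let ?c = "((lidn D n x, Did n), n)"
  have ix: "lidn D n x : lars D n" "ldm D n (lidn D n x) = x" "lcd D n (lidn D n x) = x"
   using category.idn[OF level x] by auto
  show c: "?c : obs (elts X)" using ix pb_ob_id[OF x] by simp
  let ?H = "%q ((u, a), h). (mix q h u, a)"
  have H: "simplicial_map (cylinder X) X ?H"
   unfolding simplicial_map_def using mix mix_pb by auto
  \<comment> \<open>Mixing deforms the identity of \<open>X\<close> into \<open>?R\<close>, which
    replaces an arrow by the identity of its target. The image of \<open>?R\<close> is a copy of the
    standard \<open>n\<close>-simplex, and \<open>?ta\<close> contracts it to its terminal element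
    \<open>?c\<close>.\<close>
  let ?R = "%q ua. (lidn D q (pb_ob D q n (snd ua) x), snd ua)"
  have R: "simplicial_map X X ?R"
   unfolding simplicial_map_def using category.idn[OF level] by (auto simp: pbD x pb_ob_comp[OF _ _ x])
  note S = simp_homotopy[OF X.simplicial_set_axioms X.simplicial_set_axioms H]
  have RF: "functr (elts X) (elts X) (elts_ob ?R) (elts_ar ?R)"
   by (rule functr_elts[OF R])
  have HF: "functr (elts X) (elts X) (elts_ob (%q x. ?H q (x, Dconst q v))) (elts_ar (%q x. ?H q (x, Dconst q v)))"
   if "v <= 1" for v
   by (rule functr_elts)
    (use mix mix_pb Dconst_in[OF that] in "auto simp: simplicial_map_def Dconst_comp")
  have h1: "Hot (BB (elts X)) (BB (elts X)) (Bmap (elts X) (%x. x) (%f. f))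
    (Bmap (elts X) (elts_ob ?R) (elts_ar ?R))"
  proof (rule homotopic_with_eq[OF S])
   fix y assume y: "y : topspace (BB (elts X))"
   show "Bmap (elts X) (%x. x) (%f. f) y =
     Bmap (elts X) (elts_ob (%q x. ?H q (x, Dconst q 0))) (elts_ar (%q x. ?H q (x, Dconst q 0))) y"
    by (rule Bmap_cong[OF functr_id HF _ _ y])
     (auto simp: elts_ob_def elts_ar_def mix_0 split: prod.splits elim!: elements_arE)
   show "Bmap (elts X) (elts_ob ?R) (elts_ar ?R) y =
     Bmap (elts X) (elts_ob (%q x. ?H q (x, Dconst q 1))) (elts_ar (%q x. ?H q (x, Dconst q 1))) y"
    by (rule Bmap_cong[OF RF HF _ _ y])
     (use mix_1 in "auto simp: elts_ob_def elts_ar_def split: prod.splits elim!: elements_arE")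
  qed simp
  let ?ta = "%((u, a), q). (((lidn D q (pb_ob D q n a x), a), q), ?c, (lidn D q (pb_ob D q n a x), a), a)"
  have "nat_trans (elts X) (elts X) (elts_ob ?R) (elts_ar ?R) (%_. ?c) (%_. idn (elts X) ?c) ?ta"
   unfolding nat_trans_def
  proof (intro conjI ballI)
   fix f assume "f : ars (elts X)"
   then show "cmp (elts X) (idn (elts X) ?c) (?ta (dm (elts X) f)) =
     cmp (elts X) (?ta (cd (elts X) f)) (elts_ar ?R f)"
    by (elim elements_arE) (auto simp: elts_ar_def elements_cmp comp_id)
  qed (use category.idn[OF level] pbD(1)[OF _ x] pbD(5)[OF _ x] ix pb_ob_id[OF x] 
    in "auto simp: elts_ob_def comp_id")
  from nat_trans_homotopic[OF catX catX RF functr_const[OF catX c] this] h1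
  show "Hot (BB (elts X)) (BB (elts X)) (Bmap (elts X) (%x. x) (%f. f))
    (Bmap (elts X) (%_. ?c) (%_. idn (elts X) ?c))"
   using homotopic_with_trans by blast
 qed
 let ?Pso = "%((y :: 'x, q :: nat), (_ :: 'x * nat, _ :: 'x * nat, u, a)). ((u, a), q) :: ('f * (nat => nat)) * nat"
 let ?Psa = "%(s, t, (_ :: 'x * nat, _ :: 'x * nat, _ :: 'x, b :: nat => nat)). (?Pso s, ?Pso t, fst (?Pso s), b)"
 let ?Pho = "%((u, a), q). ((ldm D q u, q), ((ldm D q u, q), (x, n), u, a))"
 let ?Pha = "%(((u', a'), r), ((u, a), q), _ :: 'f * (nat => nat), b). (?Pho ((u', a'), r), ?Pho ((u, a), q),
   ((ldm D r u', r), (ldm D q u, q), ldm D r u', b))"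
 have obK: "EX u a q. s = ((ldm D q u, q), ((ldm D q u, q), (x, n), u, a)) & (u, a) : simps X q"
  if "s : obs ?K" for s
  using that by (cases s) (auto simp: e grothendieck_map_ob_def objects_inclusion_def strict_mor_def)
 have arK: "EX u a q r b. f = (?Pho (sact X r q b (u, a), r), ?Pho ((u, a), q),
   ((ldm D r (pb_ar D r q b u), r), (ldm D q u, q), ldm D r (pb_ar D r q b u), b)) & (u, a) : simps X q & b : Delta r q"
  if f: "f : ars ?K" for f
 proof -
  obtain s g t g' h where ff: "f = ((s, g), (t, g'), h)" by (metis prod.exhaust)
  have "(s, g) : obs ?K" "(t, g') : obs ?K" using f by (auto simp: ff)
  then obtain u' a' r u a q where o: "(s, g) = ((ldm D r u', r), ((ldm D r u', r), (x, n), u', a'))"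
   "(t, g') = ((ldm D q u, q), ((ldm D q u, q), (x, n), u, a))" "(u', a') : simps X r" "(u, a) : simps X q"
   using obK by metis
  have h: "h : ars ?E" "dm ?E h = s" "cd ?E h = t" "cmp (Gro D) g' (?a h) = g" using f by (auto simp: ff)
  from h(1) show ?thesis
  proof (rule elements_arE)
   fix r' y q' b assume hh: "h = ((sact (obsset D) r' q' b y, r'), (y, q'), sact (obsset D) r' q' b y, b)"
    "y : simps (obsset D) q'" "b : Delta r' q'" "sact (obsset D) r' q' b y : simps (obsset D) r'"
   have eqs: "r' = r" "q' = q" "y = ldm D q u" "ldm D r u' = pb_ob D r q b y"
    using h(2,3) o by (auto simp: hh)
   have b: "b : Delta r q" and y: "y : lobs D q" using hh eqs by auto
   let ?z = "pb_ob D r q b y"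
   have zo: "?z : lobs D r" using hh eqs by simp
   have ah: "?a h = ((?z, r), (y, q), lidn D r ?z, b)"
    using incl_simps(1)[OF y b refl] by (simp add: hh eqs)
   have u: "u : lars D q" using o by auto
   have "lcp D r (pb_ar D r q b u) (lidn D r ?z) = pb_ar D r q b u"
    using category.idn_right[OF level pbD(2)[OF b u]] pbD(3)[OF b u] eqs by simp
   moreover have "((y, q), (x, n), u, a) : ars (Gro D)" using o eqs x y by auto
   moreover have "((?z, r), (y, q), lidn D r ?z, b) : ars (Gro D)"
    using zo y b category.idn[OF level zo] by simp
   ultimately have "g = ((?z, r), (x, n), pb_ar D r q b u, cp r a b)"
    using h(4) o(2) ah cmp_strict(1)[of y q x n u a ?z r "lidn D r ?z" b] eqs by simp
   then show ?thesis
    using o eqs b pbD(3)[OF b u] by (intro exI[of _ u] exI[of _ a] exI[of _ q] exI[of _ r] exI[of _ b]) (auto simp: ff hh)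
  qed
 qed
 have Ps: "functr ?K (elts X) ?Pso ?Psa"
 proof (rule functrI)
  fix s assume "s : obs ?K"
  from obK[OF this] show "?Pso s : obs (elts X)" "?Psa (idn ?K s) = idn (elts X) (?Pso s)" by auto
 next
  fix f assume "f : ars ?K"
  from arK[OF this] show "?Psa f : ars (elts X) & dm (elts X) (?Psa f) = ?Pso (dm ?K f) & cd (elts X) (?Psa f) = ?Pso (cd ?K f)"
   using X.sact_in by auto
 next
  fix f g assume f: "f : ars ?K" and g: "g : ars ?K" and fg: "dm ?K g = cd ?K f"
  from arK[OF f] arK[OF g] show "?Psa (cmp ?K g f) = cmp (elts X) (?Psa g) (?Psa f)"
   by (auto simp: elements_cmp)
 qed
 have Ph: "functr (elts X) ?K ?Pho ?Pha"
 proof (rule functrI)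
  fix s assume "s : obs (elts X)"
  then show "?Pho s : obs ?K" "?Pha (idn (elts X) s) = idn ?K (?Pho s)"
   using x category.dm[OF level] by (cases s; auto simp: e grothendieck_map_ob_def objects_inclusion_def strict_mor_def)+
 next
  fix f assume "f : ars (elts X)"
  then show "?Pha f : ars ?K & dm ?K (?Pha f) = ?Pho (dm (elts X) f) & cd ?K (?Pha f) = ?Pho (cd (elts X) f)"
  proof (rule elements_arE)
   fix r ua q b assume f: "f = ((sact X r q b ua, r), (ua, q), sact X r q b ua, b)" "ua : simps X q" "b : Delta r q"
    "sact X r q b ua : simps X r"
   obtain u a where ua: "ua = (u, a)" by (cases ua)
   have u: "u : lars D q" "a : Delta q n" "lcd D q u = pb_ob D q n a x" using f by (auto simp: ua)
   let ?y = "ldm D q u" let ?z = "pb_ob D r q b ?y"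
   have y: "?y : lobs D q" using category.dm[OF level u(1)] .
   have z: "?z : lobs D r" "ldm D r (pb_ar D r q b u) = ?z" using pbD[OF f(3)] y u by auto
   have ah: "?a ((?z, r), (?y, q), ?z, b) = ((?z, r), (?y, q), lidn D r ?z, b)"
    using incl_simps(1)[OF y f(3) refl] .
   have "lcp D r (pb_ar D r q b u) (lidn D r ?z) = pb_ar D r q b u"
    using category.idn_right[OF level pbD(2)[OF f(3) u(1)]] z by simp
   moreover have "((?y, q), (x, n), u, a) : ars (Gro D)" using u x y by simp
   moreover have "((?z, r), (?y, q), lidn D r ?z, b) : ars (Gro D)"
    using z y f(3) category.idn[OF level z(1)] by simp
   ultimately have "cmp (Gro D) ((?y, q), (x, n), u, a) (?a ((?z, r), (?y, q), ?z, b)) =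
     ((?z, r), (x, n), pb_ar D r q b u, cp r a b)"
    using cmp_strict(1)[of ?y q x n u a ?z r "lidn D r ?z" b] ah by simp
   then show ?thesis
    using f u x y z pbD[OF f(3)] pb_ob_comp[OF f(3) u(2) x]
    by (simp add: ua e grothendieck_map_ob_def objects_inclusion_def strict_mor_def)
  qed
 next
  fix f g assume f: "f : ars (elts X)" and g: "g : ars (elts X)" and fg: "dm (elts X) g = cd (elts X) f"
  then show "?Pha (cmp (elts X) g f) = cmp ?K (?Pha g) (?Pha f)"
   by (elim elements_arE) (auto simp: elements_cmp split: prod.splits)
 qed
 show "contract (BB ?K)"
 proof (rule contract_iso[OF Ps Ph _ _ _ _ contr])
  fix s assume "s : obs ?K"
  from obK[OF this] show "?Pho (?Pso s) = s" by auto
 next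
  fix f assume "f : ars ?K"
  from arK[OF this] show "?Pha (?Psa f) = f" by auto
 next
  fix s assume "s : obs (elts X)"
  then show "?Pso (?Pho s) = s" by (cases s) auto
 next
  fix f assume "f : ars (elts X)"
  then show "?Psa (?Pha f) = f" by (elim elements_arE) (auto split: prod.splits)
 qed
qed

end

section \<open>Coreflective simplicial subcategories\<close>

lemma contract_initial:
 assumes E: "category E" and z: "z : obs E"
  and bang: "!!x. x : obs E ==> EX! f. f : ars E & dm E f = z & cd E f = x"
 shows "contract (BB E)"
proof (rule contract_op, rule contract_terminal[of _ z "%x. THE f. f : ars E & dm E f = z & cd E f = x"])
 show "category (op_cat E)" by (rule category_op[OF E])
 show "x : obs (op_cat E) ==> (THE f. f : ars E & dm E f = z & cd E f = x) : ars (op_cat E) &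
   dm (op_cat E) (THE f. f : ars E & dm E f = z & cd E f = x) = x &
   cd (op_cat E) (THE f. f : ars E & dm E f = z & cd E f = x) = z" for x
  using theI'[OF bang[of x]] by simp
 show "f = g" if "f : ars (op_cat E)" "g : ars (op_cat E)" "dm (op_cat E) f = dm (op_cat E) g" "cd (op_cat E) f = z"
  "cd (op_cat E) g = z" for f g
  using that bang[OF category.cd[OF E], of f] by auto
qed (use z in simp)

text \<open>\<open>F / b\<close> lies over the slice \<open>S / P b\<close>, which is contractible.
  By \<open>lift\<close> this projection has precartesian lifts, and by \<open>terminal\<close> its
  fibres have terminal objects, so the dual of Theorem A makes it an equivalence; thus
  \<open>F / b\<close> is contractible and Theorem A applies to \<open>F\<close>.\<close>

theorem fibred_equiv:
 assumes cats: "category A" "category B" "category S"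
  and F: "functr A B Fo Fa" and P: "functr B S Po Pa"
  and lift: "!!a m. [|a : obs A; m : ars S; cd S m = Po (Fo a)|] ==> EX c. c : ars A & cd A c = a & Pa (Fa c) = m &
    (ALL d. d : ars A & cd A d = a & Pa (Fa d) = m -->
     (EX! v. v : ars A & dm A v = dm A d & cd A v = dm A c & Pa (Fa v) = idn S (dm S m) & cmp A c v = d))"
  and terminal: "!!b g. [|b : obs B; g : ars S; cd S g = Po b|] ==> EX t e. t : obs A & e : ars B & dm B e = Fo t &
    cd B e = b & Pa e = g & (ALL a f. a : obs A & f : ars B & dm B f = Fo a & cd B f = b & Pa f = g -->
     (EX! v. v : ars A & dm A v = a & cd A v = t & Pa (Fa v) = idn S (dm S g) & cmp B e (Fa v) = f))"
 shows "hequiv (BB A) (BB B) (Bmap B Fo Fa)"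
proof (rule theorem_A[OF cats(1,2) F])
 interpret A: category A by (rule cats)
 interpret B: category B by (rule cats)
 interpret S: category S by (rule cats)
 note Fs = functrD[OF F] and Ps = functrD[OF P]
 fix b assume b: "b : obs B"
 let ?C = "comma A B Fo Fa b" and ?L = "comma S S (%x. x) (%f. f) (Po b)"
 have C: "category ?C" by (rule category_comma[OF cats(1,2) F])
 have L: "category ?L" by (rule category_comma[OF cats(3,3) functr_id])
 let ?po = "%(a, f). (Po (Fo a), Pa f)"
 let ?pa = "%(s, t, h). (?po s, ?po t, Pa (Fa h))"
 have pj: "functr ?C ?L ?po ?pa"
 proof (rule functrI)
  show "x : obs ?C ==> ?po x : obs ?L" for x using Fs Ps by (cases x) auto
  show "f : ars ?C ==> ?pa f : ars ?L & dm ?L (?pa f) = ?po (dm ?C f) & cd ?L (?pa f) = ?po (cd ?C f)" for f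
   using Fs Ps by (cases f) (auto simp flip: Ps(6))
  show "x : obs ?C ==> ?pa (idn ?C x) = idn ?L (?po x)" for x using Fs Ps by (cases x) auto
  show "[|f : ars ?C; g : ars ?C; dm ?C g = cd ?C f|] ==> ?pa (cmp ?C g f) = cmp ?L (?pa g) (?pa f)" for f g
   using Fs Ps by (cases f; cases g) auto
 qed
 \<comment> \<open>\<open>comma\<close> only forms over-categories. In the opposites it describes
   arrows from \<open>l\<close> to the projection, and these are what the lifts act on.\<close>
 have "hequiv (BB (op_cat ?C)) (BB (op_cat ?L)) (Bmap (op_cat ?L) ?po ?pa)"
 proof (rule theorem_A[OF category_op[OF C] category_op[OF L] functr_op[OF pj]])
  fix l assume "l : obs (op_cat ?L)"
  then obtain s g where l: "l = (s, g)" and g: "s : obs S" "g : ars S" "dm S g = s" "cd S g = Po b" by (cases l) auto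
  let ?G = "comma (op_cat ?C) (op_cat ?L) ?po ?pa l"
  \<comment> \<open>\<open>i\<close> is the identity of \<open>l\<close>, and \<open>H\<close> below
    is the strict fibre over \<open>l\<close>, a full subcategory of the comma category
    \<open>?G\<close>. Its arrows are reversed, so a terminal object of the fibre is initial in
    \<open>H\<close>.\<close>
  define i where "i = ((s, g), (s, g), idn S s)"
  define H where "H = ?G(|obs := {x : obs ?G. snd x = i}, ars := {h : ars ?G. snd (dm ?G h) = i & snd (cd ?G h) = i}|)"
  have G: "category ?G" by (rule category_comma[OF category_op[OF C] category_op[OF L] functr_op[OF pj]])
  interpret G: category ?G by (rule G)
  have Hs [simp]: "x : obs H <-> x : obs ?G & snd x = i"
   "h : ars H <-> h : ars ?G & snd (dm ?G h) = i & snd (cd ?G h) = i"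
   "dm H = dm ?G" "cd H = cd ?G" "idn H = idn ?G" "cmp H = cmp ?G" for x h by (auto simp: H_def)
  have H: "category H" by unfold_locales (auto simp: G.dm G.cd G.idn G.cmp G.idn_left G.idn_right G.cmp_assoc)
  have Gob: "((a, f), M) : obs ?G <-> a : obs A & f : ars B & dm B f = Fo a & cd B f = b &
    (EX m. M = ((s, g), (Po (Fo a), Pa f), m) & m : ars S & dm S m = s & cd S m = Po (Fo a) & cmp S (Pa f) m = g)" for a f M
   using Fs Ps g by (cases M) (auto simp: l)
  have Gar: "h : ars ?G <-> (EX a f m a' f' m' c. h = (((a, f), ((s, g), (Po (Fo a), Pa f), m)),
      ((a', f'), ((s, g), (Po (Fo a'), Pa f'), m')), ((a', f'), (a, f), c)) &
    ((a, f), ((s, g), (Po (Fo a), Pa f), m)) : obs ?G & ((a', f'), ((s, g), (Po (Fo a'), Pa f'), m')) : obs ?G &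
    c : ars A & dm A c = a' & cd A c = a & cmp B f (Fa c) = f' & cmp S (Pa (Fa c)) m' = m)" (is "_ = ?R h") for h
  proof
   assume h: "h : ars ?G"
   obtain a f M a' f' M' u w c where hh: "h = (((a, f), M), ((a', f'), M'), (u, w, c))" by (metis prod.exhaust)
   have "((a, f), M) : obs ?G" "((a', f'), M') : obs ?G" using h by (auto simp: hh)
   then show "?R h" using h unfolding Gob by (auto simp: hh)
  next
   assume "?R h"
   then obtain a f m a' f' m' c where h: "h = (((a, f), ((s, g), (Po (Fo a), Pa f), m)),
      ((a', f'), ((s, g), (Po (Fo a'), Pa f'), m')), ((a', f'), (a, f), c))"
    and o: "((a, f), ((s, g), (Po (Fo a), Pa f), m)) : obs ?G" "((a', f'), ((s, g), (Po (Fo a'), Pa f'), m')) : obs ?G"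
    and c: "c : ars A" "dm A c = a'" "cd A c = a" "cmp B f (Fa c) = f'" "cmp S (Pa (Fa c)) m' = m" by blast
   have "Pa f' = cmp S (Pa f) (Pa (Fa c))" using o(1) c Fs Ps(6)[OF Fs(2)[OF c(1)], of f] unfolding Gob by simp
   then show "h : ars ?G" using o[unfolded Gob] c g Ps(2)[of f] Ps(2)[of f'] Ps(3,4)[of f] Ps(3,4)[of f'] Ps(1)[OF Fs(1), of a] Ps(1)[OF Fs(1), of a'] Ps(2)[OF Fs(2)[OF c(1)]]
     Ps(3,4)[OF Fs(2)[OF c(1)]] Fs(3,4)[OF c(1)] unfolding h l by simp
  qed
  obtain t e where t: "t : obs A" "e : ars B" "dm B e = Fo t" "cd B e = b" "Pa e = g"
   and te: "!!a f. [|a : obs A; f : ars B; dm B f = Fo a; cd B f = b; Pa f = g|] ==>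
     EX! v. v : ars A & dm A v = a & cd A v = t & Pa (Fa v) = idn S s & cmp B e (Fa v) = f"
   using terminal[OF b g(2,4)] g(3) by blast
  have Pt: "Po (Fo t) = s" using Ps(3)[OF t(2)] t g by simp
  have Pi: "Po (Fo a) = s" "Pa f = g" "a : obs A" "f : ars B" "dm B f = Fo a" "cd B f = b" if "((a, f), i) : obs ?G" for a f
   using that unfolding Gob by (auto simp: i_def)
  have z: "((t, e), i) : obs ?G" unfolding Gob using t g Pt S.idn[OF g(1)] S.idn_right[OF g(2)] by (auto simp: i_def)
  have cH: "contract (BB H)"
  proof (rule contract_initial[OF H, of "((t, e), i)"])
   fix x assume "x : obs H"
   then obtain a f where x: "x = ((a, f), i)" "((a, f), i) : obs ?G" by (cases x) auto
   note p = Pi[OF x(2)]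
   obtain v where v: "v : ars A" "dm A v = a" "cd A v = t" "Pa (Fa v) = idn S s" "cmp B e (Fa v) = f"
    and vu: "!!w. [|w : ars A; dm A w = a; cd A w = t; Pa (Fa w) = idn S s; cmp B e (Fa w) = f|] ==> w = v"
    using te[OF p(3-6,2)] by blast
   let ?h = "(((t, e), i), ((a, f), i), ((a, f), (t, e), v))"
   show "EX! h. h : ars H & dm H h = ((t, e), i) & cd H h = x"
   proof (rule ex1I[of _ ?h])
    show "?h : ars H & dm H ?h = ((t, e), i) & cd H ?h = x"
     unfolding Hs Gar using v z x(2) p(1,2) Pt S.idn[OF g(1)] S.idn_left[of "idn S s"] t(5) by (simp add: x(1) i_def)
    fix h assume h: "h : ars H & dm H h = ((t, e), i) & cd H h = x"
    then obtain c where c: "h = (((t, e), i), ((a, f), i), ((a, f), (t, e), c))" "c : ars A" "dm A c = a" "cd A c = t"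
     "cmp B e (Fa c) = f" "cmp S (Pa (Fa c)) (idn S s) = idn S s"
     by (auto simp: x(1) i_def Gar simp del: comma_simps(6))
    have "Pa (Fa c) = idn S s" using c(2,3,6) Fs Ps p(1) S.idn_right[of "Pa (Fa c)"] by simp
    then show "h = ?h" using vu[OF c(2-4) _ c(5)] c(1) by simp
   qed
  qed (use z in simp)
  define U where "U X R E <-> R : obs H & E : ars ?G & dm ?G E = X & cd ?G E = R &
    (ALL Z h. Z : obs H & h : ars ?G & dm ?G h = X & cd ?G h = Z --> (EX! k. k : ars H & dm H k = R & cd H k = Z & cmp ?G k E = h))" for X R E
  have "EX R E. U X R E" if X: "X : obs ?G" for X
  proof -
   obtain a f M where X0: "X = ((a, f), M)" by (metis prod.exhaust)
   obtain m where M: "M = ((s, g), (Po (Fo a), Pa f), m)" and a: "a : obs A" "f : ars B" "dm B f = Fo a" "cd B f = b"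
    and m: "m : ars S" "dm S m = s" "cd S m = Po (Fo a)" "cmp S (Pa f) m = g"
    using X unfolding X0 Gob by blast
   \<comment> \<open>The lift of \<open>m\<close> moves \<open>X\<close> into the fibre, and its
     universal property is that of a universal arrow from \<open>X\<close> to
     \<open>H\<close>.\<close>
   obtain c where c: "c : ars A" "cd A c = a" "Pa (Fa c) = m" and cart: "!!d. [|d : ars A; cd A d = a; Pa (Fa d) = m|] ==>
      EX! v. v : ars A & dm A v = dm A d & cd A v = dm A c & Pa (Fa v) = idn S s & cmp A c v = d"
    using lift[OF a(1) m(1,3)] m(2) by blast
   define a' f' where "a' = dm A c" and "f' = cmp B f (Fa c)"
   have a': "a' : obs A" "f' : ars B" "dm B f' = Fo a'" "cd B f' = b" "Pa f' = g" "Po (Fo a') = s"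
    using c a m B.cmp[OF Fs(2)[OF c(1)] a(2)] Fs(3,4)[OF c(1)] Ps(3)[OF Fs(2)[OF c(1)]] Ps(6)[OF Fs(2)[OF c(1)] a(2)] A.dm
    by (auto simp: a'_def f'_def)
   have R: "((a', f'), i) : obs ?G" unfolding Gob using a' g S.idn[OF g(1)] S.idn_right[OF g(2)] by (auto simp: i_def)
   let ?E = "(((a, f), M), ((a', f'), i), ((a', f'), (a, f), c))"
   have E: "?E : ars ?G" unfolding Gar
    using X R a' c m S.idn_right[OF m(1)] by (auto simp: X0 M i_def a'_def f'_def)
   have "EX! k. k : ars H & dm H k = ((a', f'), i) & cd H k = Z & cmp ?G k ?E = h"
    if Z: "Z : obs H" and h: "h : ars ?G" "dm ?G h = X" "cd ?G h = Z" for Z h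
   proof -
    obtain a2 f2 where Z2: "Z = ((a2, f2), i)" "((a2, f2), i) : obs ?G" using Z by (cases Z) auto
    note p = Pi[OF Z2(2)]
    obtain d where d: "h = (((a, f), M), ((a2, f2), i), ((a2, f2), (a, f), d))" "d : ars A" "dm A d = a2" "cd A d = a"
      "cmp B f (Fa d) = f2" "cmp S (Pa (Fa d)) (idn S s) = m"
     using h by (auto simp: X0 Z2(1) M i_def Gar simp del: comma_simps(6))
    have Pd: "Pa (Fa d) = m" using d Fs Ps p(1) S.idn_right[of "Pa (Fa d)"] by simp
    obtain v where v: "v : ars A" "dm A v = a2" "cd A v = a'" "Pa (Fa v) = idn S s" "cmp A c v = d"
     and vu: "!!w. [|w : ars A; dm A w = a2; cd A w = a'; Pa (Fa w) = idn S s; cmp A c w = d|] ==> w = v"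
     using cart[OF d(2,4) Pd] unfolding d(3) a'_def[symmetric] by blast
    have fv: "cmp B f' (Fa v) = f2"
     using B.cmp_assoc[OF Fs(2)[OF v(1)] Fs(2)[OF c(1)] a(2)] Fs v c a d(5) by (auto simp: f'_def a'_def)
    let ?k = "(((a', f'), i), ((a2, f2), i), ((a2, f2), (a', f'), v))"
    show ?thesis
    proof (rule ex1I[of _ ?k])
     show "?k : ars H & dm H ?k = ((a', f'), i) & cd H ?k = Z & cmp ?G ?k ?E = h"
      unfolding Hs Gar using v fv R Z2(2) p(1,2) a'(5,6) S.idn[OF g(1)] S.idn_left[of "idn S s"] by (simp add: Z2(1) i_def d(1))
     fix k assume k: "k : ars H & dm H k = ((a', f'), i) & cd H k = Z & cmp ?G k ?E = h"
     then obtain w where w: "k = (((a', f'), i), ((a2, f2), i), ((a2, f2), (a', f'), w))" "w : ars A" "dm A w = a2" "cd A w = a'"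
       "cmp S (Pa (Fa w)) (idn S s) = idn S s"
      by (auto simp: Z2(1) i_def Gar simp del: comma_simps(6))
     have "cmp A c w = d" using k by (simp add: w(1) d(1))
     moreover have "Pa (Fa w) = idn S s" using w Fs Ps p(1) S.idn_right[of "Pa (Fa w)"] by simp
     ultimately show "k = ?k" using vu[OF w(2-4)] w(1) by simp
    qed
   qed
   then show ?thesis unfolding U_def using R E X0 by (intro exI[of _ "((a', f'), i)"] exI[of _ ?E]) auto
  qed
  then have "EX E. U X (SOME R. EX E. U X R E) E" if "X : obs ?G" for X by (rule someI_ex) (use that in auto)
  note ex = someI_ex[OF this]
  define r et where "r X = (SOME R. EX E. U X R E)" and "et X = (SOME E. U X (r X) E)" for X
  have ret: "U X (r X) (et X)" if "X : obs ?G" for X unfolding et_def r_def by (rule ex[OF that])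
  have "hequiv (BB H) (BB ?G) (Bmap ?G (%x. x) (%f. f))"
  proof (rule universal_arrows_equiv[OF H G, of _ _ r et])
   show "functr H ?G (%x. x) (%f. f)" by (rule functrI) auto
   show "r X : obs H & et X : ars ?G & dm ?G (et X) = X & cd ?G (et X) = r X" if "X : obs ?G" for X
    using ret[OF that] unfolding U_def by (elim conjE) (intro conjI)
   show "EX! k. k : ars H & dm H k = r X & cd H k = Z & cmp ?G k (et X) = h"
    if X: "X : obs ?G" and "Z : obs H" "h : ars ?G" "dm ?G h = X" "cd ?G h = Z" for X Z h
    using ret[OF X] that(2-5) unfolding U_def by (elim conjE allE impE) (intro conjI)
  qed
  then show "contract (BB ?G)"
   using cH by (metis hequiv_inverse contract_equiv)
 qed
 moreover have "contract (BB ?L)" by (rule slice_contractible[OF cats(3) Ps(1)[OF b]])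
 ultimately show "contract (BB ?C)"
  by (metis contract_equiv contract_op op_cat_simps(7))
qed

text \<open>An extensional function on \<open>{..q}\<close> does not determine the codomain
  \<open>[p]\<close>, so both dimensions belong to the arrow.\<close>

definition Delta_cat :: "(nat, nat * nat * (nat => nat)) cat" where
 "Delta_cat = (|obs = UNIV, ars = {(q, p, a). a : Delta q p}, dm = (%(q, p, a). q), cd = (%(q, p, a). p),
   idn = (%p. (p, p, Did p)), cmp = (%(_, p, a) (r, q, b). (r, p, cp r a b))|)"

lemma Delta_cat_simps [simp]:
 "obs Delta_cat = UNIV" "(q, p, a) : ars Delta_cat <-> a : Delta q p" "dm Delta_cat (q, p, a) = q"
 "cd Delta_cat (q, p, a) = p" "idn Delta_cat p = (p, p, Did p)"
 "cmp Delta_cat (q, p, a) (r, q', b) = (r, p, cp r a b)"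
 by (simp_all add: Delta_cat_def)

definition shape :: "('x, 'f) groth_arrow => nat * nat * (nat => nat)" where
 "shape = (%((y, q), (x, p), u, a). (q, p, a))"

lemma shape_simps [simp]: "shape ((y, q), (x, p), u, a) = (q, p, a)"
 by (simp add: shape_def)

lemma category_Delta: "category Delta_cat"
 by unfold_locales (auto simp: Delta_cat_def comp_id comp_assoc)

definition full_subsimp :: "('x, 'f) simp_cat => ('x, 'f) simp_cat => bool" where
 "full_subsimp D' D <->
   (ALL p. lobs D' p \<subseteq> lobs D p &
    lars D' p = {u : lars D p. ldm D p u : lobs D' p & lcd D p u : lobs D' p} &
    ldm D' p = ldm D p & lcd D' p = lcd D p &
    lidn D' p = lidn D p & lcp D' p = lcp D p) &
   pb_ob D' = pb_ob D & pb_ar D' = pb_ar D"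

locale full_subcategory = strict_simp D + D': strict_simp D'
 for D D' :: "('x, 'f) simp_cat" +
 assumes full: "full_subsimp D' D"
begin

lemma full_simps [simp]:
 "ldm D' p = ldm D p" "lcd D' p = lcd D p" "lidn D' p = lidn D p"
 "lcp D' p = lcp D p" "pb_ob D' = pb_ob D" "pb_ar D' = pb_ar D"
 using full unfolding full_subsimp_def by auto

lemma full_obs: "x : lobs D' p ==> x : lobs D p"
 using full unfolding full_subsimp_def by blast

lemma full_ars: "u : lars D' p <->
  u : lars D p & ldm D p u : lobs D' p & lcd D p u : lobs D' p"
 using full unfolding full_subsimp_def by blast

lemma Gro_full_ars:
 "((y, q), (x, p), u, a) : ars (Gro D') <->
  ((y, q), (x, p), u, a) : ars (Gro D) & y : lobs D' q & x : lobs D' p"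
 using D'.pbD(1) by (auto simp: full_ars full_obs)

lemma cmp_full: "cmp (Gro D') = cmp (Gro D)"
 by (auto simp: fun_eq_iff grothendieck_def pcmp D'.pcmp split: prod.splits)

lemma functr_full: "functr (Gro D') (Gro D) (%x. x) (%f. f)"
proof (rule functrI)
 fix f assume f: "f : ars (Gro D')"
 obtain y q x p u a where ff: "f = ((y, q), (x, p), u, a)" by (metis prod.exhaust)
 show "f : ars (Gro D) & dm (Gro D) f = dm (Gro D') f &
   cd (Gro D) f = cd (Gro D') f"
  using f unfolding ff Gro_full_ars by simp
next
 fix x assume "x : obs (Gro D')"
 then show "x : obs (Gro D)" "idn (Gro D') x = idn (Gro D) x"
  by (cases x; auto simp: full_obs punit D'.punit)+
qed (simp add: cmp_full)

lemma inc_simps: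
 "x : obs (Gro D') ==> Gro_ob (inclusion D) x = x"
 "f : ars (Gro D') ==> Gro_ar D (inclusion D) f = f"
proof -
 assume f: "f : ars (Gro D')"
 obtain y q x p u a where ff: "f = ((y, q), (x, p), u, a)" by (metis prod.exhaust)
 have "u : lars D q" "lcd D q u = pb_ob D q p a x"
  using f unfolding ff Gro_full_ars by simp_all
 then show "Gro_ar D (inclusion D) f = f"
  using category.idn_left[OF level, of u q] by (simp add: ff grothendieck_map_ar_def inclusion_def strict_mor_def)
qed (auto simp: grothendieck_map_ob_def inclusion_def strict_mor_def)

text \<open>\<open>fibred_equiv\<close> over the simplex category. The lift of \<open>b\<close> at
  \<open>y\<close> is the identity of \<open>b^* y\<close>, an object of \<open>D'\<close> since the
  subcategory is simplicial. Over an operator \<open>a\<close> into \<open>[p]\<close> the terminal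
  object is the coreflection of \<open>a^* x\<close>, chosen separately for each
  \<open>a\<close>.\<close>

theorem coreflective_equiv:
 assumes coreflection: "!!p x. x : lobs D p ==> EX ep. ep : lars D p & ldm D p ep : lobs D' p &
   lcd D p ep = x & (ALL u. u : lars D p & ldm D p u : lobs D' p & lcd D p u = x -->
    (EX! v. v : lars D p & ldm D p v = ldm D p u & lcd D p v = ldm D p ep &
     lcp D p ep v = u))"
 shows "hequiv (BB (Gro D')) (BB (Gro D)) (Bmap (Gro D) (%x. x) (%f. f))"
proof (rule fibred_equiv[OF D'.category_Gro category_Gro category_Delta functr_full])
 show "functr (Gro D) Delta_cat snd shape"
 proof (rule functrI)
  fix f g assume f: "f : ars (Gro D)" "g : ars (Gro D)" "dm (Gro D) g = cd (Gro D) f"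
  obtain z r y q v b Y x p u a where "f = ((z, r), (y, q), v, b)" "g = (Y, (x, p), u, a)" by (metis prod.exhaust)
  then show "shape (cmp (Gro D) g f) = cmp Delta_cat (shape g) (shape f)" using f by (auto simp: cmp_strict(1))
 qed auto
next
 fix X m assume X: "X : obs (Gro D')" "m : ars Delta_cat" "cd Delta_cat m = snd X"
 obtain y q r b where e: "X = (y, q)" "m = (r, q, b)" using X(3) by (cases X; cases m) auto
 define z where "z = pb_ob D r q b y"
 have y: "y : lobs D' q" "b : Delta r q" "z : lobs D' r" using X D'.pbD(1) by (auto simp: e z_def)
 note id = category.idn[OF level full_obs[OF y(3)]] and i = pb_ob_id[OF full_obs[OF y(3)]] pb_ar_id comp_id[OF y(2)]
 let ?c = "((z, r), (y, q), lidn D r z, b)"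
 have c: "?c : ars (Gro D')" unfolding Gro_full_ars using y id full_obs by (auto simp: z_def)
 have "EX! v. v : ars (Gro D') & dm (Gro D') v = dm (Gro D') d & cd (Gro D') v = (z, r) &
   shape v = (r, r, Did r) & cmp (Gro D') ?c v = d"
  if d: "d : ars (Gro D')" "cd (Gro D') d = X" "shape d = m" for d
 proof -
  obtain x w where dd: "d = ((x, r), (y, q), w, b)" using d by (cases d) (auto simp: e)
  have w: "w : lars D r" "ldm D r w = x" "lcd D r w = z" "x : lobs D' r"
   using d(1) unfolding dd Gro_full_ars by (auto simp: z_def)
  have v: "((x, r), (z, r), u, Did r) : ars (Gro D') <-> u : lars D r & ldm D r u = x & lcd D r u = z" for u
   unfolding Gro_full_ars using y w full_obs i by auto
  have k: "cmp (Gro D') ?c ((x, r), (z, r), u, Did r) = ((x, r), (y, q), u, b)"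
   if "u : lars D r" "ldm D r u = x" "lcd D r u = z" for u
   using D'.cmp_strict(1)[OF c v[THEN iffD2]] that id i category.idn_left[OF level that(1)] by simp
  show ?thesis
  proof (rule ex1I[of _ "((x, r), (z, r), w, Did r)"])
   fix u assume u: "u : ars (Gro D') & dm (Gro D') u = dm (Gro D') d & cd (Gro D') u = (z, r) &
    shape u = (r, r, Did r) & cmp (Gro D') ?c u = d"
   then obtain w' where "u = ((x, r), (z, r), w', Did r)" by (cases u) (auto simp: dd)
   then show "u = ((x, r), (z, r), w, Did r)" using u v[of w'] k[of w'] by (auto simp: dd)
  qed (use v k[OF w(1-3)] w in "auto simp: dd")
 qed
 then show "EX c. c : ars (Gro D') & cd (Gro D') c = X & shape c = m & (ALL d. d : ars (Gro D') &
   cd (Gro D') d = X & shape d = m --> (EX! v. v : ars (Gro D') & dm (Gro D') v = dm (Gro D') d &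
    cd (Gro D') v = dm (Gro D') c & shape v = idn Delta_cat (dm Delta_cat m) & cmp (Gro D') c v = d))"
  using c by (intro exI[of _ ?c]) (auto simp: e)
next
 fix X m assume X: "X : obs (Gro D)" "m : ars Delta_cat" "cd Delta_cat m = snd X"
 obtain x p q a where e: "X = (x, p)" "m = (q, p, a)" using X(3) by (cases X; cases m) auto
 have x: "x : lobs D p" "a : Delta q p" using X by (auto simp: e)
 define z where "z = pb_ob D q p a x"
 have z: "z : lobs D q" using x pbD(1) by (auto simp: z_def)
 obtain ep where ep: "ep : lars D q" "ldm D q ep : lobs D' q" "lcd D q ep = z"
  and univ: "!!u. [|u : lars D q; ldm D q u : lobs D' q; lcd D q u = z|] ==>
   EX! v. v : lars D q & ldm D q v = ldm D q u & lcd D q v = ldm D q ep & lcp D q ep v = u"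
  using coreflection[OF z] by blast
 define t where "t = ldm D q ep"
 note i = pb_ob_id[OF full_obs[OF ep(2)]] pb_ar_id comp_id[OF x(2)]
 let ?e = "((t, q), (x, p), ep, a)"
 have E: "?e : ars (Gro D)" using x ep full_obs by (auto simp: z_def t_def)
 have "EX! v. v : ars (Gro D') & dm (Gro D') v = s & cd (Gro D') v = (t, q) &
   shape v = (q, q, Did q) & cmp (Gro D) ?e v = f"
  if f: "s : obs (Gro D')" "f : ars (Gro D)" "dm (Gro D) f = s" "cd (Gro D) f = X" "shape f = m" for s f
 proof -
  obtain y u where ff: "f = ((y, q), (x, p), u, a)" "s = (y, q)" using f by (cases f) (auto simp: e)
  have u: "u : lars D q" "ldm D q u = y" "lcd D q u = z" "y : lobs D' q" using f by (auto simp: ff z_def)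
  have v: "((y, q), (t, q), w, Did q) : ars (Gro D') <-> w : lars D q & ldm D q w = y & lcd D q w = t" for w
   unfolding Gro_full_ars using ep u full_obs i by (auto simp: t_def)
  have k: "cmp (Gro D) ?e ((y, q), (t, q), w, Did q) = ((y, q), (x, p), lcp D q ep w, a)"
   if "((y, q), (t, q), w, Did q) : ars (Gro D')" for w
   using cmp_strict(1)[OF E, of y q w "Did q"] that i ep(1) unfolding Gro_full_ars by simp
  obtain w where w: "w : lars D q" "ldm D q w = y" "lcd D q w = t" "lcp D q ep w = u"
   and wu: "!!w'. [|w' : lars D q; ldm D q w' = y; lcd D q w' = t; lcp D q ep w' = u|] ==> w' = w"
   using univ[OF u(1) _ u(3)] u(2,4) unfolding t_def by blast
  show ?thesis
  proof (rule ex1I[of _ "((y, q), (t, q), w, Did q)"])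
   fix h assume h: "h : ars (Gro D') & dm (Gro D') h = s & cd (Gro D') h = (t, q) &
    shape h = (q, q, Did q) & cmp (Gro D) ?e h = f"
   then obtain w' where "h = ((y, q), (t, q), w', Did q)" by (cases h) (auto simp: ff)
   then show "h = ((y, q), (t, q), w, Did q)" using h v[of w'] k[of w'] wu[of w'] by (auto simp: ff)
  qed (use v k[of w] w in "auto simp: ff")
 qed
 then show "EX t e. t : obs (Gro D') & e : ars (Gro D) & dm (Gro D) e = t & cd (Gro D) e = X & shape e = m &
   (ALL a f. a : obs (Gro D') & f : ars (Gro D) & dm (Gro D) f = a & cd (Gro D) f = X & shape f = m -->
     (EX! v. v : ars (Gro D') & dm (Gro D') v = a & cd (Gro D') v = t & shape v = idn Delta_cat (dm Delta_cat m) &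
      cmp (Gro D) e v = f))"
  using E ep(2) by (intro exI[of _ "(t, q)"] exI[of _ ?e]) (auto simp: e t_def)
qed

end

section \<open>Reflections\<close>

definition strict_sfun ::
 "('x, 'f) simp_cat => ('y, 'g) simp_cat => (nat => 'x => 'y) => (nat => 'f => 'g) => bool" where
 "strict_sfun D' D Ko Ka <->
   (ALL p. functr (level D' p) (level D p) (Ko p) (Ka p)) &
   (ALL q p a x. a : Delta q p & x : lobs D' p --> Ko q (pb_ob D' q p a x) = pb_ob D q p a (Ko p x)) &
   (ALL q p a u. a : Delta q p & u : lars D' p --> Ka q (pb_ar D' q p a u) = pb_ar D q p a (Ka p u))"

locale strict_fun = strict_simp D + D': strict_simp D'
 for D :: "('y, 'g) simp_cat" and D' :: "('x, 'f) simp_cat" +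
 fixes Ko Ka
 assumes K: "strict_sfun D' D Ko Ka"
begin

lemma KD: "functr (level D' p) (level D p) (Ko p) (Ka p)"
 "[|a : Delta q p; x : lobs D' p|] ==> Ko q (pb_ob D' q p a x) = pb_ob D q p a (Ko p x)"
 "[|a : Delta q p; u : lars D' p|] ==> Ka q (pb_ar D' q p a u) = pb_ar D q p a (Ka p u)"
 using K unfolding strict_sfun_def by blast+

lemmas Ks = functrD[OF KD(1)]

lemma strict_simps:
 "Gro_ob (strict_mor D Ko Ka) (x, p) = (Ko p x, p)"
 "((y, q), (x, p), u, a) : ars (Gro D') ==>
   Gro_ar D (strict_mor D Ko Ka) ((y, q), (x, p), u, a) = ((Ko q y, q), (Ko p x, p), Ka q u, a)"
proof -
 assume f: "((y, q), (x, p), u, a) : ars (Gro D')"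
 then have "Ka q u : lars D q" "lcd D q (Ka q u) = pb_ob D q p a (Ko p x)"
  using Ks KD(2) by auto
 then show "Gro_ar D (strict_mor D Ko Ka) ((y, q), (x, p), u, a) = ((Ko q y, q), (Ko p x, p), Ka q u, a)"
  using category.idn_left[OF level, of "Ka q u" q] by (simp add: grothendieck_map_ar_def strict_mor_def)
qed (simp add: grothendieck_map_ob_def strict_mor_def)

lemma strict_mor_ars:
 "((y, q), (x, p), u, a) : ars (Gro D') ==> ((Ko q y, q), (Ko p x, p), Ka q u, a) : ars (Gro D)"
 using Ks KD(2) by auto

lemma functr_strict:
 "functr (Gro D') (Gro D) (Gro_ob (strict_mor D Ko Ka))
  (Gro_ar D (strict_mor D Ko Ka))"
 (is "functr ?E' ?E ?o ?a")
proof (rule functrI)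
 fix x assume "x : obs ?E'"
 then show "?o x : obs ?E" using Ks(1) by (cases x) (auto simp: strict_simps)
next
 fix f assume f: "f : ars ?E'"
 obtain y q x p u a where ff: "f = ((y, q), (x, p), u, a)" by (metis prod.exhaust)
 show "?a f : ars ?E & dm ?E (?a f) = ?o (dm ?E' f) & cd ?E (?a f) = ?o (cd ?E' f)"
  unfolding ff strict_simps(2)[OF f[unfolded ff]]
  using strict_mor_ars[OF f[unfolded ff]] by (simp only: Gro_simps(3,4) strict_simps(1) simp_thms)
next
 fix X assume X: "X : obs ?E'"
 obtain x p where xx: "X = (x, p)" by (cases X)
 have x: "x : lobs D' p" using X by (simp add: xx)
 have "((x, p), (x, p), lidn D' p x, Did p) : ars ?E'"
  using x category.idn[OF D'.level x] D'.pb_ob_id[OF x] by simp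
 from strict_simps(2)[OF this] show "?a (idn ?E' X) = idn ?E (?o X)"
  using Ks(5)[OF x] by (simp add: xx strict_simps(1) D'.punit punit)
next
 fix f g assume f: "f : ars ?E'" and g: "g : ars ?E'" and fg: "dm ?E' g = cd ?E' f"
 obtain z r y q v b where f': "f = ((z, r), (y, q), v, b)" by (metis prod.exhaust)
 obtain Y x p u a where g0: "g = (Y, (x, p), u, a)" by (metis prod.exhaust)
 have g': "g = ((y, q), (x, p), u, a)" using fg by (simp add: f' g0)
 note F = f[unfolded f'] and G = g[unfolded g']
 note c = D'.cmp_strict[OF G F]
 have m: "b : Delta r q" "u : lars D' q" "v : lars D' r" "ldm D' q u = y" 
  "lcd D' r v = pb_ob D' r q b y" using F G by auto
 have "((z, r), (x, p), lcp D' r (pb_ar D' r q b u) v, cp r a b) : ars ?E'"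
  using c F G by auto
 from strict_simps(2)[OF this]
 show "?a (cmp ?E' g f) = cmp ?E (?a g) (?a f)"
  unfolding f' g' c(1) strict_simps(2)[OF F] strict_simps(2)[OF G]
   cmp_strict(1)[OF strict_mor_ars[OF G] strict_mor_ars[OF F]]
  using Ks(6)[OF m(3) D'.pbD(2)[OF m(1,2)]] D'.pbD(3)[OF m(1,2)] m KD(3)[OF m(1,2)] by simp
qed

text \<open>An arrow from \<open>(x, [p])\<close> to the image of \<open>(y, [n])\<close> over
  \<open>a\<close> is an arrow from \<open>x\<close> to \<open>Ko (a^* y)\<close> in
  \<open>D p\<close>. It factors uniquely through the reflection of \<open>x\<close>, taken over the
  identity operator.\<close>

theorem reflective_equiv:
 assumes refl: "!!p x. x : lobs D p ==> EX r et. r : lobs D' p & et : lars D p &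
   ldm D p et = x & lcd D p et = Ko p r &
   (ALL y u. y : lobs D' p & u : lars D p & ldm D p u = x & lcd D p u = Ko p y -->
    (EX! v. v : lars D' p & ldm D' p v = r & lcd D' p v = y & lcp D p (Ka p v) et = u))"
 shows "hequiv (BB (Gro D')) (BB (Gro D))
  (Bmap (Gro D) (Gro_ob (strict_mor D Ko Ka)) (Gro_ar D (strict_mor D Ko Ka)))"
proof -
 let ?U = "%p x (r, et). r : lobs D' p & et : lars D p &
   ldm D p et = x & lcd D p et = Ko p r &
   (ALL y u. y : lobs D' p & u : lars D p & ldm D p u = x & lcd D p u = Ko p y -->
    (EX! v. v : lars D' p & ldm D' p v = r & lcd D' p v = y & lcp D p (Ka p v) et = u))"
 define R where "R p x = (SOME R. ?U p x R)" for p x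
 have R0: "?U p x (R p x)" if x: "x : lobs D p" for p x
 proof -
  have "EX R. ?U p x R"
   unfolding split_paired_Ex prod.case by (rule refl[OF x])
  then show ?thesis unfolding R_def by (rule someI_ex)
 qed
 define r where "r p x = fst (R p x)" for p x
 define et where "et p x = snd (R p x)" for p x
 note R1 = R0[unfolded case_prod_unfold, folded r_def et_def]
 have R: "r p x : lobs D' p" "et p x : lars D p" "ldm D p (et p x) = x" "lcd D p (et p x) = Ko p (r p x)"
  if "x : lobs D p" for p x
  using R1[OF that] by - ((elim conjE, assumption)+)
 have univ: "EX! v. v : lars D' p & ldm D' p v = r p x & lcd D' p v = y & lcp D p (Ka p v) (et p x) = u"
  if x: "x : lobs D p" and y: "y : lobs D' p" "u : lars D p" "ldm D p u = x" "lcd D p u = Ko p y" for p x y u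
  by (rule R1[OF x, THEN conjunct2, THEN conjunct2, THEN conjunct2, THEN conjunct2, rule_format, OF conjI[OF y(1) conjI[OF y(2) conjI[OF y(3,4)]]]])
 let ?r = "%(x, p). (r p x, p)" and ?et = "%(x, p). ((x, p), (Ko p (r p x), p), et p x, Did p)"
 show ?thesis
 proof (rule universal_arrows_equiv[OF D'.category_Gro category_Gro functr_strict,
    where r = ?r and et = ?et])
  fix b assume "b : obs (Gro D)"
  then obtain x p where b: "b = (x, p)" "x : lobs D p" by (cases b) auto
  show "?r b : obs (Gro D') & ?et b : ars (Gro D) & dm (Gro D) (?et b) = b &
    cd (Gro D) (?et b) = Gro_ob (strict_mor D Ko Ka) (?r b)"
   using R[OF b(2)] Ks(1)[OF R(1)[OF b(2)]] pb_ob_id by (simp add: b strict_simps)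
 next
  fix b a' f assume bb: "b : obs (Gro D)" and aa: "a' : obs (Gro D')" and f: "f : ars (Gro D)"
   "dm (Gro D) f = b" "cd (Gro D) f = Gro_ob (strict_mor D Ko Ka) a'"
  obtain x p where b: "b = (x, p)" "x : lobs D p" using bb by (cases b) auto
  obtain y n where a': "a' = (y, n)" "y : lobs D' n" using aa by (cases a') auto
  obtain S T u a where ff: "f = (S, T, u, a)" by (metis prod.exhaust)
  have ST: "S = (x, p)" "T = (Ko n y, n)" using f by (auto simp: ff b a' strict_simps)
  have F: "((x, p), (Ko n y, n), u, a) : ars (Gro D)" using f(1) by (simp only: ff ST)
  then have m: "a : Delta p n" "u : lars D p" "ldm D p u = x" "lcd D p u = pb_ob D p n a (Ko n y)" by auto
  have ay: "pb_ob D' p n a y : lobs D' p" using D'.pbD(1)[OF m(1) a'(2)] .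
  have Kay: "Ko p (pb_ob D' p n a y) = pb_ob D p n a (Ko n y)" using KD(2)[OF m(1) a'(2)] .
  note Rx = R[OF b(2)]
  have E: "((x, p), (Ko p (r p x), p), et p x, Did p) : ars (Gro D)"
   using Rx Ks(1)[OF Rx(1)] pb_ob_id b by simp
  have eq: "g : ars (Gro D') & dm (Gro D') g = ?r b & cd (Gro D') g = a' &
    cmp (Gro D) (Gro_ar D (strict_mor D Ko Ka) g) (?et b) = f <->
    (EX v. g = ((r p x, p), (y, n), v, a) & v : lars D' p & ldm D' p v = r p x &
     lcd D' p v = pb_ob D' p n a y & lcp D p (Ka p v) (et p x) = u)" (is "?L <-> ?R") for g
  proof
   assume L: ?L
   obtain S' T' v c where g: "g = (S', T', v, c)" by (metis prod.exhaust)
   have ST': "S' = (r p x, p)" "T' = (y, n)" using L by (auto simp: g b a')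
   have G: "((r p x, p), (y, n), v, c) : ars (Gro D')" using conjunct1[OF L] by (simp only: g ST')
   have v: "v : lars D' p" "ldm D' p v = r p x" "lcd D' p v = pb_ob D' p n c y" "c : Delta p n" using G by auto
   have "cmp (Gro D) ((Ko p (r p x), p), (Ko n y, n), Ka p v, c) ((x, p), (Ko p (r p x), p), et p x, Did p) = f"
    using L strict_simps(2)[OF G] by (simp add: g ST' b)
   then have "lcp D p (Ka p v) (et p x) = u" "c = a"
    using cmp_strict(1)[OF strict_mor_ars[OF G] E] pb_ar_id[OF Ks(2)[OF v(1)]] comp_id[OF v(4)] by (auto simp: ff)
   then show ?R using v by (auto simp: g ST')
  next
   assume ?R
   then obtain v where v: "g = ((r p x, p), (y, n), v, a)" "v : lars D' p" "ldm D' p v = r p x"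
     "lcd D' p v = pb_ob D' p n a y" "lcp D p (Ka p v) (et p x) = u" by blast
   have G: "((r p x, p), (y, n), v, a) : ars (Gro D')" using v Rx a' m by simp
   then show ?L
    using v cmp_strict(1)[OF strict_mor_ars[OF G] E] pb_ar_id[OF Ks(2)[OF v(2)]] comp_id[OF m(1)] strict_simps(2)[OF G]
    by (simp add: b a' ff ST)
  qed
  have "EX! v. v : lars D' p & ldm D' p v = r p x & lcd D' p v = pb_ob D' p n a y &
    lcp D p (Ka p v) (et p x) = u"
   using univ[OF b(2) ay m(2,3)] m(4) Kay by simp
  then show "EX! g. g : ars (Gro D') & dm (Gro D') g = ?r b & cd (Gro D') g = a' &
    cmp (Gro D) (Gro_ar D (strict_mor D Ko Ka) g) (?et b) = f"
   unfolding eq by auto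
 qed
qed

end

section \<open>Calculus in a bicategory\<close>

lemma mem_mors: "u : mors C y x <-> u : Mor C & src C u = y & tgt C u = x"
 by (auto simp: mors_def)

lemma mem_cells: "a : cells C u v <-> a : Cell C & ddom C a = u & dcod C a = v"
 by (auto simp: cells_def)

context bicategory
begin

lemma hom_cat_facts:
 assumes a: "a : Cell C"
 shows "category (hom_cat C (src C (ddom C a)) (tgt C (ddom C a)))"
  "a : ars (hom_cat C (src C (ddom C a)) (tgt C (ddom C a)))"
 using hom_category[OF tgt[OF ddom[OF a]] src[OF ddom[OF a]]] a parallel[OF a] ddom[OF a] dcod[OF a]
 by (auto simp: hom_cat_def mem_mors)

lemmas [simp] = src tgt ddom dcod

lemma src_dcod [simp]: "a : Cell C ==> src C (dcod C a) = src C (ddom C a)"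
 and tgt_dcod [simp]: "a : Cell C ==> tgt C (dcod C a) = tgt C (ddom C a)"
 using parallel by auto

lemma vid_simps [simp]:
 assumes "u : Mor C" shows "vid C u : Cell C" "ddom C (vid C u) = u" "dcod C (vid C u) = u"
 using category.idn[OF hom_category[OF tgt[OF assms] src[OF assms]], of u] assms
 by (auto simp: hom_cat_def mem_mors)

lemma vcomp_simps [simp]:
 assumes "a : Cell C" "b : Cell C" "ddom C b = dcod C a"
 shows "b ;; a : Cell C" "ddom C (b ;; a) = ddom C a" "dcod C (b ;; a) = dcod C b"
 using category.cmp[OF hom_cat_facts(1)[OF assms(1)], of a b] hom_cat_facts(2)[OF assms(1)] hom_cat_facts(2)[OF assms(2)] assms
 by (auto simp: hom_cat_def)

lemma vcomp_vid [simp]: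
 assumes "a : Cell C" shows "ddom C a = u ==> a ;; vid C u = a" "dcod C a = u ==> vid C u ;; a = a"
 using category.idn_right[OF hom_cat_facts[OF assms]] category.idn_left[OF hom_cat_facts[OF assms]]
 by (auto simp: hom_cat_def)

lemma v_assoc:
 assumes "a : Cell C" "b : Cell C" "c : Cell C" "ddom C b = dcod C a" "ddom C c = dcod C b"
 shows "c ;; b ;; a = c ;; (b ;; a)"
 using category.cmp_assoc[OF hom_cat_facts(1)[OF assms(1)] hom_cat_facts(2)[OF assms(1)], of b c]
  hom_cat_facts(2)[OF assms(2)] hom_cat_facts(2)[OF assms(3)] assms by (auto simp: hom_cat_def)

lemma mcomp_simps [simp]:
 assumes "u : Mor C" "v : Mor C" "src C u = tgt C v"
 shows "u <> v : Mor C" "src C (u <> v) = src C v" "tgt C (u <> v) = tgt C u"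
 using mcomp[of u "src C u" "tgt C u" v "src C v"] assms by (auto simp: mem_mors)

lemma unit_mor_simps [simp]:
 assumes "x : Ob C" shows "unit_mor C x : Mor C" "src C (unit_mor C x) = x" "tgt C (unit_mor C x) = x"
 using unit_mor[OF assms] by (auto simp: mem_mors)

lemma hcomp_simps [simp]:
 assumes "a : Cell C" "b : Cell C" "src C (ddom C a) = tgt C (ddom C b)"
 shows "a *. b : Cell C" "ddom C (a *. b) = ddom C a <> ddom C b" "dcod C (a *. b) = dcod C a <> dcod C b"
 using hcomp[of "ddom C a" "src C (ddom C a)" "tgt C (ddom C a)" "ddom C b" "src C (ddom C b)" a _ b] assms
 by (auto simp: mem_mors mem_cells)

lemma hcomp_vid_vid [simp]:
 "u : Mor C ==> v : Mor C ==> src C u = tgt C v ==> vid C u *. vid C v = vid C (u <> v)"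
 using hcomp_vid by (simp add: mem_mors)

lemma hcomp_vcomp:
 assumes "a : Cell C" "a' : Cell C" "b : Cell C" "b' : Cell C" "ddom C a' = dcod C a" "ddom C b' = dcod C b"
  "src C (ddom C a) = tgt C (ddom C b)"
 shows "(a' *. b') ;; (a *. b) = (a' ;; a) *. (b' ;; b)"
 using interchange[of "ddom C a" "src C (ddom C a)" "tgt C (ddom C a)" "ddom C b" "src C (ddom C b)" a _ a' _ b _ b'] assms
 by (auto simp: mem_mors mem_cells)

lemma constraint_simps [simp]:
 shows "[|u : Mor C; v : Mor C; w : Mor C; src C u = tgt C v; src C v = tgt C w|] ==> asc C u v w : Cell C"
  "[|u : Mor C; v : Mor C; w : Mor C; src C u = tgt C v; src C v = tgt C w|] ==> ddom C (asc C u v w) = u <> (v <> w)"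
  "[|u : Mor C; v : Mor C; w : Mor C; src C u = tgt C v; src C v = tgt C w|] ==> dcod C (asc C u v w) = u <> v <> w"
  "[|u : Mor C; v : Mor C; w : Mor C; src C u = tgt C v; src C v = tgt C w|] ==> invcell C (asc C u v w)"
  "u : Mor C ==> lun C u : Cell C" "u : Mor C ==> ddom C (lun C u) = unit_mor C (tgt C u) <> u"
  "u : Mor C ==> dcod C (lun C u) = u" "u : Mor C ==> invcell C (lun C u)"
  "u : Mor C ==> run C u : Cell C" "u : Mor C ==> ddom C (run C u) = u <> unit_mor C (src C u)"
  "u : Mor C ==> dcod C (run C u) = u" "u : Mor C ==> invcell C (run C u)"
 using asc[of u "src C u" "tgt C u" v "src C v" w "src C w"] lun[of u "src C u" "tgt C u"] run[of u "src C u" "tgt C u"]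
 by (auto simp: mem_mors mem_cells)

lemma asc_nat:
 assumes "a : Cell C" "b : Cell C" "c : Cell C" "src C (ddom C a) = tgt C (ddom C b)" "src C (ddom C b) = tgt C (ddom C c)"
 shows "asc C (dcod C a) (dcod C b) (dcod C c) ;; (a *. (b *. c)) = a *. b *. c ;; asc C (ddom C a) (ddom C b) (ddom C c)"
 using asc_natural[of "ddom C a" "src C (ddom C a)" "tgt C (ddom C a)" "ddom C b" "src C (ddom C b)" "ddom C c" "src C (ddom C c)"] assms
 by (auto simp: mem_mors mem_cells)

lemma lun_nat: "a : Cell C ==> tgt C (ddom C a) = x ==> lun C (dcod C a) ;; (vid C (unit_mor C x) *. a) = a ;; lun C (ddom C a)"
 using lun_natural[of "ddom C a" "src C (ddom C a)" x] by (auto simp: mem_mors mem_cells)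

lemma run_nat: "a : Cell C ==> src C (ddom C a) = x ==> run C (dcod C a) ;; (a *. vid C (unit_mor C x)) = a ;; run C (ddom C a)"
 using run_natural[of "ddom C a" x "tgt C (ddom C a)"] by (auto simp: mem_mors mem_cells)

lemma inverse_cells_unique:
 assumes "inverse_cells C a b" "inverse_cells C a b'" shows "b' = b"
proof -
 have "b' = b' ;; (a ;; b)" using assms by (auto simp: inverse_cells_def mem_cells)
 also have "... = b' ;; a ;; b" using assms by (subst v_assoc) (auto simp: inverse_cells_def mem_cells)
 also have "... = b" using assms by (auto simp: inverse_cells_def mem_cells)
 finally show ?thesis .
qed

lemma cell_inv_eq: "inverse_cells C a b ==> cinv C a = b"
 unfolding cell_inv_def using inverse_cells_unique by blast

lemma inverse_cell_inv: "invcell C a ==> inverse_cells C a (cinv C a)"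
 using cell_inv_eq unfolding invertible_cell_def by blast

lemma invertibleI: "inverse_cells C a b ==> invcell C a"
 by (auto simp: invertible_cell_def)

lemma inverse_cells_sym: "inverse_cells C a b ==> inverse_cells C b a"
 by (auto simp: inverse_cells_def mem_cells)

lemma cell_inv_simps [simp]:
 assumes "invcell C a"
 shows "cinv C a : Cell C" "ddom C (cinv C a) = dcod C a" "dcod C (cinv C a) = ddom C a"
  "invcell C (cinv C a)" "cinv C (cinv C a) = a"
  "cinv C a ;; a = vid C (ddom C a)" "a ;; cinv C a = vid C (dcod C a)"
 using inverse_cell_inv[OF assms] inverse_cells_sym[OF inverse_cell_inv[OF assms]] cell_inv_eq[OF inverse_cells_sym[OF inverse_cell_inv[OF assms]]]
  invertibleI[OF inverse_cells_sym[OF inverse_cell_inv[OF assms]]]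
 by (simp_all add: inverse_cells_def mem_cells)

lemma inv_Cell: "invcell C a ==> a : Cell C"
 by (auto simp: invertible_cell_def inverse_cells_def)

lemma inverse_cells_vid: "u : Mor C ==> inverse_cells C (vid C u) (vid C u)"
 by (simp add: inverse_cells_def mem_cells)

lemma inverse_cells_vcomp:
 assumes a: "invcell C a" and b: "invcell C b" and ab: "ddom C b = dcod C a"
 shows "inverse_cells C (b ;; a) (cinv C a ;; cinv C b)"
proof -
 note [simp] = inv_Cell[OF a] inv_Cell[OF b] a b ab
 have "cinv C a ;; cinv C b ;; (b ;; a) = cinv C a ;; (cinv C b ;; b ;; a)" by (simp add: v_assoc del: cell_inv_simps(6,7))
 moreover have "b ;; a ;; (cinv C a ;; cinv C b) = b ;; (a ;; cinv C a ;; cinv C b)" by (simp add: v_assoc del: cell_inv_simps(6,7))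
 ultimately show ?thesis by (simp add: inverse_cells_def mem_cells)
qed

lemma inverse_cells_hcomp:
 assumes a: "invcell C a" and b: "invcell C b" and ab: "src C (ddom C a) = tgt C (ddom C b)"
 shows "inverse_cells C (a *. b) (cinv C a *. cinv C b)"
 using inv_Cell[OF a] inv_Cell[OF b] assms
 by (simp add: inverse_cells_def mem_cells hcomp_vcomp)

lemma invertible_vid [simp]: "u : Mor C ==> invcell C (vid C u)" "u : Mor C ==> cinv C (vid C u) = vid C u"
 by (rule invertibleI, erule inverse_cells_vid) (rule cell_inv_eq, erule inverse_cells_vid)

lemma invertible_vcomp [simp]:
 "[|invcell C a; invcell C b; ddom C b = dcod C a|] ==> invcell C (b ;; a)"
 "[|invcell C a; invcell C b; ddom C b = dcod C a|] ==> cinv C (b ;; a) = cinv C a ;; cinv C b"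
 by (rule invertibleI, rule inverse_cells_vcomp; assumption) (rule cell_inv_eq, rule inverse_cells_vcomp; assumption)

lemma invertible_hcomp [simp]:
 "[|invcell C a; invcell C b; src C (ddom C a) = tgt C (ddom C b)|] ==> invcell C (a *. b)"
 "[|invcell C a; invcell C b; src C (ddom C a) = tgt C (ddom C b)|] ==> cinv C (a *. b) = cinv C a *. cinv C b"
 by (rule invertibleI, rule inverse_cells_hcomp; assumption) (rule cell_inv_eq, rule inverse_cells_hcomp; assumption)

lemma inv_cancel [simp]:
 assumes "invcell C a" "b : Cell C"
 shows "ddom C a = dcod C b ==> cinv C a ;; (a ;; b) = b" "dcod C a = dcod C b ==> a ;; (cinv C a ;; b) = b"
  "ddom C b = dcod C a ==> b ;; a ;; cinv C a = b" "ddom C b = ddom C a ==> b ;; cinv C a ;; a = b"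
proof -
 note i = inv_Cell[OF assms(1)] cell_inv_simps[OF assms(1)]
 show "cinv C a ;; (a ;; b) = b" if "ddom C a = dcod C b"
  by (subst v_assoc[symmetric]) (simp_all add: i assms that)
 show "a ;; (cinv C a ;; b) = b" if "dcod C a = dcod C b"
  by (subst v_assoc[symmetric]) (simp_all add: i assms that)
 show "b ;; a ;; cinv C a = b" if "ddom C b = dcod C a"
  by (subst v_assoc) (simp_all add: i assms that)
 show "b ;; cinv C a ;; a = b" if "ddom C b = ddom C a"
  by (subst v_assoc) (simp_all add: i assms that)
qed

lemma cancel_left:
 assumes "invcell C a" "b : Cell C" "c : Cell C" "ddom C a = dcod C b" "dcod C c = dcod C b" "a ;; b = a ;; c"
 shows "b = c"
proof -
 have "b = cinv C a ;; (a ;; b)" using inv_cancel(1)[OF assms(1,2,4)] by (rule sym)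
 also have "... = c" unfolding assms(6) by (rule inv_cancel(1)[OF assms(1,3)]) (simp only: assms(4,5))
 finally show ?thesis .
qed

lemma cancel_right:
 assumes "invcell C a" "b : Cell C" "c : Cell C" "ddom C b = dcod C a" "ddom C c = dcod C a" "b ;; a = c ;; a"
 shows "b = c"
proof -
 have "b = b ;; a ;; cinv C a" using inv_cancel(3)[OF assms(1,2,4)] by (rule sym)
 also have "... = c" unfolding assms(6) by (rule inv_cancel(3)[OF assms(1,3,5)])
 finally show ?thesis .
qed

lemma pentagon':
 "[|u : Mor C; v : Mor C; w : Mor C; k : Mor C; src C u = tgt C v; src C v = tgt C w; src C w = tgt C k|] ==>
  asc C (u <> v) w k ;; asc C u v (w <> k) = (asc C u v w *. vid C k) ;; (asc C u (v <> w) k ;; (vid C u *. asc C v w k))"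
 using pentagon[of u "src C u" "tgt C u" v "src C v" w "src C w" k "src C k"] by (simp add: mem_mors v_assoc)

lemma triangle':
 "[|u : Mor C; v : Mor C; src C u = tgt C v; x = tgt C v|] ==> (run C u *. vid C v) ;; asc C u (unit_mor C x) v = vid C u *. lun C v"
 using triangle[of u "src C u" "tgt C u" v "src C v"] by (simp add: mem_mors)

text \<open>Naturality of the left unit constraint makes composition with a unit conjugate to the
  identity. Equations between cells may thus be checked after whiskering with a unit.\<close>

lemma unit_left_faithful:
 assumes "a : Cell C" "b : Cell C" "ddom C a = ddom C b" "dcod C a = dcod C b" "x = tgt C (ddom C b)"
  "vid C (unit_mor C x) *. a = vid C (unit_mor C x) *. b"
 shows "a = b"
 by (rule cancel_right[of "lun C (ddom C b)"]) (use assms lun_nat[of a] lun_nat[of b] in auto)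

lemma unit_right_faithful:
 assumes "a : Cell C" "b : Cell C" "ddom C a = ddom C b" "dcod C a = dcod C b" "x = src C (ddom C b)"
  "a *. vid C (unit_mor C x) = b *. vid C (unit_mor C x)"
 shows "a = b"
 by (rule cancel_right[of "run C (ddom C b)"]) (use assms run_nat[of a] run_nat[of b] in auto)

lemma vid_whisker:
 "[|u : Mor C; a : Cell C; b : Cell C; src C u = tgt C (ddom C a); ddom C b = dcod C a|] ==>
  vid C u *. (b ;; a) = (vid C u *. b) ;; (vid C u *. a)"
 "[|u : Mor C; a : Cell C; b : Cell C; tgt C u = src C (ddom C a); ddom C b = dcod C a|] ==>
  (b ;; a) *. vid C u = (b *. vid C u) ;; (a *. vid C u)"
 by (simp_all add: hcomp_vcomp)

lemma hcomp_vcomp_tail: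
 assumes "a : Cell C" "a' : Cell C" "b : Cell C" "b' : Cell C" "ddom C a' = dcod C a" "ddom C b' = dcod C b"
  "src C (ddom C a) = tgt C (ddom C b)" "t : Cell C" "dcod C t = ddom C a <> ddom C b"
 shows "(a' *. b') ;; ((a *. b) ;; t) = (a' ;; a) *. (b' ;; b) ;; t"
 by (subst v_assoc[symmetric]) (use assms in "simp_all add: hcomp_vcomp")

lemma inverse_square:
 assumes "A ;; s = t ;; B" "invcell C A" "invcell C B" "s : Cell C" "t : Cell C"
  "ddom C A = dcod C s" "dcod C B = ddom C t" "ddom C s = ddom C B" "dcod C t = dcod C A"
 shows "s ;; cinv C B = cinv C A ;; t"
proof -
 note [simp] = assms(2-5) inv_Cell[OF assms(2)] inv_Cell[OF assms(3)]
 have "s ;; cinv C B = cinv C A ;; (A ;; s) ;; cinv C B"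
  using assms(6,8) by simp
 also have "... = cinv C A ;; (t ;; B ;; cinv C B)"
  unfolding assms(1) using assms(7,9) by (simp add: v_assoc)
 finally show ?thesis using assms(7) by simp
qed

text \<open>Kelly's argument: after whiskering with a unit on the left, the claim follows from the
  pentagon for 1, 1, \<open>u\<close>, \<open>v\<close> and two triangles.\<close>

lemma lun_mcomp:
 assumes [simp]: "u : Mor C" "v : Mor C" "src C u = tgt C v" "x = tgt C u"
 shows "(lun C u *. vid C v) ;; asc C (unit_mor C x) u v = lun C (u <> v)"
proof (rule unit_left_faithful[where x = "tgt C u"])
 let ?I = "unit_mor C (tgt C u)"
 let ?a = "asc C ?I u v"
 have "?a ;; (vid C ?I *. lun C (u <> v)) = ?a ;; ((run C ?I *. vid C (u <> v)) ;; asc C ?I ?I (u <> v))"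
  by (simp add: triangle')
 also have "... = ?a ;; (run C ?I *. (vid C u *. vid C v)) ;; asc C ?I ?I (u <> v)"
  by (simp add: v_assoc)
 also have "?a ;; (run C ?I *. (vid C u *. vid C v)) = (run C ?I *. vid C u *. vid C v) ;; asc C (?I <> ?I) u v"
  using asc_nat[of "run C ?I" "vid C u" "vid C v"] by simp
 also have "... ;; asc C ?I ?I (u <> v) = (run C ?I *. vid C u *. vid C v) ;;
   ((asc C ?I ?I u *. vid C v) ;; (asc C ?I (?I <> u) v ;; (vid C ?I *. ?a)))"
  by (simp add: v_assoc pentagon')
 also have "... = (((run C ?I *. vid C u) ;; asc C ?I ?I u) *. vid C v) ;; asc C ?I (?I <> u) v ;; (vid C ?I *. ?a)"
  by (simp add: vid_whisker(2) v_assoc)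
 also have "... = (vid C ?I *. lun C u *. vid C v) ;; asc C ?I (?I <> u) v ;; (vid C ?I *. ?a)"
  by (simp add: triangle')
 also have "... = ?a ;; (vid C ?I *. (lun C u *. vid C v)) ;; (vid C ?I *. ?a)"
  using asc_nat[of "vid C ?I" "lun C u" "vid C v"] by simp
 also have "... = ?a ;; (vid C ?I *. ((lun C u *. vid C v) ;; ?a))"
  by (simp add: vid_whisker(1) v_assoc)
 finally have "?a ;; (vid C ?I *. lun C (u <> v)) = ?a ;; (vid C ?I *. ((lun C u *. vid C v) ;; ?a))" .
 from cancel_left[OF _ _ _ _ _ this]
 show "vid C ?I *. ((lun C u *. vid C v) ;; asc C (unit_mor C x) u v) = vid C ?I *. lun C (u <> v)" by simp
qed simp_all

text \<open>The mirror image of \<open>lun_mcomp\<close>: whisker on the right and use the pentagon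
  for \<open>u\<close>, \<open>v\<close>, 1, 1.\<close>

lemma run_mcomp:
 assumes [simp]: "u : Mor C" "v : Mor C" "src C u = tgt C v" "x = src C v"
 shows "run C (u <> v) ;; asc C u v (unit_mor C x) = vid C u *. run C v"
proof (rule unit_right_faithful[where x = "src C v"])
 let ?I = "unit_mor C (src C v)"
 let ?b = "asc C u (v <> ?I) ?I ;; (vid C u *. asc C v ?I ?I)"
 have "((run C (u <> v) ;; asc C u v ?I) *. vid C ?I) ;; ?b
   = (run C (u <> v) *. vid C ?I) ;; asc C (u <> v) ?I ?I ;; asc C u v (?I <> ?I)"
  by (simp add: pentagon' vid_whisker(2) v_assoc)
 also have "... = vid C u *. vid C v *. lun C ?I ;; asc C u v (?I <> ?I)"
  by (simp add: triangle')
 also have "... = asc C u v ?I ;; (vid C u *. (vid C v *. lun C ?I))"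
  using asc_nat[of "vid C u" "vid C v" "lun C ?I"] by simp
 also have "... = asc C u v ?I ;; (vid C u *. (run C v *. vid C ?I)) ;; (vid C u *. asc C v ?I ?I)"
  by (subst triangle'[symmetric]) (simp_all, subst vid_whisker(1), simp_all add: v_assoc)
 also have "asc C u v ?I ;; (vid C u *. (run C v *. vid C ?I)) = (vid C u *. run C v *. vid C ?I) ;; asc C u (v <> ?I) ?I"
  using asc_nat[of "vid C u" "run C v" "vid C ?I"] by simp
 also have "... ;; (vid C u *. asc C v ?I ?I) = (vid C u *. run C v *. vid C ?I) ;; ?b"
  by (simp add: v_assoc)
 finally show "(run C (u <> v) ;; asc C u v (unit_mor C x)) *. vid C ?I = vid C u *. run C v *. vid C ?I"
  unfolding assms(4) by (rule cancel_right[rotated 5]) simp_all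
qed simp_all

text \<open>Naturality of the left unit constraint at its own component shows that whiskering it
  with the unit gives the component at the square of the unit. Comparing \<open>lun_mcomp\<close>
  with the triangle then identifies the two constraints.\<close>

lemma lun_unit: assumes [simp]: "x : Ob C" shows "lun C (unit_mor C x) = run C (unit_mor C x)"
proof (rule unit_right_faithful[where x = x])
 let ?I = "unit_mor C x"
 have "lun C ?I ;; (vid C ?I *. lun C ?I) = lun C ?I ;; lun C (?I <> ?I)"
  using lun_nat[of "lun C ?I"] by simp
 then have "vid C ?I *. lun C ?I = lun C (?I <> ?I)" by (rule cancel_left[rotated 5]) simp_all
 then have "(lun C ?I *. vid C ?I) ;; asc C ?I ?I ?I = (run C ?I *. vid C ?I) ;; asc C ?I ?I ?I"
  by (simp add: lun_mcomp triangle')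
 then show "lun C ?I *. vid C ?I = run C ?I *. vid C ?I" by (rule cancel_right[rotated 5]) simp_all
qed simp_all

end

text \<open>Dual bicategory with the deformations reversed; the constraints are inverted to keep
  their direction. Oplax functors to \<open>C\<close> are lax functors to \<open>co C\<close>, so
  each argument about lax functors is made once.\<close>

definition co :: "('o, 'm, 'd) bicat => ('o, 'm, 'd) bicat" where
 "co C = C(|ddom := dcod C, dcod := ddom C, vcomp := (%b a. vcomp C a b), asc := (%u v w. cinv C (asc C u v w)),
   lun := (%u. cinv C (lun C u)), run := (%u. cinv C (run C u))|)"

lemma co_simps [simp]:
 "Ob (co C) = Ob C" "Mor (co C) = Mor C" "Cell (co C) = Cell C" "src (co C) = src C" "tgt (co C) = tgt C"
 "ddom (co C) = dcod C" "dcod (co C) = ddom C" "vid (co C) = vid C" "vcomp (co C) b a = vcomp C a b"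
 "mcomp (co C) = mcomp C" "hcomp (co C) = hcomp C" "unit_mor (co C) = unit_mor C"
 "asc (co C) u v w = cinv C (asc C u v w)" "lun (co C) u = cinv C (lun C u)" "run (co C) u = cinv C (run C u)"
 "mors (co C) = mors C" "cells (co C) u v = cells C v u"
 by (auto simp: co_def mors_def cells_def fun_eq_iff)

lemma (in bicategory) co_invertible [simp]:
 "inverse_cells (co C) = inverse_cells C" "invcell (co C) = invcell C" "cinv (co C) = cinv C"
proof -
 show *: "inverse_cells (co C) = inverse_cells C"
  by (auto simp: inverse_cells_def mem_cells fun_eq_iff)
 show "invcell (co C) = invcell C" "cinv (co C) = cinv C"
  by (auto simp: invertible_cell_def cell_inv_def fun_eq_iff *)
qed

lemma (in bicategory) bicategory_co: "bicategory (co C)"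
proof (rule bicategory.intro, goal_cases)
 case (6 x y)
 have "hom_cat (co C) y x = op_cat (hom_cat C y x)"
  by (auto simp: hom_cat_def op_cat_def fun_eq_iff)
 then show ?case using category_op[OF hom_category] 6 by simp
next
 case (10 u y x v z a u' a' u'' b v' b' v'')
 then show ?case
  using hcomp_vcomp[of a' a b' b] src_dcod[of a] tgt_dcod[of b] src_dcod[of a'] tgt_dcod[of b']
  by (auto simp: mem_mors mem_cells)
next
 case (15 u y x v z w t a u' b v' c w')
 then have *: "a : Cell C" "b : Cell C" "c : Cell C" "dcod C a = u" "dcod C b = v" "dcod C c = w"
   "ddom C a = u'" "ddom C b = v'" "ddom C c = w'" "src C u = tgt C v" "src C v = tgt C w"
   by (auto simp: mem_mors mem_cells)
 have [simp]: "u' : Mor C" "v' : Mor C" "w' : Mor C" "src C u' = tgt C v'" "src C v' = tgt C w'"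
  using * ddom[of a] ddom[of b] ddom[of c] src_dcod[of a] src_dcod[of b] tgt_dcod[of b] tgt_dcod[of c] by simp_all
 have "asc C u v w ;; (a *. (b *. c)) = a *. b *. c ;; asc C u' v' w'"
  using asc_nat[of a b c] * by simp
 from inverse_square[OF this] show ?case using * 15(1-3) by (simp add: mem_mors)
next
 case (16 u y x a u')
 then have *: "a : Cell C" "dcod C a = u" "ddom C a = u'" "tgt C u' = x" "x : Ob C" "u' : Mor C" "u : Mor C" "tgt C u = x"
  using tgt_dcod[of a] ddom[of a] tgt[of u] by (auto simp: mem_mors mem_cells)
 have "lun C u ;; (vid C (unit_mor C x) *. a) = a ;; lun C u'" using lun_nat[of a x] * by simp
 from inverse_square[OF this] show ?case using * by simp
next
 case (17 u y x a u')
 then have *: "a : Cell C" "dcod C a = u" "ddom C a = u'" "src C u' = y" "y : Ob C" "u' : Mor C" "u : Mor C" "src C u = y"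
  using src_dcod[of a] ddom[of a] src[of u] by (auto simp: mem_mors mem_cells)
 have "run C u ;; (a *. vid C (unit_mor C y)) = a ;; run C u'" using run_nat[of a y] * by simp
 from inverse_square[OF this] show ?case using * by simp
next
 case (18 u y x v z w t k s)
 then have *: "u : Mor C" "v : Mor C" "w : Mor C" "k : Mor C" "src C u = tgt C v" "src C v = tgt C w" "src C w = tgt C k"
  by (auto simp: mem_mors)
 from arg_cong[OF pentagon'[OF *], of "cinv C"] show ?case using * by (simp add: v_assoc)
next
 case (19 u y x v z)
 then have *: "u : Mor C" "v : Mor C" "src C u = tgt C v" "y = tgt C v"
  by (auto simp: mem_mors)
 from arg_cong[OF triangle'[OF *], of "cinv C"] show ?case using * by simp
qed (auto simp: mem_mors mem_cells hcomp_vcomp)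

section \<open>Lax functors and their nerves\<close>

lemma restr_data_simps [simp]:
 "lob (restr_data p F) i = (if i <= p then lob F i else undefined)"
 "lmor (restr_data p F) i j = (if i <= j & j <= p then lmor F i j else undefined)"
 "lcmp (restr_data p F) i j k = (if i <= j & j <= k & k <= p then lcmp F i j k else undefined)"
 "lone (restr_data p F) i = (if i <= p then lone F i else undefined)"
 "restr_data p (restr_data p F) = restr_data p F"
 by (auto simp: restr_data_def fun_eq_iff)

lemma restr_simps [simp]:
 "restr p f i j = (if i <= j & j <= p then f i j else undefined)" "restr p (restr p f) = restr p f"
 by (auto simp: restr_trans_def fun_eq_iff)

lemma data_eqI:
 assumes "restr_data p F = F" "restr_data p G = G" "!!i. i <= p ==> lob F i = lob G i" "!!i j. i <= j ==> j <= p ==> lmor F i j = lmor G i j"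
  "!!i j k. i <= j ==> j <= k ==> k <= p ==> lcmp F i j k = lcmp G i j k" "!!i. i <= p ==> lone F i = lone G i"
 shows "F = G"
proof -
 have "restr_data p F = restr_data p G" using assms(3-6) by (auto simp: restr_data_def fun_eq_iff)
 then show ?thesis by (simp add: assms(1,2))
qed

lemma trans_eqI:
 assumes "restr p f = f" "restr p g = g" "!!i j. i <= j ==> j <= p ==> f i j = g i j"
 shows "f = g"
proof -
 have "restr p f = restr p g" using assms(3) by (auto simp: restr_trans_def fun_eq_iff)
 then show ?thesis by (simp add: assms(1,2))
qed

lemma Delta_le: "a : Delta q p ==> i <= q ==> a i <= p" "a : Delta q p ==> i <= j ==> j <= q ==> a i <= a j"
 by (auto simp: Delta_def mono_on_def PiE_def Pi_def)

lemma pull_simps [simp]: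
 "lob (pulld q a F) i = (if i <= q then lob F (a i) else undefined)"
 "lmor (pulld q a F) i j = (if i <= j & j <= q then lmor F (a i) (a j) else undefined)"
 "lcmp (pulld q a F) i j k = (if i <= j & j <= k & k <= q then lcmp F (a i) (a j) (a k) else undefined)"
 "lone (pulld q a F) i = (if i <= q then lone F (a i) else undefined)"
 "restr_data q (pulld q a F) = pulld q a F"
 "pull_trans q a f i j = (if i <= j & j <= q then f (a i) (a j) else undefined)"
 "restr q (pull_trans q a f) = pull_trans q a f"
 by (simp_all add: pull_data_def pull_trans_def)

lemma pull_comp:
 assumes b: "b : Delta r q"
 shows "pulld r b (pulld q a F) = pulld r (cp r a b) F"
  "pull_trans r b (pull_trans q a f) = pull_trans r (cp r a b) f"
 by (rule data_eqI[of r]; simp add: compose_def Delta_le[OF b]) (rule trans_eqI[of r]; simp add: compose_def Delta_le[OF b])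

lemma pull_id:
 "restr_data p F = F ==> pulld p (Did p) F = F"
 "restr p f = f ==> pull_trans p (Did p) f = f"
 by (rule data_eqI[of p]; simp add: Delta_id_def) (rule trans_eqI[of p]; simp add: Delta_id_def)

lemma restr_trans_cong:
 "(!!i j. i <= j ==> j <= p ==> f i j = g i j) ==> restr p f = restr p g"
 by (auto simp: restr_trans_def fun_eq_iff)

lemma pull_restr:
 "a : Delta q p ==> pull_trans q a (restr p f) = restr q (%i j. f (a i) (a j))"
 unfolding pull_trans_def by (rule restr_trans_cong) (simp add: Delta_le)

lemma fnerve_simps [simp]:
 "lobs (fnerve C P T) p = {F. P p F}"
 "x : lars (fnerve C P T) p <-> P p (fst x) & P p (fst (snd x)) & T p (fst x) (fst (snd x)) (snd (snd x))"
 "ldm (fnerve C P T) p x = fst x" "lcd (fnerve C P T) p x = fst (snd x)"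
 "lidn (fnerve C P T) p F = (F, F, restr p (%i j. vid C (lmor F i j)))"
 "lcp (fnerve C P T) p y x = (fst x, fst (snd y), restr p (%i j. vcomp C (snd (snd y) i j) (snd (snd x) i j)))"
 "pb_ob (fnerve C P T) q p a F = pulld q a F"
 "pb_ar (fnerve C P T) q p a x = (pulld q a (fst x), pulld q a (fst (snd x)), pull_trans q a (snd (snd x)))"
 by (auto simp: functor_nerve_def strict_simp_cat_def functor_cat_def case_prod_unfold)

definition base_data where
 "base_data C p F <-> restr_data p F = F & (ALL i j. i <= j & j <= p --> lmor F i j : Mor C)"

text \<open>The closure properties under which a class of functors and transformations forms a
  strict simplicial category; all five functor nerves are instances.\<close>

locale ftype = bicategory C for C :: "('o, 'm, 'd) bicat" (structure) +
 fixes P :: "nat => ('o, 'm, 'd) lax_data => bool" and T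
 assumes base: "P p F ==> base_data C p F"
  and pullP: "a : Delta q p ==> P p F ==> P q (pulld q a F)"
  and family: "P p F ==> P p F' ==> T p F F' al ==> trans_family C p F F' al"
  and idT: "P p F ==> T p F F (restr p (%i j. vid C (lmor F i j)))"
  and cmpT: "P p F ==> P p F' ==> P p F'' ==> T p F F' al ==> T p F' F'' be ==> T p F F'' (restr p (%i j. vcomp C (be i j) (al i j)))"
  and pullT: "a : Delta q p ==> P p F ==> P p F' ==> T p F F' al ==> T q (pulld q a F) (pulld q a F') (pull_trans q a al)"
begin

abbreviation "NV == fnerve C P T"

lemma familyD:
 assumes "P p F" "P p F'" "T p F F' al"
 shows "restr p al = al" "i <= j ==> j <= p ==> al i j : Cell C"
  "i <= j ==> j <= p ==> ddom C (al i j) = lmor F i j" "i <= j ==> j <= p ==> dcod C (al i j) = lmor F' i j"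
 using family[OF assms] by (auto simp: trans_family_def mem_cells)

lemma category_functors: "category (level NV p)"
proof (unfold_locales, goal_cases)
 case (3 F) then show ?case using idT by simp
next
 case (4 f g) then show ?case using cmpT by auto
next
 case (5 f)
 then have f: "P p (fst f)" "P p (fst (snd f))" "T p (fst f) (fst (snd f)) (snd (snd f))" by auto
 have "restr p (%i j. snd (snd f) i j ;; restr p (%i j. vid C (lmor (fst f) i j)) i j) = snd (snd f)"
  by (rule trans_eqI[of p]) (simp_all add: familyD[OF f])
 then show ?case by (simp add: prod_eq_iff)
next
 case (6 f)
 then have f: "P p (fst f)" "P p (fst (snd f))" "T p (fst f) (fst (snd f)) (snd (snd f))" by auto
 have "restr p (%i j. restr p (%i j. vid C (lmor (fst (snd f)) i j)) i j ;; snd (snd f) i j) = snd (snd f)"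
  by (rule trans_eqI[of p]) (simp_all add: familyD[OF f])
 then show ?case by (simp add: prod_eq_iff)
next
 case (7 f g h)
 then have f: "P p (fst f)" "P p (fst (snd f))" "T p (fst f) (fst (snd f)) (snd (snd f))"
  and g: "P p (fst g)" "P p (fst (snd g))" "T p (fst g) (fst (snd g)) (snd (snd g))"
  and h: "P p (fst h)" "P p (fst (snd h))" "T p (fst h) (fst (snd h)) (snd (snd h))" by auto
 have "fst h = fst (snd g)" "fst g = fst (snd f)" using 7 by simp_all
 then show ?case
  by (auto simp: fun_eq_iff restr_trans_def v_assoc familyD[OF f] familyD[OF g] familyD[OF h])
qed auto

sublocale strict_simp NV
proof (rule strict_simp.intro, goal_cases)
 case (1 p) then show ?case by (rule category_functors)
next
 case (2 a q p)
 note a = Delta_le[OF 2]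
 show ?case
  by (rule functrI) (simp_all add: pullP[OF 2] pullT[OF 2] a pull_restr[OF 2] cong: restr_trans_cong)
next
 case (5 x p) then show ?case using base[of p x] by (simp add: base_data_def pull_id)
next
 case (6 u p)
 then have u: "P p (fst u)" "P p (fst (snd u))" "T p (fst u) (fst (snd u)) (snd (snd u))" by auto
 show ?case using base[OF u(1)] base[OF u(2)] familyD(1)[OF u] by (simp add: base_data_def pull_id prod_eq_iff)
qed (auto simp: pull_comp, auto simp: functor_nerve_def strict_simp_cat_def functor_cat_def)

end

locale lax_fun = bicategory C for C :: "('o, 'm, 'd) bicat" (structure) +
 fixes p F assumes F: "laxF C p F"
begin

lemma lax_restr: "restr_data p F = F"
 using F by (simp add: lax_functor_def)

lemma lax_data [simp]:
 "i <= p ==> lob F i : Ob C" "i <= j ==> j <= p ==> lmor F i j : Mor C"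
 "i <= j ==> j <= p ==> src C (lmor F i j) = lob F j" "i <= j ==> j <= p ==> tgt C (lmor F i j) = lob F i"
 "i <= j ==> j <= k ==> k <= p ==> lcmp F i j k : Cell C"
 "i <= j ==> j <= k ==> k <= p ==> ddom C (lcmp F i j k) = lmor F i j <> lmor F j k"
 "i <= j ==> j <= k ==> k <= p ==> dcod C (lcmp F i j k) = lmor F i k"
 "i <= p ==> lone F i : Cell C" "i <= p ==> ddom C (lone F i) = unit_mor C (lob F i)" "i <= p ==> dcod C (lone F i) = lmor F i i"
proof -
 have *: "ALL i<=p. lob F i : Ob C"
  "ALL i j. i <= j & j <= p --> lmor F i j : Mor C & src C (lmor F i j) = lob F j & tgt C (lmor F i j) = lob F i"
  "ALL i j k. i <= j & j <= k & k <= p --> lcmp F i j k : Cell C & ddom C (lcmp F i j k) = lmor F i j <> lmor F j k &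
   dcod C (lcmp F i j k) = lmor F i k"
  "ALL i<=p. lone F i : Cell C & ddom C (lone F i) = unit_mor C (lob F i) & dcod C (lone F i) = lmor F i i"
  using F unfolding lax_functor_def mem_mors mem_cells by - ((elim conjE, assumption)+)
 show "i <= p ==> lob F i : Ob C" "i <= j ==> j <= p ==> lmor F i j : Mor C"
  "i <= j ==> j <= p ==> src C (lmor F i j) = lob F j" "i <= j ==> j <= p ==> tgt C (lmor F i j) = lob F i"
  "i <= j ==> j <= k ==> k <= p ==> lcmp F i j k : Cell C"
  "i <= j ==> j <= k ==> k <= p ==> ddom C (lcmp F i j k) = lmor F i j <> lmor F j k"
  "i <= j ==> j <= k ==> k <= p ==> dcod C (lcmp F i j k) = lmor F i k"
  "i <= p ==> lone F i : Cell C" "i <= p ==> ddom C (lone F i) = unit_mor C (lob F i)" "i <= p ==> dcod C (lone F i) = lmor F i i"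
  using * by simp_all
qed

lemma lax_assoc: "i <= j ==> j <= k ==> k <= l ==> l <= p ==>
  lcmp F i j l ;; (vid C (lmor F i j) *. lcmp F j k l) =
  lcmp F i k l ;; ((lcmp F i j k *. vid C (lmor F k l)) ;; asc C (lmor F i j) (lmor F j k) (lmor F k l))"
 using F[unfolded lax_functor_def, THEN conjunct2, THEN conjunct2, THEN conjunct2, THEN conjunct2, THEN conjunct2, THEN conjunct1, rule_format, of i j k l]
 by (simp add: v_assoc)

lemma lax_unit:
 "i <= j ==> j <= p ==> lcmp F i j j ;; (vid C (lmor F i j) *. lone F j) = run C (lmor F i j)"
 "i <= j ==> j <= p ==> lcmp F i i j ;; (lone F i *. vid C (lmor F i j)) = lun C (lmor F i j)"
 using F[unfolded lax_functor_def, THEN conjunct2, THEN conjunct2, THEN conjunct2, THEN conjunct2, THEN conjunct2, THEN conjunct2, rule_format, of i j]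
 by simp_all

end

context bicategory
begin

lemma laxFI:
 assumes "restr_data p F = F" and [simp]: "!!i. i <= p ==> lob F i : Ob C"
  "!!i j. i <= j ==> j <= p ==> lmor F i j : Mor C & src C (lmor F i j) = lob F j & tgt C (lmor F i j) = lob F i"
  "!!i j k. i <= j ==> j <= k ==> k <= p ==> lcmp F i j k : Cell C & ddom C (lcmp F i j k) = lmor F i j <> lmor F j k
    & dcod C (lcmp F i j k) = lmor F i k"
  "!!i. i <= p ==> lone F i : Cell C & ddom C (lone F i) = unit_mor C (lob F i) & dcod C (lone F i) = lmor F i i"
  and a: "!!i j k l. i <= j ==> j <= k ==> k <= l ==> l <= p ==>
   lcmp F i j l ;; (vid C (lmor F i j) *. lcmp F j k l) =
   lcmp F i k l ;; ((lcmp F i j k *. vid C (lmor F k l)) ;; asc C (lmor F i j) (lmor F j k) (lmor F k l))"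
  and u: "!!i j. i <= j ==> j <= p ==> lcmp F i j j ;; (vid C (lmor F i j) *. lone F j) = run C (lmor F i j)"
   "!!i j. i <= j ==> j <= p ==> lcmp F i i j ;; (lone F i *. vid C (lmor F i j)) = lun C (lmor F i j)"
 shows "laxF C p F"
 unfolding lax_functor_def mem_mors mem_cells
 by (intro conjI allI impI; (elim conjE)?; simp add: assms v_assoc)

lemma laxTI:
 assumes "restr p f = f" "!!i. i <= p ==> lob F i = lob G i"
  "!!i j. i <= j ==> j <= p ==> f i j : Cell C & ddom C (f i j) = lmor F i j & dcod C (f i j) = lmor G i j"
  "!!i j k. i <= j ==> j <= k ==> k <= p ==> lcmp G i j k ;; (f i j *. f j k) = f i k ;; lcmp F i j k"
  "!!i. i <= p ==> f i i ;; lone F i = lone G i"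
 shows "laxT C p F G f"
 unfolding lax_trans_def trans_family_def mem_cells using assms by blast

lemma laxTD:
 assumes "laxT C p F G f"
 shows "restr p f = f" "i <= p ==> lob F i = lob G i"
  "i <= j ==> j <= p ==> f i j : Cell C" "i <= j ==> j <= p ==> ddom C (f i j) = lmor F i j"
  "i <= j ==> j <= p ==> dcod C (f i j) = lmor G i j"
  "i <= j ==> j <= k ==> k <= p ==> lcmp G i j k ;; (f i j *. f j k) = f i k ;; lcmp F i j k"
  "i <= p ==> f i i ;; lone F i = lone G i"
 using assms unfolding lax_trans_def trans_family_def mem_cells by blast+

lemma lax_trans_family: "laxT C p F G f ==> trans_family C p F G f"
 by (simp add: lax_trans_def)

text \<open>If \<open>c\<close> is compatible with the composition cells of \<open>M\<close> and
  \<open>F\<close>, then the associativity of \<open>F\<close> gives that of \<open>M\<close> after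
  composition with \<open>c i l\<close>. It is applied where \<open>c i l\<close> is an identity,
  for mixtures and for normalization.\<close>

lemma (in lax_fun) assoc_transfer:
 assumes M: "!!i j. i <= j ==> j <= p ==> lmor M i j : Mor C & src C (lmor M i j) = lob F j & tgt C (lmor M i j) = lob F i"
  and L: "!!i j k. i <= j ==> j <= k ==> k <= p ==> lcmp M i j k : Cell C & ddom C (lcmp M i j k) = lmor M i j <> lmor M j k &
   dcod C (lcmp M i j k) = lmor M i k"
  and c: "!!i j. i <= j ==> j <= p ==> c i j : Cell C & ddom C (c i j) = lmor M i j & dcod C (c i j) = lmor F i j"
  and cmp: "!!i j k. i <= j ==> j <= k ==> k <= p ==> lcmp F i j k ;; (c i j *. c j k) = c i k ;; lcmp M i j k"
  and ijkl: "i <= j" "j <= k" "k <= l" "l <= p"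
 shows "c i l ;; (lcmp M i j l ;; (vid C (lmor M i j) *. lcmp M j k l)) =
  c i l ;; (lcmp M i k l ;; ((lcmp M i j k *. vid C (lmor M k l)) ;; asc C (lmor M i j) (lmor M j k) (lmor M k l)))"
proof -
 have "c i l ;; (lcmp M i j l ;; (vid C (lmor M i j) *. lcmp M j k l)) = lcmp F i j l ;; (c i j *. c j l) ;; (vid C (lmor M i j) *. lcmp M j k l)"
  using ijkl by (simp add: cmp M L c flip: v_assoc)
 also have "... = lcmp F i j l ;; (c i j *. (lcmp F j k l ;; (c j k *. c k l)))"
  using cmp[of j k l] ijkl by (simp add: M L c v_assoc hcomp_vcomp)
 also have "... = lcmp F i j l ;; (vid C (lmor F i j) *. lcmp F j k l) ;; (c i j *. (c j k *. c k l))"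
  using ijkl by (simp add: M L c v_assoc hcomp_vcomp)
 also have "... = lcmp F i k l ;; (lcmp F i j k *. vid C (lmor F k l)) ;; (asc C (lmor F i j) (lmor F j k) (lmor F k l) ;; (c i j *. (c j k *. c k l)))"
  using ijkl by (simp add: M L c lax_assoc v_assoc)
 also have "... = lcmp F i k l ;; (lcmp F i j k *. vid C (lmor F k l)) ;; ((c i j *. c j k *. c k l) ;; asc C (lmor M i j) (lmor M j k) (lmor M k l))"
  using asc_nat[of "c i j" "c j k" "c k l"] ijkl by (simp add: M L c)
 also have "... = lcmp F i k l ;; (c i k *. c k l) ;; (lcmp M i j k *. vid C (lmor M k l)) ;; asc C (lmor M i j) (lmor M j k) (lmor M k l)"
  using cmp[of i j k] ijkl by (simp add: M L c v_assoc hcomp_vcomp hcomp_vcomp_tail)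
 also have "... = c i l ;; (lcmp M i k l ;; ((lcmp M i j k *. vid C (lmor M k l)) ;; asc C (lmor M i j) (lmor M j k) (lmor M k l)))"
  using cmp[of i k l] ijkl by (simp add: M L c v_assoc)
 finally show ?thesis .
qed

lemma laxF_pull:
 assumes a: "a : Delta q p" and "laxF C p F" shows "laxF C q (pulld q a F)"
proof -
 interpret lax_fun C p F by unfold_locales fact
 note [simp] = Delta_le[OF a] lax_unit
 have [simp]: "i <= j ==> j <= k ==> k <= q ==> a i <= a k" for i j k using Delta_le(2)[OF a] by simp
 show ?thesis by (rule laxFI) (simp_all add: lax_assoc)
qed

lemma laxT_pull:
 assumes a: "a : Delta q p" and f: "laxT C p F G f"
 shows "laxT C q (pulld q a F) (pulld q a G) (pull_trans q a f)"
 by (rule laxTI) (auto simp: laxTD[OF f] Delta_le[OF a])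

lemma lax_trans_id:
 assumes "laxF C p F" shows "laxT C p F F (restr p (%i j. vid C (lmor F i j)))"
proof -
 interpret lax_fun C p F by unfold_locales fact
 show ?thesis by (rule laxTI) simp_all
qed

lemma laxT_comp:
 assumes "laxF C p F" "laxF C p G" "laxF C p H" and f: "laxT C p F G f" and g: "laxT C p G H g"
 shows "laxT C p F H (restr p (%i j. g i j ;; f i j))"
proof -
 interpret F: lax_fun C p F by unfold_locales fact
 interpret G: lax_fun C p G by unfold_locales fact
 interpret H: lax_fun C p H by unfold_locales fact
 note f = laxTD[OF f] and g = laxTD[OF g]
 show ?thesis
 proof (rule laxTI, goal_cases)
  case (4 i j k)
  have "lcmp H i j k ;; ((g i j ;; f i j) *. (g j k ;; f j k)) = lcmp H i j k ;; (g i j *. g j k) ;; (f i j *. f j k)"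
   using 4 by (simp add: f(3-5) g(3-5) hcomp_vcomp v_assoc)
  also have "... = g i k ;; (lcmp G i j k ;; (f i j *. f j k))"
   using 4 by (simp add: f(3-5) g(3-6) v_assoc)
  also have "... = g i k ;; f i k ;; lcmp F i j k"
   using 4 by (simp add: f(3-6) g(3-5) v_assoc)
  finally show ?case using 4 by simp
 qed (simp_all add: f g v_assoc)
qed

lemma ftype_lax:
 assumes "!!p F. P p F ==> laxF C p F" "!!q p a F. a : Delta q p ==> P p F ==> P q (pulld q a F)"
 shows "ftype C P (laxT C)"
proof (unfold_locales, goal_cases)
 case (1 p F)
 interpret lax_fun C p F by unfold_locales (rule assms(1)[OF 1])
 show ?case by (simp add: base_data_def lax_restr)
qed (use assms in "auto intro: laxT_pull lax_trans_id laxT_comp lax_trans_family")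

lemma oplax_functor_co: "oplax_functor C p F <-> laxF (co C) p F"
proof -
 \<comment> \<open>The oplax axioms have the constraint on the left-hand side, the lax axioms in
   \<open>co C\<close> its inverse on the other side.\<close>
 have e: "A ;; X ;; L = Y <-> X ;; L = cinv C A ;; Y"
  if "invcell C A" "X : Cell C" "L : Cell C" "Y : Cell C" "dcod C X = ddom C A" "dcod C L = ddom C X" "dcod C Y = dcod C A" for A X L Y
  using that inv_Cell[OF that(1)] by (auto simp: v_assoc)
 show ?thesis
  unfolding oplax_functor_def lax_functor_def
 proof (intro conj_cong refl, goal_cases)
  case 5
  then have 1: "i <= j ==> j <= p ==> lmor F i j : Mor C & src C (lmor F i j) = lob F j & tgt C (lmor F i j) = lob F i"
   "i <= j ==> j <= k ==> k <= p ==> lcmp F i j k : Cell C & dcod C (lcmp F i j k) = lmor F i j <> lmor F j k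
    & ddom C (lcmp F i j k) = lmor F i k" for i j k by (simp_all add: mem_mors mem_cells)
  show ?case
   by (intro all_cong1 imp_cong refl, elim conjE, subst e) (simp_all add: 1)
 next
  case 6
  then have 1: "i <= j ==> j <= p ==> lmor F i j : Mor C & src C (lmor F i j) = lob F j & tgt C (lmor F i j) = lob F i"
   "i <= j ==> j <= k ==> k <= p ==> lcmp F i j k : Cell C & dcod C (lcmp F i j k) = lmor F i j <> lmor F j k
    & ddom C (lcmp F i j k) = lmor F i k" 
   "i <= p ==> lob F i : Ob C & lone F i : Cell C & dcod C (lone F i) = unit_mor C (lob F i) & ddom C (lone F i) = lmor F i i" for i j k
   by (simp_all add: mem_mors mem_cells)
  show ?case
   by (intro all_cong1 imp_cong refl conj_cong; elim conjE; subst e; simp add: 1)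
 qed simp_all
qed

lemma normal_data_co [simp]: "normal_data (co C) = normal_data C"
 by (simp add: normal_data_def fun_eq_iff)

lemma oplaxT_co: "oplaxT C p F G f <-> laxT (co C) p G F f"
 by (auto simp: oplax_trans_def lax_trans_def trans_family_def)

lemma ftype_oplax:
 assumes P: "!!p F. P p F ==> laxF (co C) p F" "!!q p a F. a : Delta q p ==> P p F ==> P q (pulld q a F)"
 shows "ftype C P (oplaxT C)"
proof -
 interpret co: bicategory "co C" by (rule bicategory_co)
 interpret ftype "co C" P "laxT (co C)" by (rule co.ftype_lax) (fact P)+
 show ?thesis
 proof (unfold_locales, goal_cases)
  case (5 p F F' F'' f g)
  then show ?case using cmpT[of p F'' F' F g f] by (simp add: oplaxT_co)
 qed (use base P pullT idT in "auto simp: base_data_def oplaxT_co oplax_trans_def[THEN iffD1, THEN conjunct1]")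
qed

end

section \<open>Mixing the source and the target of a transformation\<close>

text \<open>For \<open>f\<close> from \<open>F\<close> to \<open>G\<close>, \<open>mix_to\<close>
  and \<open>mix_from\<close> factor \<open>f\<close> through \<open>mix_data\<close>, which is
  \<open>F\<close> between indices marked by \<open>g\<close> and \<open>G\<close> elsewhere. Its
  composition cells with an unmarked end first push both factors to \<open>G\<close>.\<close>

definition mix_to where
 "mix_to C p g G f = restr p (%i j. if g i & g j then f i j else vid C (lmor G i j))"

definition mix_from where
 "mix_from C p g F f = restr p (%i j. if g i & g j then vid C (lmor F i j) else f i j)"

definition mix_data :: "('o, 'm, 'd) bicat => nat => (nat => bool) => ('o, 'm, 'd) lax_data =>
  ('o, 'm, 'd) lax_data => (nat => nat => 'd) => ('o, 'm, 'd) lax_data" where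
 "mix_data C p g F G f = restr_data p
   (|lob = lob G, lmor = (%i j. if g i & g j then lmor F i j else lmor G i j),
   lcmp = (%i j k. if g i & g k then lcmp F i j k
    else vcomp C (lcmp G i j k) (hcomp C (mix_to C p g G f i j) (mix_to C p g G f j k))),
   lone = (%i. if g i then lone F i else lone G i)|)"

lemma mix_data_simps [simp]:
 "restr_data p (mix_data C p g F G f) = mix_data C p g F G f"
 "i <= p ==> lob (mix_data C p g F G f) i = lob G i"
 "i <= j ==> j <= p ==> lmor (mix_data C p g F G f) i j = (if g i & g j then lmor F i j else lmor G i j)"
 "i <= j ==> j <= k ==> k <= p ==> lcmp (mix_data C p g F G f) i j k = (if g i & g k then lcmp F i j k
   else vcomp C (lcmp G i j k) (hcomp C (mix_to C p g G f i j) (mix_to C p g G f j k)))"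
 "i <= p ==> lone (mix_data C p g F G f) i = (if g i then lone F i else lone G i)"
 by (simp_all add: mix_data_def)

lemma mix_simps:
 "i <= j ==> j <= p ==> mix_to C p g G f i j = (if g i & g j then f i j else vid C (lmor G i j))"
 "restr p (mix_to C p g G f) = mix_to C p g G f"
 "i <= j ==> j <= p ==> mix_from C p g F f i j = (if g i & g j then vid C (lmor F i j) else f i j)"
 "restr p (mix_from C p g F f) = mix_from C p g F f"
 by (simp_all add: mix_to_def mix_from_def)

lemma pull_mix:
 assumes b: "b : Delta r q" and g: "!!i. i <= r ==> g' i = g (b i)"
 shows "pull_trans r b (mix_to C q g G f) = mix_to C r g' (pulld r b G) (pull_trans r b f)"
  "pull_trans r b (mix_from C q g F f) = mix_from C r g' (pulld r b F) (pull_trans r b f)"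
  "pulld r b (mix_data C q g F G f) = mix_data C r g' (pulld r b F) (pulld r b G) (pull_trans r b f)"
proof -
 show "pull_trans r b (mix_to C q g G f) = mix_to C r g' (pulld r b G) (pull_trans r b f)"
  "pull_trans r b (mix_from C q g F f) = mix_from C r g' (pulld r b F) (pull_trans r b f)"
  by (rule trans_eqI[of r]; simp add: mix_simps Delta_le[OF b] g)+
 show "pulld r b (mix_data C q g F G f) = mix_data C r g' (pulld r b F) (pulld r b G) (pull_trans r b f)"
  by (rule data_eqI[of r]) (simp_all add: mix_simps Delta_le[OF b] g)
qed

locale lax_tra = bicategory C + F: lax_fun C p F + G: lax_fun C p G for C (structure) and p F G +
 fixes f assumes f: "laxT C p F G f"
begin

lemmas trans_simps [simp] = laxTD(3-5)[OF f]
lemmas trans_restr = laxTD(1)[OF f]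
lemmas trans_lob = laxTD(2)[OF f]
lemmas trans_cmp = laxTD(6)[OF f]
lemmas trans_one = laxTD(7)[OF f]

text \<open>Convexity of the marked indices ensures that a composition with marked ends takes place
  entirely in \<open>F\<close>.\<close>

context
 fixes g :: "nat => bool"
 assumes convex: "!!i j k. i <= j ==> j <= k ==> k <= p ==> g i ==> g k ==> g j"
begin

abbreviation "M == mix_data C p g F G f"
abbreviation "c == mix_to C p g G f"
abbreviation "d == mix_from C p g F f"

lemma c_simps [simp]:
 assumes "i <= j" "j <= p"
 shows "c i j : Cell C" "ddom C (c i j) = lmor M i j" "dcod C (c i j) = lmor G i j"
  "d i j : Cell C" "ddom C (d i j) = lmor F i j" "dcod C (d i j) = lmor M i j"
 using assms by (auto simp: mix_simps)

lemma c_cmp: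
 assumes "i <= j" "j <= k" "k <= p" shows "lcmp G i j k ;; (c i j *. c j k) = c i k ;; lcmp M i j k"
 using assms convex[of i j k] trans_cmp[of i j k] by (auto simp: mix_simps trans_lob)

lemma c_one: "i <= p ==> c i i ;; lone M i = lone G i"
 using trans_one[of i] by (auto simp: mix_simps)

text \<open>Between marked ends the laws are those of \<open>F\<close>. Otherwise
  \<open>mix_to\<close> is an identity between the outer indices, so associativity comes from
  \<open>G\<close> by \<open>assoc_transfer\<close>, and the unit laws of \<open>G\<close> apply
  through \<open>c_one\<close>.\<close>

lemma lax_functor_mix: "laxF C p M"
proof (rule laxFI, goal_cases)
 case 1 then show ?case by simp
next
 case (2 i) then show ?case by simp
next
 case (3 i j) then show ?case by (simp add: trans_lob)
next
 case (4 i j k) then show ?case using convex[OF 4] by (auto simp: trans_lob)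
next
 case (5 i) then show ?case by (simp add: trans_lob)
next
 case (6 i j k l)
 show ?case
 proof (cases "g i & g l")
  case True
  then have "g j" "g k" using convex[of i j l] convex[of i k l] 6 by auto
  then show ?thesis using True 6 F.lax_assoc[OF 6] by simp
 next
  case False
  have M: "i <= j ==> j <= p ==> lmor M i j : Mor C & src C (lmor M i j) = lob G j & tgt C (lmor M i j) = lob G i" for i j
   by (simp add: trans_lob)
  have L: "i <= j ==> j <= k ==> k <= p ==> lcmp M i j k : Cell C & ddom C (lcmp M i j k) = lmor M i j <> lmor M j k &
   dcod C (lcmp M i j k) = lmor M i k" for i j k
   using convex[of i j k] by (auto simp: trans_lob)
  have "c i l = vid C (lmor G i l)" "lmor M i l = lmor G i l" using False 6 by (auto simp: mix_simps mix_data_simps)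
  then show ?thesis
   using G.assoc_transfer[where M = M and c = c, OF _ _ _ c_cmp 6] 6 by (simp add: M L del: mix_data_simps(3,4))
 qed
next
 case (7 i j)
 show ?case
 proof (cases "g i & g j")
  case True then show ?thesis using 7 F.lax_unit(1)[OF 7] by simp
 next
  case False
  then have "lcmp M i j j ;; (vid C (lmor M i j) *. lone M j) = lcmp G i j j ;; (vid C (lmor G i j) *. (c j j ;; lone M j))"
   using 7 by (auto simp: v_assoc hcomp_vcomp mix_simps trans_lob)
  then show ?thesis using False 7 c_one[of j] G.lax_unit(1)[OF 7] by auto
 qed
next
 case (8 i j)
 show ?case
 proof (cases "g i & g j")
  case True then show ?thesis using 8 F.lax_unit(2)[OF 8] by simp
 next
  case False
  then have "lcmp M i i j ;; (lone M i *. vid C (lmor M i j)) = lcmp G i i j ;; ((c i i ;; lone M i) *. vid C (lmor G i j))"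
   using 8 by (auto simp: v_assoc hcomp_vcomp mix_simps trans_lob)
  then show ?thesis using False 8 c_one[of i] G.lax_unit(2)[OF 8] by auto
 qed
qed

lemma lax_trans_mix_to: "laxT C p M G c"
 by (rule laxTI) (auto simp: c_cmp c_one mix_simps(2) simp del: mix_data_simps(3,4,5))

lemma c_d: "i <= j ==> j <= p ==> c i j ;; d i j = f i j"
 by (simp add: mix_simps)

lemma lax_trans_mix_from: "laxT C p F M d"
proof (rule laxTI, goal_cases)
 case (4 i j k)
 interpret M: lax_fun C p M by unfold_locales (rule lax_functor_mix)
 show ?case
 proof (cases "g i & g k")
  case True then show ?thesis using convex[of i j k] 4 by (simp add: mix_simps)
 next
  case False
  then have "lcmp M i j k ;; (d i j *. d j k) = lcmp G i j k ;; ((c i j ;; d i j) *. (c j k ;; d j k))"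
   using 4 by (auto simp: v_assoc hcomp_vcomp trans_lob simp del: mix_data_simps(3))
  then show ?thesis using False 4 trans_cmp[of i j k] by (auto simp: c_d mix_simps)
 qed
qed (auto simp: mix_simps trans_lob trans_one)

end

end

lemma convex_Delta:
 "h : Delta q 1 ==> i <= j ==> j <= k ==> k <= q ==> h i = v ==> h k = v ==> h j = v"
 using Delta_le(2)[of h q 1 i j] Delta_le(2)[of h q 1 j k] by auto

lemma mix_const:
 "restr_data p G = G ==> restr_data p F = F ==> (!!i. i <= p ==> lob F i = lob G i) ==> (!!i. i <= p ==> g i) ==> mix_data C p g F G f = F"
 "restr p f = f ==> (!!i. i <= p ==> g i) ==> mix_to C p g G f = f"
 "(!!i. i <= p ==> ~ g i) ==> mix_to C p g G f = restr p (%i j. vid C (lmor G i j))"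
 "(!!i. i <= p ==> g i) ==> mix_from C p g F f = restr p (%i j. vid C (lmor F i j))"
 "restr p f = f ==> (!!i. i <= p ==> ~ g i) ==> mix_from C p g F f = f"
 by (rule data_eqI[of p]; simp) ((rule trans_eqI[of p]; simp add: mix_simps)+)

lemma (in bicategory) mix_const_none:
 assumes "laxF C p G" "!!i. i <= p ==> ~ g i" shows "mix_data C p g F G f = G"
proof -
 interpret lax_fun C p G by unfold_locales fact
 show ?thesis by (rule data_eqI[of p]) (use assms(2) in "simp_all add: mix_simps lax_restr")
qed

definition mix_stable where
 "mix_stable C P <-> (ALL p F. P p F --> laxF C p F) & (ALL q p a F. a : Delta q p & P p F --> P q (pulld q a F)) &
   (ALL p F G f g. P p F & P p G & (ALL i<=p. lob F i = lob G i) & laxF C p (mix_data C p g F G f) --> P p (mix_data C p g F G f))"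

context bicategory
begin

lemma mix_stable_lax: "mix_stable C (laxF C)" "mix_stable C (%p F. laxF C p F & normal_data C p F)"
 unfolding mix_stable_def by (auto simp: laxF_pull) (auto simp: normal_data_def Delta_le)

text \<open>\<open>F\<close> is kept where \<open>h\<close> is 0. For \<open>h\<close> constantly 0
  the mixed arrow is the given one, for \<open>h\<close> constantly 1 it is the identity of the
  target.\<close>

theorem lax_obj_equiv:
 assumes P: "mix_stable C P"
 shows "hinduced (dsc (functor_sset P)) (fnerve C P (laxT C)) (objects_inclusion (fnerve C P (laxT C)))"
proof -
 note P = P[unfolded mix_stable_def, THEN conjunct1, rule_format] P[unfolded mix_stable_def, THEN conjunct2, THEN conjunct1, rule_format, OF conjI]
  P[unfolded mix_stable_def, THEN conjunct2, THEN conjunct2, rule_format, OF conjI[OF _ conjI[OF _ conjI]]]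
 interpret ftype C P "laxT C" by (rule ftype_lax) (fact P)+
 let ?D = "fnerve C P (laxT C)"
 let ?mix = "%q h (F, G, f). (mix_data C q (%i. h i = (0::nat)) F G f, G, mix_to C q (%i. h i = 0) G f)"
 have "hequiv (BB (elts (obsset ?D))) (BB (Gro ?D))
   (Bmap (Gro ?D) (Gro_ob (objects_inclusion ?D)) (Gro_ar ?D (objects_inclusion ?D)))"
 proof (rule obj_incl_equiv[where mix = ?mix])
  fix q h u assume h: "h : Delta q 1" and u: "u : ars (level ?D q)"
  obtain F G f where uu: "u = (F, G, f)" by (metis prod.exhaust)
  have FG: "P q F" "P q G" "laxT C q F G f" using u by (auto simp: uu)
  interpret lax_tra C q F G f by unfold_locales (use FG P(1) in auto)
  have g: "i <= j ==> j <= k ==> k <= q ==> h i = 0 ==> h k = 0 ==> h j = 0" for i j k by (rule convex_Delta[OF h])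
  show "?mix q h u : ars (level ?D q) & cd (level ?D q) (?mix q h u) = cd (level ?D q) u"
   using lax_functor_mix[OF g] lax_trans_mix_to[OF g] FG P(3)[OF FG(1,2)] trans_lob by (simp add: uu)
 next
  fix r q b h u assume b: "b : Delta r q" and h: "h : Delta q 1" and "u : ars (level ?D q)"
  obtain F G f where uu: "u = (F, G, f)" by (metis prod.exhaust)
  show "pb_ar ?D r q b (?mix q h u) = ?mix r (cp r h b) (pb_ar ?D r q b u)"
   by (simp add: uu pull_mix[OF b, of "%i. cp r h b i = 0"] compose_def)
 next
  fix q u assume u: "u : ars (level ?D q)"
  obtain F G f where uu: "u = (F, G, f)" by (metis prod.exhaust)
  have FG: "P q F" "P q G" "laxT C q F G f" using u by (auto simp: uu)
  interpret lax_tra C q F G f by unfold_locales (use FG P(1) in auto)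
  show "?mix q (Dconst q 0) u = u"
   by (simp add: uu mix_const(1,2)[of q] F.lax_restr G.lax_restr trans_lob trans_restr Dconst_def)
  show "?mix q (Dconst q 1) u = idn (level ?D q) (cd (level ?D q) u)"
   using mix_const_none[OF G.F] by (simp add: uu mix_const(3) Dconst_def)
 qed
 moreover have "dsc (functor_sset P) = dsc (obsset ?D)"
  by (simp add: obsset_def functor_sset_def fun_eq_iff)
 ultimately show ?thesis
  by (simp add: induces_homotopy_equivalence_def classifying_space_def classifying_map_def Bmap_def)
qed

text \<open>In \<open>co C\<close> the transformation runs from \<open>G\<close> to
  \<open>F\<close>, so the roles change: the target \<open>G\<close> is kept where \<open>h\<close>
  is 1, and \<open>mix_from\<close>, read in \<open>C\<close>, is the arrow from the mixture to
  \<open>G\<close>.\<close>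

theorem oplax_obj_equiv:
 assumes P: "mix_stable (co C) P"
 shows "hinduced (dsc (functor_sset P)) (fnerve C P (oplaxT C)) (objects_inclusion (fnerve C P (oplaxT C)))"
proof -
 note P = P[unfolded mix_stable_def, THEN conjunct1, rule_format] P[unfolded mix_stable_def, THEN conjunct2, THEN conjunct1, rule_format, OF conjI]
  P[unfolded mix_stable_def, THEN conjunct2, THEN conjunct2, rule_format, OF conjI[OF _ conjI[OF _ conjI]]]
 interpret co: bicategory "co C" by (rule bicategory_co)
 interpret ftype C P "oplaxT C" by (rule ftype_oplax) (fact P)+
 let ?D = "fnerve C P (oplaxT C)"
 let ?mix = "%q h (F, G, f). (mix_data (co C) q (%i. h i = (1::nat)) G F f, G, mix_from (co C) q (%i. h i = 1) G f)"
 have "hequiv (BB (elts (obsset ?D))) (BB (Gro ?D))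
   (Bmap (Gro ?D) (Gro_ob (objects_inclusion ?D)) (Gro_ar ?D (objects_inclusion ?D)))"
 proof (rule obj_incl_equiv[where mix = ?mix])
  fix q h u assume h: "h : Delta q 1" and u: "u : ars (level ?D q)"
  obtain F G f where uu: "u = (F, G, f)" by (metis prod.exhaust)
  have FG: "P q G" "P q F" "laxT (co C) q G F f" using u by (auto simp: uu oplaxT_co)
  interpret lax_tra "co C" q G F f by unfold_locales (use FG P(1) in auto)
  have g: "i <= j ==> j <= k ==> k <= q ==> h i = 1 ==> h k = 1 ==> h j = 1" for i j k by (rule convex_Delta[OF h])
  show "?mix q h u : ars (level ?D q) & cd (level ?D q) (?mix q h u) = cd (level ?D q) u"
   using lax_functor_mix[OF g] lax_trans_mix_from[OF g] FG P(3)[OF FG(1,2)] trans_lob by (simp add: uu oplaxT_co)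
 next
  fix r q b h u assume b: "b : Delta r q" and h: "h : Delta q 1" and "u : ars (level ?D q)"
  obtain F G f where uu: "u = (F, G, f)" by (metis prod.exhaust)
  show "pb_ar ?D r q b (?mix q h u) = ?mix r (cp r h b) (pb_ar ?D r q b u)"
   by (simp add: uu pull_mix[OF b, of "%i. cp r h b i = 1"] compose_def)
 next
  fix q u assume u: "u : ars (level ?D q)"
  obtain F G f where uu: "u = (F, G, f)" by (metis prod.exhaust)
  have FG: "P q G" "P q F" "laxT (co C) q G F f" using u by (auto simp: uu oplaxT_co)
  interpret lax_tra "co C" q G F f by unfold_locales (use FG P(1) in auto)
  show "?mix q (Dconst q 0) u = u"
   using co.mix_const_none[OF G.F] by (simp add: uu mix_const(5)[of q] trans_restr Dconst_def)
  show "?mix q (Dconst q 1) u = idn (level ?D q) (cd (level ?D q) u)"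
   by (simp add: uu mix_const(1,4)[of q] F.lax_restr G.lax_restr trans_lob Dconst_def)
 qed
 moreover have "dsc (functor_sset P) = dsc (obsset ?D)"
  by (simp add: obsset_def functor_sset_def fun_eq_iff)
 ultimately show ?thesis
  by (simp add: induces_homotopy_equivalence_def classifying_space_def classifying_map_def Bmap_def)
qed

end

section \<open>Normalization\<close>

definition lax_corefl where
 "lax_corefl C P p F N e <-> P p N & laxT C p N F e &
   (ALL H u. P p H & laxT C p H F u --> (EX! v. laxT C p H N v & restr p (%i j. vcomp C (e i j) (v i j)) = u))"

definition lax_coreflv where
 "lax_coreflv C P P' <-> (ALL p F. P p F --> (EX N e. lax_corefl C P' p F N e))"

lemma lax_coreflD:
 assumes "lax_corefl C P p F N e"
 shows "P p N" "laxT C p N F e"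
  "P p H ==> laxT C p H F u ==> EX! v. laxT C p H N v & restr p (%i j. vcomp C (e i j) (v i j)) = u"
 using assms unfolding lax_corefl_def by blast+

definition lax_class where
 "lax_class C P <-> (ALL p F. P p F --> laxF C p F) & (ALL q p a F. a : Delta q p & P p F --> P q (pulld q a F))"

lemma is_functor_cong:
 assumes A: "category A" and F: "functr A B Fo Fa" and eq: "!!x. x : obs A ==> Go x = Fo x" "!!f. f : ars A ==> Ga f = Fa f"
 shows "functr A B Go Ga"
 by (rule functrI) (simp_all add: eq functrD[OF F] category.dm[OF A] category.cd[OF A] category.idn[OF A] category.cmp[OF A])

lemma mix_stable_class: "mix_stable C P ==> lax_class C P"
 unfolding mix_stable_def lax_class_def by (elim conjE) (intro conjI; assumption)

lemma lax_classD:
 "lax_class C P ==> P p F ==> laxF C p F" "lax_class C P ==> a : Delta q p ==> P p F ==> P q (pulld q a F)"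
 unfolding lax_class_def by blast+

context bicategory
begin

lemma type_lax: "lax_class C P ==> ftype C P (laxT C)"
 by (rule ftype_lax) (auto dest: lax_classD)

lemma type_oplax: "lax_class (co C) P ==> ftype C P (oplaxT C)"
 by (rule ftype_oplax) (auto dest: lax_classD)

lemma full_nerve:
 assumes "ftype C P T" "ftype C P' T" "!!p F. P' p F ==> P p F"
 shows "full_subcategory (fnerve C P T) (fnerve C P' T)"
proof -
 let ?D = "fnerve C P T" and ?D' = "fnerve C P' T"
 interpret D: ftype C P T by fact
 interpret D': ftype C P' T by fact
 show ?thesis
 proof
  have "pb_ob ?D' = pb_ob ?D" "pb_ar ?D' = pb_ar ?D" "!!p. dm (level ?D' p) = dm (level ?D p) & cd (level ?D' p) = cd (level ?D p) &
    idn (level ?D' p) = idn (level ?D p) & cmp (level ?D' p) = cmp (level ?D p)"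
   by (simp_all add: fun_eq_iff)
  then show "full_subsimp ?D' ?D" unfolding full_subsimp_def by (auto simp: assms(3))
 qed
qed

theorem lax_corefl_equiv:
 assumes P: "lax_class C P" and P': "lax_class C P'" and sub: "!!p F. P' p F ==> P p F" and coref: "lax_coreflv C P P'"
 shows "hinduced (fnerve C P' (laxT C)) (fnerve C P (laxT C)) (inclusion (fnerve C P (laxT C)))"
proof -
 let ?D = "fnerve C P (laxT C)" and ?D' = "fnerve C P' (laxT C)"
 interpret D: ftype C P "laxT C" by (rule type_lax) fact
 interpret D': ftype C P' "laxT C" by (rule type_lax) fact
 interpret full_subcategory ?D ?D'
  by (rule full_nerve[OF D.ftype_axioms D'.ftype_axioms sub])
 have "hequiv (BB (Gro ?D')) (BB (Gro ?D)) (Bmap (Gro ?D) (%x. x) (%f. f))"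
 proof (rule coreflective_equiv)
  fix p F assume "F : obs (level ?D p)"
  then have F: "P p F" by simp
  from coref[unfolded lax_coreflv_def, rule_format, OF F]
  obtain N e where "lax_corefl C P' p F N e" by (elim exE)
  note N = lax_coreflD[OF this]
  show "EX ep. ep : ars (level ?D p) & dm (level ?D p) ep : obs (level ?D' p) &
   cd (level ?D p) ep = F & (ALL u. u : ars (level ?D p) & dm (level ?D p) u : obs (level ?D' p) & cd (level ?D p) u = F -->
    (EX! v. v : ars (level ?D p) & dm (level ?D p) v = dm (level ?D p) u & cd (level ?D p) v = dm (level ?D p) ep &
     cmp (level ?D p) ep v = u))"
  proof (rule exI[of _ "(N, F, e)"], intro conjI allI impI)
   fix u assume u: "u : ars (level ?D p) & dm (level ?D p) u : obs (level ?D' p) & cd (level ?D p) u = F"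
   obtain H G g where uu: "u = (H, G, g)" by (metis prod.exhaust)
   have H: "P' p H" "G = F" "laxT C p H F g" using u by (auto simp: uu)
   from N(3)[OF H(1,3)] obtain v where v: "laxT C p H N v & restr p (%i j. e i j ;; v i j) = g"
    "ALL v'. laxT C p H N v' & restr p (%i j. e i j ;; v' i j) = g --> v' = v" by (erule ex1E)
   show "EX! v. v : ars (level ?D p) & dm (level ?D p) v = dm (level ?D p) u & cd (level ?D p) v = dm (level ?D p) (N, F, e) &
     cmp (level ?D p) (N, F, e) v = u"
   proof (rule ex1I[of _ "(H, N, v)"])
    fix x assume x: "x : ars (level ?D p) & dm (level ?D p) x = dm (level ?D p) u & cd (level ?D p) x = dm (level ?D p) (N, F, e) &
     cmp (level ?D p) (N, F, e) x = u"
    obtain A B w where xx: "x = (A, B, w)" by (metis prod.exhaust)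
    have "A = H" "B = N" "laxT C p H N w & restr p (%i j. e i j ;; w i j) = g" using x by (auto simp: uu xx)
    then show "x = (H, N, v)" using v(2)[rule_format, of w] by (simp add: xx)
   qed (use v(1) H N(1,2) sub in "simp add: uu")
  qed (use N(1,2) F sub in auto)
 qed
 then have "hequiv (BB (Gro ?D')) (BB (Gro ?D)) (Bmap (Gro ?D) (Gro_ob (inclusion ?D)) (Gro_ar ?D (inclusion ?D)))"
  by (rule hequiv_eq)
   (rule Bmap_cong[OF functr_full is_functor_cong[OF D'.category_Gro functr_full]]; simp add: inc_simps)
 then show ?thesis
  by (simp add: induces_homotopy_equivalence_def classifying_space_def classifying_map_def Bmap_def)
qed

text \<open>A coreflection in \<open>co C\<close> is a reflection in \<open>C\<close>. The functor
  \<open>Ko\<close>, \<open>Ka\<close> is assumed to be full and faithful onto the objects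
  satisfying \<open>P'\<close>; besides inclusions this covers the Segal nerve, which is embedded by
  inverting constraints.\<close>

theorem oplax_refl_equiv:
 assumes P: "lax_class (co C) P" and K: "strict_sfun D' (fnerve C P (oplaxT C)) Ko Ka"
  and D': "strict_simp D'" and coref: "lax_coreflv (co C) P P'"
  and obs: "!!p H. P' p H ==> EX r. r : lobs D' p & Ko p r = H" "!!p r. r : lobs D' p ==> P' p (Ko p r)"
  and full: "!!p r y v. r : lobs D' p ==> y : lobs D' p ==> oplaxT C p (Ko p r) (Ko p y) v ==>
   EX! w. w : lars D' p & ldm D' p w = r & lcd D' p w = y & Ka p w = (Ko p r, Ko p y, v)"
 shows "hinduced D' (fnerve C P (oplaxT C)) (strict_mor (fnerve C P (oplaxT C)) Ko Ka)"
proof -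
 let ?D = "fnerve C P (oplaxT C)"
 interpret D: ftype C P "oplaxT C" by (rule type_oplax) fact
 interpret D': strict_simp D' by fact
 interpret strict_fun ?D D' Ko Ka by unfold_locales fact
 have "hequiv (BB (Gro D')) (BB (Gro ?D))
  (Bmap (Gro ?D) (Gro_ob (strict_mor ?D Ko Ka)) (Gro_ar ?D (strict_mor ?D Ko Ka)))"
 proof (rule reflective_equiv)
  fix p F assume "F : obs (level ?D p)"
  then have F: "P p F" by simp
  from coref[unfolded lax_coreflv_def, rule_format, OF F]
  obtain N e where "lax_corefl (co C) P' p F N e" by (elim exE)
  note N = lax_coreflD[OF this]
  from obs(1)[OF N(1)] obtain r where r: "r : lobs D' p" "Ko p r = N" by blast
  have PN: "P p N" using Ks(1)[OF r(1)] r(2) by simp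
  show "EX r et. r : lobs D' p & et : ars (level ?D p) & dm (level ?D p) et = F & cd (level ?D p) et = Ko p r &
   (ALL y u. y : lobs D' p & u : ars (level ?D p) & dm (level ?D p) u = F & cd (level ?D p) u = Ko p y -->
    (EX! v. v : lars D' p & ldm D' p v = r & lcd D' p v = y & cmp (level ?D p) (Ka p v) et = u))"
  proof (rule exI[of _ r], rule exI[of _ "(F, N, e)"], intro conjI allI impI)
   fix y u assume u: "y : lobs D' p & u : ars (level ?D p) & dm (level ?D p) u = F & cd (level ?D p) u = Ko p y"
   then obtain g where uu: "u = (F, Ko p y, g)" and g: "oplaxT C p F (Ko p y) g" by (cases u) auto
   have yP: "P' p (Ko p y)" by (rule obs(2)[OF conjunct1[OF u]])
   from N(3)[OF yP g[unfolded oplaxT_co]]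
   obtain v where v: "oplaxT C p N (Ko p y) v & restr p (%i j. v i j ;; e i j) = g"
    "ALL v'. oplaxT C p N (Ko p y) v' & restr p (%i j. v' i j ;; e i j) = g --> v' = v"
    unfolding oplaxT_co co_simps by (erule ex1E)
   from full[OF r(1) _ conjunct1[OF v(1), folded r(2)]] u have "EX! w. w : lars D' p & ldm D' p w = r & lcd D' p w = y & Ka p w = (N, Ko p y, v)"
    by (simp add: r(2))
   moreover have "(cmp (level ?D p) (Ka p w) (F, N, e) = u) = (Ka p w = (N, Ko p y, v))"
    if w: "w : lars D' p" "ldm D' p w = r" "lcd D' p w = y" for w
   proof -
    have k: "Ka p w : ars (level ?D p)" "fst (Ka p w) = N" "fst (snd (Ka p w)) = Ko p y"
     using Ks(2,3,4)[OF w(1)] w r by auto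
    then have "oplaxT C p N (Ko p y) (snd (snd (Ka p w)))" by auto
    then show ?thesis using v(1) v(2)[rule_format, of "snd (snd (Ka p w))"] k by (simp add: uu prod_eq_iff) blast
   qed
   ultimately show "EX! v. v : lars D' p & ldm D' p v = r & lcd D' p v = y & cmp (level ?D p) (Ka p v) (F, N, e) = u"
    by (simp cong: conj_cong)
  qed (use N(1,2) F PN r in "auto simp: oplaxT_co")
 qed
 then show ?thesis
  by (simp add: induces_homotopy_equivalence_def classifying_space_def classifying_map_def Bmap_def)
qed

theorem oplax_corefl_equiv:
 assumes P: "lax_class (co C) P" and P': "lax_class (co C) P'" and sub: "!!p F. P' p F ==> P p F" and coref: "lax_coreflv (co C) P P'"
 shows "hinduced (fnerve C P' (oplaxT C)) (fnerve C P (oplaxT C)) (inclusion (fnerve C P (oplaxT C)))"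
 unfolding inclusion_def
proof (rule oplax_refl_equiv[OF P _ _ coref])
 interpret D: ftype C P "oplaxT C" by (rule type_oplax) fact
 interpret D': ftype C P' "oplaxT C" by (rule type_oplax) fact
 show "strict_simp (fnerve C P' (oplaxT C))" by unfold_locales
 show "strict_sfun (fnerve C P' (oplaxT C)) (fnerve C P (oplaxT C)) (%p x. x) (%p u. u)"
  unfolding strict_sfun_def by (auto intro!: functrI simp: sub)
qed auto

end

text \<open>Only the morphisms \<open>F i i\<close> are replaced, by units. The composition cells
  with a repeated index are then forced by the unit laws to be unit constraints.\<close>

definition normalize :: "('o, 'm, 'd) bicat => nat => ('o, 'm, 'd) lax_data => ('o, 'm, 'd) lax_data" where
 "normalize C p F = restr_data p
   (|lob = lob F, lmor = (%i j. if i = j then unit_mor C (lob F i) else lmor F i j),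
   lcmp = (%i j k. let N = (%i j. if i = j then unit_mor C (lob F i) else lmor F i j) in
    if i = j then lun C (N i k) else if j = k then run C (N i j) else lcmp F i j k),
   lone = (%i. vid C (unit_mor C (lob F i)))|)"

lemma (in bicategory) whisker_comm:
 assumes "a : Cell C" "b : Cell C" "src C (ddom C a) = tgt C (ddom C b)"
 shows "a *. b = (a *. vid C (dcod C b)) ;; (vid C (ddom C a) *. b)" "a *. b = (vid C (dcod C a) *. b) ;; (a *. vid C (ddom C b))"
 using assms by (simp_all add: hcomp_vcomp)

context lax_fun
begin

abbreviation "N == normalize C p F"
abbreviation "e == restr p (%i j. if i = j then lone F i else vid C (lmor F i j))"

lemma normalize_simps [simp]:
 "restr_data p N = N" "i <= p ==> lob N i = lob F i"
 "i <= j ==> j <= p ==> lmor N i j = (if i = j then unit_mor C (lob F i) else lmor F i j)"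
 "i <= j ==> j <= k ==> k <= p ==> lcmp N i j k = (if i = j then lun C (lmor N i k) else if j = k then run C (lmor N i j) else lcmp F i j k)"
 "i <= p ==> lone N i = vid C (unit_mor C (lob F i))"
 by (auto simp: normalize_def Let_def)

lemma normalize_nat:
 assumes "i <= j" "j <= k" "k <= p" shows "lcmp F i j k ;; (e i j *. e j k) = e i k ;; lcmp N i j k"
proof (cases "i = k")
 case True
 then have ij: "j = i" "k = i" using assms by auto
 have "lcmp F i i i ;; (lone F i *. lone F i) = lcmp F i i i ;; (lone F i *. vid C (lmor F i i)) ;; (vid C (unit_mor C (lob F i)) *. lone F i)"
  using assms by (subst whisker_comm(1)) (simp_all add: v_assoc ij)
 then show ?thesis using lax_unit(2)[of i i] lun_nat[of "lone F i"] assms by (simp add: ij)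
qed (use assms lax_unit in auto)

text \<open>For \<open>l ~= i\<close> the comparison \<open>e i l\<close> is an identity, and
  associativity is transferred from \<open>F\<close>. If all four indices coincide, it is the
  triangle identity together with the equality of the two unit constraints at a unit.\<close>

lemma lax_functor_normalize: "laxF C p N"
proof (rule laxFI, goal_cases)
 case (4 i j k) then show ?case by auto
next
 case (6 i j k l)
 show ?case
 proof (cases "l = i")
  case True
  then have *: "j = i" "k = i" "l = i" using 6 by auto
  show ?thesis unfolding * using 6 triangle'[of "unit_mor C (lob F i)" "unit_mor C (lob F i)"] lun_unit[of "lob F i"] by simp
 next
  case False
  then show ?thesis using assoc_transfer[where M = N and c = e, OF _ _ _ normalize_nat 6] 6 by auto
 qed
qed (auto simp: lun_unit)

lemma lax_trans_normalize: "laxT C p N F e"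
 by (rule laxTI) (use normalize_nat in \<open>auto simp del: normalize_simps(4) restr_simps(1)\<close>, auto)

text \<open>For a normal source the unit axiom forces \<open>u i i\<close> to be the unit cell of
  \<open>F\<close>. So \<open>u\<close> factors through \<open>e\<close>, with identities on the
  diagonal, and normality leaves no other choice.\<close>

lemma normalize_universal:
 assumes H: "normal_lax_functor C p H" and u: "laxT C p H F u"
 shows "EX! v. laxT C p H N v & restr p (%i j. e i j ;; v i j) = u"
proof -
 interpret H: lax_fun C p H by unfold_locales (use H normal_lax_functor_def in blast)
 note u = laxTD[OF u]
 have n: "lmor H i i = unit_mor C (lob H i)" "lone H i = vid C (unit_mor C (lob H i))" if "i <= p" for i
  using H that by (auto simp: normal_lax_functor_def normal_data_def)
 have uii: "u i i = lone F i" if "i <= p" for i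
  using that n(1) u(7)[OF that] u(3,4)[of i i] by (simp add: n)
 let ?v = "restr p (%i j. if i = j then vid C (unit_mor C (lob F i)) else u i j)"
 have ev: "e i j ;; ?v i j = u i j" if "i <= j" "j <= p" for i j
  using that u uii by auto
 have vt: "?v i j : Cell C & ddom C (?v i j) = lmor H i j & dcod C (?v i j) = lmor N i j" if "i <= j" "j <= p" for i j
  using that u n by auto
 show ?thesis
 proof (rule ex1I[of _ ?v], intro conjI)
  show "laxT C p H N ?v"
  proof (rule laxTI, goal_cases)
   case (4 i j k)
   show ?case
   proof (cases "i = k")
    case True
    then have ij: "j = i" "k = i" using 4 by auto
    show ?thesis using H.lax_unit(2)[of i i] 4 u(2)[of i] by (simp add: ij n)
   next
    case False
    then have "lcmp N i j k ;; (?v i j *. ?v j k) = e i k ;; lcmp N i j k ;; (?v i j *. ?v j k)"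
     using 4 by auto
    also have "... = lcmp F i j k ;; (e i j *. e j k) ;; (?v i j *. ?v j k)"
     by (simp only: normalize_nat[OF 4])
    also have "... = lcmp F i j k ;; ((e i j ;; ?v i j) *. (e j k ;; ?v j k))"
     using 4 vt[of i j] vt[of j k] by (simp add: v_assoc hcomp_vcomp)
    also have "... = ?v i k ;; lcmp H i j k"
     using 4 u(6)[OF 4] False by (simp only: ev) simp
    finally show ?thesis .
   qed
  qed (use vt u n in auto)
  show "restr p (%i j. e i j ;; ?v i j) = u"
   by (rule trans_eqI[of p], rule restr_simps(2), rule u(1), subst restr_simps(1)) (simp only: ev simp_thms if_True)
 next
  fix v assume v: "laxT C p H N v & restr p (%i j. e i j ;; v i j) = u"
  note w = laxTD[OF conjunct1[OF v]]
  show "v = ?v"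
  proof (rule trans_eqI[of p])
   fix i j assume ij: "i <= j" "j <= p"
   show "v i j = ?v i j"
   proof (cases "i = j")
    case True
    then show ?thesis using ij w(3-5)[OF ij] w(7)[of i] u(2)[of i] n[of i] by simp
   next
    case False
    then show ?thesis using arg_cong[OF conjunct2[OF v], of "%f. f i j"] ij w(3,5)[OF ij] by simp
   qed
  qed (use w in auto)
 qed
qed

end

context bicategory
begin

lemma lax_class_normal: "lax_class C (laxF C)" "lax_class C (%p F. laxF C p F & normal_data C p F)"
 by (rule mix_stable_class, rule mix_stable_lax)+

lemma lax_corefl_normal: "lax_coreflv C (laxF C) (%p F. laxF C p F & normal_data C p F)"
 unfolding lax_coreflv_def
proof (intro allI impI)
 fix p F assume "laxF C p F"
 then interpret lax_fun C p F by unfold_locales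
 have "lax_corefl C (%p F. laxF C p F & normal_data C p F) p F N e"
  unfolding lax_corefl_def
  by (intro conjI allI impI lax_functor_normalize lax_trans_normalize normalize_universal)
   (auto simp: normal_data_def normal_lax_functor_def)
 then show "EX N e. lax_corefl C (%p F. laxF C p F & normal_data C p F) p F N e" by blast
qed

end

section \<open>Rectification\<close>

declare string_ext.simps [simp del] ext_cell.simps [simp del]

lemma ext_simps:
 "j <= i ==> string_ext m e s i j = e (fst s ! i)" "string_ext m e s i (Suc i) = snd s ! i"
 "i < j ==> string_ext m e s i (Suc j) = m (string_ext m e s i j) (snd s ! j)"
 by (cases j; simp add: string_ext.simps)+

lemma mem_sobs: "s : obs (strc C p) <-> length (fst s) = Suc p & length (snd s) = p & set (fst s) \<subseteq> Ob C &
  (ALL i<p. snd s ! i : Mor C & src C (snd s ! i) = fst s ! Suc i & tgt C (snd s ! i) = fst s ! i)"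
 by (cases s) (simp add: string_cat_def hom_cat_def mem_mors)

locale comp_string = bicategory C for C :: "('o, 'm, 'd) bicat" (structure) +
 fixes p s assumes s: "s : obs (strc C p)"
begin

abbreviation "X i == fst s ! i"
abbreviation "U j == snd s ! j"
abbreviation "E == string_ext (mcomp C) (unit_mor C) s"
abbreviation "K == ext_cell C s"

lemma string_simps [simp]:
 "i <= p ==> X i : Ob C" "j < p ==> U j : Mor C" "j < p ==> src C (U j) = X (Suc j)" "j < p ==> tgt C (U j) = X j"
 using s nth_mem[of i "fst s"] unfolding mem_sobs by auto

lemmas E_simps [simp] = ext_simps[where m = "mcomp C" and e = "unit_mor C" and s = s]

lemma E_types [simp]:
 assumes "i <= j" "j <= p" shows "E i j : Mor C" "src C (E i j) = X j" "tgt C (E i j) = X i"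
proof -
 have "E i j : Mor C & src C (E i j) = X j & tgt C (E i j) = X i" using assms
 proof (induction j)
  case (Suc j)
  then consider "i = Suc j" | "i = j" | "i < j" by linarith
  then show ?case using Suc by cases auto
 qed simp
 then show "E i j : Mor C" "src C (E i j) = X j" "tgt C (E i j) = X i" by auto
qed

lemma K_simps [simp]:
 "i <= k ==> k <= p ==> K i i k = lun C (E i k)" "i <= k ==> k <= p ==> K i k k = run C (E i k)"
 "i < k ==> K i k (Suc k) = vid C (E i (Suc k))"
 "i < j ==> j < k ==> K i j (Suc k) = (K i j k *. vid C (U k)) ;; asc C (E i j) (E j k) (U k)"
 by (cases k; cases "i = k"; auto simp: ext_cell.simps Let_def lun_unit)+

lemma K_types [simp]:
 assumes "i <= j" "j <= k" "k <= p"
 shows "K i j k : Cell C" "ddom C (K i j k) = E i j <> E j k" "dcod C (K i j k) = E i k" "invcell C (K i j k)"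
proof -
 have "K i j k : Cell C & ddom C (K i j k) = E i j <> E j k & dcod C (K i j k) = E i k & invcell C (K i j k)" using assms
 proof (induction k)
  case (Suc k)
  then consider "i = j" | "j = Suc k" | "i < j" "j = k" | "i < j" "j < k" by linarith
  then show ?case using Suc by cases auto
 qed simp
 then show "K i j k : Cell C" "ddom C (K i j k) = E i j <> E j k" "dcod C (K i j k) = E i k" "invcell C (K i j k)" by auto
qed

text \<open>The recursion for \<open>ext_cell\<close>, which covers \<open>i < j < k\<close>, in a
  form valid for all weakly increasing indices. The additional cases are unit coherence.\<close>

lemma K_append:
 assumes "i <= j" "j <= k" "k < p"
 shows "K i j (Suc k) ;; (vid C (E i j) *. K j k (Suc k)) = K i k (Suc k) ;; ((K i j k *. vid C (U k)) ;; asc C (E i j) (E j k) (U k))"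
proof -
 consider "i < j" "j < k" | "i < j" "j = k" | "i = j" "j < k" | "i = j" "j = k" using assms by linarith
 then show ?thesis
 proof cases
  case 4
  then show ?thesis using assms lun_nat[of "lun C (U k)" "X k"] lun_mcomp[of "unit_mor C (X k)" "U k" "X k"] by simp
 qed (use assms triangle'[of "E i j" "U k"] lun_mcomp[of "E i k" "U k" "X i"] in simp_all)
qed

text \<open>Induction on \<open>l\<close>: \<open>K_append\<close> peels off the last morphism,
  naturality of the associativity constraint moves the remaining cells past it, and the pentagon
  rebrackets. Both sides are first composed with the invertible cell \<open>?r\<close>, which brings
  them to the form of \<open>K_append\<close>; it is cancelled at the end.\<close>

lemma K_assoc:
 assumes "i <= j" "j <= k" "k <= l" "l <= p"
 shows "K i j l ;; (vid C (E i j) *. K j k l) = K i k l ;; ((K i j k *. vid C (E k l)) ;; asc C (E i j) (E j k) (E k l))"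
 using assms(3,4)
proof (induction l rule: dec_induct)
 case base
 then show ?case using assms run_nat[of "K i j k" "X k"] run_mcomp[of "E i j" "E j k" "X k", symmetric] by (simp flip: v_assoc)
next
 case (step m)
 let ?r = "vid C (E i j) *. (vid C (E j k) *. K k m (Suc m))"
 let ?a = "asc C (E i j) (E j k <> E k m) (U m) ;; (vid C (E i j) *. asc C (E j k) (E k m) (U m))"
 have o: "i <= k" "i <= m" "j <= m" "k <= m" "m < p" "Suc m <= p" "m <= p" "k <= Suc m" "j <= Suc m" "i <= Suc m" "k <= p" "j <= p" "i <= p" using step assms by linarith+
 have IH: "K i j m ;; (vid C (E i j) *. K j k m) = K i k m ;; ((K i j k *. vid C (E k m)) ;; asc C (E i j) (E j k) (E k m))"
  using step by simp
 note t = o assms(1,2) v_assoc hcomp_vcomp hcomp_vcomp_tail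
 have n1: "asc C (E i j) (E j m) (U m) ;; (vid C (E i j) *. (K j k m *. vid C (U m))) = vid C (E i j) *. K j k m *. vid C (U m) ;; asc C (E i j) (E j k <> E k m) (U m)"
  using asc_nat[of "vid C (E i j)" "K j k m" "vid C (U m)"] by (simp add: t del: K_simps E_simps(3))
 have n2: "K i j k *. vid C (E k m) *. vid C (U m) ;; asc C (E i j <> E j k) (E k m) (U m) = asc C (E i k) (E k m) (U m) ;; (K i j k *. vid C (E k m <> U m))"
  using asc_nat[of "K i j k" "vid C (E k m)" "vid C (U m)"] by (simp add: t del: K_simps E_simps(3))
 have n3: "vid C (E i j <> E j k) *. K k m (Suc m) ;; asc C (E i j) (E j k) (E k m <> U m) = asc C (E i j) (E j k) (E k (Suc m)) ;; ?r"
  using asc_nat[of "vid C (E i j)" "vid C (E j k)" "K k m (Suc m)"] by (simp add: t del: K_simps E_simps(3))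
 have n4: "asc C (E i j <> E j k) (E k m) (U m) ;; asc C (E i j) (E j k) (E k m <> U m) = (asc C (E i j) (E j k) (E k m) *. vid C (U m)) ;; ?a"
  using pentagon'[of "E i j" "E j k" "E k m" "U m"] by (simp add: t del: K_simps E_simps(3))
 have "K i j (Suc m) ;; (vid C (E i j) *. K j k (Suc m)) ;; ?r = K i j (Suc m) ;; (vid C (E i j) *. (K j k (Suc m) ;; (vid C (E j k) *. K k m (Suc m))))"
  by (simp add: t del: K_simps E_simps(3))
 also have "... = K i j (Suc m) ;; (vid C (E i j) *. (K j m (Suc m) ;; ((K j k m *. vid C (U m)) ;; asc C (E j k) (E k m) (U m))))"
  by (simp only: K_append[OF assms(2) o(4,5)])
 also have "... = K i j (Suc m) ;; (vid C (E i j) *. K j m (Suc m)) ;; (vid C (E i j) *. (K j k m *. vid C (U m))) ;; (vid C (E i j) *. asc C (E j k) (E k m) (U m))"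
  by (simp add: t del: K_simps E_simps(3))
 also have "... = K i m (Suc m) ;; ((K i j m *. vid C (U m)) ;; asc C (E i j) (E j m) (U m)) ;; (vid C (E i j) *. (K j k m *. vid C (U m))) ;; (vid C (E i j) *. asc C (E j k) (E k m) (U m))"
  by (simp only: K_append[OF assms(1) o(3,5)])
 also have "... = K i m (Suc m) ;; (K i j m *. vid C (U m)) ;; (asc C (E i j) (E j m) (U m) ;; (vid C (E i j) *. (K j k m *. vid C (U m)))) ;; (vid C (E i j) *. asc C (E j k) (E k m) (U m))"
  by (simp add: o assms(1,2) v_assoc del: K_simps E_simps(3))
 also have "... = K i m (Suc m) ;; ((K i j m ;; (vid C (E i j) *. K j k m)) *. vid C (U m)) ;; ?a"
  unfolding n1 by (simp add: t del: K_simps E_simps(3))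
 also have "... = K i m (Suc m) ;; ((K i k m ;; (K i j k *. vid C (E k m))) *. vid C (U m)) ;; ((asc C (E i j) (E j k) (E k m) *. vid C (U m)) ;; ?a)"
  unfolding IH by (simp add: t del: K_simps E_simps(3))
 also have "... = K i m (Suc m) ;; (K i k m *. vid C (U m)) ;; (K i j k *. vid C (E k m) *. vid C (U m) ;; asc C (E i j <> E j k) (E k m) (U m)) ;; asc C (E i j) (E j k) (E k m <> U m)"
  unfolding n4[symmetric] by (simp add: t del: K_simps E_simps(3))
 also have "... = K i m (Suc m) ;; ((K i k m *. vid C (U m)) ;; asc C (E i k) (E k m) (U m)) ;; (K i j k *. vid C (E k m <> U m)) ;; asc C (E i j) (E j k) (E k m <> U m)"
  unfolding n2 by (simp add: o assms(1,2) v_assoc del: K_simps E_simps(3))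
 also have "... = K i k (Suc m) ;; (vid C (E i k) *. K k m (Suc m)) ;; (K i j k *. vid C (E k m <> U m)) ;; asc C (E i j) (E j k) (E k m <> U m)"
  by (simp only: K_append[OF o(1,4,5)])
 also have "... = K i k (Suc m) ;; (K i j k *. vid C (E k (Suc m))) ;; (vid C (E i j <> E j k) *. K k m (Suc m) ;; asc C (E i j) (E j k) (E k m <> U m))"
  by (simp add: t del: K_simps E_simps(3))
 also have "... = K i k (Suc m) ;; ((K i j k *. vid C (E k (Suc m))) ;; asc C (E i j) (E j k) (E k (Suc m))) ;; ?r"
  unfolding n3 by (simp add: o assms(1,2) v_assoc del: K_simps E_simps(3))
 finally show ?case
  by (rule cancel_right[rotated 5]) (simp_all add: o assms(1,2) del: K_simps E_simps(3))
qed

abbreviation "R == extd C p s"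

lemma ext_data_simps [simp]:
 "restr_data p R = R" "i <= p ==> lob R i = X i" "i <= j ==> j <= p ==> lmor R i j = E i j"
 "i <= j ==> j <= k ==> k <= p ==> lcmp R i j k = K i j k" "i <= p ==> lone R i = vid C (unit_mor C (X i))"
 by (simp_all add: ext_data_def)

lemma lax_ext: "laxF C p R"
 by (rule laxFI) (simp_all add: K_assoc del: K_simps(3,4) E_simps(3))

lemma nhom_ext: "nhom C p R"
 unfolding normal_homomorphism_def homomorphism_def normal_data_def
 using lax_ext by (auto simp del: K_simps(3,4) E_simps(3))

sublocale R: lax_fun C p R
 by unfold_locales (rule lax_ext)

context
 fixes F t
 assumes F: "laxF C p F" and lob: "!!i. i <= p ==> lob F i = X i"
  and t: "!!j. j < p ==> t j : Cell C & ddom C (t j) = U j & dcod C (t j) = lmor F j (Suc j)"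
begin

interpretation F: lax_fun C p F by unfold_locales (rule F)

text \<open>The transformation from the rectification to \<open>F\<close> generated by cells
  \<open>t\<close> on the consecutive morphisms: left bracketed composites are sent to
  \<open>F\<close> by its own composition cells, and units by its unit cells.\<close>

fun etr where
 "etr i 0 = lone F i"
| "etr i (Suc j) = (if Suc j <= i then lone F i else if i = j then t j else lcmp F i j (Suc j) ;; (etr i j *. t j))"

lemma etr_simps:
 "etr i i = lone F i" "etr i (Suc i) = t i" "i < j ==> etr i (Suc j) = lcmp F i j (Suc j) ;; (etr i j *. t j)"
 by (cases i; simp)+

declare etr.simps [simp del]

lemma etr_types [simp]:
 assumes "i <= j" "j <= p" shows "etr i j : Cell C" "ddom C (etr i j) = E i j" "dcod C (etr i j) = lmor F i j"
proof -
 have "etr i j : Cell C & ddom C (etr i j) = E i j & dcod C (etr i j) = lmor F i j" using assms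
 proof (induction j)
  case 0 then show ?case by (simp add: etr_simps lob)
 next
  case (Suc j)
  then consider "i = Suc j" | "i = j" | "i < j" by linarith
  then show ?case using Suc t[of j] lob by cases (auto simp: etr_simps)
 qed
 then show "etr i j : Cell C" "ddom C (etr i j) = E i j" "dcod C (etr i j) = lmor F i j" by auto
qed

lemma etr_invertible:
 assumes "!!i j k. i <= j ==> j <= k ==> k <= p ==> invcell C (lcmp F i j k)" "!!i. i <= p ==> invcell C (lone F i)"
  "!!j. j < p ==> invcell C (t j)" "i <= j" "j <= p"
 shows "invcell C (etr i j)"
 using assms(4,5)
proof (induction j)
 case 0 then show ?case by (simp add: etr_simps assms)
next
 case (Suc j)
 then consider "i = Suc j" | "i = j" | "i < j" by linarith
 then show ?case using Suc t[of j] lob by cases (auto simp: etr_simps assms)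
qed

lemma etr_append:
 assumes "i <= k" "k < p"
 shows "etr i (Suc k) ;; K i k (Suc k) = lcmp F i k (Suc k) ;; (etr i k *. t k)"
proof (cases "i = k")
 case True
 have "lcmp F k k (Suc k) ;; (lone F k *. t k) = lcmp F k k (Suc k) ;; (lone F k *. vid C (lmor F k (Suc k))) ;; (vid C (unit_mor C (X k)) *. t k)"
  using assms t[of k] lob by (subst whisker_comm(1)) (simp_all add: v_assoc)
 then show ?thesis using F.lax_unit(2)[of k "Suc k"] lun_nat[of "t k" "X k"] t[of k] assms by (simp add: True etr_simps)
qed (use assms t[of k] in "simp add: etr_simps lob")

text \<open>The scheme of \<open>K_assoc\<close>, with the associativity axiom of \<open>F\<close>
  in place of the pentagon.\<close>

lemma etr_nat:
 assumes "i <= j" "j <= k" "k <= p"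
 shows "lcmp F i j k ;; (etr i j *. etr j k) = etr i k ;; K i j k"
 using assms(2,3)
proof (induction k rule: dec_induct)
 case base
 have "lcmp F i j j ;; (etr i j *. lone F j) = lcmp F i j j ;; (vid C (lmor F i j) *. lone F j) ;; (etr i j *. vid C (unit_mor C (X j)))"
  using assms base lob by (subst whisker_comm(2)) (simp_all add: v_assoc)
 then show ?case using F.lax_unit(1)[of i j] run_nat[of "etr i j" "X j"] assms base by (simp add: etr_simps)
next
 case (step k)
 have o: "i <= k" "k < p" "Suc k <= p" "k <= p" "i <= Suc k" "j <= Suc k" "j <= p" "i <= p" using step assms by linarith+
 note t' = o assms(1) step(1) lob v_assoc hcomp_vcomp hcomp_vcomp_tail conjunct1[OF t] t[THEN conjunct2, THEN conjunct1] t[THEN conjunct2, THEN conjunct2]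
 let ?e = etr
 have IH: "lcmp F i j k ;; (?e i j *. ?e j k) = ?e i k ;; K i j k" using step by simp
 have "lcmp F i j (Suc k) ;; (?e i j *. ?e j (Suc k)) ;; (vid C (E i j) *. K j k (Suc k)) = lcmp F i j (Suc k) ;; (?e i j *. (?e j (Suc k) ;; K j k (Suc k)))"
  by (simp add: t' del: K_simps E_simps(3))
 also have "... = lcmp F i j (Suc k) ;; (vid C (lmor F i j) *. lcmp F j k (Suc k)) ;; (?e i j *. (?e j k *. t k))"
  by (simp add: etr_append t' del: K_simps E_simps(3))
 also have "... = lcmp F i k (Suc k) ;; (lcmp F i j k *. vid C (lmor F k (Suc k))) ;; (asc C (lmor F i j) (lmor F j k) (lmor F k (Suc k)) ;; (?e i j *. (?e j k *. t k)))"
  by (simp add: F.lax_assoc t' del: K_simps E_simps(3))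
 also have "... = lcmp F i k (Suc k) ;; ((lcmp F i j k ;; (?e i j *. ?e j k)) *. t k) ;; asc C (E i j) (E j k) (U k)"
  using asc_nat[of "?e i j" "?e j k" "t k"] by (simp add: t' del: K_simps E_simps(3))
 also have "... = lcmp F i k (Suc k) ;; (?e i k *. t k) ;; ((K i j k *. vid C (U k)) ;; asc C (E i j) (E j k) (U k))"
  by (simp add: IH t' del: K_simps E_simps(3))
 also have "... = ?e i (Suc k) ;; (K i k (Suc k) ;; ((K i j k *. vid C (U k)) ;; asc C (E i j) (E j k) (U k)))"
  by (simp add: etr_append[symmetric] t' del: K_simps E_simps(3))
 also have "... = ?e i (Suc k) ;; K i j (Suc k) ;; (vid C (E i j) *. K j k (Suc k))"
  by (simp add: K_append[symmetric] t' del: K_simps E_simps(3))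
 finally show ?case
  by (rule cancel_right[rotated 5]) (simp_all add: t' del: K_simps E_simps(3))
qed

lemma lax_trans_ext: "laxT C p R F (restr p etr)"
 by (rule laxTI) (simp_all add: lob etr_nat etr_simps(1) del: K_simps(3,4) E_simps(3))

text \<open>Compatibility with the composition at \<open>i\<close>, \<open>k\<close>,
  \<open>Suc k\<close> determines the component at \<open>i\<close>, \<open>Suc k\<close>, because
  the cell \<open>K i k (Suc k)\<close> is invertible.\<close>

lemma etr_unique:
 assumes f: "laxT C p R F f" and ft: "!!j. j < p ==> f j (Suc j) = t j"
 shows "f = restr p etr"
proof (rule trans_eqI[of p])
 note f = laxTD[OF f]
 fix i j assume "i <= j" "j <= p"
 then have "f i j = etr i j"
 proof (induction j rule: dec_induct)
  case base
  then show ?case using f(7)[of i] f(3,4)[of i i] by (simp add: etr_simps)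
 next
  case (step k)
  have "f i (Suc k) ;; K i k (Suc k) = etr i (Suc k) ;; K i k (Suc k)"
   using f(6)[of i k "Suc k"] step ft[of k] by (simp add: etr_append del: K_simps E_simps(3))
  then show ?case by (rule cancel_right[rotated 5]) (use step f(3-5) in "simp_all del: K_simps E_simps(3)")
 qed
 then show "f i j = restr p etr i j" using \<open>i <= j\<close> \<open>j <= p\<close> by simp
qed (use laxTD(1)[OF f] in simp_all)

end

end

section \<open>The Segal nerve\<close>

definition spine :: "nat => ('o, 'm, 'd) lax_data => ('o, 'm) string" where
 "spine p F = (map (lob F) [0..<Suc p], map (%j. lmor F j (Suc j)) [0..<p])"

lemma spine_simps [simp]:
 "i <= p ==> fst (spine p F) ! i = lob F i" "j < p ==> snd (spine p F) ! j = lmor F j (Suc j)"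
 by (simp_all add: spine_def del: upt_Suc)

lemma (in lax_fun) spine_obs: "spine p F : obs (strc C p)"
 unfolding mem_sobs by (auto simp: spine_def simp del: upt_Suc)

context comp_string
begin

text \<open>The rectification is the free lax functor on its string: cells on the consecutive
  morphisms extend to a transformation, uniquely by \<open>ext_eqI\<close>. Invertible cells into a
  homomorphism extend to invertible components.\<close>

lemma ext_universal:
 assumes "laxF C p F" "!!i. i <= p ==> lob F i = X i"
  "!!j. j < p ==> t j : Cell C & ddom C (t j) = U j & dcod C (t j) = lmor F j (Suc j)"
 shows "EX f. laxT C p R F f & (ALL j<p. f j (Suc j) = t j) &
  (homomorphism C p F & (ALL j<p. invcell C (t j)) --> (ALL i j. i <= j & j <= p --> invcell C (f i j)))"
 using etr_simps(2)[OF assms] etr_invertible[OF assms]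
 by (intro exI[of _ "restr p (etr F t)"] conjI lax_trans_ext[OF assms]) (simp_all add: homomorphism_def)

lemma ext_eqI:
 assumes F: "laxF C p F" and f: "laxT C p R F f" and g: "laxT C p R F g" and eq: "!!j. j < p ==> f j (Suc j) = g j (Suc j)"
 shows "f = g"
proof -
 have t: "g j (Suc j) : Cell C & ddom C (g j (Suc j)) = U j & dcod C (g j (Suc j)) = lmor F j (Suc j)" if "j < p" for j
  using laxTD(3-5)[OF g, of j "Suc j"] that by simp
 have X: "lob F i = X i" if "i <= p" for i using laxTD(2)[OF g that] that by simp
 show ?thesis
  using etr_unique[OF F X t f eq] etr_unique[OF F X t g] by simp
qed

end

context bicategory
begin

lemma laxT_inv:
 assumes "laxF C p F" "laxF C p G" and f: "laxT C p F G f"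
  and inv: "!!i j. i <= j ==> j <= p ==> invcell C (f i j)"
 shows "laxT C p G F (restr p (%i j. cinv C (f i j)))"
proof -
 interpret lax_tra C p F G f by unfold_locales fact+
 show ?thesis
 proof (rule laxTI, goal_cases)
  case (4 i j k)
  have "f i k ;; lcmp F i j k = lcmp G i j k ;; (f i j *. f j k)" using trans_cmp[OF 4] by simp
  from inverse_square[OF this] show ?case using 4 inv trans_lob by simp
 next
  case (5 i)
  have "cinv C (f i i) ;; (f i i ;; lone F i) = lone F i" using 5 inv by (subst inv_cancel(1)) simp_all
  then show ?case using trans_one[of i] 5 by simp
 qed (use inv trans_lob in auto)
qed

text \<open>A normal homomorphism \<open>H\<close> is isomorphic, by \<open>f\<close>, to the
  rectification of its own spine. Transformations out of \<open>H\<close> are thus fixed by their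
  consecutive components, and since the counit \<open>e\<close> is an identity on consecutive
  morphisms, these lift uniquely; the lift of \<open>u\<close> is \<open>g\<close> composed with the
  inverse of \<open>f\<close>.\<close>

lemma lax_corefl_hom: "lax_coreflv C (%p F. laxF C p F & normal_data C p F) (nhom C)"
 unfolding lax_coreflv_def
proof (intro allI impI)
 fix p F assume F0: "laxF C p F & normal_data C p F"
 then interpret F: lax_fun C p F by unfold_locales blast
 interpret S: comp_string C p "spine p F" by unfold_locales (rule F.spine_obs)
 have "EX e. laxT C p S.R F e & (ALL j<p. e j (Suc j) = vid C (lmor F j (Suc j)))"
  using S.ext_universal[OF F.F, of "%j. vid C (lmor F j (Suc j))"] by auto
 then obtain e where "laxT C p S.R F e & (ALL j<p. e j (Suc j) = vid C (lmor F j (Suc j)))" by (elim exE)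
 note e = this[THEN conjunct1] this[THEN conjunct2, rule_format]
 have "EX! v. laxT C p H S.R v & restr p (%i j. e i j ;; v i j) = u" if H: "nhom C p H" and u: "laxT C p H F u" for H u
 proof -
  have H': "laxF C p H" "homomorphism C p H" using H by (simp_all add: normal_homomorphism_def homomorphism_def)
  interpret H: lax_fun C p H by unfold_locales fact
  interpret T: comp_string C p "spine p H" by unfold_locales (rule H.spine_obs)
  interpret u: lax_tra C p H F u by unfold_locales (rule u)
  interpret e: lax_tra C p S.R F e by unfold_locales (rule e)
  have "EX f. laxT C p T.R H f & (ALL j<p. f j (Suc j) = vid C (lmor H j (Suc j))) & (ALL i j. i <= j & j <= p --> invcell C (f i j))"
   using T.ext_universal[OF H.F, of "%j. vid C (lmor H j (Suc j))"] H'(2) by auto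
  then obtain f where "laxT C p T.R H f & (ALL j<p. f j (Suc j) = vid C (lmor H j (Suc j))) & (ALL i j. i <= j & j <= p --> invcell C (f i j))"
   by (elim exE)
  note f = this[THEN conjunct1] this[THEN conjunct2, THEN conjunct1, rule_format] this[THEN conjunct2, THEN conjunct2, rule_format, OF conjI]
  have "EX g. laxT C p T.R S.R g & (ALL j<p. g j (Suc j) = u j (Suc j))"
   using T.ext_universal[OF S.R.F, of "%j. u j (Suc j)"] u.trans_lob by auto
  then obtain g where "laxT C p T.R S.R g & (ALL j<p. g j (Suc j) = u j (Suc j))" by (elim exE)
  note g = this[THEN conjunct1] this[THEN conjunct2, rule_format]
  interpret f: lax_tra C p T.R H f by unfold_locales (rule f)
  interpret g: lax_tra C p T.R S.R g by unfold_locales (rule g)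
  have fi: "laxT C p H T.R (restr p (%i j. cinv C (f i j)))" by (rule laxT_inv[OF T.R.F H.F f(1,3)])
  let ?v = "restr p (%i j. g i j ;; cinv C (f i j))"
  have "?v = restr p (%i j. g i j ;; restr p (%i j. cinv C (f i j)) i j)" by (rule restr_trans_cong) simp
  then have v: "laxT C p H S.R ?v" using laxT_comp[OF H.F T.R.F S.R.F fi g(1)] by simp
  \<comment> \<open>Both sides start at a rectification and agree on consecutive morphisms, where
    \<open>e\<close> and \<open>f\<close> are identities.\<close>
  have eg: "restr p (%i j. e i j ;; g i j) = restr p (%i j. u i j ;; f i j)"
   by (rule T.ext_eqI[OF F.F laxT_comp[OF T.R.F S.R.F F.F g(1) e(1)] laxT_comp[OF T.R.F H.F F.F f(1) u]])
    (simp add: e f g)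
  have egf: "e i j ;; g i j = u i j ;; f i j" if "i <= j" "j <= p" for i j
   using fun_cong[OF fun_cong[OF eg], of i j] that by simp
  show ?thesis
  proof (rule ex1I[of _ ?v], intro conjI v)
   show "restr p (%i j. e i j ;; ?v i j) = u"
   proof (rule trans_eqI[of p])
    fix i j assume ij: "i <= j" "j <= p"
    have "e i j ;; ?v i j = u i j ;; f i j ;; cinv C (f i j)" using ij f(3) by (simp add: egf[symmetric] v_assoc)
    then show "restr p (%i j. e i j ;; ?v i j) i j = u i j" using ij f(3) by simp
   qed (simp_all add: u.trans_restr)
  next
   fix w assume w: "laxT C p H S.R w & restr p (%i j. e i j ;; w i j) = u"
   interpret w: lax_tra C p H S.R w by unfold_locales (rule conjunct1[OF w])
   have ew: "e i j ;; w i j = u i j" if "i <= j" "j <= p" for i j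
    using fun_cong[OF fun_cong[OF conjunct2[OF w]], of i j] that by simp
   have wf: "restr p (%i j. w i j ;; f i j) = g"
    by (rule T.ext_eqI[OF S.R.F laxT_comp[OF T.R.F H.F S.R.F f(1) conjunct1[OF w]] g(1)])
     (use ew e(2) w.trans_simps in "simp add: f g flip: ew")
   show "w = ?v"
   proof (rule trans_eqI[of p])
    fix i j assume ij: "i <= j" "j <= p"
    have "g i j = w i j ;; f i j" using fun_cong[OF fun_cong[OF wf], of i j] ij by simp
    then show "w i j = ?v i j" using ij f(3) by simp
   qed (simp_all add: w.trans_restr)
  qed
 qed
 then have "lax_corefl C (nhom C) p F S.R e"
  unfolding lax_corefl_def using S.nhom_ext e(1) by blast
 then show "EX N e. lax_corefl C (nhom C) p F N e" by blast
qed

lemma lax_class_hom: "lax_class C (nhom C)"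
 unfolding lax_class_def normal_homomorphism_def homomorphism_def normal_data_def
 by (auto simp: laxF_pull Delta_le)

end

section \<open>Inverting the constraints of normal homomorphisms\<close>

lemma invert_data_simps [simp]:
 "restr_data p (invd C p F) = invd C p F" "i <= p ==> lob (invd C p F) i = lob F i"
 "i <= j ==> j <= p ==> lmor (invd C p F) i j = lmor F i j"
 "i <= j ==> j <= k ==> k <= p ==> lcmp (invd C p F) i j k = cinv C (lcmp F i j k)"
 "i <= p ==> lone (invd C p F) i = cinv C (lone F i)"
 by (simp_all add: invert_data_def)

locale hom_fun = bicategory C for C :: "('o, 'm, 'd) bicat" (structure) +
 fixes p F assumes hom: "nhom C p F"
begin

sublocale lax_fun C p F
 by unfold_locales (use hom in "simp add: normal_homomorphism_def homomorphism_def")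

lemma hom_simps [simp]:
 "i <= j ==> j <= k ==> k <= p ==> invcell C (lcmp F i j k)"
 "i <= p ==> lmor F i i = unit_mor C (lob F i)" "i <= p ==> lone F i = vid C (unit_mor C (lob F i))"
 using hom by (simp_all add: normal_homomorphism_def homomorphism_def normal_data_def)

lemma invert_data_invert: "invd C p (invd C p F) = F"
 by (rule data_eqI[of p]) (simp_all add: lax_restr)

lemma normal_homomorphism_invert: "nhom (co C) p (invd C p F)"
proof -
 interpret co: bicategory "co C" by (rule bicategory_co)
 let ?G = "invd C p F"
 have "laxF (co C) p ?G"
 proof (rule co.laxFI, goal_cases)
  case (6 i j k l)
  then show ?case using arg_cong[OF lax_assoc[OF 6], of "cinv C"] by (simp add: v_assoc)
 next
  case (7 i j)
  then show ?case using arg_cong[OF lax_unit(1)[OF 7], of "cinv C"] by simp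
 next
  case (8 i j)
  then show ?case using arg_cong[OF lax_unit(2)[OF 8], of "cinv C"] by simp
 qed simp_all
 then show ?thesis by (simp add: normal_homomorphism_def homomorphism_def normal_data_def)
qed

end

context bicategory
begin

text \<open>\<open>co (co C)\<close> is not literally \<open>C\<close>: its constraints are double
  inverses, which return the original cell only for composable morphisms. These are the only ones
  that a lax functor meets.\<close>

lemma lax_functor_co_co: "laxF (co (co C)) p F ==> laxF C p F"
proof -
 assume "laxF (co (co C)) p F"
 interpret co: bicategory "co C" by (rule bicategory_co)
 interpret coco: lax_fun "co (co C)" p F
  using bicategory.bicategory_co[OF bicategory_co] by (rule lax_fun.intro) (unfold_locales, fact)
 note [simp] = coco.lax_data[simplified]
 show ?thesis
  by (rule laxFI) (use coco.lax_assoc coco.lax_unit in "simp_all add: coco.lax_restr")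
qed

lemma normal_homomorphism_co_invert:
 assumes "nhom (co C) p F"
 shows "nhom C p (invd C p F)" "invd C p (invd C p F) = F"
proof -
 interpret co: bicategory "co C" by (rule bicategory_co)
 interpret co: hom_fun "co C" p F by unfold_locales fact
 have [simp]: "invd (co C) = invd C" by (simp add: invert_data_def fun_eq_iff)
 show "nhom C p (invd C p F)"
  using co.normal_homomorphism_invert lax_functor_co_co co.co_invertible co.lax_data(1)[simplified]
  by (simp add: normal_homomorphism_def homomorphism_def normal_data_def)
 show "invd C p (invd C p F) = F" using co.invert_data_invert by simp
qed

lemma lax_trans_invert:
 assumes "nhom C p F" "nhom C p G"
 shows "oplaxT C p (invd C p F) (invd C p G) f <-> laxT C p F G f"
proof -
 interpret F: hom_fun C p F by unfold_locales fact
 interpret G: hom_fun C p G by unfold_locales fact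
 have fam: "trans_family C p (invd C p F) (invd C p G) f <-> trans_family C p F G f"
  by (auto simp: trans_family_def)
 show ?thesis
  unfolding oplax_trans_def lax_trans_def fam
 proof (intro conj_cong refl all_cong1 imp_cong, goal_cases)
  case (1 i j k)
  then have "i <= j" "j <= k" "k <= p" "i <= k" "j <= p" "i <= p" by auto
  note [simp] = this
  have [simp]: "f i j : Cell C & ddom C (f i j) = lmor F i j & dcod C (f i j) = lmor G i j" "lob F j = lob G j" if "i <= j" "j <= p" for i j
   using 1 that by (auto simp: trans_family_def mem_cells)
  show ?case
  proof
   assume "lcmp (invd C p G) i j k ;; f i k = f i j *. f j k ;; lcmp (invd C p F) i j k"
   then have "cinv C (lcmp G i j k) ;; f i k = f i j *. f j k ;; cinv C (lcmp F i j k)" by simp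
   from inverse_square[OF this] show "lcmp G i j k ;; f i j *. f j k = f i k ;; lcmp F i j k" by simp
  next
   assume "lcmp G i j k ;; f i j *. f j k = f i k ;; lcmp F i j k"
   from inverse_square[OF this] show "lcmp (invd C p G) i j k ;; f i k = f i j *. f j k ;; lcmp (invd C p F) i j k" by simp
  qed
 next
  case (2 i)
  then show ?case by (simp add: trans_family_def mem_cells)
 qed
qed

lemma nclasses:
 "normal_lax_functor C = (%p F. laxF C p F & normal_data C p F)"
 "normal_oplax_functor C = (%p F. laxF (co C) p F & normal_data (co C) p F)"
 "oplax_functor C = laxF (co C)"
 by (simp_all add: normal_lax_functor_def normal_oplax_functor_def oplax_functor_co fun_eq_iff)

lemma invert_normal_homomorphism:
 assumes "nhom C p F"
 shows "nhom (co C) p (invd C p F)" "normal_oplax_functor C p (invd C p F)"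
proof -
 interpret hom_fun C p F by unfold_locales fact
 show "nhom (co C) p (invd C p F)" by (rule normal_homomorphism_invert)
 then show "normal_oplax_functor C p (invd C p F)"
  by (simp add: normal_homomorphism_def homomorphism_def nclasses)
qed

lemma strict_segal_to_oplax:
 "strict_sfun (Segal C) (normal_oplax_nerve C) (invd C)
  (%p (F, F', al). (invd C p F, invd C p F', al))"
proof -
 have pull: "invd C q (pulld q a F) = pulld q a (invd C p F)" if "a : Delta q p" for q p a F
  by (rule data_eqI[of q]) (simp_all add: Delta_le[OF that])
 show ?thesis
  unfolding strict_sfun_def case_prod_unfold segal_nerve_def normal_oplax_nerve_def
  by (intro conjI allI impI functrI; simp add: invert_normal_homomorphism pull lax_trans_invert cong: restr_trans_cong)
qed

text \<open>Normal homomorphisms are coreflective among the normal lax functors to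
  \<open>co C\<close>, and inverting constraints identifies them with the normal homomorphisms to
  \<open>C\<close>.\<close>

theorem segal_oplax_equiv:
 "hinduced (Segal C) (normal_oplax_nerve C) (segal_to_oplax C)"
proof -
 interpret co: bicategory "co C" by (rule bicategory_co)
 interpret D': ftype C "nhom C" "laxT C" by (rule type_lax[OF lax_class_hom])
 show ?thesis
  unfolding segal_to_oplax_def normal_oplax_nerve_def
 proof (rule oplax_refl_equiv[where P' = "nhom (co C)", OF _ strict_segal_to_oplax[unfolded normal_oplax_nerve_def]])
  show "lax_class (co C) (normal_oplax_functor C)" unfolding nclasses by (rule co.lax_class_normal)
  show "lax_coreflv (co C) (normal_oplax_functor C) (nhom (co C))"
   unfolding nclasses by (rule co.lax_corefl_hom)
  show "strict_simp (Segal C)" unfolding segal_nerve_def by unfold_locales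
  show "EX r. r : lobs (Segal C) p & invd C p r = H" if "nhom (co C) p H" for p H
   using normal_homomorphism_co_invert[OF that] by (auto simp: segal_nerve_def)
  show "nhom (co C) p (invd C p r)" if "r : lobs (Segal C) p" for p r
   using that invert_normal_homomorphism by (simp add: segal_nerve_def)
  show "EX! w. w : lars (Segal C) p & ldm (Segal C) p w = r & lcd (Segal C) p w = y &
    (case w of (F, F', al) => (invd C p F, invd C p F', al)) = (invd C p r, invd C p y, v)"
   if "r : lobs (Segal C) p" "y : lobs (Segal C) p" "oplaxT C p (invd C p r) (invd C p y) v" for p r y v
   by (rule ex1I[of _ "(r, y, v)"]) (use that lax_trans_invert in "auto simp: segal_nerve_def case_prod_unfold prod_eq_iff")
 qed
qed

theorem segal_lax_equiv:
 "hinduced (Segal C) (normal_lax_nerve C) (inclusion (normal_lax_nerve C))"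
 unfolding segal_nerve_def normal_lax_nerve_def nclasses
 by (rule lax_corefl_equiv[OF lax_class_normal(2) lax_class_hom _ lax_corefl_hom])
  (simp add: normal_homomorphism_def homomorphism_def)

end

section \<open>Formal composites\<close>

text \<open>Unlike \<open>word_eval\<close>, the composition and the units are parameters: one
  recursion evaluates words in morphisms and in deformations, and also substitutes words into
  words.\<close>

primrec weval :: "('u => 'u => 'u) => ('o => 'u) => ('o, 'u) string => word => 'u" where
 "weval m e s (Gen k) = snd s ! (k - 1)"
| "weval m e s (Unit i) = e (fst s ! i)"
| "weval m e s (Cmp v w) = m (weval m e s v) (weval m e s w)"

lemma word_eval: "word_eval C s w = weval (mcomp C) (unit_mor C) s w"
 by (induction w) auto

text \<open>Positivity of \<open>k\<close> matters, because \<open>word_tgt (Gen k)\<close> is the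
  truncated difference \<open>k - 1\<close>.\<close>

primrec wfw :: "nat => word => bool" where
 "wfw p (Gen k) <-> 0 < k & k <= p"
| "wfw p (Unit i) <-> i <= p"
| "wfw p (Cmp v w) <-> wfw p v & wfw p w & wsrc v = wtgt w"

lemma wfw_le: "wfw p w ==> wtgt w <= wsrc w & wsrc w <= p"
 by (induction w) auto

text \<open>Evaluates a string of words at \<open>s\<close>; this is how the computation on the
  generic string is carried over to all strings.\<close>

definition smap :: "('u => 'u => 'u) => ('o => 'u) => ('o, 'u) string => (nat, word) string => ('o, 'u) string" where
 "smap m e s z = (map (%i. fst s ! i) (fst z), map (weval m e s) (snd z))"

definition word_path :: "nat => (nat, word) string => bool" where
 "word_path p z <-> length (fst z) = Suc (length (snd z)) & (ALL x:set (fst z). x <= p) &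
   (ALL j<length (snd z). wfw p (snd z ! j) & wtgt (snd z ! j) = fst z ! j & wsrc (snd z ! j) = fst z ! Suc j)"

lemma nth_delete:
 "i < length xs ==> j < length xs - 1 ==> (take i xs @ drop (Suc i) xs) ! j = (if j < i then xs ! j else xs ! Suc j)"
 by (auto simp: nth_append)

lemma nth_merge:
 "0 < i ==> i < length ws ==> j < length ws - 1 ==>
  (take (i - 1) ws @ w # drop (Suc i) ws) ! j = (if j < i - 1 then ws ! j else if j = i - 1 then w else ws ! Suc j)"
 by (auto simp: nth_append nth_Cons split: nat.splits intro!: arg_cong[of _ _ "(!) ws"])

lemma face_path:
 assumes z: "word_path p z" and i: "i <= length (snd z)" "snd z ~= []"
 shows "word_path p (face Cmp i z)" "fst (face Cmp i z) = take i (fst z) @ drop (Suc i) (fst z)"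
  "length (snd (face Cmp i z)) = length (snd z) - 1" "face m i (smap m e s z) = smap m e s (face Cmp i z)"
proof -
 obtain xs ws where zz: "z = (xs, ws)" by (cases z)
 have l: "length xs = Suc (length ws)" "i <= length ws" "ws ~= []" "!!x. x : set xs ==> x <= p" using z i by (auto simp: word_path_def zz)
 have w: "wfw p (ws ! j)" "wtgt (ws ! j) = xs ! j" "wsrc (ws ! j) = xs ! Suc j" if "j < length ws" for j
  using z that by (auto simp: word_path_def zz)
 define ws' where "ws' = snd (face Cmp i z)"
 have f: "face Cmp i z = (take i xs @ drop (Suc i) xs, ws')" by (simp add: ws'_def zz face_def)
 have ws': "ws' = (if i = 0 then tl ws else if i = length ws then butlast ws
   else take (i - 1) ws @ Cmp (ws ! (i - 1)) (ws ! i) # drop (Suc i) ws)" by (simp add: ws'_def zz face_def)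
 have len: "length ws' = length ws - 1" using l(2,3) by (auto simp: ws')
 have "wfw p (ws' ! j) & wtgt (ws' ! j) = (take i xs @ drop (Suc i) xs) ! j & wsrc (ws' ! j) = (take i xs @ drop (Suc i) xs) ! Suc j"
  if j: "j < length ws - 1" for j
 proof -
  have n: "ws' ! j = (if i = 0 then ws ! Suc j else if i = length ws then ws ! j
    else if j < i - 1 then ws ! j else if j = i - 1 then Cmp (ws ! (i - 1)) (ws ! i) else ws ! Suc j)"
   using j l(2) nth_merge[of i ws j] by (auto simp: ws' nth_tl nth_butlast)
  have x: "(take i xs @ drop (Suc i) xs) ! j = (if j < i then xs ! j else xs ! Suc j)"
   "(take i xs @ drop (Suc i) xs) ! Suc j = (if Suc j < i then xs ! Suc j else xs ! Suc (Suc j))"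
   using j l(1,2) by (simp_all only: nth_delete)
  consider "i = 0" | "i = length ws" "0 < i" | "0 < i" "j < i - 1" | "0 < i" "i < length ws" "j = i - 1" | "0 < i" "i < length ws" "i - 1 < j"
   using l(2) by linarith
  then show ?thesis using j w[of j] w[of "Suc j"] unfolding n x by cases (auto simp: l(2))
 qed
 then show "word_path p (face Cmp i z)" unfolding word_path_def f using l len
  by (auto dest: in_set_takeD in_set_dropD)
 show "fst (face Cmp i z) = take i (fst z) @ drop (Suc i) (fst z)" by (simp add: zz face_def)
 show "length (snd (face Cmp i z)) = length (snd z) - 1" unfolding f snd_conv by (simp add: len zz)
 show "face m i (smap m e s z) = smap m e s (face Cmp i z)"
  using l by (auto simp: zz smap_def face_def take_map drop_map map_tl map_butlast)
qed

lemma degen_path: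
 assumes z: "word_path p z" and i: "i <= length (snd z)"
 shows "word_path p (degen Unit i z)" "fst (degen Unit i z) = take (Suc i) (fst z) @ drop i (fst z)"
  "length (snd (degen Unit i z)) = Suc (length (snd z))" "degen e i (smap m e s z) = smap m e s (degen Unit i z)"
proof -
 obtain xs ws where zz: "z = (xs, ws)" by (cases z)
 have l: "length xs = Suc (length ws)" "i <= length ws" "!!x. x : set xs ==> x <= p" using z i by (auto simp: word_path_def zz)
 have w: "wfw p (ws ! j)" "wtgt (ws ! j) = xs ! j" "wsrc (ws ! j) = xs ! Suc j" if "j < length ws" for j
  using z that by (auto simp: word_path_def zz)
 let ?ws = "take i ws @ Unit (xs ! i) # drop i ws"
 have "wfw p (?ws ! j) & wtgt (?ws ! j) = (take (Suc i) xs @ drop i xs) ! j & wsrc (?ws ! j) = (take (Suc i) xs @ drop i xs) ! Suc j"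
  if j: "j < Suc (length ws)" for j
 proof -
  have n: "?ws ! j = (if j < i then ws ! j else if j = i then Unit (xs ! i) else ws ! (j - 1))"
   using j l(2) by (auto simp: nth_append nth_Cons split: nat.splits intro!: arg_cong[of _ _ "(!) ws"])
  have x: "(take (Suc i) xs @ drop i xs) ! k = (if k <= i then xs ! k else xs ! (k - 1))" if "k < Suc (length xs)" for k
   using that l(1,2) by (auto simp: nth_append intro!: arg_cong[of _ _ "(!) xs"])
  have x': "(take (Suc i) xs @ drop i xs) ! j = (if j <= i then xs ! j else xs ! (j - 1))"
   "(take (Suc i) xs @ drop i xs) ! Suc j = (if j < i then xs ! Suc j else xs ! j)"
   using j l(1) x[of j] x[of "Suc j"] by (simp_all add: Suc_le_eq)
  consider "j < i" | "j = i" | "i < j" "Suc (j - 1) = j" by linarith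
  then show ?thesis
  proof cases
   case 1 then show ?thesis using w[of j] l(2) unfolding n x' by simp
  next
   case 2 then show ?thesis using l(1-3) j unfolding n x' by simp
  next
   case 3 then show ?thesis using w[of "j - 1"] j unfolding n x' by simp
  qed
 qed
 then show "word_path p (degen Unit i z)" unfolding word_path_def zz degen_def using l
  by (auto dest: in_set_takeD in_set_dropD)
 show "fst (degen Unit i z) = take (Suc i) (fst z) @ drop i (fst z)" by (simp add: zz degen_def)
 show "length (snd (degen Unit i z)) = Suc (length (snd z))" using l by (simp add: zz degen_def)
 show "degen e i (smap m e s z) = smap m e s (degen Unit i z)"
  using l by (simp add: zz smap_def degen_def take_map drop_map)
qed

text \<open>Applied with decreasing index, a face leaves the lower vertices alone. So the vertex
  list is always an untouched initial segment followed by the surviving vertices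
  \<open>ys\<close>.\<close>

lemma fold_face:
 assumes "word_path p z" "fst z = [0..<n] @ ys" "filter (%i. ~ P i) [0..<n] @ ys ~= []"
 shows "word_path p (fold (face Cmp) (rev (filter P [0..<n])) z) &
  fst (fold (face Cmp) (rev (filter P [0..<n])) z) = filter (%i. ~ P i) [0..<n] @ ys &
  fold (face m) (rev (filter P [0..<n])) (smap m e s z) = smap m e s (fold (face Cmp) (rev (filter P [0..<n])) z)"
 using assms
proof (induction n arbitrary: z ys)
 case (Suc n)
 show ?case
 proof (cases "P n")
  case True
  have l: "n <= length (snd z)" using Suc.prems(1,2) by (simp add: word_path_def)
  have "n + length ys ~= 0" using Suc.prems(3) True by (cases n) auto
  then have "snd z ~= []" using Suc.prems(1,2) by (auto simp: word_path_def)
  note f = face_path[OF Suc.prems(1) l this]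
  have "fst (face Cmp n z) = [0..<n] @ ys" unfolding f(2) Suc.prems(2) by simp
  from Suc.IH[OF f(1) this] Suc.prems(3) True show ?thesis by (simp add: f(4))
 next
  case False
  then show ?thesis using Suc.IH[of z "n # ys"] Suc.prems by simp
 qed
qed simp

lemma sorted_list_insert_least:
 "finite A ==> (!!x. x : A ==> b < x) ==> sorted_list_of_set (insert b A) = b # sorted_list_of_set A" for b :: nat
 by (subst sorted_list_of_set_insert) (auto intro!: insort_is_Cons simp: less_imp_le)

text \<open>The invariant: once the degeneracies below \<open>n\<close> have been applied, the
  vertices are \<open>a 0\<close>, ..., \<open>a n\<close>, followed by the elements of the image
  above \<open>a n\<close>, each listed once.\<close>

lemma fold_degen:
 assumes a: "a : Delta q p" and z: "word_path p z" "fst z = sorted_list_of_set (a ` {..q})" and n: "n <= q"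
 shows "word_path p (fold (degen Unit) (filter (%j. a j = a (Suc j)) [0..<n]) z) &
  fst (fold (degen Unit) (filter (%j. a j = a (Suc j)) [0..<n]) z) = map a [0..<Suc n] @ sorted_list_of_set {x : a ` {..q}. a n < x} &
  fold (degen e) (filter (%j. a j = a (Suc j)) [0..<n]) (smap m e s z) = smap m e s (fold (degen Unit) (filter (%j. a j = a (Suc j)) [0..<n]) z)"
 using n
proof (induction n)
 case 0
 have "a 0 < a i" if "i <= q" "a i ~= a 0" for i using Delta_le(2)[OF a _ that(1), of 0] that(2) by simp
 then have "a ` {..q} = insert (a 0) {x : a ` {..q}. a 0 < x}" by auto
 then have "sorted_list_of_set (a ` {..q}) = a 0 # sorted_list_of_set {x : a ` {..q}. a 0 < x}"
  by (rule ssubst) (rule sorted_list_insert_least; simp)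
 then show ?case using z by simp
next
 case (Suc n)
 let ?z = "fold (degen Unit) (filter (%j. a j = a (Suc j)) [0..<n]) z"
 have IH: "word_path p ?z" "fst ?z = map a [0..<Suc n] @ sorted_list_of_set {x : a ` {..q}. a n < x}"
  "fold (degen e) (filter (%j. a j = a (Suc j)) [0..<n]) (smap m e s z) = smap m e s ?z" using Suc by auto
 show ?case
 proof (cases "a n = a (Suc n)")
  case True
  have l: "n <= length (snd ?z)" using IH(1) arg_cong[OF IH(2), of length] by (simp add: word_path_def del: upt_Suc)
  note d = degen_path[OF IH(1) l]
  have "fst (degen Unit n ?z) = map a [0..<Suc (Suc n)] @ sorted_list_of_set {x : a ` {..q}. a n < x}"
   unfolding d(2) IH(2) by (simp add: True)
  then show ?thesis using d(1) True by (simp add: IH(3) d(4))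
 next
  case False
  then have lt: "a n < a (Suc n)" using Delta_le(2)[OF a, of n "Suc n"] Suc.prems by simp
  have "{x : a ` {..q}. a n < x} = insert (a (Suc n)) {x : a ` {..q}. a (Suc n) < x}"
  proof (intro Set.set_eqI iffI)
   fix x assume x: "x : {x : a ` {..q}. a n < x}"
   then obtain i where i: "x = a i" "i <= q" "a n < a i" by auto
   then have "~ i <= n" using Delta_le(2)[OF a, of i n] Suc.prems by linarith
   then have "Suc n <= i" by simp
   then have "a (Suc n) <= x" using Delta_le(2)[OF a] i by simp
   then show "x : insert (a (Suc n)) {x : a ` {..q}. a (Suc n) < x}" using i by (auto simp: le_less)
  qed (use lt Suc.prems in auto)
  then have "sorted_list_of_set {x : a ` {..q}. a n < x} = a (Suc n) # sorted_list_of_set {x : a ` {..q}. a (Suc n) < x}"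
   by (simp only:) (rule sorted_list_insert_least; simp)
  then show ?thesis using IH False by simp
 qed
qed

lemma word_path_generic: "word_path p (generic_string p)"
 by (auto simp: word_path_def generic_string_def nth_append simp del: upt_Suc)

lemma smap_generic: "length (fst s) = Suc p ==> length (snd s) = p ==> smap m e s (generic_string p) = s"
 by (cases s) (auto simp: smap_def generic_string_def list_eq_iff_nth_eq simp del: upt_Suc)

lemma sorted_list_filter: "sorted_list_of_set {i. i < n & P i} = filter P [0..<n]"
 by (rule sorted_distinct_set_unique) (auto simp: sorted_wrt_filter)

text \<open>Faces and degeneracies commute with evaluation, so the pullback is computed once, on the
  generic string, and then evaluated. The same words serve morphisms, deformations and iterated
  pullbacks.\<close>

theorem string_pull_words:
 assumes a: "a : Delta q p"
 shows "word_path p (word_pull q p a (generic_string p))" "fst (word_pull q p a (generic_string p)) = map a [0..<Suc q]"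
  "length (fst s) = Suc p ==> length (snd s) = p ==> string_pull m e q p a s = smap m e s (word_pull q p a (generic_string p))"
proof -
 have D: "sorted_list_of_set ({..p} - a ` {..q}) = filter (%i. i ~: a ` {..q}) [0..<Suc p]"
  unfolding sorted_list_filter[symmetric] by (rule arg_cong[of _ _ sorted_list_of_set]) auto
 have im: "filter (%i. ~ i ~: a ` {..q}) [0..<Suc p] = sorted_list_of_set (a ` {..q})"
  unfolding sorted_list_filter[symmetric] by (rule arg_cong[of _ _ sorted_list_of_set]) (use Delta_le(1)[OF a] in "auto simp: less_Suc_eq_le")
 let ?z = "fold (face Cmp) (rev (filter (%i. i ~: a ` {..q}) [0..<Suc p])) (generic_string p)"
 have f: "word_path p ?z & fst ?z = filter (%i. ~ i ~: a ` {..q}) [0..<Suc p] @ [] &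
   fold (face m) (rev (filter (%i. i ~: a ` {..q}) [0..<Suc p])) (smap m e s (generic_string p)) = smap m e s ?z" for m e and s :: "('o, 'u) string"
 proof (rule fold_face[OF word_path_generic])
  show "fst (generic_string p) = [0..<Suc p] @ []" by (simp add: generic_string_def)
  have "sorted_list_of_set (a ` {..q}) ~= []" by simp
  then show "filter (%i. ~ i ~: a ` {..q}) [0..<Suc p] @ [] ~= []" unfolding im by simp
 qed
 note f' = f[unfolded im append_Nil2]
 note zfst = f'[THEN conjunct2, THEN conjunct1] f'[THEN conjunct1]
 have e: "{x : a ` {..q}. a q < x} = {}" using Delta_le(2)[OF a] by (auto simp: not_less)
 note d = fold_degen[OF a zfst(2,1) order_refl, unfolded e]
 show "word_path p (word_pull q p a (generic_string p))" "fst (word_pull q p a (generic_string p)) = map a [0..<Suc q]"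
  unfolding string_pull_def D sorted_list_filter using d[THEN conjunct1] d[THEN conjunct2, THEN conjunct1] by simp_all
 show "string_pull m e q p a s = smap m e s (word_pull q p a (generic_string p))" if "length (fst s) = Suc p" "length (snd s) = p"
  unfolding string_pull_def D sorted_list_filter
  using d[THEN conjunct2, THEN conjunct2] f'[of m e s, THEN conjunct2, THEN conjunct2] by (simp add: smap_generic[OF that] del: upt_Suc)
qed

text \<open>Substitution lemma: evaluating after substitution is evaluating at the pulled back
  string.\<close>

lemma weval_weval:
 assumes z: "word_path p z" "length (snd z) = q" and v: "wfw q v"
 shows "weval m e s (weval Cmp Unit z v) = weval m e (smap m e s z) v"
 using v by (induction v) (use z in "auto simp: smap_def word_path_def")

lemma wfw_weval:
 assumes z: "word_path p z" "length (snd z) = q" and v: "wfw q v"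
 shows "wfw p (weval Cmp Unit z v) & wtgt (weval Cmp Unit z v) = fst z ! wtgt v & wsrc (weval Cmp Unit z v) = fst z ! wsrc v"
 using v
proof (induction v)
 case (Gen k)
 then have "snd z ! (k - 1) = snd z ! (k - 1) & k - 1 < length (snd z) & Suc (k - 1) = k" using z by auto
 then show ?case using z(1) Gen unfolding word_path_def by simp
qed (use z in "auto simp: word_path_def")

lemma string_pull_id: "length (fst s) = Suc p ==> length (snd s) = p ==> string_pull m e p p (Did p) s = s"
proof -
 have "Did p ` {..p} = {..p}" "{j. j < p & Did p j = Did p (Suc j)} = {}" by (auto simp: Delta_id_def)
 then show ?thesis unfolding string_pull_def by (simp only: Diff_cancel sorted_list_of_set_empty) simp
qed

section \<open>Coherence\<close>

text \<open>\<open>nu C s w\<close> is the canonical deformation from the value of \<open>w\<close> to its left bracketed normal form.\<close>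

primrec nu :: "('o, 'm, 'd) bicat => ('o, 'm) string => word => 'd" where
 "nu C s (Gen k) = vid C (snd s ! (k - 1))"
| "nu C s (Unit i) = vid C (unit_mor C (fst s ! i))"
| "nu C s (Cmp v w) = vcomp C (ext_cell C s (wtgt v) (wsrc v) (wsrc w)) (hcomp C (nu C s v) (nu C s w))"

abbreviation "NF p == string_ext Cmp Unit (generic_string p)"

lemma string_ext_words:
 assumes z: "word_path p z" "length (snd z) = q" and ij: "i <= j" "j <= q"
 shows "wfw p (string_ext Cmp Unit z i j) & wtgt (string_ext Cmp Unit z i j) = fst z ! i &
   wsrc (string_ext Cmp Unit z i j) = fst z ! j"
  "weval m e s (string_ext Cmp Unit z i j) = string_ext m e (smap m e s z) i j"
 unfolding atomize_conj using ij
proof (induction j)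
 case 0 then show ?case using z by (simp add: ext_simps word_path_def smap_def)
next
 case (Suc j)
 then consider "i = Suc j" | "i = j" | "i < j" by linarith
 then show ?case using z Suc by cases (auto simp: ext_simps word_path_def smap_def)
qed

lemma ext_generic:
 assumes "i <= j" "j <= p" shows "wfw p (NF p i j)" "wtgt (NF p i j) = i" "wsrc (NF p i j) = j"
  "length (fst s) = Suc p ==> length (snd s) = p ==> weval m e s (NF p i j) = string_ext m e s i j"
proof -
 have "length (snd (generic_string p)) = p" "fst (generic_string p) ! i = i" "fst (generic_string p) ! j = j"
  using assms by (simp_all add: generic_string_def del: upt_Suc)
 then show "wfw p (NF p i j)" "wtgt (NF p i j) = i" "wsrc (NF p i j) = j"
  "length (fst s) = Suc p ==> length (snd s) = p ==> weval m e s (NF p i j) = string_ext m e s i j"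
  using string_ext_words(1)[OF word_path_generic _ assms] string_ext_words(2)[OF word_path_generic _ assms, of p m e s]
  by (simp_all add: smap_generic)
qed

context comp_string
begin

abbreviation "V == weval (mcomp C) (unit_mor C) s"
abbreviation "n == nu C s"

lemma string_length [simp]: "length (fst s) = Suc p" "length (snd s) = p"
 using s by (auto simp: mem_sobs)

lemma V_types [simp]:
 assumes "wfw p w" shows "V w : Mor C" "src C (V w) = X (wsrc w)" "tgt C (V w) = X (wtgt w)"
proof -
 have "V w : Mor C & src C (V w) = X (wsrc w) & tgt C (V w) = X (wtgt w)" using assms
 proof (induction w)
  case (Gen k)
  then obtain j where "k = Suc j" "j < p" by (cases k) auto
  then show ?case by simp
 qed auto
 then show "V w : Mor C" "src C (V w) = X (wsrc w)" "tgt C (V w) = X (wtgt w)" by auto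
qed

lemma nu_types [simp]:
 assumes "wfw p w"
 shows "n w : Cell C" "ddom C (n w) = V w" "dcod C (n w) = E (wtgt w) (wsrc w)" "invcell C (n w)"
proof -
 have "n w : Cell C & ddom C (n w) = V w & dcod C (n w) = E (wtgt w) (wsrc w) & invcell C (n w)" using assms
 proof (induction w)
  case (Gen k)
  then obtain j where "k = Suc j" "j < p" by (cases k) auto
  then show ?case by simp
 next
  case (Cmp v w)
  then have "wtgt v <= wsrc v" "wsrc v <= wsrc w" "wsrc w <= p" "wsrc v <= p" "wtgt w = wsrc v"
   using wfw_le[of p v] wfw_le[of p w] by auto
  then show ?case using Cmp by simp
 qed auto
 then show "n w : Cell C" "ddom C (n w) = V w" "dcod C (n w) = E (wtgt w) (wsrc w)" "invcell C (n w)" by auto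
qed

text \<open>Every canonical deformation commutes with the passage to normal forms. As
  \<open>nu\<close> is invertible, it is determined by its two words. The rules also apply to
  ill-formed words, so the invariant includes that the two words are well-formed together.\<close>

lemma canonical_sound:
 "canonical C s v w c ==> (wfw p v <-> wfw p w) & (wfw p v --> wsrc v = wsrc w & wtgt v = wtgt w &
   c : Cell C & ddom C c = V v & dcod C c = V w & n w ;; c = n v)"
proof (induction rule: canonical.induct)
 case (can_asc u v w)
 have "n (Cmp (Cmp u v) w) ;; asc C (V u) (V v) (V w) = n (Cmp u (Cmp v w))" if w: "wfw p (Cmp u (Cmp v w))"
 proof -
  let ?i = "wtgt u" and ?j = "wsrc u" and ?k = "wsrc v" and ?l = "wsrc w"
  have o: "?i <= ?j" "?j <= ?k" "?k <= ?l" "?l <= p" "?k <= p" "?j <= p" "?i <= ?k" "?j <= ?l"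
   "wtgt w = wsrc v" "wtgt v = wsrc u"
   "wfw p u" "wfw p v" "wfw p w"
   using w wfw_le[of p u] wfw_le[of p v] wfw_le[of p w] by auto
  have "n (Cmp (Cmp u v) w) ;; asc C (V u) (V v) (V w)
    = K ?i ?k ?l ;; (K ?i ?j ?k *. vid C (E ?k ?l)) ;; (n u *. n v *. n w ;; asc C (V u) (V v) (V w))"
   by (simp add: o v_assoc hcomp_vcomp hcomp_vcomp_tail del: K_simps)
  also have "n u *. n v *. n w ;; asc C (V u) (V v) (V w) = asc C (E ?i ?j) (E ?j ?k) (E ?k ?l) ;; (n u *. (n v *. n w))"
   using asc_nat[of "n u" "n v" "n w"] by (simp add: o)
  also have "K ?i ?k ?l ;; (K ?i ?j ?k *. vid C (E ?k ?l)) ;; (asc C (E ?i ?j) (E ?j ?k) (E ?k ?l) ;; (n u *. (n v *. n w)))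
    = K ?i ?k ?l ;; ((K ?i ?j ?k *. vid C (E ?k ?l)) ;; asc C (E ?i ?j) (E ?j ?k) (E ?k ?l)) ;; (n u *. (n v *. n w))"
   by (simp add: o v_assoc del: K_simps)
  also have "... = K ?i ?j ?l ;; (vid C (E ?i ?j) *. K ?j ?k ?l) ;; (n u *. (n v *. n w))"
   by (simp only: K_assoc[OF o(1-4)])
  also have "... = n (Cmp u (Cmp v w))"
   by (simp add: o v_assoc hcomp_vcomp del: K_simps)
  finally show ?thesis .
 qed
 then show ?case by (auto simp: word_eval)
next
 case (can_lun w)
 show ?case using lun_nat[of "n w" "X (wtgt w)"] wfw_le[of p w] by (auto simp: word_eval)
next
 case (can_run w)
 show ?case using run_nat[of "n w" "X (wsrc w)"] wfw_le[of p w] by (auto simp: word_eval)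
next
 case (can_inv v w c d)
 show ?case
 proof (intro conjI impI)
  assume w: "wfw p w"
  then have c: "wfw p v" "wsrc v = wsrc w" "wtgt v = wtgt w" "c : Cell C" "ddom C c = V v" "dcod C c = V w" "n w ;; c = n v"
   using can_inv.IH by auto
  have d: "d : Cell C" "ddom C d = V w" "dcod C d = V v" "c ;; d = vid C (V w)" using can_inv.hyps(2) c by (auto simp: inverse_cells_def mem_cells)
  have "n v ;; d = n w ;; (c ;; d)" unfolding c(7)[symmetric] using c(4-6) d(1-3) w by (subst v_assoc) simp_all
  then show "n v ;; d = n w" "wsrc w = wsrc v" "wtgt w = wtgt v" "d : Cell C" "ddom C d = V w" "dcod C d = V v"
   using w c d by simp_all
 qed (use can_inv.IH in auto)
next
 case (can_vcomp u v w c d)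
 then show ?case by (auto simp flip: v_assoc)
next
 case (can_hcomp v v' c w w' d)
 show ?case
 proof (intro conjI impI)
  assume "wfw p (Cmp v w)"
  then have o: "wfw p v" "wfw p w" "wsrc v = wtgt w" by auto
  note c = can_hcomp.IH(1)[THEN conjunct2, rule_format, OF o(1)] can_hcomp.IH(2)[THEN conjunct2, rule_format, OF o(2)]
  have o': "wfw p v'" "wfw p w'" "wtgt v' <= wsrc v'" "wtgt w' <= wsrc w'" "wsrc w' <= p" "wsrc v' = wtgt w'"
   using can_hcomp.IH c o wfw_le[of p v'] wfw_le[of p w'] by auto
  show "n (Cmp v' w') ;; (c *. d) = n (Cmp v w)" using c o o' by (simp add: v_assoc hcomp_vcomp)
  show "c *. d : Cell C" "ddom C (c *. d) = V (Cmp v w)" "dcod C (c *. d) = V (Cmp v' w')" using c o o' by simp_all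
 qed (use can_hcomp.IH in auto)
qed (auto simp: word_eval)

text \<open>Needed for existence: the cells of the rectification are built from constraints, hence
  so is \<open>nu\<close>.\<close>

lemma canonical_K:
 assumes "i <= j" "j <= k" "k <= p" shows "canonical C s (Cmp (NF p i j) (NF p j k)) (NF p i k) (K i j k)"
 using assms
proof (induction k)
 case 0
 then show ?case using can_lun[of C s "NF p 0 0"] by (simp add: ext_simps word_eval generic_string_def del: upt_Suc)
next
 case (Suc k)
 have e: "word_eval C s (NF p a b) = E a b" if "a <= b" "b <= p" for a b
  using ext_generic(4)[OF that, of s] by (simp add: word_eval)
 have g: "NF p b (Suc b) = Gen (Suc b)" "snd (generic_string p) ! b = Gen (Suc b)" "word_eval C s (Gen (Suc b)) = U b" if "b < p" for b
  using that by (simp_all add: ext_simps generic_string_def del: upt_Suc)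
 have u: "NF p b b = Unit b" if "b <= p" for b
  using that by (simp add: ext_simps generic_string_def del: upt_Suc)
 consider "i = j" | "i < j" "j = Suc k" | "i < j" "j = k" | "i < j" "j < k" using Suc.prems by linarith
 then show ?case
 proof cases
  case 1
  then show ?thesis using can_lun[of C s "NF p i (Suc k)"] Suc.prems ext_generic[of i "Suc k" p] by (simp add: e u)
 next
  case 2
  then show ?thesis using can_run[of C s "NF p i (Suc k)"] Suc.prems ext_generic[of i "Suc k" p] by (simp add: e u)
 next
  case 3
  then show ?thesis using can_id[of C s "NF p i (Suc k)"] Suc.prems by (simp add: e g ext_simps(3))
 next
  case 4
  have "canonical C s (Cmp (NF p i j) (NF p j k)) (NF p i k) (K i j k)" using Suc 4 by simp
  note h = can_hcomp[OF this can_id[of C s "Gen (Suc k)"]]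
  from can_vcomp[OF can_asc h] show ?thesis
   using 4 Suc.prems by (simp add: e g ext_simps(3))
 qed
qed

lemma canonical_nu: "wfw p w ==> canonical C s w (NF p (wtgt w) (wsrc w)) (n w)"
proof (induction w)
 case (Gen k)
 then obtain j where "k = Suc j" "j < p" by (cases k) auto
 then show ?case using can_id[of C s "Gen k"] by (simp add: ext_simps generic_string_def del: upt_Suc)
next
 case (Unit i)
 then show ?case using can_id[of C s "Unit i"] by (simp add: ext_simps generic_string_def del: upt_Suc)
next
 case (Cmp v w)
 then have o: "wfw p v" "wfw p w" "wsrc v = wtgt w" by auto
 have "canonical C s (Cmp (NF p (wtgt v) (wsrc v)) (NF p (wtgt w) (wsrc w))) (NF p (wtgt v) (wsrc w))
   (K (wtgt v) (wsrc v) (wsrc w))"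
  using canonical_K[of "wtgt v" "wsrc v" "wsrc w"] o wfw_le[of p v] wfw_le[of p w] by simp
 from can_vcomp[OF can_hcomp[OF Cmp.IH(1)[OF o(1)] Cmp.IH(2)[OF o(2)]] this] show ?case by simp
qed

text \<open>The coherence theorem in the form used below: two words with the same ends are joined
  through their common normal form, and by \<open>canonical_sound\<close> in no other way. It turns
  the definite description into a formula.\<close>

lemma canonical_cell_eq:
 assumes "wfw p v" "wfw p w" "wsrc v = wsrc w" "wtgt v = wtgt w"
 shows "canonical_cell C s v w = cinv C (n w) ;; n v"
 unfolding canonical_cell_def
proof (rule the_equality)
 have "canonical C s (NF p (wtgt v) (wsrc v)) w (cinv C (n w))"
  using can_inv[OF canonical_nu[OF assms(2)] inverse_cell_inv] assms by simp
 from can_vcomp[OF canonical_nu[OF assms(1)] this] show "canonical C s v w (cinv C (n w) ;; n v)" .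
next
 fix c assume "canonical C s v w c"
 then have "c : Cell C" "dcod C c = V w" "n w ;; c = n v" using canonical_sound assms by blast+
 then show "c = cinv C (n w) ;; n v" using assms inv_cancel(1)[of "n w" c] by simp
qed

text \<open>\<open>nu\<close> at a normal form is canonical from this word to itself, hence
  idempotent by soundness; an invertible idempotent is an identity.\<close>

lemma nu_NF: assumes "i <= j" "j <= p" shows "n (NF p i j) = vid C (E i j)"
proof -
 note g = ext_generic[OF assms]
 have V: "V (NF p i j) = E i j" by (rule g(4)) simp_all
 have "n (NF p i j) ;; n (NF p i j) = n (NF p i j)"
  using canonical_sound[OF canonical_nu[OF g(1)]] g by simp
 then have "n (NF p i j) ;; n (NF p i j) = n (NF p i j) ;; vid C (E i j)" using g V by simp
 then show ?thesis by (rule cancel_left[rotated 5]) (use g V assms in simp_all)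
qed

end

section \<open>Pulled back strings and the structure cells of \<open>J\<close>\<close>

locale pulled_str = comp_string C p s for C :: "('o, 'm, 'd) bicat" (structure) and p s +
 fixes q a assumes a: "a : Delta q p"
begin

abbreviation "W == word_pull q p a (generic_string p)"
abbreviation "y == pb_ob (Nerve C) q p a s"

lemma pb_string: "y = smap (mcomp C) (unit_mor C) s W"
 using string_pull_words(3)[OF a, of s "mcomp C" "unit_mor C"] by (simp add: pseudo_nerve_def)

lemma W_facts:
 "word_path p W" "length (snd W) = q" "length (fst W) = Suc q" "i <= q ==> fst W ! i = a i"
 "j < q ==> wfw p (snd W ! j) & wtgt (snd W ! j) = a j & wsrc (snd W ! j) = a (Suc j)"
proof -
 note w = string_pull_words(1,2)[OF a]
 show l: "word_path p W" "length (snd W) = q" "length (fst W) = Suc q" using w unfolding word_path_def by (auto simp del: upt_Suc)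
 show f: "fst W ! i = a i" if "i <= q" for i unfolding w(2) using that by (simp del: upt_Suc)
 show "wfw p (snd W ! j) & wtgt (snd W ! j) = a j & wsrc (snd W ! j) = a (Suc j)" if "j < q"
  using w(1) that l(2) f[of j] f[of "Suc j"] unfolding word_path_def by auto
qed

lemma y_nth: "i <= q ==> fst y ! i = X (a i)" "j < q ==> snd y ! j = V (snd W ! j)" "length (fst y) = Suc q" "length (snd y) = q"
 unfolding pb_string smap_def using W_facts by simp_all

lemma y_obs: "y : obs (strc C q)"
 unfolding mem_sobs
proof (intro conjI allI impI)
 show "set (fst y) \<subseteq> Ob C" using y_nth(1,3) Delta_le(1)[OF a] by (auto simp: in_set_conv_nth less_Suc_eq_le)
qed (use y_nth W_facts in auto)

sublocale Y: comp_string C q y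
 by unfold_locales (rule y_obs)

sublocale PR: lax_fun C q "pulld q a R"
 by unfold_locales (rule laxF_pull[OF a lax_ext])

abbreviation "tht == snd (snd (mstrJ C q p a s))"

text \<open>The structure cell of \<open>J\<close> is given by canonical cells, which does not show
  its naturality. It is identified with the transformation \<open>t\<close> that is generated by the
  normalizations of the words of the pulled back string.\<close>

lemma theta:
 shows th_trans: "laxT C q Y.R (pulld q a R) tht"
  and theta_inv: "i <= j ==> j <= q ==> invcell C (tht i j)"
  and theta_step: "j < q ==> tht j (Suc j) = n (snd W ! j)"
  and theta_nu: "wfw q v ==> n (weval Cmp Unit W v) = tht (wtgt v) (wsrc v) ;; nu C y v"
proof -
 have t: "n (snd W ! j) : Cell C & ddom C (n (snd W ! j)) = Y.U j & dcod C (n (snd W ! j)) = lmor (pulld q a R) j (Suc j)" if "j < q" for j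
  using that W_facts(5)[OF that] y_nth Delta_le[OF a] by simp
 have hom: "homomorphism C q (pulld q a R)"
  using lax_class_hom nhom_ext a unfolding lax_class_def normal_homomorphism_def by blast
 have "EX t. laxT C q Y.R (pulld q a R) t & (ALL j<q. t j (Suc j) = n (snd W ! j)) &
  (homomorphism C q (pulld q a R) & (ALL j<q. invcell C (n (snd W ! j))) --> (ALL i j. i <= j & j <= q --> invcell C (t i j)))"
  by (rule Y.ext_universal[OF PR.F _ t]) (use y_nth Delta_le[OF a] in auto)
 then obtain t where "laxT C q Y.R (pulld q a R) t & (ALL j<q. t j (Suc j) = n (snd W ! j)) &
  (homomorphism C q (pulld q a R) & (ALL j<q. invcell C (n (snd W ! j))) --> (ALL i j. i <= j & j <= q --> invcell C (t i j)))"
  by (elim exE)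
 then have t1: "laxT C q Y.R (pulld q a R) t" and t2: "!!j. j < q ==> t j (Suc j) = n (snd W ! j)"
  and t3: "ALL i j. i <= j & j <= q --> invcell C (t i j)" using hom W_facts(5) by auto
 interpret t: lax_tra C q Y.R "pulld q a R" t by unfold_locales (rule t1)
 \<comment> \<open>Normalizing a substituted word can be done in two stages: normalize over the
   pulled back string, then apply \<open>t\<close>.\<close>
 have sub: "n (weval Cmp Unit W v) = t (wtgt v) (wsrc v) ;; nu C y v" if "wfw q v" for v
  using that
 proof (induction v)
  case (Gen k)
  then obtain j where k: "k = Suc j" "j < q" by (cases k) auto
  then show ?case using t2[of j] t.trans_simps[of j "Suc j"] y_nth by simp
 next
  case (Unit i)
  then show ?case using t.trans_one[of i] t.trans_simps[of i i] W_facts(4) Delta_le[OF a] y_nth by simp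
 next
  case (Cmp v w)
  let ?i = "wtgt v" and ?j = "wsrc v" and ?k = "wsrc w"
  have o: "wfw q v" "wfw q w" "wtgt w = ?j" "?i <= ?j" "?j <= ?k" "?k <= q" "?j <= q" "?i <= q" "?i <= ?k"
   using Cmp.prems wfw_le[of q v] wfw_le[of q w] by auto
  have s: "wtgt (weval Cmp Unit W v) = a ?i" "wsrc (weval Cmp Unit W v) = a ?j" "wsrc (weval Cmp Unit W w) = a ?k"
   using wfw_weval[OF W_facts(1,2)] o W_facts(4) by simp_all
  have "n (weval Cmp Unit W (Cmp v w)) = lcmp (pulld q a R) ?i ?j ?k ;; ((t ?i ?j ;; nu C y v) *. (t ?j ?k ;; nu C y w))"
   using Cmp.IH o s Delta_le[OF a] by simp
  also have "... = lcmp (pulld q a R) ?i ?j ?k ;; (t ?i ?j *. t ?j ?k) ;; (nu C y v *. nu C y w)"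
   using o y_nth by (simp add: v_assoc hcomp_vcomp del: pull_simps)
  also have "... = t ?i ?k ;; nu C y (Cmp v w)"
   using o y_nth t.trans_cmp[OF o(4,5,6)] by (simp add: v_assoc del: pull_simps K_simps)
  finally show ?case by simp
 qed
 have "tht = t"
 proof (rule trans_eqI[of q])
  fix i j assume ij: "i <= j" "j <= q"
  note z = string_ext_words(1)[OF W_facts(1,2) ij]
  have l: "length (fst W) = Suc q" "length (snd W) = q" using W_facts by auto
  have aij: "a i <= a j" "a j <= p" using ij Delta_le[OF a] by auto
  have "string_ext Cmp Unit W i j = weval Cmp Unit W (NF q i j)" using ext_generic(4)[OF ij, of W Cmp Unit] l by simp
  then have "n (string_ext Cmp Unit W i j) = t i j ;; vid C (Y.E i j)"
   using sub[OF ext_generic(1)[OF ij]] ext_generic(2,3)[OF ij] Y.nu_NF[OF ij] by simp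
  moreover have "canonical_cell C s (string_ext Cmp Unit W i j) (NF p (a i) (a j)) = cinv C (n (NF p (a i) (a j))) ;; n (string_ext Cmp Unit W i j)"
   using z ext_generic(1-3)[OF aij] W_facts(4) ij by (intro canonical_cell_eq) simp_all
  ultimately show "tht i j = t i j"
   using ij aij t.trans_simps[OF ij] by (simp add: J_segal_def nu_NF)
 qed (simp_all add: J_segal_def t.trans_restr)
 then show "laxT C q Y.R (pulld q a R) tht" "i <= j ==> j <= q ==> invcell C (tht i j)"
  "j < q ==> tht j (Suc j) = n (snd W ! j)" "wfw q v ==> n (weval Cmp Unit W v) = tht (wtgt v) (wsrc v) ;; nu C y v"
  using t1 t2[of j] t3 sub[of v] by simp_all
qed

end

section \<open>The pseudo-simplicial nerve\<close>

text \<open>A structure preserving map into a category that is injective on parallel arrows reflects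
  the unit and associativity laws.\<close>

lemma transport_category:
 assumes E': "category E'"
  and ar: "!!f. f : ars E ==> dm E f : obs E & cd E f : obs E & Ka f : ars E' & dm E' (Ka f) = Ko (dm E f) & cd E' (Ka f) = Ko (cd E f)"
  and ob: "!!x. x : obs E ==> Ko x : obs E' & idn E x : ars E & dm E (idn E x) = x & cd E (idn E x) = x & Ka (idn E x) = idn E' (Ko x)"
  and comp: "!!f g. [|f : ars E; g : ars E; dm E g = cd E f|] ==> cmp E g f : ars E & dm E (cmp E g f) = dm E f & cd E (cmp E g f) = cd E g &
    Ka (cmp E g f) = cmp E' (Ka g) (Ka f)"
  and inj: "!!f g. [|f : ars E; g : ars E; dm E f = dm E g; cd E f = cd E g; Ka f = Ka g|] ==> f = g"
 shows "category E" "functr E E' Ko Ka"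
proof -
 interpret E': category E' by (rule E')
 show "category E"
 proof (unfold_locales, goal_cases)
  case (5 f) then show ?case
   using ar[OF 5] ob[of "dm E f"] comp[of "idn E (dm E f)" f] E'.idn_right[of "Ka f"] by (intro inj) simp_all
 next
  case (6 f) then show ?case
   using ar[OF 6] ob[of "cd E f"] comp[of f "idn E (cd E f)"] E'.idn_left[of "Ka f"] by (intro inj) simp_all
 next
  case (7 f g h)
  then show ?case
   using ar[of f] ar[of g] ar[of h] comp[of f g] comp[of g h] comp[of "cmp E g f" h] comp[of f "cmp E h g"] E'.cmp_assoc[of "Ka f" "Ka g" "Ka h"]
   by (intro inj) simp_all
 qed (use ar ob comp in blast)+
 show "functr E E' Ko Ka"
  by (rule functrI) (use ar ob comp in blast)+
qed

section \<open>Arrows between strings and their extensions\<close>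

lemma strc_simps [simp]:
 "dm (strc C p) u = (fst u, map (ddom C) (snd u))" "cd (strc C p) u = (fst u, map (dcod C) (snd u))"
 "idn (strc C p) s = (fst s, map (vid C) (snd s))"
 "cmp (strc C p) v u = (fst v, map2 (vcomp C) (snd v) (snd u))"
 by (simp_all add: string_cat_def case_prod_unfold)

lemma (in bicategory) mem_sars: "u : ars (strc C p) <-> length (fst u) = Suc p & length (snd u) = p & set (fst u) \<subseteq> Ob C &
  (ALL i<p. snd u ! i : Cell C & src C (ddom C (snd u ! i)) = fst u ! Suc i & tgt C (ddom C (snd u ! i)) = fst u ! i)"
 by (cases u) (auto simp: string_cat_def hom_cat_def mem_mors)

lemma string_eqI:
 "fst u = fst v ==> length (snd u) = p ==> length (snd v) = p ==> (!!j. j < p ==> snd u ! j = snd v ! j) ==> u = v"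
 by (auto simp: prod_eq_iff list_eq_iff_nth_eq)

locale str_arrow = bicategory C for C :: "('o, 'm, 'd) bicat" (structure) +
 fixes p u assumes u: "u : ars (strc C p)"
begin

abbreviation "d == (fst u, map (ddom C) (snd u))"
abbreviation "c == (fst u, map (dcod C) (snd u))"
abbreviation "e == %x. vid C (unit_mor C x)"

lemma u_simps [simp]: "length (fst u) = Suc p" "length (snd u) = p" "i < p ==> snd u ! i : Cell C"
 "i < p ==> src C (ddom C (snd u ! i)) = fst u ! Suc i" "i < p ==> tgt C (ddom C (snd u ! i)) = fst u ! i"
 using u by (auto simp: mem_sars)

lemma d_c_obs: "d : obs (strc C p)" "c : obs (strc C p)"
 using u by (auto simp: mem_sars mem_sobs)

sublocale Dm: comp_string C p d
 by unfold_locales (rule d_c_obs)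

sublocale Cd: comp_string C p c
 by unfold_locales (rule d_c_obs)

abbreviation "h == restr p (string_ext (hcomp C) e u)"

text \<open>The cells of the rectification at \<open>i\<close>, \<open>j\<close>,
  \<open>Suc j\<close> with \<open>i < j\<close> are identities, so the transformation generated by
  the entries of \<open>u\<close> is their iterated horizontal composite.\<close>

lemma laxT_arrow: "laxT C p Dm.R Cd.R h"
proof -
 have "EX f. laxT C p Dm.R Cd.R f & (ALL j<p. f j (Suc j) = snd u ! j)"
  using Dm.ext_universal[OF Cd.lax_ext, of "%j. snd u ! j"] by auto
 then obtain f where f: "laxT C p Dm.R Cd.R f & (ALL j<p. f j (Suc j) = snd u ! j)" by (elim exE)
 interpret f: lax_tra C p Dm.R Cd.R f by unfold_locales (rule conjunct1[OF f])
 have "h = f"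
 proof (rule trans_eqI[of p])
  fix i j assume "i <= j" "j <= p"
  then show "h i j = f i j"
  proof (induction j rule: dec_induct)
   case base
   then show ?case using f.trans_one[of i] f.trans_simps[of i i] by (simp add: ext_simps)
  next
   case (step j)
   show ?case
   proof (cases "i = j")
    case True then show ?thesis using step f by (simp add: ext_simps)
   next
    case False
    then show ?thesis using step f.trans_cmp[of i j "Suc j"] f f.trans_simps[of i "Suc j"] by (simp add: ext_simps)
   qed
  qed
 qed (simp_all add: f.trans_restr)
 then show ?thesis using f by simp
qed

lemma h_step: "j < p ==> h j (Suc j) = snd u ! j"
 by (simp add: ext_simps)

sublocale h: lax_tra C p Dm.R Cd.R h
 by unfold_locales (rule laxT_arrow)

text \<open>Naturality of the normalization \<open>nu\<close> in the string: evaluating a word in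
  deformations corresponds to the extension \<open>h\<close> between the normal forms.\<close>

lemma weval_arrow:
 assumes "wfw p w"
 shows "weval (hcomp C) e u w : Cell C & ddom C (weval (hcomp C) e u w) = Dm.V w & dcod C (weval (hcomp C) e u w) = Cd.V w &
  Cd.n w ;; weval (hcomp C) e u w = h (wtgt w) (wsrc w) ;; Dm.n w"
 using assms
proof (induction w)
 case (Gen k)
 then obtain j where k: "k = Suc j" "j < p" by (cases k) auto
 then show ?case using h_step[of j] by (simp del: restr_simps(1))
next
 case (Unit i)
 then show ?case using h.trans_one[of i] h.trans_simps[of i i] Cd.string_simps(1)[of i] by (simp del: restr_simps(1))
next
 case (Cmp v w)
 let ?H = "weval (hcomp C) e u" and ?i = "wtgt v" and ?j = "wsrc v" and ?k = "wsrc w"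
 have o: "wfw p v" "wfw p w" "wtgt w = ?j" "?i <= ?j" "?j <= ?k" "?k <= p" "?j <= p" "?i <= p" "?i <= ?k"
  using Cmp.prems wfw_le[of p v] wfw_le[of p w] by auto
 note IH = Cmp.IH(1)[OF o(1)] Cmp.IH(2)[OF o(2)]
 have t: "i <= j ==> j <= p ==> ddom C (h i j) = Dm.E i j" "i <= j ==> j <= p ==> dcod C (h i j) = Cd.E i j"
  "i <= j ==> j <= p ==> h i j : Cell C" for i j by (simp_all del: restr_simps(1))
 have "Cd.n (Cmp v w) ;; ?H (Cmp v w) = Cd.K ?i ?j ?k ;; ((h ?i ?j ;; Dm.n v) *. (h ?j ?k ;; Dm.n w))"
  using o IH by (simp add: v_assoc hcomp_vcomp del: restr_simps(1) Cd.K_simps)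
 also have "... = Cd.K ?i ?j ?k ;; (h ?i ?j *. h ?j ?k) ;; (Dm.n v *. Dm.n w)"
  using o t by (simp add: v_assoc hcomp_vcomp del: restr_simps(1) Cd.K_simps)
 also have "... = h ?i ?k ;; Dm.n (Cmp v w)"
  using o t h.trans_cmp[OF o(4,5,6)] by (simp add: v_assoc del: restr_simps(1) Cd.K_simps Dm.K_simps)
 finally show ?case using o IH by simp
qed

lemma mar_eq: "mar (J_segal C) p u = (Dm.R, Cd.R, h)"
 by (simp add: J_segal_def)

end

context bicategory
begin

lemma pull_arrow:
 assumes u: "u : ars (strc C q)" and b: "b : Delta r q"
 defines "v == pb_ar (Nerve C) r q b u"
 shows "v = smap (hcomp C) (%x. vid C (unit_mor C x)) u (word_pull r q b (generic_string q))"
  "v : ars (strc C r)" "dm (strc C r) v = pb_ob (Nerve C) r q b (dm (strc C q) u)"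
  "cd (strc C r) v = pb_ob (Nerve C) r q b (cd (strc C q) u)"
proof -
 interpret u: str_arrow C q u by unfold_locales fact
 interpret D: pulled_str C q u.d r b by unfold_locales fact
 interpret K: pulled_str C q u.c r b by unfold_locales fact
 show v: "v = smap (hcomp C) (%x. vid C (unit_mor C x)) u D.W"
  using string_pull_words(3)[OF b, of u "hcomp C" u.e] by (simp add: v_def pseudo_nerve_def)
 have f: "fst v = fst D.y" "fst v = fst K.y" unfolding v D.pb_string K.pb_string smap_def by simp_all
 have s: "length (snd v) = r" "!!j. j < r ==> snd v ! j = weval (hcomp C) u.e u (snd D.W ! j)"
  using D.W_facts(2) unfolding v smap_def by simp_all
 have w: "snd v ! j : Cell C" "ddom C (snd v ! j) = snd D.y ! j" "dcod C (snd v ! j) = snd K.y ! j" if "j < r" for j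
  using u.weval_arrow[of "snd D.W ! j"] D.W_facts(5)[OF that] D.y_nth(2)[OF that] K.y_nth(2)[OF that] s(2)[OF that] by simp_all
 show "dm (strc C r) v = pb_ob (Nerve C) r q b (dm (strc C q) u)"
  "cd (strc C r) v = pb_ob (Nerve C) r q b (cd (strc C q) u)"
  unfolding strc_simps by (rule string_eqI[of _ _ r]; use f s w D.y_nth(4) K.y_nth(4) in simp)+
 show "v : ars (strc C r)"
  unfolding mem_sars using f s(1) w D.y_obs by (simp add: mem_sobs)
qed

lemma string_comp:
 assumes f: "f : ars (strc C q)" and g: "g : ars (strc C q)" and fg: "dm (strc C q) g = cd (strc C q) f"
 shows "cmp (strc C q) g f : ars (strc C q)" "dm (strc C q) (cmp (strc C q) g f) = dm (strc C q) f"
  "cd (strc C q) (cmp (strc C q) g f) = cd (strc C q) g"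
  "j < q ==> snd (cmp (strc C q) g f) ! j = snd g ! j ;; snd f ! j"
proof -
 have l: "length (snd f) = q" "length (snd g) = q" "fst g = fst f" using f g fg by (simp_all add: mem_sars)
 show n: "snd (cmp (strc C q) g f) ! j = snd g ! j ;; snd f ! j" if "j < q" for j using that l by simp
 have m: "ddom C (snd g ! j) = dcod C (snd f ! j)" if "j < q" for j
  using arg_cong[OF fg, of "%s. snd s ! j"] that l by simp
 have c: "snd f ! j : Cell C" "snd g ! j : Cell C" if "j < q" for j using f g that by (simp_all add: mem_sars)
 show "cmp (strc C q) g f : ars (strc C q)"
  using f g l m c unfolding mem_sars by simp
 show "dm (strc C q) (cmp (strc C q) g f) = dm (strc C q) f"
  "cd (strc C q) (cmp (strc C q) g f) = cd (strc C q) g"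
  by (rule string_eqI[of _ _ q]; use l m c in simp)+
qed

lemma J_arrow:
 assumes x: "x : obs (strc C p)" and a: "a : Delta q p" and u: "u : ars (strc C q)"
  and cu: "cd (strc C q) u = pb_ob (Nerve C) q p a x"
 defines "J == lcp (Segal C) q (mstrJ C q p a x) (mar (J_segal C) q u)"
 shows "fst J = extd C q (dm (strc C q) u)" "fst (snd J) = pulld q a (extd C p x)"
  "laxT C q (extd C q (dm (strc C q) u)) (pulld q a (extd C p x)) (snd (snd J))"
  "j < q ==> snd (snd J) j (Suc j) = nu C x (snd (word_pull q p a (generic_string p)) ! j) ;; snd u ! j"
  "restr q (snd (snd J)) = snd (snd J)"
  "i <= j ==> j <= q ==> snd (snd J) i j = snd (snd (mstrJ C q p a x)) i j ;; snd (snd (mar (J_segal C) q u)) i j"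
proof -
 interpret X: pulled_str C p x q a by unfold_locales fact+
 interpret u: str_arrow C q u by unfold_locales fact
 have c: "u.c = X.y" using cu by simp
 have J: "J = (u.Dm.R, pulld q a X.R, restr q (%i j. X.tht i j ;; u.h i j))"
  unfolding J_def u.mar_eq segal_nerve_def fnerve_simps by (simp add: J_segal_def)
 show "fst J = extd C q (dm (strc C q) u)" "fst (snd J) = pulld q a (extd C p x)" "restr q (snd (snd J)) = snd (snd J)"
  by (simp_all add: J)
 show "laxT C q (extd C q (dm (strc C q) u)) (pulld q a (extd C p x)) (snd (snd J))"
  using laxT_comp[OF u.Dm.lax_ext X.Y.lax_ext X.PR.F _ X.th_trans, of u.h] u.laxT_arrow
  unfolding J c by simp
 show "snd (snd J) j (Suc j) = nu C x (snd X.W ! j) ;; snd u ! j" if "j < q"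
  using that X.theta_step[OF that] u.h_step[OF that] by (simp add: J del: restr_simps(1)) (simp only: restr_simps(1), simp)
 show "snd (snd J) i j = snd (snd (mstrJ C q p a x)) i j ;; snd (snd (mar (J_segal C) q u)) i j" if "i <= j" "j <= q"
  using that unfolding u.mar_eq J snd_conv by (subst restr_simps(1)) simp
qed

text \<open>A transformation out of a rectification is fixed by its consecutive components. The
  component at \<open>j\<close> is the normalization of the \<open>j\<close>-th word composed with
  the \<open>j\<close>-th entry of \<open>u\<close>, and as the former is invertible, the entry can
  be solved for.\<close>

lemma J_bijective:
 assumes x: "x : obs (strc C p)" and a: "a : Delta q p" and y: "y : obs (strc C q)"
  and f: "laxT C q (extd C q y) (pulld q a (extd C p x)) f"
 shows "EX! u. u : ars (strc C q) & dm (strc C q) u = y & cd (strc C q) u = pb_ob (Nerve C) q p a x &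
   snd (snd (lcp (Segal C) q (mstrJ C q p a x) (mar (J_segal C) q u))) = f"
proof -
 interpret X: pulled_str C p x q a by unfold_locales fact+
 interpret y: comp_string C q y by unfold_locales fact
 interpret f: lax_tra C q y.R "pulld q a X.R" f by unfold_locales fact
 note w = X.W_facts(5)
 have fx: "fst y = fst X.y"
  by (rule nth_equalityI) (use f.trans_lob X.y_nth(1,3) Delta_le(1)[OF a] in "auto simp: less_Suc_eq_le")
 have fj: "f j (Suc j) : Cell C" "ddom C (f j (Suc j)) = snd y ! j" "dcod C (f j (Suc j)) = X.E (a j) (a (Suc j))" if "j < q" for j
  using that f.trans_simps[of j "Suc j"] Delta_le[OF a] by simp_all
 define u where "u = (fst y, map (%j. cinv C (X.n (snd X.W ! j)) ;; f j (Suc j)) [0..<q])"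
 have uj: "snd u ! j = cinv C (X.n (snd X.W ! j)) ;; f j (Suc j)" "snd u ! j : Cell C" "ddom C (snd u ! j) = snd y ! j" "dcod C (snd u ! j) = snd X.y ! j"
  if "j < q" for j
  using that w[OF that] fj[OF that] X.y_nth(2)[OF that] by (simp_all add: u_def)
 have u: "u : ars (strc C q)" unfolding mem_sars using y uj by (simp add: mem_sobs) (simp add: u_def)
 have du: "dm (strc C q) u = y" "cd (strc C q) u = X.y"
  unfolding strc_simps by (rule string_eqI[of _ _ q]; use uj fx X.y_nth(4) y.string_length in "simp add: u_def")+
 note J = J_arrow[OF x a u du(2), unfolded du(1)]
 show ?thesis
 proof (rule ex1I[of _ u], intro conjI u du)
  show "snd (snd (lcp (Segal C) q (mstrJ C q p a x) (mar (J_segal C) q u))) = f"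
   by (rule y.ext_eqI[OF X.PR.F J(3) f]) (use J(4) uj(1) w fj in "simp del: fnerve_simps")
 next
  fix v assume v: "v : ars (strc C q) & dm (strc C q) v = y & cd (strc C q) v = X.y &
   snd (snd (lcp (Segal C) q (mstrJ C q p a x) (mar (J_segal C) q v))) = f"
  note V = J_arrow(4)[OF x a v[THEN conjunct1] v[THEN conjunct2, THEN conjunct2, THEN conjunct1], unfolded v[THEN conjunct2, THEN conjunct2, THEN conjunct2]]
  have v': "snd v ! j : Cell C" "length (snd v) = q" "dcod C (snd v ! j) = snd X.y ! j" if "j < q" for j
   using v[THEN conjunct1] that arg_cong[OF v[THEN conjunct2, THEN conjunct2, THEN conjunct1], of "%s. snd s ! j"] by (simp_all add: mem_sars)
  have l: "length (snd v) = q" using v by (simp add: mem_sars)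
  show "v = u"
  proof (rule string_eqI[of _ _ q])
   show "fst v = fst u" using v by (auto simp: u_def)
   fix j assume j: "j < q"
   show "snd v ! j = snd u ! j"
    unfolding uj(1)[OF j] V[OF j] using w[OF j] v'[OF j] X.y_nth(2)[OF j] by simp
  qed (use l in "simp_all add: u_def")
 qed
qed


text \<open>The structure cell of the nerve compares the string pulled back twice with the string
  pulled back once. The last claim expresses it, up to normalization, by a component of the
  structure cell of \<open>J\<close>.\<close>

lemma pcmp_cell:
 assumes x: "x : obs (strc C p)" and a: "a : Delta q p" and b: "b : Delta r q"
 defines "k == pcmp (Nerve C) r q p b a x" and "y == pb_ob (Nerve C) q p a x"
 shows "k : ars (strc C r)" "dm (strc C r) k = pb_ob (Nerve C) r q b y"
  "cd (strc C r) k = pb_ob (Nerve C) r p (cp r a b) x"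
  "j < r ==> nu C x (snd (word_pull r p (cp r a b) (generic_string p)) ! j) ;; snd k ! j =
   snd (snd (mstrJ C q p a x)) (b j) (b (Suc j)) ;; nu C y (snd (word_pull r q b (generic_string q)) ! j)"
proof -
 have ab: "cp r a b : Delta r p" by (rule cp_Delta[OF b a])
 interpret X: pulled_str C p x q a by unfold_locales fact+
 interpret Y: pulled_str C q X.y r b by unfold_locales fact
 interpret Z: pulled_str C p x r "cp r a b" by unfold_locales fact
 have W: "word_pull r q b X.W = smap Cmp Unit X.W Y.W"
  by (rule string_pull_words(3)[OF b X.W_facts(3,2)])
 have w: "wfw p (snd (word_pull r q b X.W) ! j)" "wtgt (snd (word_pull r q b X.W) ! j) = a (b j)"
  "wsrc (snd (word_pull r q b X.W) ! j) = a (b (Suc j))" "snd (word_pull r q b X.W) ! j = weval Cmp Unit X.W (snd Y.W ! j)"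
  "X.V (snd (word_pull r q b X.W) ! j) = X.Y.V (snd Y.W ! j)"
  if "j < r" for j
 proof -
  show e: "snd (word_pull r q b X.W) ! j = weval Cmp Unit X.W (snd Y.W ! j)"
   unfolding W smap_def using Y.W_facts(2) that by simp
  show "X.V (snd (word_pull r q b X.W) ! j) = X.Y.V (snd Y.W ! j)"
   unfolding e X.pb_string by (rule weval_weval[OF X.W_facts(1,2)]) (use Y.W_facts(5)[OF that] in simp)
  show "wfw p (snd (word_pull r q b X.W) ! j)" "wtgt (snd (word_pull r q b X.W) ! j) = a (b j)"
   "wsrc (snd (word_pull r q b X.W) ! j) = a (b (Suc j))"
   unfolding e using wfw_weval[OF X.W_facts(1,2), of "snd Y.W ! j"] Y.W_facts(5)[OF that] X.W_facts(4) Delta_le(1)[OF b] that by simp_all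
 qed
 have z: "wfw p (snd Z.W ! j)" "wtgt (snd Z.W ! j) = a (b j)" "wsrc (snd Z.W ! j) = a (b (Suc j))" if "j < r" for j
  using Z.W_facts(5)[OF that] that by (simp_all add: compose_def)
 have l: "length (snd (word_pull r q b X.W)) = r" unfolding W smap_def using Y.W_facts(2) by simp
 have k: "k = (map (%i. fst x ! i) (fst Z.W), map2 (canonical_cell C x) (snd (word_pull r q b X.W)) (snd Z.W))"
  by (simp add: k_def pseudo_nerve_def Let_def)
 have kj: "snd k ! j = cinv C (X.n (snd Z.W ! j)) ;; X.n (snd (word_pull r q b X.W) ! j)" if "j < r" for j
  unfolding k using that l Z.W_facts(2) X.canonical_cell_eq[OF w(1)[OF that] z(1)[OF that]] w(2,3)[OF that] z(2,3)[OF that] by simp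
 have kt: "snd k ! j : Cell C" "ddom C (snd k ! j) = snd Y.y ! j" "dcod C (snd k ! j) = snd Z.y ! j" if "j < r" for j
  unfolding kj[OF that] using w[OF that] z[OF that] Y.y_nth(2)[OF that] Z.y_nth(2)[OF that] by simp_all
 have f: "fst k = fst Z.y" unfolding k Z.pb_string smap_def by simp
 have f': "fst k = fst Y.y"
  unfolding f by (rule nth_equalityI) (use Y.y_nth(1,3) Z.y_nth(1,3) X.y_nth(1) Delta_le(1)[OF b] in "auto simp: less_Suc_eq_le compose_def")
 have lk: "length (snd k) = r" unfolding k using l Z.W_facts(2) by simp
 show "k : ars (strc C r)" unfolding mem_sars using Y.y_obs f' kt lk by (simp add: mem_sobs)
 show "dm (strc C r) k = pb_ob (Nerve C) r q b y" "cd (strc C r) k = pb_ob (Nerve C) r p (cp r a b) x"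
  unfolding strc_simps y_def by (rule string_eqI[of _ _ r]; use lk kt f f' Y.y_nth(4) Z.y_nth(4) in simp)+
 show "X.n (snd Z.W ! j) ;; snd k ! j = X.tht (b j) (b (Suc j)) ;; nu C y (snd Y.W ! j)" if "j < r"
 proof -
  have "X.n (snd Z.W ! j) ;; snd k ! j = X.n (snd (word_pull r q b X.W) ! j)"
   unfolding kj[OF that] by (rule inv_cancel(2)) (use w(1-3)[OF that] z[OF that] in simp_all)
  then show ?thesis unfolding y_def w(4)[OF that] using X.theta_nu[of "snd Y.W ! j"] Y.W_facts(5)[OF that] by simp
 qed
qed

section \<open>The functor induced by \<open>J\<close> on the Grothendieck constructions\<close>

interpretation S: ftype C "nhom C" "laxT C"
 by (rule type_lax[OF lax_class_hom])

abbreviation "S == Segal C"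
abbreviation "JO == Gro_ob (J_segal C)"
abbreviation "JA == Gro_ar S (J_segal C)"

lemma category_S: "category (Gro S)"
 unfolding segal_nerve_def by (rule S.category_Gro)

lemma pseudo_simps [simp]: "level (Nerve C) = strc C" "punit (Nerve C) p s = idn (strc C p) s"
 by (simp_all add: pseudo_nerve_def)

lemma JA_simps:
 assumes "((y, q), (x, p), u, a) : ars (Gro (Nerve C))"
 defines "f == snd (snd (lcp S q (mstrJ C q p a x) (mar (J_segal C) q u)))"
 shows "JA ((y, q), (x, p), u, a) = ((extd C q y, q), (extd C p x, p), (extd C q y, pulld q a (extd C p x), f), a)"
  "JA ((y, q), (x, p), u, a) : ars (Gro S)" "laxT C q (extd C q y) (pulld q a (extd C p x)) f"
  "j < q ==> f j (Suc j) = nu C x (snd (word_pull q p a (generic_string p)) ! j) ;; snd u ! j"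
proof -
 have m: "y : obs (strc C q)" "x : obs (strc C p)" "a : Delta q p" "u : ars (strc C q)"
  "dm (strc C q) u = y" "cd (strc C q) u = pb_ob (Nerve C) q p a x"
  using assms(1) unfolding Gro_simps pseudo_simps by blast+
 note J = J_arrow[OF m(2,3,4,6), unfolded m(5), folded f_def]
 show e: "JA ((y, q), (x, p), u, a) = ((extd C q y, q), (extd C p x, p), (extd C q y, pulld q a (extd C p x), f), a)"
  unfolding grothendieck_map_ar_def prod.case using J(1,2) by (simp add: J_segal_def f_def prod_eq_iff)
 show l: "laxT C q (extd C q y) (pulld q a (extd C p x)) f" by (rule J(3))
 show "j < q ==> f j (Suc j) = nu C x (snd (word_pull q p a (generic_string p)) ! j) ;; snd u ! j" by (rule J(4))
 interpret x: comp_string C p x by unfold_locales fact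
 interpret y: comp_string C q y by unfold_locales fact
 show "JA ((y, q), (x, p), u, a) : ars (Gro S)"
  unfolding e unfolding segal_nerve_def using l x.nhom_ext y.nhom_ext m(3) S.pullP[OF m(3) x.nhom_ext] by simp
qed

lemma J_full:
 assumes "x : obs (strc C p)" "y : obs (strc C q)" "a : Delta q p" "laxT C q (extd C q y) (pulld q a (extd C p x)) f"
 shows "EX! u. ((y, q), (x, p), u, a) : ars (Gro (Nerve C)) &
  JA ((y, q), (x, p), u, a) = ((extd C q y, q), (extd C p x, p), (extd C q y, pulld q a (extd C p x), f), a)"
proof -
 have e: "((y, q), (x, p), u, a) : ars (Gro (Nerve C)) &
  JA ((y, q), (x, p), u, a) = ((extd C q y, q), (extd C p x, p), (extd C q y, pulld q a (extd C p x), f), a) <->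
  u : ars (strc C q) & dm (strc C q) u = y & cd (strc C q) u = pb_ob (Nerve C) q p a x &
   snd (snd (lcp S q (mstrJ C q p a x) (mar (J_segal C) q u))) = f" for u
  using JA_simps(1)[of y q x p u a] assms(1-3) unfolding Gro_simps pseudo_simps by (auto simp del: strc_simps)
 show ?thesis unfolding e by (rule J_bijective[OF assms(1,3,2,4)])
qed

end

context bicategory
begin

interpretation S: ftype C "nhom C" "laxT C"
 by (rule type_lax[OF lax_class_hom])

abbreviation "EN == Gro (Nerve C)"
abbreviation "ES == Gro (Segal C)"

lemma JO_simps [simp]: "JO (x, p) = (extd C p x, p)"
 by (simp add: grothendieck_map_ob_def J_segal_def)

lemma J_idn:
 assumes x: "x : obs (strc C p)"
 shows "idn EN (x, p) : ars EN" "JA (idn EN (x, p)) = idn ES (JO (x, p))"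
proof -
 interpret x: comp_string C p x by unfold_locales fact
 have p: "pb_ob (Nerve C) p p (Did p) x = x"
  using string_pull_id[of x p "mcomp C" "unit_mor C"] by (simp add: pseudo_nerve_def)
 have W: "word_pull p p (Did p) (generic_string p) = generic_string p"
  by (rule string_pull_id) (simp_all add: generic_string_def)
 have gn: "snd (generic_string p) ! j = Gen (Suc j)" if "j < p" for j
  using that by (simp add: generic_string_def del: upt_Suc)
 have i: "(fst x, map (vid C) (snd x)) : ars (strc C p)" "(fst x, map (ddom C o vid C) (snd x)) = x" "(fst x, map (dcod C o vid C) (snd x)) = x"
  using x by (auto simp: mem_sars mem_sobs intro!: string_eqI[of _ _ p])
 show I: "idn EN (x, p) : ars EN"
  unfolding Gro_simps pseudo_simps strc_simps using i x by (simp add: p Delta_id_in)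
 note I' = I[unfolded Gro_simps(5) pseudo_simps]
 note J = JA_simps[OF I']
 have pl: "pulld p (Did p) x.R = x.R" by (rule pull_id(1)) simp
 have "snd (snd (lcp S p (mstrJ C p p (Did p) x) (mar (J_segal C) p (idn (strc C p) x)))) =
   restr p (%i j. vid C (lmor x.R i j))"
  by (rule x.ext_eqI[OF x.lax_ext J(3)[unfolded pl] lax_trans_id[OF x.lax_ext]])
   (use J(4)[unfolded W] gn in simp)
 then have "JA ((x, p), (x, p), idn (strc C p) x, Did p) =
   ((x.R, p), (x.R, p), (x.R, x.R, restr p (%i j. vid C (lmor x.R i j))), Did p)"
  unfolding J(1) pl by simp
 moreover have "idn ES (x.R, p) = ((x.R, p), (x.R, p), (x.R, x.R, restr p (%i j. vid C (lmor x.R i j))), Did p)"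
  unfolding segal_nerve_def Gro_simps(5) S.punit fnerve_simps ..
 ultimately show "JA (idn EN (x, p)) = idn ES (JO (x, p))"
  by (simp only: Gro_simps(5) pseudo_simps JO_simps)
qed

text \<open>Both sides are transformations out of the rectification of \<open>z\<close>, so it
  suffices to compare consecutive components. There \<open>pcmp_cell\<close> trades the structure
  cell of the nerve for that of \<open>J\<close>, and \<open>weval_arrow\<close> moves the
  normalization past \<open>u\<close>.\<close>

lemma J_cmp:
 assumes G: "((y, q), (x, p), u, a) : ars EN" and F: "((z, r), (y, q), v, b) : ars EN"
 defines "w == cmp (strc C r) (pcmp (Nerve C) r q p b a x) (cmp (strc C r) (pb_ar (Nerve C) r q b u) v)"
 shows "cmp EN ((y, q), (x, p), u, a) ((z, r), (y, q), v, b) = ((z, r), (x, p), w, cp r a b)"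
  "((z, r), (x, p), w, cp r a b) : ars EN"
  "JA ((z, r), (x, p), w, cp r a b) = cmp ES (JA ((y, q), (x, p), u, a)) (JA ((z, r), (y, q), v, b))"
proof -
 show "cmp EN ((y, q), (x, p), u, a) ((z, r), (y, q), v, b) = ((z, r), (x, p), w, cp r a b)"
  by (simp add: cmp_grothendieck w_def)
 have m: "y : obs (strc C q)" "x : obs (strc C p)" "a : Delta q p" "u : ars (strc C q)"
  "dm (strc C q) u = y" "cd (strc C q) u = pb_ob (Nerve C) q p a x"
  "z : obs (strc C r)" "b : Delta r q" "v : ars (strc C r)"
  "dm (strc C r) v = z" "cd (strc C r) v = pb_ob (Nerve C) r q b y"
  using F G unfolding Gro_simps pseudo_simps by blast+
 have ab: "cp r a b : Delta r p" by (rule cp_Delta[OF m(8,3)])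
 note pu = pull_arrow[OF m(4,8)] and k = pcmp_cell[OF m(2,3,8)]
 note c1 = string_comp[OF m(9) pu(2) pu(3)[unfolded m(5), folded m(11)]]
 have c: "dm (strc C r) (pcmp (Nerve C) r q p b a x) = cd (strc C r) (cmp (strc C r) (pb_ar (Nerve C) r q b u) v)"
  unfolding k(2) c1(3) pu(4) m(6) ..
 note c2 = string_comp[OF c1(1) k(1) c, folded w_def]
 show w: "((z, r), (x, p), w, cp r a b) : ars EN"
  unfolding Gro_simps pseudo_simps using m ab c2(1-3) c1(2) k(3) by (simp del: strc_simps)
 interpret u: str_arrow C q u by unfold_locales (rule m(4))
 interpret X: pulled_str C p x q a by unfold_locales (rule m)+
 interpret z: comp_string C r z by unfold_locales (rule m)
 interpret Y: pulled_str C q y r b by unfold_locales (rule m)+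
 interpret Z: pulled_str C p x r "cp r a b" by unfold_locales (rule ab)
 define fu where "fu = snd (snd (lcp S q (mstrJ C q p a x) (mar (J_segal C) q u)))"
 define fv where "fv = snd (snd (lcp S r (mstrJ C r q b y) (mar (J_segal C) r v)))"
 define fw where "fw = snd (snd (lcp S r (mstrJ C r p (cp r a b) x) (mar (J_segal C) r w)))"
 note Jw = JA_simps[OF w, folded fw_def] and Ju = JA_simps[OF G, folded fu_def] and Jv = JA_simps[OF F, folded fv_def]
 have dc: "u.d = y" "u.c = X.y" using m(5,6) by simp_all
 have fu: "fu i j = X.tht i j ;; u.h i j" if "i <= j" "j <= q" for i j
  using J_arrow(6)[OF m(2,3,4,6) that, folded fu_def] unfolding u.mar_eq snd_conv .
 have pc: "pulld r b (pulld q a X.R) = pulld r (cp r a b) X.R" by (rule pull_comp(1)[OF m(8)])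
 have g: "laxT C r z.R (pulld r (cp r a b) X.R) (restr r (%i j. pull_trans r b fu i j ;; fv i j))"
  using laxT_comp[OF z.lax_ext Y.PR.F _ Jv(3) laxT_pull[OF m(8) Ju(3)]] laxF_pull[OF m(8) X.PR.F]
  unfolding pc by blast
 have "fw = restr r (%i j. pull_trans r b fu i j ;; fv i j)"
 proof (rule z.ext_eqI[OF Z.PR.F Jw(3) g])
  fix j assume j: "j < r"
  let ?w = "snd Y.W ! j" and ?c = "snd (pcmp (Nerve C) r q p b a x) ! j" and ?i = "b j" and ?k = "b (Suc j)"
  let ?h = "weval (hcomp C) u.e u ?w"
  have o: "?i <= ?k" "?k <= q" using Delta_le[OF m(8)] j by auto
  note W = Y.W_facts(5)[OF j]
  interpret P: pulled_str C q X.y r b by unfold_locales (rule m)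
  have vj: "snd v ! j : Cell C" "dcod C (snd v ! j) = Y.V ?w"
   using m(9) j arg_cong[OF m(11), of "%s. snd s ! j"] Y.y_nth(2)[OF j] by (simp_all add: mem_sars)
  have uj: "snd (pb_ar (Nerve C) r q b u) ! j = ?h" unfolding pu(1) smap_def using Y.W_facts(2) j by simp
  have h: "?h : Cell C" "ddom C (?h) = Y.V ?w" "dcod C (?h) = X.Y.V ?w"
   "nu C X.y ?w ;; ?h = u.h ?i ?k ;; nu C y ?w"
   using u.weval_arrow[of ?w, unfolded dc] W by simp_all
  have kj: "?c : Cell C" "ddom C (?c) = X.Y.V ?w"
   "dcod C (?c) = X.V (snd Z.W ! j)"
   using k(1) j arg_cong[OF k(2), of "%s. snd s ! j"] arg_cong[OF k(3), of "%s. snd s ! j"] P.y_nth(2)[OF j] Z.y_nth(2)[OF j]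
   by (simp_all add: mem_sars)
  have th: "X.tht ?i ?k : Cell C" "ddom C (X.tht ?i ?k) = X.Y.E ?i ?k" "dcod C (X.tht ?i ?k) = X.E (a ?i) (a ?k)"
   using laxTD(3-5)[OF X.th_trans o] o Delta_le[OF m(3)] by simp_all
  have hh: "u.h ?i ?k : Cell C" "ddom C (u.h ?i ?k) = Y.E ?i ?k" "dcod C (u.h ?i ?k) = X.Y.E ?i ?k"
   using laxTD(3-5)[OF u.laxT_arrow[unfolded dc] o] o by simp_all
  note Zw = Z.W_facts(5)[OF j]
  have "fw j (Suc j) = X.n (snd Z.W ! j) ;; (?c ;; (?h ;; snd v ! j))"
   unfolding Jw(4)[OF j] c2(4)[OF j] c1(4)[OF j] uj ..
  also have "... = X.n (snd Z.W ! j) ;; ?c ;; (?h ;; snd v ! j)"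
   using kj h(1-3) vj Zw by (simp add: v_assoc)
  also have "... = X.tht ?i ?k ;; nu C X.y ?w ;; (?h ;; snd v ! j)"
   unfolding k(4)[OF j] ..
  also have "... = X.tht ?i ?k ;; (nu C X.y ?w ;; ?h) ;; snd v ! j"
   using th h(1-3) vj W by (simp add: v_assoc)
  also have "... = X.tht ?i ?k ;; u.h ?i ?k ;; (nu C y ?w ;; snd v ! j)"
   unfolding h(4) using th hh vj W by (simp add: v_assoc del: restr_simps(1))
  also have "... = fu ?i ?k ;; fv j (Suc j)"
   unfolding fu[OF o] Jv(4)[OF j] ..
  finally show "fw j (Suc j) = restr r (%i j. pull_trans r b fu i j ;; fv i j) j (Suc j)"
   using j by simp
 qed
 moreover have "cmp ES ((extd C q y, q), (X.R, p), (extd C q y, pulld q a X.R, fu), a) ((z.R, r), (extd C q y, q), (z.R, pulld r b (extd C q y), fv), b) =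
   ((z.R, r), (X.R, p), (z.R, pulld r b (pulld q a X.R), restr r (%i j. pull_trans r b fu i j ;; fv i j)), cp r a b)"
  using S.cmp_strict(1)[OF Ju(2)[unfolded Ju(1), unfolded segal_nerve_def] Jv(2)[unfolded Jv(1), unfolded segal_nerve_def]]
  unfolding segal_nerve_def by simp
 ultimately show "JA ((z, r), (x, p), w, cp r a b) = cmp ES (JA ((y, q), (x, p), u, a)) (JA ((z, r), (y, q), v, b))"
  unfolding Jw(1) Ju(1) Jv(1) pc by simp
qed

lemma category_N: "category EN" "functr EN ES JO JA"
proof -
 have A: "dm EN f : obs EN & cd EN f : obs EN & JA f : ars ES & dm ES (JA f) = JO (dm EN f) & cd ES (JA f) = JO (cd EN f)"
  if f: "f : ars EN" for f
 proof -
  obtain y q x p u a where ff: "f = ((y, q), (x, p), u, a)" by (metis prod.exhaust)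
  note F = f[unfolded ff]
  have "(y, q) : obs EN" "(x, p) : obs EN" using F unfolding Gro_simps by blast+
  then show ?thesis using JA_simps(2)[OF F] unfolding ff JA_simps(1)[OF F] Gro_simps(3,4) JO_simps by blast
 qed
 have B: "JO x : obs ES & idn EN x : ars EN & dm EN (idn EN x) = x & cd EN (idn EN x) = x & JA (idn EN x) = idn ES (JO x)"
  if x: "x : obs EN" for x
 proof -
  obtain s p where xx: "x = (s, p)" "s : obs (strc C p)" using x by (cases x) simp
  interpret s: comp_string C p s by unfold_locales (rule xx)
  show ?thesis using J_idn[OF xx(2)] s.nhom_ext by (simp add: xx(1) segal_nerve_def)
 qed
 have D: "cmp EN g f : ars EN & dm EN (cmp EN g f) = dm EN f & cd EN (cmp EN g f) = cd EN g & JA (cmp EN g f) = cmp ES (JA g) (JA f)"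
  if f: "f : ars EN" and g: "g : ars EN" and fg: "dm EN g = cd EN f" for f g
 proof -
  obtain z r y q v b where ff: "f = ((z, r), (y, q), v, b)" by (metis prod.exhaust)
  obtain Y x p u a where gg: "g = (Y, (x, p), u, a)" by (metis prod.exhaust)
  have Y: "Y = (y, q)" using fg by (simp add: ff gg)
  note c = J_cmp[OF g[unfolded gg Y] f[unfolded ff]]
  show ?thesis unfolding ff gg Y c(1) using c(2,3) by simp
 qed
 have I: "f = g" if f: "f : ars EN" and g: "g : ars EN" and e: "dm EN f = dm EN g" "cd EN f = cd EN g" "JA f = JA g" for f g
 proof -
  obtain y q x p u a where ff: "f = ((y, q), (x, p), u, a)" by (metis prod.exhaust)
  obtain Y X v b where gg: "g = (Y, X, v, b)" by (metis prod.exhaust)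
  have YX: "Y = (y, q)" "X = (x, p)" using e by (simp_all add: ff gg)
  note F = f[unfolded ff] and G = g[unfolded gg YX]
  have ab: "b = a" using e(3) unfolding ff gg YX JA_simps(1)[OF F] JA_simps(1)[OF G] by simp
  have m: "x : obs (strc C p)" "y : obs (strc C q)" "a : Delta q p"
   using F unfolding Gro_simps pseudo_simps by blast+
  note U = J_full[OF m JA_simps(3)[OF F]]
  have "v = u"
  proof (rule trans[OF sym[OF the1_equality[OF U]] the1_equality[OF U]]; intro conjI)
   show "((y, q), (x, p), v, a) : ars EN" using G unfolding ab .
   show "((y, q), (x, p), u, a) : ars EN" by (rule F)
   show "JA ((y, q), (x, p), v, a) = ((extd C q y, q), (extd C p x, p), (extd C q y, pulld q a (extd C p x),
     snd (snd (lcp S q (mstrJ C q p a x) (mar (J_segal C) q u)))), a)"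
    using e(3) unfolding ff gg YX ab JA_simps(1)[OF F] by (rule sym)
   show "JA ((y, q), (x, p), u, a) = ((extd C q y, q), (extd C p x, p), (extd C q y, pulld q a (extd C p x),
     snd (snd (lcp S q (mstrJ C q p a x) (mar (J_segal C) q u)))), a)"
    by (rule JA_simps(1)[OF F])
  qed
  then show ?thesis by (simp add: ff gg YX ab)
 qed
 show "category EN" "functr EN ES JO JA"
  by (rule transport_category[OF category_S A B D I]; assumption)+
qed

end

section \<open>Comparison of the nerves\<close>

lemma induces_iff: "hinduced D D' F <-> hequiv (BB (Gro D)) (BB (Gro D'))
  (Bmap (Gro D') (Gro_ob F) (Gro_ar D' F))"
 by (simp add: induces_homotopy_equivalence_def classifying_space_def classifying_map_def Bmap_def)

lemma hequiv_Bmap_cong: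
 assumes "category A" "functr A B Fo Fa" "!!x. x : obs A ==> Go x = Fo x" "!!f. f : ars A ==> Ga f = Fa f"
  and "hequiv (BB A) (BB B) (Bmap B Fo Fa)"
 shows "hequiv (BB A) (BB B) (Bmap B Go Ga)"
 by (rule hequiv_eq[OF assms(5)])
  (rule Bmap_cong[OF assms(2) is_functor_cong[OF assms(1,2)]]; use assms(3,4) in simp)

text \<open>The two inclusions of objects and the inclusions of simplicial sets and of simplicial
  categories form a commutative square; three of its sides are equivalences, and hence the fourth
  is.\<close>

lemma (in full_subcategory) obj_full_equiv:
 assumes "hinduced (dsc (obsset D')) D' (objects_inclusion D')"
  and "hinduced (dsc (obsset D)) D (objects_inclusion D)"
  and "hinduced D' D (inclusion D)"
 shows "hinduced (dsc (obsset D')) (dsc (obsset D))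
  (inclusion (dsc (obsset D)))"
proof -
 let ?X' = "dsc (obsset D')" and ?X = "dsc (obsset D)"
 interpret X: strict_simp ?X by (rule strict_discrete[OF simplicial_set_object])
 interpret X': strict_simp ?X' by (rule strict_discrete[OF D'.simplicial_set_object])
 interpret X: full_subcategory ?X ?X'
  by unfold_locales (auto simp: full_subsimp_def full_obs fun_eq_iff)
 let ?I = "Gro_ob (inclusion ?X)" and ?Ia = "Gro_ar ?X (inclusion ?X)"
 let ?O = "Gro_ob (objects_inclusion D)" and ?Oa = "Gro_ar D (objects_inclusion D)"
 let ?O' = "Gro_ob (objects_inclusion D')" and ?Oa' = "Gro_ar D' (objects_inclusion D')"
 let ?J = "Gro_ob (inclusion D)" and ?Ja = "Gro_ar D (inclusion D)"
 have I: "functr (Gro ?X') (Gro ?X) ?I ?Ia"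
  by (rule is_functor_cong[OF X'.category_Gro X.functr_full]) (simp_all only: X.inc_simps)
 have J: "functr (Gro D') (Gro D) ?J ?Ja"
  by (rule is_functor_cong[OF D'.category_Gro functr_full]) (simp_all only: inc_simps)
 note O = functr_incl and O' = D'.functr_incl
 show ?thesis
  unfolding induces_iff
 proof (rule Bmap_equiv_cancel[OF I O _ assms(2)[unfolded induces_iff]],
   rule hequiv_Bmap_cong[OF X'.category_Gro functr_comp[OF O' J] _ _
    Bmap_equiv_comp[OF O' J assms(1,3)[unfolded induces_iff]]])
  fix z assume z: "z : obs (Gro ?X')"
  show "?O (?I z) = ?J (?O' z)"
   by (cases z) (simp add: grothendieck_map_ob_def objects_inclusion_def inclusion_def strict_mor_def)
 next
  fix f assume f: "f : ars (Gro ?X')"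
  obtain y q x p u a where ff: "f = ((y, q), (x, p), u, a)" by (metis prod.exhaust)
  have m: "x : lobs D' p" "a : Delta q p" "u = y" "y = pb_ob D q p a x"
   using f unfolding ff Gro_simps by auto
  have o: "?Oa' f = ((y, q), (x, p), lidn D q y, a)"
   unfolding ff m(3) using D'.incl_simps(1)[OF m(1,2)] m(4) by simp
  have "?Ja (?Oa' f) = ?Oa' f" by (rule inc_simps(2)) (rule functrD(2)[OF O' f])
  moreover have "?Oa (?Ia f) = ((y, q), (x, p), lidn D q y, a)"
   unfolding X.inc_simps(2)[OF f] unfolding ff m(3) using incl_simps(1)[OF full_obs[OF m(1)] m(2,4)] .
  ultimately show "?Oa (?Ia f) = ?Ja (?Oa' f)" by (simp add: o)
 qed
qed

text \<open>The functor induced by the composite lax morphism agrees with the composite of the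
  induced functors: \<open>Ka\<close> preserves the composition of a structure cell with an arrow,
  and the structure cell of the strict factor is an identity that gets absorbed.\<close>

lemma (in strict_fun) comp_equiv:
 assumes cat: "category (Gro D0)" and F: "functr (Gro D0) (Gro D') (Gro_ob F) (Gro_ar D' F)"
  and m: "!!y q x p u a. ((y, q), (x, p), u, a) : ars (Gro D0) ==> mar F q u : lars D' q & mstr F q p a x : lars D' q &
   ldm D' q (mstr F q p a x) = lcd D' q (mar F q u)"
  and "hinduced D0 D' F" "hinduced D' D (strict_mor D Ko Ka)"
 shows "hinduced D0 D (lax_mor_comp D (strict_mor D Ko Ka) F)"
 unfolding induces_iff
proof (rule hequiv_Bmap_cong[OF cat functr_comp[OF F functr_strict] _ _
  Bmap_equiv_comp[OF F functr_strict assms(4,5)[unfolded induces_iff]]])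
 fix z assume "z : obs (Gro D0)"
 then show "Gro_ob (lax_mor_comp D (strict_mor D Ko Ka) F) z = Gro_ob (strict_mor D Ko Ka) (Gro_ob F z)"
  by (cases z) (simp add: grothendieck_map_ob_def lax_mor_comp_def strict_mor_def)
next
 fix f assume f: "f : ars (Gro D0)"
 obtain y q x p u a where ff: "f = ((y, q), (x, p), u, a)" by (metis prod.exhaust)
 note M = m[OF f[unfolded ff]]
 have g: "Gro_ar D' F f = ((mob F q y, q), (mob F p x, p), lcp D' q (mstr F q p a x) (mar F q u), a)"
  by (simp add: ff grothendieck_map_ar_def)
 have G: "Gro_ar D' F f : ars (Gro D')" using functrD(2)[OF F f] by simp
 have c: "lcd D' q (lcp D' q (mstr F q p a x) (mar F q u)) = pb_ob D' q p a (mob F p x)" "a : Delta q p" "mob F p x : lobs D' p"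
  using G unfolding g Gro_simps by blast+
 have t: "Ka q (mstr F q p a x) : lars D q" "Ka q (mar F q u) : lars D q"
  "lcd D q (Ka q (mstr F q p a x)) = pb_ob D q p a (Ko p (mob F p x))"
  using Ks(2,4) M c KD(2) D'.level_cmp(3)[of "mar F q u" q "mstr F q p a x"] by simp_all
 have e: "Gro_ar D (strict_mor D Ko Ka) (Gro_ar D' F f) =
   ((Ko q (mob F q y), q), (Ko p (mob F p x), p), lcp D q (Ka q (mstr F q p a x)) (Ka q (mar F q u)), a)"
  unfolding g using strict_simps(2)[OF G[unfolded g]] Ks(6)[of "mar F q u" q "mstr F q p a x"] M by simp
 have i: "lcp D q (lidn D q (pb_ob D q p a (Ko p (mob F p x)))) (Ka q (mstr F q p a x)) = Ka q (mstr F q p a x)"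
  using category.idn_left[OF level t(1)] t(3) by simp
 show "Gro_ar D (lax_mor_comp D (strict_mor D Ko Ka) F) f = Gro_ar D (strict_mor D Ko Ka) (Gro_ar D' F f)"
  unfolding e by (simp add: ff grothendieck_map_ar_def lax_mor_comp_def strict_mor_def i)
qed

context bicategory
begin

interpretation S: ftype C "nhom C" "laxT C"
 by (rule type_lax[OF lax_class_hom])

lemma spine_counit:
 assumes "nhom C p F"
 shows "EX e. laxT C p (extd C p (spine p F)) F e & (ALL i j. i <= j & j <= p --> invcell C (e i j))"
proof -
 interpret F: hom_fun C p F by unfold_locales fact
 interpret s: comp_string C p "spine p F" by unfold_locales (rule F.spine_obs)
 show ?thesis using s.ext_universal[OF F.F, of "%j. vid C (lmor F j (Suc j))"] assms by (auto simp: normal_homomorphism_def)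
qed

text \<open>The universal arrow at a normal homomorphism \<open>F\<close> is the inverse of the
  invertible counit from the rectified spine to \<open>F\<close>, over the identity operator.
  Precomposition with it is bijective, and by \<open>J_full\<close> every arrow out of the rectified
  spine comes from exactly one arrow of strings.\<close>

theorem J_segal_equiv: "hinduced (Nerve C) (Segal C) (J_segal C)"
proof -
 define e where "e p F = (SOME e. laxT C p (extd C p (spine p F)) F e & (ALL i j. i <= j & j <= p --> invcell C (e i j)))" for p F
 have e: "laxT C p (extd C p (spine p F)) F (e p F)" "i <= j ==> j <= p ==> invcell C (e p F i j)"
  if "nhom C p F" for p F i j
  using someI_ex[OF spine_counit[OF that]] unfolding e_def[symmetric] by blast+
 define e' where "e' p F = restr p (%i j. cinv C (e p F i j))" for p F
 let ?r = "%(F, p). (spine p F, p)"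
  and ?et = "%(F, p). ((F, p), (extd C p (spine p F), p), (F, extd C p (spine p F), e' p F), Did p)"
 have eta: "?et (F, p) : ars ES" "laxT C p F (extd C p (spine p F)) (e' p F)" "spine p F : obs (strc C p)"
  "nhom C p (extd C p (spine p F))" "laxF C p F"
  if F: "nhom C p F" for p F
 proof -
  interpret F: hom_fun C p F by unfold_locales fact
  interpret s: comp_string C p "spine p F" by unfold_locales (rule F.spine_obs)
  show l: "laxT C p F s.R (e' p F)" unfolding e'_def by (rule laxT_inv[OF s.lax_ext F.F e[OF F]])
  show "spine p F : obs (strc C p)" "nhom C p s.R" "laxF C p F"
   by (rule F.spine_obs s.nhom_ext F.F)+
  show "?et (F, p) : ars ES"
   using l F s.nhom_ext pull_id(1)[of p s.R] by (simp add: segal_nerve_def)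
 qed
 have "hequiv (BB EN) (BB ES) (Bmap ES JO JA)"
 proof (rule universal_arrows_equiv[OF category_N(1) category_S category_N(2), where r = ?r and et = ?et])
  fix b assume "b : obs ES"
  then obtain F p where b: "b = (F, p)" "nhom C p F" by (cases b) (auto simp: segal_nerve_def)
  show "?r b : obs EN & ?et b : ars ES & dm ES (?et b) = b & cd ES (?et b) = JO (?r b)"
   using eta(1,3)[OF b(2)] by (simp add: b(1))
 next
  fix b c f assume bo: "b : obs ES" and co: "c : obs EN" and f: "f : ars ES" "dm ES f = b" "cd ES f = JO c"
  obtain F p where b: "b = (F, p)" and F: "nhom C p F" using bo by (cases b) (auto simp: segal_nerve_def)
  obtain y n where c: "c = (y, n)" and y: "y : obs (strc C n)" using co by (cases c) auto
  obtain A B ph a where ff: "f = (A, B, ph, a)" by (metis prod.exhaust)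
  have AB: "A = (F, p)" "B = (extd C n y, n)" using f(2,3) by (simp_all add: ff b c)
  let ?R = "extd C p (spine p F)" and ?Y = "extd C n y"
  obtain g where ph: "ph = (F, pulld p a ?Y, g)" and g: "laxT C p F (pulld p a ?Y) g" and a: "a : Delta p n"
   using f(1) unfolding ff AB segal_nerve_def by (cases ph) auto
  note E = eta[OF F]
  interpret y: comp_string C n y by unfold_locales (rule y)
  interpret e: lax_tra C p ?R F "e p F" 
   by unfold_locales (use e(1)[OF F] E in "auto simp: normal_homomorphism_def homomorphism_def")
  interpret g: lax_tra C p F "pulld p a ?Y" g
   by unfold_locales (use g laxF_pull[OF a y.lax_ext] in auto)
  let ?g = "restr p (%i j. g i j ;; e p F i j)"
  have g': "laxT C p ?R (pulld p a ?Y) ?g" by (rule laxT_comp[OF e.F.F e.G.F g.G.F e(1)[OF F] g])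
  have key: "cmp ES ((?R, p), (?Y, n), (?R, pulld p c' ?Y, k), c') (?et b) = f <-> c' = a & k = ?g"
   if K: "((?R, p), (?Y, n), (?R, pulld p c' ?Y, k), c') : ars ES" for k c'
  proof -
   have k: "laxT C p ?R (pulld p c' ?Y) k" "c' : Delta p n" using K unfolding segal_nerve_def by auto
   have "cmp ES ((?R, p), (?Y, n), (?R, pulld p c' ?Y, k), c') (?et b) =
     ((F, p), (?Y, n), (F, pulld p c' ?Y, restr p (%i j. k i j ;; e' p F i j)), c')"
    using S.cmp_strict(1)[OF K[unfolded segal_nerve_def] E(1)[unfolded segal_nerve_def prod.case]] k
     pull_id(2)[OF laxTD(1)[OF k(1)]] pull_id(1)[of p "pulld p c' ?Y"]
    by (simp add: b segal_nerve_def comp_id cong: restr_trans_cong)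
   moreover have "restr p (%i j. k i j ;; e' p F i j) = g <-> k = ?g" if "c' = a"
   proof
    assume h: "restr p (%i j. k i j ;; e' p F i j) = g"
    show "k = ?g"
    proof (rule trans_eqI[of p])
     fix i j assume ij: "i <= j" "j <= p"
     have "g i j = k i j ;; cinv C (e p F i j)" using fun_cong[OF fun_cong[OF h], of i j] ij by (simp add: e'_def)
     then show "k i j = ?g i j" using ij e(2)[OF F ij] laxTD(3-5)[OF k(1) ij] by simp
    qed (simp_all add: laxTD(1)[OF k(1)])
   next
    assume h: "k = ?g"
    show "restr p (%i j. k i j ;; e' p F i j) = g"
     unfolding h by (rule trans_eqI[of p]) (simp_all add: e'_def e(2)[OF F] g.trans_restr)
   qed
   ultimately show ?thesis by (auto simp: ff AB ph)
  qed
  note U = J_full[OF y E(3) a g']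
  from ex1_implies_ex[OF U] obtain u where "((spine p F, p), (y, n), u, a) : ars EN &
   JA ((spine p F, p), (y, n), u, a) = ((?R, p), (?Y, n), (?R, pulld p a ?Y, ?g), a)" by (elim exE)
  note u = conjunct1[OF this] conjunct2[OF this]
  show "EX! G. G : ars EN & dm EN G = ?r b & cd EN G = c & cmp ES (JA G) (?et b) = f"
  proof (rule ex1I[of _ "((spine p F, p), (y, n), u, a)"])
   show "((spine p F, p), (y, n), u, a) : ars EN & dm EN ((spine p F, p), (y, n), u, a) = ?r b &
     cd EN ((spine p F, p), (y, n), u, a) = c & cmp ES (JA ((spine p F, p), (y, n), u, a)) (?et b) = f"
    using u key[OF JA_simps(2)[OF u(1), unfolded u(2)]] unfolding u(2) by (simp only: b c prod.case Gro_simps(3,4) simp_thms)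
  next
   fix G assume G: "G : ars EN & dm EN G = ?r b & cd EN G = c & cmp ES (JA G) (?et b) = f"
   obtain A' B' v d where gg: "G = (A', B', v, d)" by (metis prod.exhaust)
   have AB': "A' = (spine p F, p)" "B' = (y, n)" using G by (simp_all add: gg b c)
   have v: "((spine p F, p), (y, n), v, d) : ars EN" using conjunct1[OF G] unfolding gg AB' .
   note Jv = JA_simps[OF v]
   have dk: "d = a & snd (snd (lcp S p (mstrJ C p n d y) (mar (J_segal C) p v))) = ?g"
    using G key[OF Jv(2)[unfolded Jv(1)]] unfolding gg AB' Jv(1) by blast
   note d = conjunct1[OF dk]
   have jv: "JA ((spine p F, p), (y, n), v, a) = ((?R, p), (?Y, n), (?R, pulld p a ?Y, ?g), a)"
    using Jv(1) unfolding conjunct2[OF dk] unfolding d .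
   have "v = u"
    by (rule trans[OF sym[OF the1_equality[OF U conjI[OF v[unfolded d] jv]]] the1_equality[OF U conjI[OF u]]])
   then show "G = ((spine p F, p), (y, n), u, a)" by (simp add: gg AB' d)
  qed
 qed
 then show ?thesis by (simp add: induces_iff)
qed

lemma J_arrows:
 assumes "((y, q), (x, p), u, a) : ars EN"
 shows "mar (J_segal C) q u : lars S q & mstrJ C q p a x : lars S q &
   ldm S q (mstrJ C q p a x) = lcd S q (mar (J_segal C) q u)"
proof -
 have m: "x : obs (strc C p)" "a : Delta q p" "u : ars (strc C q)" "cd (strc C q) u = pb_ob (Nerve C) q p a x"
  using assms unfolding Gro_simps pseudo_simps by blast+
 interpret X: pulled_str C p x q a by unfold_locales (rule m)+
 interpret u: str_arrow C q u by unfold_locales (rule m)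
 have c: "u.c = X.y" using m(4) by simp
 have m': "fst (mstrJ C q p a x) = X.Y.R" "fst (snd (mstrJ C q p a x)) = pulld q a X.R"
  by (simp_all add: J_segal_def)
 show ?thesis
  unfolding u.mar_eq unfolding segal_nerve_def fnerve_simps fst_conv snd_conv c m'
  using u.laxT_arrow[unfolded c] X.th_trans u.Dm.nhom_ext X.Y.nhom_ext S.pullP[OF m(2) X.nhom_ext]
  by (intro conjI refl)
qed

end

theorem theorem6p1:
  fixes C :: "('o, 'm, 'd) bicat"
  assumes "bicategory C"
  shows "(induces_homotopy_equivalence (pseudo_nerve C) (segal_nerve C) (J_segal C) \<and>
          induces_homotopy_equivalence (pseudo_nerve C) (normal_lax_nerve C) (J_normal_lax C) \<and>
          induces_homotopy_equivalence (pseudo_nerve C) (normal_oplax_nerve C) (J_normal_oplax C)) \<and>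
         (induces_homotopy_equivalence (segal_nerve C) (normal_lax_nerve C)
            (inclusion (normal_lax_nerve C)) \<and>
          induces_homotopy_equivalence (normal_lax_nerve C) (lax_nerve C)
            (inclusion (lax_nerve C)) \<and>
          induces_homotopy_equivalence (segal_nerve C) (normal_oplax_nerve C)
            (segal_to_oplax C) \<and>
          induces_homotopy_equivalence (normal_oplax_nerve C) (oplax_nerve C)
            (inclusion (oplax_nerve C))) \<and>
         (induces_homotopy_equivalence (lax_geometric_nerve C) (lax_nerve C)
            (objects_inclusion (lax_nerve C)) \<and>
          induces_homotopy_equivalence (normal_lax_geometric_nerve C) (normal_lax_nerve C)
            (objects_inclusion (normal_lax_nerve C)) \<and>
          induces_homotopy_equivalence (normal_oplax_geometric_nerve C) (normal_oplax_nerve C)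
            (objects_inclusion (normal_oplax_nerve C)) \<and>
          induces_homotopy_equivalence (oplax_geometric_nerve C) (oplax_nerve C)
            (objects_inclusion (oplax_nerve C))) \<and>
         (induces_homotopy_equivalence (normal_lax_geometric_nerve C) (lax_geometric_nerve C)
            (inclusion (lax_geometric_nerve C)) \<and>
          induces_homotopy_equivalence (normal_oplax_geometric_nerve C) (oplax_geometric_nerve C)
            (inclusion (oplax_geometric_nerve C)))"
proof -
 interpret bicategory C by fact
 interpret co: bicategory "co C" by (rule bicategory_co)
 note L = lax_class_normal and O = co.lax_class_normal
 interpret S: ftype C "nhom C" "laxT C" by (rule type_lax[OF lax_class_hom])
 interpret Lu: ftype C "%p F. laxF C p F & normal_data C p F" "laxT C" by (rule type_lax[OF L(2)])
 interpret L: ftype C "laxF C" "laxT C" by (rule type_lax[OF L(1)])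
 interpret Ou: ftype C "%p F. laxF (co C) p F & normal_data (co C) p F" "oplaxT C" by (rule type_oplax[OF O(2)])
 interpret O: ftype C "laxF (co C)" "oplaxT C" by (rule type_oplax[OF O(1)])
 have J1: "hinduced (Nerve C) (normal_lax_nerve C) (J_normal_lax C)"
 proof -
  interpret strict_fun "normal_lax_nerve C" "Segal C" "%p x. x" "%p u. u"
   unfolding segal_nerve_def normal_lax_nerve_def nclasses
   by unfold_locales (auto intro!: functrI simp: strict_sfun_def normal_homomorphism_def homomorphism_def)
  show ?thesis
   unfolding J_normal_lax_def inclusion_def
   by (rule comp_equiv[OF category_N J_arrows J_segal_equiv segal_lax_equiv[unfolded inclusion_def]])
 qed
 have J2: "hinduced (Nerve C) (normal_oplax_nerve C) (J_normal_oplax C)"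
 proof -
  interpret strict_fun "normal_oplax_nerve C" "Segal C" "invd C" "%p (F, F', al). (invd C p F, invd C p F', al)"
   by (intro strict_fun.intro strict_fun_axioms.intro strict_segal_to_oplax)
    (unfold segal_nerve_def normal_oplax_nerve_def nclasses, unfold_locales)
  show ?thesis
   unfolding J_normal_oplax_def segal_to_oplax_def
   by (rule comp_equiv[OF category_N J_arrows J_segal_equiv segal_oplax_equiv[unfolded segal_to_oplax_def]])
 qed
 have incl: "hinduced (normal_lax_nerve C) (lax_nerve C) (inclusion (lax_nerve C))"
  "hinduced (normal_oplax_nerve C) (oplax_nerve C) (inclusion (oplax_nerve C))"
  unfolding lax_nerve_def normal_lax_nerve_def oplax_nerve_def normal_oplax_nerve_def nclasses
  by (rule lax_corefl_equiv[OF L _ lax_corefl_normal] oplax_corefl_equiv[OF O _ co.lax_corefl_normal]; simp)+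
 have obj: "hinduced (lax_geometric_nerve C) (lax_nerve C) (objects_inclusion (lax_nerve C))"
  "hinduced (normal_lax_geometric_nerve C) (normal_lax_nerve C) (objects_inclusion (normal_lax_nerve C))"
  "hinduced (normal_oplax_geometric_nerve C) (normal_oplax_nerve C) (objects_inclusion (normal_oplax_nerve C))"
  "hinduced (oplax_geometric_nerve C) (oplax_nerve C) (objects_inclusion (oplax_nerve C))"
  unfolding lax_nerve_def normal_lax_nerve_def oplax_nerve_def normal_oplax_nerve_def nclasses
   lax_geometric_nerve_def normal_lax_geometric_nerve_def oplax_geometric_nerve_def normal_oplax_geometric_nerve_def
  by (rule lax_obj_equiv[OF mix_stable_lax(1)] lax_obj_equiv[OF mix_stable_lax(2)]
    oplax_obj_equiv[OF co.mix_stable_lax(2)] oplax_obj_equiv[OF co.mix_stable_lax(1)])+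
 have sset: "functor_sset P = obsset (fnerve C P T)" for P T
  by (simp add: obsset_def functor_sset_def fun_eq_iff)
 have "hinduced (normal_lax_geometric_nerve C) (lax_geometric_nerve C) (inclusion (lax_geometric_nerve C))"
  using full_subcategory.obj_full_equiv[OF full_nerve[OF L.ftype_axioms Lu.ftype_axioms]] obj(1,2) incl(1)
  unfolding lax_nerve_def normal_lax_nerve_def nclasses lax_geometric_nerve_def normal_lax_geometric_nerve_def sset[where T = "laxT C"]
  by blast
 moreover have "hinduced (normal_oplax_geometric_nerve C) (oplax_geometric_nerve C) (inclusion (oplax_geometric_nerve C))"
  using full_subcategory.obj_full_equiv[OF full_nerve[OF O.ftype_axioms Ou.ftype_axioms]] obj(3,4) incl(2)
  unfolding oplax_nerve_def normal_oplax_nerve_def nclasses oplax_geometric_nerve_def normal_oplax_geometric_nerve_def sset[where T = "oplaxT C"]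
  by blast
 ultimately show ?thesis
  using J_segal_equiv J1 J2 segal_lax_equiv segal_oplax_equiv incl obj by (intro conjI)
qed

end
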